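(* For $t\in\mathbb{Q}$ let \[ E_t:\ y^2=x\bigl(x^2-(2t^2-2t+1)(4t^4-12t^3+6t^2+2t-1)x+16(t^2-3t+1)(t-1)^5t^5\bigr). \] Let $(t,u,z)\in\mathbb{Q}^3$ satisfy \[ (2t-1)^5(4t^2-2t-1)z^2=(2u-1)^5(4u^2-2u-1). \] Define \begin{align*} a=&\,2(8t^6z - 32t^5z + 40t^4z - 20t^3z + 4tz - 8u^6 + 32u^5 - 40u^4 + 20u^3 - 4u - z + 1),\\ a_0=&-64t^5(t-1)^5(t^2-3t+1),\\ a_2=&\,2(32t^{12}z - 256t^{11}z + 832t^{10}z - 1440t^9z + 1440t^8z - 960t^7z + 64t^6u^6 - 256t^6u^5 + 320t^6u^4 - 160t^6u^3 + 32t^6u + 640t^6z - 8t^6\\ &- 256t^5u^6 + 1024t^5u^5 - 1280t^5u^4 + 640t^5u^3 - 128t^5u - 480t^5z + 32t^5 + 320t^4u^6 - 1280t^4u^5 + 1600t^4u^4 - 800t^4u^3 \\ &+ 160t^4u + 240t^4z - 40t^4 - 160t^3u^6 + 640t^3u^5 - 800t^3u^4 + 400t^3u^3 - 80t^3u - 40t^3z + 20t^3 - 16t^2z + 32tu^6 - 128tu^5\\ &+ 160tu^4 - 80tu^3 + 16tu + 8tz - 4t - 8u^6 + 32u^5 - 40u^4 + 20u^3 - 4u - z + 1),\\ a_4=&\,384t^7z^2 - 128t^6u^6z + 512t^6u^5z - 640t^6u^4z + 320t^6u^3z - 64t^6uz - 1152t^6z^2 + 16t^6z + 512t^5u^6z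 - 2048t^5u^5z \\ &+ 2560t^5u^4z - 1280t^5u^3z + 256t^5uz + 1344t^5z^2 - 64t^5z - 640t^4u^6z + 2560t^4u^5z - 3200t^4u^4z + 1600t^4u^3z \\ &- 320t^4uz - 720t^4z^2 + 80t^4z + 320t^3u^6z - 1280t^3u^5z + 1600t^3u^4z - 800t^3u^3z + 160t^3uz + 120t^3z^2 - 40t^3z + 48t^2z^2\\ &- 64tu^6z + 256tu^5z - 320tu^4z + 160tu^3z - 32tuz - 24tz^2 + 8tz - 64u^{12} + 512u^{11} - 1664u^{10} + 2880u^9 - 2880u^8 \\ &+ 1536u^7 + 16u^6z - 128u^6 - 64u^5z - 384u^5 + 80u^4z + 240u^4 - 40u^3z - 40u^3 - 16u^2 + 8uz + 8u + 3z^2 - 2z - 1,\\ a_6=&\,z(-128t^7z^2 + 384t^6z^2 - 448t^5z^2 + 240t^4z^2 - 40t^3z^2 - 16t^2z^2 + 8tz^2 + 64u^{12} - 512u^{11} + 1664u^{10} - 2880u^9 \\ &+ 2880u^8 - 1536u^7 + 128u^6 + 384u^5 - 240u^4 + 40u^3 + 16u^2 - 8u - z^2 + 1). \end{align*} Suppose that $a\neq 0$ (equivalently, $z\neq \frac{8u^6 - 32u^5 + 40u^4 - 20u^3 + 4u - 1}{8t^6 - 32t^5 + 40t^4 - 20t^3 + 4t - 1}$) and $t,u\notin\{0,\tfrac12,1\}$. Then $y^2=a(a_6x^6+a_4x^4+a_2x^2+a_0)$ defines a genus $2$ curve $C$ over $\mathbb{Q}$, its Jacobian $\operatorname{Jac}(C)$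 is $(2,2)$-isogenous to $E_t\times E_u$, and in particular $\operatorname{rk}_5\operatorname{Jac}(C)(\mathbb{Q})_{\mathrm{tors}}=2$. Explicitly, $E_t$ is isomorphic to the elliptic curve $E_t':y^2=a(a_0x^3+a_2x^2+a_4x+a_6)$, $E_u$ is isomorphic to the elliptic curve $E_u':y^2=a(a_6x^3+a_4x^2+a_2x+a_0)$, and the isogeny may be induced by the two bielliptic maps $C\to E_t'$, $(x,y)\mapsto(1/x^2,y/x^3)$, and $C\to E_u'$, $(x,y)\mapsto(x^2,y)$.
   Context: For a finitely generated abelian group $A$ and integer $m>1$, $\operatorname{rk}_m A$ is the largest integer $r$ such that $A$ has a subgroup isomorphic to $(\mathbb{Z}/m\mathbb{Z})^r$. $\operatorname{Jac}(C)(\mathbb{Q})_{\mathrm{tors}}$ denotes the rational torsion subgroup of the Jacobian of $C$. The curve $E_t$ is the universal elliptic curve over the modular curve $X_1(10)$; it has the rational point $(4(t-1)(t^2-3t+1)t^3,\ 4(t-1)(t^2-3t+1)t^3(2t-1))$ of order $10$. A $(2,2)$-isogeny is an isogeny whose kernel is isomorphic to $(\mathbb{Z}/2\mathbb{Z})^2$. *)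

theory Defs
  imports
    "HOL-Library.Product_Plus"
    "HOL-Computational_Algebra.Computational_Algebra"
    "HOL-Algebra.Algebraic_Closure_Type"
    "HOL-Algebra.Free_Abelian_Groups"
    "HOL-Algebra.Product_Groups"
    "HOL-Algebra.Elementary_Groups"
begin

section \<open>Curves \<open>y\<^sup>2 = f(x)\<close> over the rationals and their geometric points\<close>

type_synonym qbar = "rat alg_closure"

datatype point = Aff qbar qbar | Infty qbar

definition base_change :: "rat poly \<Rightarrow> qbar poly" where
  "base_change f = map_poly to_ac f"

text \<open>
  For squarefree nonconstant \<open>f\<close> put \<open>d = \<lceil>deg f / 2\<rceil>\<close>.  The smooth projective curve with affine
  equation \<open>y\<^sup>2 = f(x)\<close> is glued from that affine curve and the affine curve
  \<open>s\<^sup>2 = w\<^bsup>2d\<^esup> f(1/w)\<close> along \<open>w = 1/x\<close>, \<open>s = y/x\<^sup>d\<close>.  The points not on the first chart are those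
  with \<open>w = 0\<close>, where \<open>s\<^sup>2\<close> is the coefficient of \<open>x\<^bsup>2d\<^esup>\<close> in \<open>f\<close>; \<open>Infty s\<close> is the point
  \<open>(w, s) = (0, s)\<close>.  For \<open>deg f = 3\<close> there is exactly one, namely \<open>Infty 0\<close>.
\<close>

definition half_deg :: "rat poly \<Rightarrow> nat" where
  "half_deg f = (Polynomial.degree f + 1) div 2"

definition points :: "rat poly \<Rightarrow> point set" where
  "points f = {Aff x y | x y. y ^ 2 = poly (base_change f) x} \<union>
              {Infty s | s. s ^ 2 = Polynomial.coeff (base_change f) (2 * half_deg f)}"

definition smooth_curve :: "rat poly \<Rightarrow> bool" where
  "smooth_curve f \<longleftrightarrow> Polynomial.degree f > 0 \<and> squarefree f"


section \<open>The function field and orders of vanishing\<close>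

text \<open>The pair \<open>(A, B)\<close> stands for the function \<open>A(x) + B(x) y\<close>.\<close>

type_synonym ratfun = "qbar poly fract \<times> qbar poly fract"

definition eval_fract :: "qbar poly fract \<Rightarrow> qbar fls \<Rightarrow> qbar fls" where
  "eval_fract A \<xi> = (THE z. \<exists>p q. q \<noteq> 0 \<and> A = Fraction_Field.Fract p q \<and>
      z = poly (map_poly fls_const p) \<xi> / poly (map_poly fls_const q) \<xi>)"

text \<open>
  A formal local parametrisation at a point: a solution \<open>(\<xi>, \<eta>)\<close> of the equation in Laurent
  series which, in the coordinates of a chart around the point, consists of power series with
  the coordinates of the point as constant terms and with a nonzero tangent vector.  Expanding
  functions along it identifies the completed local ring at the point with the ring of power
  series, so that the subdegree of the expansion is the order of vanishing and, for a function
  that is regular at the point, the constant term is its value.  Neither depends on the choice of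
  the parametrisation.
\<close>

definition branch_at :: "qbar fls \<Rightarrow> qbar fls \<Rightarrow> qbar \<Rightarrow> qbar \<Rightarrow> bool" where
  "branch_at \<xi> \<eta> x y \<longleftrightarrow>
     fls_subdegree \<xi> \<ge> 0 \<and> fls_subdegree \<eta> \<ge> 0 \<and> fls_nth \<xi> 0 = x \<and> fls_nth \<eta> 0 = y \<and>
     (fls_nth \<xi> 1 \<noteq> 0 \<or> fls_nth \<eta> 1 \<noteq> 0)"

fun local_param :: "rat poly \<Rightarrow> point \<Rightarrow> qbar fls \<times> qbar fls \<Rightarrow> bool" where
  "local_param f (Aff x y) (\<xi>, \<eta>) \<longleftrightarrow>
     \<eta> ^ 2 = poly (map_poly fls_const (base_change f)) \<xi> \<and> branch_at \<xi> \<eta> x y"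
| "local_param f (Infty s) (\<xi>, \<eta>) \<longleftrightarrow>
     \<eta> ^ 2 = poly (map_poly fls_const (base_change f)) \<xi> \<and>
     branch_at (1 / \<xi>) (\<eta> / \<xi> ^ half_deg f) 0 s"

definition expand :: "rat poly \<Rightarrow> point \<Rightarrow> ratfun \<Rightarrow> qbar fls" where
  "expand f P h = (case (SOME \<theta>. local_param f P \<theta>) of
     (\<xi>, \<eta>) \<Rightarrow> eval_fract (fst h) \<xi> + eval_fract (snd h) \<xi> * \<eta>)"

definition ord_at :: "rat poly \<Rightarrow> point \<Rightarrow> ratfun \<Rightarrow> int" where
  "ord_at f P h = fls_subdegree (expand f P h)"

definition regular_at :: "rat poly \<Rightarrow> point \<Rightarrow> ratfun \<Rightarrow> bool" where
  "regular_at f P h \<longleftrightarrow> h = 0 \<or> ord_at f P h \<ge> 0"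

definition value_at :: "rat poly \<Rightarrow> point \<Rightarrow> ratfun \<Rightarrow> qbar" where
  "value_at f P h = fls_nth (expand f P h) 0"


section \<open>Divisors, the genus, and the Jacobian\<close>

abbreviation divisors :: "rat poly \<Rightarrow> (point \<Rightarrow>\<^sub>0 int) monoid" where
  "divisors f \<equiv> free_Abelian_group (points f)"

definition div_degree :: "(point \<Rightarrow>\<^sub>0 int) \<Rightarrow> int" where
  "div_degree D = (\<Sum>P\<in>Poly_Mapping.keys D. Poly_Mapping.lookup D P)"

definition divisors0 :: "rat poly \<Rightarrow> (point \<Rightarrow>\<^sub>0 int) monoid" where
  "divisors0 f = (divisors f)\<lparr>carrier := {D \<in> carrier (divisors f). div_degree D = 0}\<rparr>"

definition principal :: "rat poly \<Rightarrow> (point \<Rightarrow>\<^sub>0 int) set" where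
  "principal f = {D \<in> carrier (divisors f).
     \<exists>h. h \<noteq> 0 \<and> (\<forall>P\<in>points f. Poly_Mapping.lookup D P = ord_at f P h)}"

definition rr_space :: "rat poly \<Rightarrow> (point \<Rightarrow>\<^sub>0 int) \<Rightarrow> ratfun set" where
  "rr_space f D = {h. h = 0 \<or> (\<forall>P\<in>points f. ord_at f P h \<ge> - Poly_Mapping.lookup D P)}"

definition scale_fun :: "qbar \<Rightarrow> ratfun \<Rightarrow> ratfun" where
  "scale_fun c h = (to_fract [:c:] * fst h, to_fract [:c:] * snd h)"

lemma vector_space_scale_fun: "vector_space scale_fun"
proof -
  have add: "to_fract [:a + b:] = to_fract [:a:] + to_fract [:b:]" for a b :: qbar
    by (simp flip: to_fract_add)
  have mult: "to_fract [:a * b:] = to_fract [:a:] * to_fract [:b:]" for a b :: qbar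
    by (simp flip: to_fract_mult)
  have one: "to_fract [:1::qbar:] = 1"
    by (metis one_pCons to_fract_1)
  show ?thesis
    by unfold_locales
       (simp_all add: scale_fun_def add mult one algebra_simps prod_eq_iff)
qed

text \<open>Riemann's definition: the genus is the supremum of \<open>deg D + 1 - dim L(D)\<close>.\<close>

definition genus :: "rat poly \<Rightarrow> int" where
  "genus f = (SUP D\<in>carrier (divisors f).
     div_degree D + 1 - int (vector_space.dim scale_fun (rr_space f D)))"

text \<open>The group of geometric points of the Jacobian is the group of degree 0 divisor classes.\<close>

definition jacobian :: "rat poly \<Rightarrow> (point \<Rightarrow>\<^sub>0 int) set monoid" where
  "jacobian f = divisors0 f Mod principal f"

definition div_class :: "rat poly \<Rightarrow> (point \<Rightarrow>\<^sub>0 int) \<Rightarrow> (point \<Rightarrow>\<^sub>0 int) set" where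
  "div_class f D = principal f #>\<^bsub>divisors0 f\<^esub> D"


section \<open>The Galois action and rational points of the Jacobian\<close>

definition galois :: "(qbar \<Rightarrow> qbar) set" where
  "galois = {\<sigma>. bij \<sigma> \<and> (\<forall>x y. \<sigma> (x + y) = \<sigma> x + \<sigma> y \<and> \<sigma> (x * y) = \<sigma> x * \<sigma> y)}"

primrec galois_point :: "(qbar \<Rightarrow> qbar) \<Rightarrow> point \<Rightarrow> point" where
  "galois_point \<sigma> (Aff x y) = Aff (\<sigma> x) (\<sigma> y)"
| "galois_point \<sigma> (Infty s) = Infty (\<sigma> s)"

definition galois_class ::
  "(qbar \<Rightarrow> qbar) \<Rightarrow> (point \<Rightarrow>\<^sub>0 int) set \<Rightarrow> (point \<Rightarrow>\<^sub>0 int) set" where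
  "galois_class \<sigma> c = frag_extend (frag_of \<circ> galois_point \<sigma>) ` c"

definition jacobian_rat :: "rat poly \<Rightarrow> (point \<Rightarrow>\<^sub>0 int) set monoid" where
  "jacobian_rat f = (jacobian f)\<lparr>carrier :=
     {c \<in> carrier (jacobian f). \<forall>\<sigma>\<in>galois. galois_class \<sigma> c = c}\<rparr>"

definition torsion :: "('a, 'b) monoid_scheme \<Rightarrow> ('a, 'b) monoid_scheme" where
  "torsion G = G\<lparr>carrier := {x \<in> carrier G. \<exists>n::nat. n > 0 \<and> x [^]\<^bsub>G\<^esub> n = \<one>\<^bsub>G\<^esub>}\<rparr>"

definition rk :: "nat \<Rightarrow> ('a, 'b) monoid_scheme \<Rightarrow> nat" where
  "rk m G = (GREATEST r. \<exists>H. subgroup H G \<and>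
     G\<lparr>carrier := H\<rparr> \<cong> product_group {..<r} (\<lambda>_. integer_mod_group m))"


section \<open>Morphisms of curves\<close>

definition fracts_over :: "qbar set \<Rightarrow> qbar poly fract set" where
  "fracts_over k = {Fraction_Field.Fract p q | p q.
     q \<noteq> 0 \<and> set (Polynomial.coeffs p) \<subseteq> k \<and> set (Polynomial.coeffs q) \<subseteq> k}"

definition funs_over :: "qbar set \<Rightarrow> ratfun set" where
  "funs_over k = fracts_over k \<times> fracts_over k"

definition inf_chart :: "nat \<Rightarrow> qbar \<Rightarrow> qbar \<Rightarrow> point" where
  "inf_chart d w s = (if w = 0 then Infty s else Aff (1 / w) (s / w ^ d))"

text \<open>
  Morphism defined over the subfield \<open>k\<close>: near every point the map is given, in one of the two
  charts of the target, by regular functions with coefficients in \<open>k\<close>.  The neighbourhoods of a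
  point on an irreducible curve are the cofinite sets containing it.
\<close>

definition morphism_over ::
  "qbar set \<Rightarrow> rat poly \<Rightarrow> rat poly \<Rightarrow> (point \<Rightarrow> point) \<Rightarrow> bool" where
  "morphism_over k f g \<phi> \<longleftrightarrow>
     \<phi> ` points f \<subseteq> points g \<and>
     (\<forall>P\<in>points f. \<exists>chart\<in>{Aff, inf_chart (half_deg g)}.
        \<exists>u\<in>funs_over k. \<exists>v\<in>funs_over k. \<exists>S. finite S \<and> P \<notin> S \<and>
          (\<forall>Q\<in>points f - S. regular_at f Q u \<and> regular_at f Q v \<and>
             \<phi> Q = chart (value_at f Q u) (value_at f Q v)))"


section \<open>Elliptic curves\<close>

definition elliptic_curve :: "rat poly \<Rightarrow> bool" where
  "elliptic_curve g \<longleftrightarrow> Polynomial.degree g = 3 \<and> squarefree g"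

text \<open>
  The group law with origin \<open>O = Infty 0\<close>: the sum of \<open>P\<close> and \<open>Q\<close> is the point \<open>R\<close> for which the
  divisor \<open>P + Q - R - O\<close> is principal.
\<close>

definition ec_group :: "rat poly \<Rightarrow> point monoid" where
  "ec_group g = \<lparr>carrier = points g,
     monoid.mult = (\<lambda>P Q. THE R. R \<in> points g \<and>
        frag_of P + frag_of Q - frag_of R - frag_of (Infty 0) \<in> principal g),
     one = Infty 0\<rparr>"

definition ec_isomorphism :: "rat poly \<Rightarrow> rat poly \<Rightarrow> (point \<Rightarrow> point) \<Rightarrow> bool" where
  "ec_isomorphism g h \<alpha> \<longleftrightarrow>
     bij_betw \<alpha> (points g) (points h) \<and> \<alpha> (Infty 0) = Infty 0 \<and>
     morphism_over (range to_ac) g h \<alpha> \<and>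
     morphism_over (range to_ac) h g (inv_into (points g) \<alpha>)"

definition ec_isomorphic :: "rat poly \<Rightarrow> rat poly \<Rightarrow> bool" where
  "ec_isomorphic g h \<longleftrightarrow> (\<exists>\<alpha>. ec_isomorphism g h \<alpha>)"

text \<open>A bielliptic map is a morphism of degree 2 onto an elliptic curve.\<close>

definition bielliptic_map :: "rat poly \<Rightarrow> rat poly \<Rightarrow> (point \<Rightarrow> point) \<Rightarrow> bool" where
  "bielliptic_map f g \<phi> \<longleftrightarrow>
     elliptic_curve g \<and> morphism_over (range to_ac) f g \<phi> \<and>
     finite {R \<in> points g. card {P \<in> points f. \<phi> P = R} \<noteq> 2}"


section \<open>Isogenies from a Jacobian to a product of two elliptic curves\<close>

text \<open>
  A homomorphism from the Jacobian of \<open>C\<close> to an elliptic curve \<open>E\<close> is a morphism of varieties iff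
  its composition with the Abel-Jacobi map \<open>P \<mapsto> [P - P\<^sub>0]\<close> is a morphism \<open>C \<rightarrow> E\<close>
  (the Jacobian is the Albanese variety of \<open>C\<close>), and it is defined over the rationals iff it commutes
  with the Galois action.
\<close>

definition jac_hom ::
  "rat poly \<Rightarrow> rat poly \<Rightarrow> rat poly \<Rightarrow> ((point \<Rightarrow>\<^sub>0 int) set \<Rightarrow> point \<times> point) \<Rightarrow> bool" where
  "jac_hom f g h \<psi> \<longleftrightarrow>
     \<psi> \<in> hom (jacobian f) (ec_group g \<times>\<times> ec_group h) \<and>
     (\<forall>P\<^sub>0\<in>points f.
        morphism_over UNIV f g (\<lambda>P. fst (\<psi> (div_class f (frag_of P - frag_of P\<^sub>0)))) \<and>
        morphism_over UNIV f h (\<lambda>P. snd (\<psi> (div_class f (frag_of P - frag_of P\<^sub>0))))) \<and>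
     (\<forall>\<sigma>\<in>galois. \<forall>c\<in>carrier (jacobian f).
        \<psi> (galois_class \<sigma> c) = map_prod (galois_point \<sigma>) (galois_point \<sigma>) (\<psi> c))"

definition jac_isogeny ::
  "rat poly \<Rightarrow> rat poly \<Rightarrow> rat poly \<Rightarrow> ((point \<Rightarrow>\<^sub>0 int) set \<Rightarrow> point \<times> point) \<Rightarrow> bool" where
  "jac_isogeny f g h \<psi> \<longleftrightarrow>
     jac_hom f g h \<psi> \<and>
     \<psi> ` carrier (jacobian f) = carrier (ec_group g \<times>\<times> ec_group h) \<and>
     finite (kernel (jacobian f) (ec_group g \<times>\<times> ec_group h) \<psi>)"

definition jac_22_isogeny ::
  "rat poly \<Rightarrow> rat poly \<Rightarrow> rat poly \<Rightarrow> ((point \<Rightarrow>\<^sub>0 int) set \<Rightarrow> point \<times> point) \<Rightarrow> bool" where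
  "jac_22_isogeny f g h \<psi> \<longleftrightarrow>
     jac_isogeny f g h \<psi> \<and>
     (jacobian f)\<lparr>carrier := kernel (jacobian f) (ec_group g \<times>\<times> ec_group h) \<psi>\<rparr> \<cong>
       integer_mod_group 2 \<times>\<times> integer_mod_group 2"

definition jac_22_isogenous :: "rat poly \<Rightarrow> rat poly \<Rightarrow> rat poly \<Rightarrow> bool" where
  "jac_22_isogenous f g h \<longleftrightarrow> (\<exists>\<psi>. jac_22_isogeny f g h \<psi>)"

definition push_sum :: "rat poly \<Rightarrow> (point \<Rightarrow> point) \<Rightarrow> (point \<Rightarrow>\<^sub>0 int) \<Rightarrow> point" where
  "push_sum g \<phi> D = finprod (ec_group g)
     (\<lambda>P. \<phi> P [^]\<^bsub>ec_group g\<^esub> Poly_Mapping.lookup D P) (Poly_Mapping.keys D)"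

text \<open>
  The homomorphism induced by maps \<open>\<phi>\<close>, \<open>\<chi>\<close> from \<open>C\<close> to two elliptic curves sends the class of
  \<open>\<Sum> n\<^sub>P P\<close> to \<open>(\<Sum> n\<^sub>P \<phi>(P), \<Sum> n\<^sub>P \<chi>(P))\<close>.
\<close>

definition induced_by ::
  "rat poly \<Rightarrow> rat poly \<Rightarrow> rat poly \<Rightarrow> (point \<Rightarrow> point) \<Rightarrow> (point \<Rightarrow> point) \<Rightarrow>
   ((point \<Rightarrow>\<^sub>0 int) set \<Rightarrow> point \<times> point) \<Rightarrow> bool" where
  "induced_by f g h \<phi> \<chi> \<psi> \<longleftrightarrow>
     (\<forall>D\<in>carrier (divisors0 f). \<psi> (div_class f D) = (push_sum g \<phi> D, push_sum h \<chi> D))"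


section \<open>The curves of the theorem\<close>

definition E_poly :: "rat \<Rightarrow> rat poly" where
  "E_poly t = [:0, 1:] *
     [:16 * (t^2 - 3 * t + 1) * (t - 1)^5 * t^5,
       - ((2 * t^2 - 2 * t + 1) * (4 * t^4 - 12 * t^3 + 6 * t^2 + 2 * t - 1)), 1:]"

definition coef_a :: "rat \<Rightarrow> rat \<Rightarrow> rat \<Rightarrow> rat" where
  "coef_a t u z =
    2 * (8 * t^6 * z - 32 * t^5 * z + 40 * t^4 * z - 20 * t^3 * z + 4 * t * z - 8 * u^6
      + 32 * u^5 - 40 * u^4 + 20 * u^3 - 4 * u - z + 1)"

definition coef_a0 :: "rat \<Rightarrow> rat" where
  "coef_a0 t =
    -64 * t^5 * (t - 1)^5 * (t^2 - 3 * t + 1)"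

definition coef_a2 :: "rat \<Rightarrow> rat \<Rightarrow> rat \<Rightarrow> rat" where
  "coef_a2 t u z =
    2 * (32 * t^12 * z - 256 * t^11 * z + 832 * t^10 * z - 1440 * t^9 * z + 1440 * t^8 *
      z - 960 * t^7 * z + 64 * t^6 * u^6 - 256 * t^6 * u^5 + 320 * t^6 * u^4 - 160 * t^6
      * u^3 + 32 * t^6 * u + 640 * t^6 * z - 8 * t^6 - 256 * t^5 * u^6 + 1024 * t^5 *
      u^5 - 1280 * t^5 * u^4 + 640 * t^5 * u^3 - 128 * t^5 * u - 480 * t^5 * z + 32 *
      t^5 + 320 * t^4 * u^6 - 1280 * t^4 * u^5 + 1600 * t^4 * u^4 - 800 * t^4 * u^3 +
      160 * t^4 * u + 240 * t^4 * z - 40 * t^4 - 160 * t^3 * u^6 + 640 * t^3 * u^5 - 800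
      * t^3 * u^4 + 400 * t^3 * u^3 - 80 * t^3 * u - 40 * t^3 * z + 20 * t^3 - 16 * t^2
      * z + 32 * t * u^6 - 128 * t * u^5 + 160 * t * u^4 - 80 * t * u^3 + 16 * t * u + 8
      * t * z - 4 * t - 8 * u^6 + 32 * u^5 - 40 * u^4 + 20 * u^3 - 4 * u - z + 1)"

definition coef_a4 :: "rat \<Rightarrow> rat \<Rightarrow> rat \<Rightarrow> rat" where
  "coef_a4 t u z =
    384 * t^7 * z^2 - 128 * t^6 * u^6 * z + 512 * t^6 * u^5 * z - 640 * t^6 * u^4 * z +
      320 * t^6 * u^3 * z - 64 * t^6 * u * z - 1152 * t^6 * z^2 + 16 * t^6 * z + 512 *
      t^5 * u^6 * z - 2048 * t^5 * u^5 * z + 2560 * t^5 * u^4 * z - 1280 * t^5 * u^3 * z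
      + 256 * t^5 * u * z + 1344 * t^5 * z^2 - 64 * t^5 * z - 640 * t^4 * u^6 * z + 2560
      * t^4 * u^5 * z - 3200 * t^4 * u^4 * z + 1600 * t^4 * u^3 * z - 320 * t^4 * u * z
      - 720 * t^4 * z^2 + 80 * t^4 * z + 320 * t^3 * u^6 * z - 1280 * t^3 * u^5 * z +
      1600 * t^3 * u^4 * z - 800 * t^3 * u^3 * z + 160 * t^3 * u * z + 120 * t^3 * z^2 -
      40 * t^3 * z + 48 * t^2 * z^2 - 64 * t * u^6 * z + 256 * t * u^5 * z - 320 * t *
      u^4 * z + 160 * t * u^3 * z - 32 * t * u * z - 24 * t * z^2 + 8 * t * z - 64 *
      u^12 + 512 * u^11 - 1664 * u^10 + 2880 * u^9 - 2880 * u^8 + 1536 * u^7 + 16 * u^6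
      * z - 128 * u^6 - 64 * u^5 * z - 384 * u^5 + 80 * u^4 * z + 240 * u^4 - 40 * u^3 *
      z - 40 * u^3 - 16 * u^2 + 8 * u * z + 8 * u + 3 * z^2 - 2 * z - 1"

definition coef_a6 :: "rat \<Rightarrow> rat \<Rightarrow> rat \<Rightarrow> rat" where
  "coef_a6 t u z =
    z * (-128 * t^7 * z^2 + 384 * t^6 * z^2 - 448 * t^5 * z^2 + 240 * t^4 * z^2 - 40 *
      t^3 * z^2 - 16 * t^2 * z^2 + 8 * t * z^2 + 64 * u^12 - 512 * u^11 + 1664 * u^10 -
      2880 * u^9 + 2880 * u^8 - 1536 * u^7 + 128 * u^6 + 384 * u^5 - 240 * u^4 + 40 *
      u^3 + 16 * u^2 - 8 * u - z^2 + 1)"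

definition C_poly :: "rat \<Rightarrow> rat \<Rightarrow> rat \<Rightarrow> rat poly" where
  "C_poly t u z = smult (coef_a t u z)
     [:coef_a0 t, 0, coef_a2 t u z, 0, coef_a4 t u z, 0, coef_a6 t u z:]"

definition Et'_poly :: "rat \<Rightarrow> rat \<Rightarrow> rat \<Rightarrow> rat poly" where
  "Et'_poly t u z = smult (coef_a t u z)
     [:coef_a6 t u z, coef_a4 t u z, coef_a2 t u z, coef_a0 t:]"

definition Eu'_poly :: "rat \<Rightarrow> rat \<Rightarrow> rat \<Rightarrow> rat poly" where
  "Eu'_poly t u z = smult (coef_a t u z)
     [:coef_a0 t, coef_a2 t u z, coef_a4 t u z, coef_a6 t u z:]"

end

theory Submission
  imports Defs
begin

text \<open>
  Put \<open>p = P(t)\<close>, \<open>q = Q(t)\<close>, where \<open>E\<^sub>t\<close> is \<open>y\<^sup>2 = x(x\<^sup>2 - p x + q)\<close>, and \<open>D = p\<^sup>2 - 4q\<close>, \<open>r = P(u)\<close>.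
  The hypothesis says \<open>r\<^sup>2 - 4Q(u) = D z\<^sup>2\<close>, so the 2-torsion of \<open>E\<^sub>t\<close> and \<open>E\<^sub>u\<close> is defined over the same
  field, and \<open>a\<^sub>0 x\<^sup>3 + a\<^sub>2 x\<^sup>2 + a\<^sub>4 x + a\<^sub>6\<close> is the cubic whose roots are quotients of matching differences
  of 2-torsion abscissae; it has the rational root \<open>z\<close>, and affine substitutions turn it and its
  reversal into \<open>E\<^sub>t\<close> and \<open>E\<^sub>u\<close>.  Every degree 0 class on a curve of genus 2 is \<open>[P - Q]\<close>, and it is
  killed by both quotient maps iff \<open>P = Q\<close> or \<open>P, Q\<close> are Weierstrass points \<open>(\<plusminus>x, 0)\<close>, which gives the
  kernel; the classes \<open>[P - \<iota>P]\<close> hit \<open>(2\<phi>(P), 0)\<close> and \<open>(0, 2\<chi>(P))\<close>, which gives surjectivity.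

  Orders of vanishing are handled through the fact that a valuation of the function field is
  determined up to a factor by its centre; hence morphisms and Galois automorphisms preserve
  principal divisors.

  The 5-division polynomial of \<open>E\<^sub>t\<close> is \<open>M (5 H\<^sup>2 - \<delta>\<^sup>2 M\<^sup>4)\<close> up to a factor, where the roots of \<open>M\<close> are the
  abscissae of the known points of order 5 and \<open>\<delta> \<noteq> 0\<close>.  A further rational 5-torsion point would make
  \<open>\<surd>5\<close> fixed by the Galois group.  As the kernel of the isogeny has exponent 2, multiplication by 6 lifts
  rational 5-torsion points to the Jacobian.
\<close>

section \<open>Evaluation of rational functions\<close>

text \<open>\<open>ord_at\<close> expands along a parametrisation picked by \<open>SOME\<close>, so
  orders are read off from series only for chart coordinates; all others follow because the centre
  and the value 1 on a uniformizer pin a valuation down. The maps along which principal divisors are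
  pushed have the form (x, y) \<mapsto> (u(x), w(x) y), and norms reduce their orders to rational
  functions of x. Let e1, e2 and f1, f2 be the nonzero 2-torsion abscissae of the two curves, with
  f1 - f2 = z (e1 - e2). The roots of the cubic are z, f1/e1, f2/e2. They are distinct iff
  \<open>coef_a\<close> is nonzero, that is, iff the matching of 2-torsion does not extend to an
  affine map of the line. The outer factor a selects the quadratic twist for which both isomorphisms
  have rational scalings. Behind the factored division polynomial stands the Weil pairing: a second
  independent rational point of order 5 would make the fifth roots of unity rational, and they
  generate \<surd>5. The explicit factors replace the pairing.\<close>

definition rat_eval :: "('a::field \<Rightarrow> 'b::field) \<Rightarrow> 'b \<Rightarrow> 'a poly fract \<Rightarrow> 'b" where
  "rat_eval c b A = (THE z. \<exists>p q. q \<noteq> 0 \<and> A = Fraction_Field.Fract p q \<and>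
      z = poly (map_poly c p) b / poly (map_poly c q) b)"

text \<open>The coefficient map \<open>c\<close> is left open because three instances are needed:
  \<open>fls_const\<close> for expansions along a branch, \<open>cf\<close> for substitutions x
  \<mapsto> u(x), and \<open>cf\<close> after an automorphism for the Galois action.\<close>

locale hom_evaluation =
  fixes c :: "'a::field \<Rightarrow> 'b::field" and b :: 'b
  assumes c_add: "c (x + y) = c x + c y"
    and c_mult: "c (x * y) = c x * c y"
    and c_1: "c 1 = 1"
begin

abbreviation E where "E p \<equiv> poly (map_poly c p) b"

lemma c_0 [simp]: "c 0 = 0"
  using c_add[of 0 0] by (metis add.right_neutral add_left_cancel)

lemma E_0 [simp]: "E 0 = 0" by simp

lemma E_pCons: "E (pCons a p) = c a + b * E p"
  by (simp add: map_poly_pCons)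

lemma E_add: "E (p + q) = E p + E q"
  by (induction p q rule: poly_induct2) (auto simp: E_pCons c_add algebra_simps)

lemma E_smult: "E (smult a q) = c a * E q"
  by (induction q) (auto simp: E_pCons c_mult algebra_simps)

lemma E_mult: "E (p * q) = E p * E q"
  by (induction p) (auto simp: E_pCons E_add E_smult algebra_simps)

lemma E_1 [simp]: "E 1 = 1"
  by (simp add: one_pCons E_pCons c_1)

end

text \<open>Transcendence of \<open>b\<close> over the image of \<open>c\<close> makes evaluation
  injective on polynomials, so it extends to a field embedding \<open>ev\<close> of the rational
  functions.\<close>

locale rat_evaluation = hom_evaluation +
  assumes transcendental: "p \<noteq> 0 \<Longrightarrow> poly (map_poly c p) b \<noteq> 0"
begin

abbreviation ev where "ev \<equiv> rat_eval c b"

lemma E_eq_0_iff [simp]: "E p = 0 \<longleftrightarrow> p = 0"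
  using transcendental by fastforce

lemma ev_Fract: "q \<noteq> 0 \<Longrightarrow> ev (Fraction_Field.Fract p q) = E p / E q"
  unfolding rat_eval_def
proof (rule the_equality)
  fix z assume q: "q \<noteq> 0" and "\<exists>p' q'. q' \<noteq> 0 \<and> Fraction_Field.Fract p q = Fraction_Field.Fract p' q' \<and> z = E p' / E q'"
  then obtain p' q' where *: "q' \<noteq> 0" "Fraction_Field.Fract p q = Fraction_Field.Fract p' q'" "z = E p' / E q'"
    by blast
  then have "p * q' = p' * q" using q by (simp add: eq_fract)
  then have "E p * E q' = E p' * E q" by (metis E_mult)
  with * q show "z = E p / E q" by (simp add: frac_eq_eq)
qed auto

lemma fract_cases: obtains p q where "q \<noteq> 0" "A = Fraction_Field.Fract p q"
  by (metis Fract_cases)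

lemma ev_to_fract: "ev (to_fract p) = E p"
  by (simp add: to_fract_def ev_Fract)

lemma ev_0 [simp]: "ev 0 = 0"
  using ev_to_fract[of 0] by simp

lemma ev_1 [simp]: "ev 1 = 1"
  using ev_to_fract[of 1] by simp

lemma ev_add: "ev (A + B) = ev A + ev B"
proof (cases A, cases B)
  fix p q r s assume "A = Fraction_Field.Fract p q" "q \<noteq> 0" "B = Fraction_Field.Fract r s" "s \<noteq> 0"
  then show ?thesis by (simp add: ev_Fract E_add E_mult field_simps)
qed

lemma ev_mult: "ev (A * B) = ev A * ev B"
proof (cases A, cases B)
  fix p q r s assume "A = Fraction_Field.Fract p q" "q \<noteq> 0" "B = Fraction_Field.Fract r s" "s \<noteq> 0"
  then show ?thesis by (simp add: ev_Fract E_add E_mult field_simps)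
qed

lemma ev_minus: "ev (- A) = - ev A"
  using ev_add[of A "- A"] by (simp add: add_eq_0_iff)

lemma ev_diff: "ev (A - B) = ev A - ev B"
  using ev_add[of A "- B"] by (simp add: ev_minus)

lemma ev_eq_0_iff [simp]: "ev A = 0 \<longleftrightarrow> A = 0"
proof (cases A)
  fix p q assume *: "A = Fraction_Field.Fract p q" "q \<noteq> 0"
  then show ?thesis by (auto simp: ev_Fract Zero_fract_def eq_fract)
qed

lemma ev_inverse: "ev (inverse A) = inverse (ev A)"
proof (cases "A = 0")
  case False
  then have "ev A * ev (inverse A) = 1" by (simp flip: ev_mult)
  then show ?thesis by (metis inverse_unique)
qed simp

lemma ev_divide: "ev (A / B) = ev A / ev B"
  by (simp add: divide_inverse ev_mult ev_inverse)

lemma ev_power: "ev (A ^ n) = ev A ^ n"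
  by (induction n) (auto simp: ev_mult)

end

section \<open>Constants and places of the field of rational functions in one variable\<close>

definition cf :: "'a::field \<Rightarrow> 'a poly fract" where "cf a = to_fract [:a:]"
abbreviation fx :: "'a::field poly fract" where "fx \<equiv> to_fract [:0, 1:]"

lemma cf_add: "cf (a + b) = cf a + cf b" by (simp add: cf_def flip: to_fract_add)
lemma cf_mult: "cf (a * b) = cf a * cf b" by (simp add: cf_def flip: to_fract_mult)
lemma cf_0 [simp]: "cf 0 = 0" by (simp add: cf_def)
lemma cf_1 [simp]: "cf 1 = 1" by (metis cf_def one_pCons to_fract_1)
lemma cf_minus: "cf (- a) = - cf a" using cf_add[of a "- a"] by (simp add: add_eq_0_iff)
lemma cf_diff: "cf (a - b) = cf a - cf b" using cf_add[of a "- b"] by (simp add: cf_minus)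
lemma cf_eq_0_iff [simp]: "cf a = 0 \<longleftrightarrow> a = 0" by (simp add: cf_def)
lemma cf_eq_iff [simp]: "cf a = cf b \<longleftrightarrow> a = b" by (simp add: cf_def)
lemma cf_of_nat: "cf (of_nat n) = of_nat n" by (induction n) (auto simp: cf_add)
lemma cf_numeral: "cf (numeral n) = numeral n" using cf_of_nat[of "numeral n"] by simp

lemma to_fract_pCons: "to_fract (pCons a p) = cf a + fx * to_fract p"
proof -
  have "pCons a p = [:a:] + [:0, 1:] * p" by simp
  then show ?thesis by (simp only: to_fract_add to_fract_mult cf_def)
qed

lemma to_fract_poly: "to_fract p = poly (map_poly cf p) fx"
proof (induction p)
  case (pCons a p)
  then show ?case using to_fract_pCons[of a p] by (simp add: map_poly_pCons)
qed simp

lemma poly_map_cf_to_fract: "poly (map_poly cf p) (to_fract r) = to_fract (pcompose p r)"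
  by (induction p) (auto simp: map_poly_pCons pcompose_pCons cf_def)

text \<open>A place of the rational function field, given by a generator \<open>\<pi>\<close> of that field that is
  declared to be the uniformizer.\<close>

definition place :: "'a::field poly fract \<Rightarrow> bool" where
  "place \<pi> \<longleftrightarrow> rat_evaluation cf \<pi> \<and> surj (rat_eval cf \<pi>)"

text \<open>Order of vanishing at \<pi> = 0. As \<pi> generates the field, finite points and the
  point at infinity are treated alike, with \<pi> = x - a and \<pi> = 1/x.\<close>

definition nu :: "'a::field poly fract \<Rightarrow> 'a poly fract \<Rightarrow> int" where
  "nu \<pi> A = (THE n. \<exists>p q. poly p 0 \<noteq> 0 \<and> poly q 0 \<noteq> 0 \<and>
     A = \<pi> powi n * poly (map_poly cf p) \<pi> / poly (map_poly cf q) \<pi>)"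

lemma rat_evaluation_cfI:
  assumes "\<And>p. p \<noteq> 0 \<Longrightarrow> poly (map_poly cf p) \<pi> \<noteq> 0"
  shows "rat_evaluation cf \<pi>"
  by standard (use assms in \<open>auto simp: cf_add cf_mult\<close>)

text \<open>The image of the evaluation is a subfield containing the constants, so it is the whole
  field as soon as it contains x.\<close>

lemma placeI:
  assumes tr: "\<And>p. p \<noteq> 0 \<Longrightarrow> poly (map_poly cf p) \<pi> \<noteq> 0"
    and x: "fx = rat_eval cf \<pi> B"
  shows "place \<pi>"
proof -
  interpret rat_evaluation cf \<pi> by (rule rat_evaluation_cfI) (rule tr)
  have c: "cf a \<in> range ev" for a
    using ev_to_fract[of "[:a:]"] by (intro range_eqI[of _ _ "to_fract [:a:]"]) (simp add: E_pCons)
  have p: "to_fract p \<in> range ev" for p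
  proof (induction p)
    case (pCons a p)
    then obtain C D where CD: "cf a = ev C" "to_fract p = ev D" using c[of a] by blast
    have "to_fract (pCons a p) = ev (C + B * D)"
      by (subst to_fract_pCons) (simp only: x CD ev_add ev_mult)
    then show ?case by blast
  qed (use ev_0 in \<open>metis rangeI to_fract_0\<close>)
  have "A \<in> range ev" for A
  proof (cases A)
    fix r q assume *: "A = Fraction_Field.Fract r q" "q \<noteq> 0"
    obtain C D where CD: "to_fract r = ev C" "to_fract q = ev D" using p by blast
    have "A = to_fract r / to_fract q" using * by (simp add: to_fract_def divide_fract)
    also have "\<dots> = ev (C / D)" by (simp add: CD ev_divide)
    finally show ?thesis by blast
  qed
  then show ?thesis unfolding place_def using rat_evaluation_axioms by blast
qed

lemma place_affine: "place (to_fract [:- a, 1:])"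
proof (rule placeI)
  show "p \<noteq> 0 \<Longrightarrow> poly (map_poly cf p) (to_fract [:- a, 1:]) \<noteq> 0" for p
    by (simp add: poly_map_cf_to_fract pcompose_eq_0_iff)
  then interpret rat_evaluation cf "to_fract [:- a, 1:]" by (rule rat_evaluation_cfI)
  show "fx = ev (to_fract [:a, 1:])"
    by (simp add: ev_to_fract poly_map_cf_to_fract pcompose_pCons)
qed

lemma fx_nz [simp]: "fx \<noteq> 0" by simp

lemma poly_map_cf_inverse_x:
  "poly (map_poly cf p) (1 / fx) * fx ^ degree p = to_fract (reflect_poly p)"
proof -
  have "poly (map_poly cf p) (1 / fx) * fx ^ degree p = (\<Sum>i\<le>degree p. cf (coeff p i) * (1/fx)^i * fx ^ degree p)"
    by (simp add: poly_altdef coeff_map_poly sum_distrib_right degree_map_poly)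
  also have "\<dots> = (\<Sum>i\<le>degree p. cf (coeff p i) * fx ^ (degree p - i))"
    by (intro sum.cong refl) (auto simp: power_diff power_one_over field_simps)
  also have "\<dots> = (\<Sum>i\<le>degree p. cf (coeff (reflect_poly p) i) * fx ^ i)"
    by (rule sum.reindex_bij_witness[of _ "\<lambda>i. degree p - i" "\<lambda>i. degree p - i"])
       (auto simp: coeff_reflect_poly)
  also have "\<dots> = (\<Sum>i\<le>degree (reflect_poly p). cf (coeff (reflect_poly p) i) * fx ^ i)"
    by (rule sum.mono_neutral_right) (auto simp: degree_reflect_poly_le coeff_eq_0)
  also have "\<dots> = to_fract (reflect_poly p)"
    by (subst to_fract_poly) (simp add: poly_altdef coeff_map_poly degree_map_poly)
  finally show ?thesis .
qed

lemma place_infinity: "place (1 / fx)"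
proof (rule placeI)
  show nz: "p \<noteq> 0 \<Longrightarrow> poly (map_poly cf p) (1 / fx) \<noteq> 0" for p
    using poly_map_cf_inverse_x[of p] by (auto simp: to_fract_eq_0_iff)
  then interpret rat_evaluation cf "1 / fx" by (rule rat_evaluation_cfI)
  show "fx = ev (1 / to_fract [:0, 1:])"
    by (simp add: ev_to_fract ev_divide map_poly_pCons)
qed

text \<open>No normalisation is asked for: restrictions of valuations from a ramified cover take
  values in a proper multiple of the integers. Values at 0 carry no meaning and are left
  out.\<close>

definition kval :: "('a::field poly fract \<Rightarrow> int) \<Rightarrow> bool" where
  "kval v \<longleftrightarrow> (\<forall>A B. A \<noteq> 0 \<longrightarrow> B \<noteq> 0 \<longrightarrow> v (A * B) = v A + v B) \<and>
     (\<forall>A B. A \<noteq> 0 \<longrightarrow> B \<noteq> 0 \<longrightarrow> A + B \<noteq> 0 \<longrightarrow> v (A + B) \<ge> min (v A) (v B)) \<and>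
     (\<forall>a. a \<noteq> 0 \<longrightarrow> v (cf a) = 0)"

locale place_loc =
  fixes \<pi> :: "'a::field poly fract"
  assumes place: "place \<pi>"
begin

sublocale rat_evaluation cf \<pi> using place by (simp add: place_def)

lemma pi_nz [simp]: "\<pi> \<noteq> 0"
  using E_eq_0_iff[of "[:0,1:]"] by (auto simp: E_pCons)

lemma E_split:
  assumes "p \<noteq> 0"
  obtains n q where "n = order 0 p" "poly q 0 \<noteq> 0" "p = [:0,1:]^n * q" "E p = \<pi> ^ n * E q"
proof -
  obtain q where q: "p = [:- 0, 1:] ^ order 0 p * q" "\<not> [:- 0, 1:] dvd q"
    using order_decomp[OF assms, of 0] by blast
  have "E ([:0,1:]^n) = \<pi> ^ n" for n
    by (induction n) (auto simp: E_mult E_pCons)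
  then have "E p = \<pi> ^ order 0 p * E q" using q(1) by (metis E_mult minus_zero)
  moreover have "poly q 0 \<noteq> 0" using q(2) by (simp add: poly_eq_0_iff_dvd)
  moreover have "p = [:0, 1:] ^ order 0 p * q" using q(1) by simp
  ultimately show ?thesis using that by blast
qed

lemma decomp:
  assumes "A \<noteq> 0"
  obtains n p q where "poly p 0 \<noteq> 0" "poly q 0 \<noteq> 0" "A = \<pi> powi n * E p / E q"
proof -
  from place obtain B where B: "A = ev B" unfolding place_def by blast
  obtain p q where pq: "q \<noteq> 0" "B = Fraction_Field.Fract p q" by (rule fract_cases)
  have A: "A = E p / E q" using B pq by (simp add: ev_Fract)
  with assms have "p \<noteq> 0" by auto
  obtain p' where p': "poly p' 0 \<noteq> 0" "E p = \<pi> ^ order 0 p * E p'" using E_split[OF \<open>p \<noteq> 0\<close>] by metis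
  obtain q' where q': "poly q' 0 \<noteq> 0" "E q = \<pi> ^ order 0 q * E q'" using E_split[OF \<open>q \<noteq> 0\<close>] by metis
  have "A = \<pi> powi (int (order 0 p) - int (order 0 q)) * E p' / E q'"
    by (simp add: A p' q' power_int_diff)
  with p' q' that show ?thesis by blast
qed

lemma nu_unique:
  assumes "poly p 0 \<noteq> 0" "poly q 0 \<noteq> 0" "poly r 0 \<noteq> 0" "poly s 0 \<noteq> 0"
    and "\<pi> powi m * E p / E q = \<pi> powi n * E r / E s"
  shows "m = n"
proof -
  have aux: False if "m < n" "poly p 0 \<noteq> 0" "poly q 0 \<noteq> 0" "poly r 0 \<noteq> 0" "poly s 0 \<noteq> 0"
    "\<pi> powi m * E p / E q = \<pi> powi n * E r / E s" for m n and p q r s :: "'a poly"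
  proof -
    have nz: "q \<noteq> 0" "s \<noteq> 0" using that by auto
    have "\<pi> powi n = \<pi> powi m * \<pi> ^ nat (n - m)"
      using \<open>m < n\<close> power_int_add[of \<pi> m "n - m"] by (simp add: power_int_def)
    with that(6) nz have "E p * E s = \<pi> ^ nat (n - m) * E r * E q"
      by (simp add: field_simps)
    moreover have "E ([:0,1:]^n) = \<pi> ^ n" for n
      by (induction n) (auto simp: E_mult E_pCons)
    ultimately have "E (p * s - [:0,1:] ^ nat (n - m) * r * q) = 0"
      using E_add[of "p * s - [:0,1:] ^ nat (n - m) * r * q" "[:0,1:] ^ nat (n - m) * r * q"]
      by (simp add: E_mult)
    then have "p * s = [:0,1:] ^ nat (n - m) * r * q" by simp
    then have "poly (p * s) 0 = poly ([:0,1:] ^ nat (n - m) * r * q) 0" by simp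
    moreover have "(0::'a) ^ nat (n - m) = 0" using \<open>m < n\<close> by simp
    ultimately show False using that by simp
  qed
  show ?thesis using aux[of m n p q r s] aux[of n m r s p q] assms by (metis linorder_neqE)
qed

lemma nu_eqI:
  assumes "poly p 0 \<noteq> 0" "poly q 0 \<noteq> 0" "A = \<pi> powi n * E p / E q"
  shows "nu \<pi> A = n"
  unfolding nu_def
proof (rule the_equality)
  show "\<exists>p q. poly p 0 \<noteq> 0 \<and> poly q 0 \<noteq> 0 \<and> A = \<pi> powi n * E p / E q" using assms by blast
  show "m = n" if "\<exists>p q. poly p 0 \<noteq> 0 \<and> poly q 0 \<noteq> 0 \<and> A = \<pi> powi m * E p / E q" for m
  proof -
    from that obtain r s where "poly r 0 \<noteq> 0" "poly s 0 \<noteq> 0" "A = \<pi> powi m * E r / E s" by blast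
    then show ?thesis using assms by (intro nu_unique[of r s p q]) auto
  qed
qed

lemma nu_decomp:
  assumes "A \<noteq> 0"
  obtains p q where "poly p 0 \<noteq> 0" "poly q 0 \<noteq> 0" "A = \<pi> powi (nu \<pi> A) * E p / E q"
  using decomp[OF assms] nu_eqI by metis

lemma nu_mult: "A \<noteq> 0 \<Longrightarrow> B \<noteq> 0 \<Longrightarrow> nu \<pi> (A * B) = nu \<pi> A + nu \<pi> B"
proof -
  assume "A \<noteq> 0" "B \<noteq> 0"
  obtain p q where pq: "poly p 0 \<noteq> 0" "poly q 0 \<noteq> 0" "A = \<pi> powi (nu \<pi> A) * E p / E q"
    using nu_decomp[OF \<open>A \<noteq> 0\<close>] .
  obtain r s where rs: "poly r 0 \<noteq> 0" "poly s 0 \<noteq> 0" "B = \<pi> powi (nu \<pi> B) * E r / E s"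
    using nu_decomp[OF \<open>B \<noteq> 0\<close>] .
  have "A * B = (\<pi> powi (nu \<pi> A) * E p / E q) * (\<pi> powi (nu \<pi> B) * E r / E s)" using pq rs by simp
  also have "\<dots> = \<pi> powi (nu \<pi> A + nu \<pi> B) * E (p * r) / E (q * s)"
    by (simp add: E_mult power_int_add)
  finally show ?thesis using pq rs by (intro nu_eqI[of "p * r" "q * s"]) auto
qed

text \<open>A place of degree one has the constants as residue field; the residue is
  \<open>poly p 0 / poly q 0\<close>. The alternative \<open>A = cf a\<close> avoids the meaningless
  value of \<open>nu\<close> at 0.\<close>

lemma residue:
  assumes "A = 0 \<or> nu \<pi> A \<ge> 0"
  obtains a where "A = cf a \<or> nu \<pi> (A - cf a) > 0" "A \<noteq> 0 \<and> nu \<pi> A = 0 \<Longrightarrow> a \<noteq> 0"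
proof (cases "A = 0 \<or> nu \<pi> A > 0")
  case True
  then show ?thesis using that[of 0] by auto
next
  case False
  with assms have A: "A \<noteq> 0" "nu \<pi> A = 0" by auto
  obtain p q where pq: "poly p 0 \<noteq> 0" "poly q 0 \<noteq> 0" "A = \<pi> powi (nu \<pi> A) * E p / E q"
    using nu_decomp[OF \<open>A \<noteq> 0\<close>] .
  define a where "a = poly p 0 / poly q 0"
  have a: "a \<noteq> 0" using pq by (simp add: a_def)
  have nz: "q \<noteq> 0" using pq by auto
  have Aa: "A - cf a = E (p - smult a q) / E q"
    using pq A nz E_add[of "p - smult a q" "smult a q"] by (simp add: E_smult field_simps)
  show ?thesis
  proof (cases "p - smult a q = 0")
    case True
    with Aa have "A = cf a" by (metis E_0 div_0 eq_iff_diff_eq_0)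
    with a that show ?thesis by blast
  next
    case False
    obtain n r where nr: "n = order 0 (p - smult a q)" "poly r 0 \<noteq> 0" "E (p - smult a q) = \<pi> ^ n * E r"
      using E_split[OF False] by metis
    have "poly (p - smult a q) 0 = 0" using pq by (simp add: a_def)
    with False have "n > 0" using nr(1) by (simp add: order_gt_0_iff)
    have "A - cf a = \<pi> powi (int n) * E r / E q" using Aa nr by simp
    then have "nu \<pi> (A - cf a) = int n" using nr pq by (intro nu_eqI) auto
    with \<open>n > 0\<close> have "A = cf a \<or> nu \<pi> (A - cf a) > 0" by simp
    then show ?thesis using a by (intro that) auto
  qed
qed

text \<open>Once \<pi> has positive value, polynomials in \<pi> with nonzero constant term are
  units, so only the power of \<pi> in a function counts. This is the uniqueness of a valuation of
  the rational function field with given centre.\<close>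

lemma kval_eq_nu:
  assumes v: "kval v" and pos: "v \<pi> > 0" and A: "A \<noteq> 0"
  shows "v A = v \<pi> * nu \<pi> A"
proof -
  have vm: "v (A * B) = v A + v B" if "A \<noteq> 0" "B \<noteq> 0" for A B using v that by (auto simp: kval_def)
  have va: "v (A + B) \<ge> min (v A) (v B)" if "A \<noteq> 0" "B \<noteq> 0" "A + B \<noteq> 0" for A B
    using v that by (auto simp: kval_def)
  have vc: "v (cf a) = 0" if "a \<noteq> 0" for a using v that by (auto simp: kval_def)
  have v1: "v 1 = 0" using vc[of 1] by simp
  have vinv: "v (inverse A) = - v A" if "A \<noteq> 0" for A
    using vm[of A "inverse A"] v1 that by simp
  have Ege: "v (E p) \<ge> 0" if "p \<noteq> 0" for p
    using that
  proof (induction p)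
    case (pCons a p)
    have E: "E (pCons a p) = cf a + \<pi> * E p" by (rule E_pCons)
    show ?case
    proof (cases "p = 0 \<or> a = 0")
      case True
      then show ?thesis using E pCons pos vc[of a] vm[of \<pi> "E p"] by auto
    next
      case False
      then have "v (\<pi> * E p) \<ge> 0" using pCons pos vm[of \<pi> "E p"] by simp
      moreover have "cf a + \<pi> * E p \<noteq> 0" using E pCons.prems by (metis E_eq_0_iff)
      ultimately show ?thesis using E va[of "cf a" "\<pi> * E p"] False vc[of a] by simp
    qed
  qed simp
  \<comment> \<open>All terms beyond the constant one have positive value; a positive value of the
    sum would force the nonzero constant to have positive value as well.\<close>
  have E0: "v (E p) = 0" if p: "poly p 0 \<noteq> 0" for p
  proof (cases p)
    case (pCons a r)
    have E: "E p = cf a + \<pi> * E r" using pCons E_pCons by simp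
    have a: "a \<noteq> 0" using p pCons by simp
    show ?thesis
    proof (cases "r = 0")
      case False
      have gt: "v (\<pi> * E r) > 0" using Ege[OF False] pos vm[of \<pi> "E r"] False by simp
      have pnz: "p \<noteq> 0" using p by auto
      show ?thesis
      proof (rule ccontr)
        assume "v (E p) \<noteq> 0"
        with Ege[OF pnz] have g: "v (E p) > 0" by simp
        have "v (- (\<pi> * E r)) > 0"
          using gt vm[of "cf (-1)" "\<pi> * E r"] vc[of "-1"] False by (simp add: cf_minus)
        moreover have "E p \<noteq> 0" using pnz by simp
        ultimately have "v (cf a) > 0" using va[of "E p" "- (\<pi> * E r)"] g a False E by simp
        with vc[OF a] show False by simp
      qed
    qed (use E vc a in simp)
  qed
  have pw: "v (\<pi> ^ n) = int n * v \<pi>" for n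
    by (induction n) (auto simp: v1 vm algebra_simps)
  have pwi: "v (\<pi> powi n) = n * v \<pi>" for n
  proof (cases "n \<ge> 0")
    case False
    then have "\<pi> powi n = inverse (\<pi> ^ nat (- n))" by (simp add: power_int_def power_inverse)
    with False pw[of "nat (-n)"] show ?thesis by (simp add: vinv)
  qed (use pw[of "nat n"] in \<open>simp add: power_int_def\<close>)
  obtain p q where pq: "poly p 0 \<noteq> 0" "poly q 0 \<noteq> 0" "A = \<pi> powi (nu \<pi> A) * E p / E q"
    using nu_decomp[OF A] .
  then have nz: "p \<noteq> 0" "q \<noteq> 0" by auto
  have "A = \<pi> powi (nu \<pi> A) * (E p * inverse (E q))"
    by (subst pq(3)) (simp only: divide_inverse mult.assoc)
  then have "v A = v (\<pi> powi (nu \<pi> A) * (E p * inverse (E q)))" by (rule arg_cong)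
  also have "\<dots> = v (\<pi> powi (nu \<pi> A)) + (v (E p) + v (inverse (E q)))"
    using nz by (simp add: vm)
  finally have "v A = v (\<pi> powi (nu \<pi> A)) + (v (E p) + v (inverse (E q)))" .
  then show ?thesis using pwi E0 pq(1,2) nz by (simp add: vinv)
qed

end

section \<open>The function field of \<open>y\<^sup>2 = F(x)\<close>\<close>

text \<open>Product in the quadratic extension generated by y with \<open>y^2 = F\<close>; the pair
  type itself supplies only the additive structure.\<close>

definition rmul :: "qbar poly \<Rightarrow> ratfun \<Rightarrow> ratfun \<Rightarrow> ratfun" where
  "rmul F h k = (fst h * fst k + to_fract F * snd h * snd k, fst h * snd k + snd h * fst k)"

definition rconj :: "ratfun \<Rightarrow> ratfun" where
  "rconj h = (fst h, - snd h)"

definition rnorm :: "qbar poly \<Rightarrow> ratfun \<Rightarrow> qbar poly fract" where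
  "rnorm F h = (fst h)\<^sup>2 - to_fract F * (snd h)\<^sup>2"

definition rinv :: "qbar poly \<Rightarrow> ratfun \<Rightarrow> ratfun" where
  "rinv F h = (fst h / rnorm F h, - snd h / rnorm F h)"

text \<open>That \<open>F\<close> is not a square makes the norm of a nonzero pair nonzero, so the
  pairs form a field.\<close>

locale function_field =
  fixes F :: "qbar poly"
  assumes nonsq: "A\<^sup>2 \<noteq> to_fract F"
begin

abbreviation rmul' (infixl "\<diamondop>" 70) where "h \<diamondop> k \<equiv> rmul F h k"

lemma rmul_assoc: "h \<diamondop> (k \<diamondop> l) = (h \<diamondop> k) \<diamondop> l"
  by (simp add: rmul_def algebra_simps)

lemma rmul_commute: "h \<diamondop> k = k \<diamondop> h"
  by (simp add: rmul_def algebra_simps)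

lemma rmul_add: "h \<diamondop> (k + l) = h \<diamondop> k + h \<diamondop> l"
  by (simp add: rmul_def algebra_simps)

lemma rmul_diff: "h \<diamondop> (k - l) = h \<diamondop> k - h \<diamondop> l"
  by (simp add: rmul_def algebra_simps)

lemma rmul_zero [simp]: "h \<diamondop> 0 = 0" "0 \<diamondop> h = 0"
  by (simp_all add: rmul_def zero_prod_def)

lemma rmul_one [simp]: "h \<diamondop> (1, 0) = h" "(1, 0) \<diamondop> h = h"
  by (simp_all add: rmul_def)

lemma rmul_x: "(A, 0) \<diamondop> h = (A * fst h, A * snd h)" "h \<diamondop> (A, 0) = (A * fst h, A * snd h)"
  by (simp_all add: rmul_def algebra_simps)

lemma rmul_rconj: "h \<diamondop> rconj h = (rnorm F h, 0)"
  by (simp add: rmul_def rconj_def rnorm_def power2_eq_square algebra_simps)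

lemma rnorm_eq_0_iff [simp]: "rnorm F h = 0 \<longleftrightarrow> h = 0"
proof
  assume *: "rnorm F h = 0"
  have "snd h = 0"
  proof (rule ccontr)
    assume "snd h \<noteq> 0"
    with * have "(fst h / snd h)\<^sup>2 = to_fract F"
      by (simp add: rnorm_def power_divide)
    with nonsq show False by blast
  qed
  with * show "h = 0" by (auto simp: rnorm_def prod_eq_iff)
qed (simp add: rnorm_def)

lemma rmul_eq_0_iff [simp]: "h \<diamondop> k = 0 \<longleftrightarrow> h = 0 \<or> k = 0"
proof (cases "h = 0")
  case False
  show ?thesis
  proof
    assume "h \<diamondop> k = 0"
    then have "rconj h \<diamondop> (h \<diamondop> k) = 0" by simp
    then have "(rnorm F h, 0) \<diamondop> k = 0" by (metis rmul_assoc rmul_commute rmul_rconj)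
    with False show "h = 0 \<or> k = 0" by (auto simp: rmul_x prod_eq_iff)
  qed auto
qed simp

lemma rinv_right: "h \<noteq> 0 \<Longrightarrow> h \<diamondop> rinv F h = (1, 0)"
proof -
  assume "h \<noteq> 0"
  moreover have "h \<diamondop> rinv F h = (1 / rnorm F h, 0) \<diamondop> (h \<diamondop> rconj h)"
    by (simp add: rinv_def rmul_def rconj_def algebra_simps add_divide_distrib diff_divide_distrib)
  ultimately show ?thesis by (simp add: rmul_rconj rmul_x)
qed

lemma rinv_nz: "h \<noteq> 0 \<Longrightarrow> rinv F h \<noteq> 0"
  using rinv_right[of h] by (metis fst_conv fst_zero rmul_zero(1) zero_neq_one)

lemma rconj_eq_0_iff [simp]: "rconj h = 0 \<longleftrightarrow> h = 0"
  by (auto simp: rconj_def prod_eq_iff)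

lemma rconj_rconj [simp]: "rconj (rconj h) = h" by (simp add: rconj_def)

lemma rconj_rmul: "rconj (h \<diamondop> k) = rconj h \<diamondop> rconj k"
  by (simp add: rconj_def rmul_def algebra_simps)

lemma rconj_add: "rconj (h + k) = rconj h + rconj k"
  by (simp add: rconj_def)

end

section \<open>Valuations and their centres\<close>

definition is_val :: "qbar poly \<Rightarrow> (ratfun \<Rightarrow> int) \<Rightarrow> bool" where
  "is_val F V \<longleftrightarrow> (\<forall>h k. h \<noteq> 0 \<longrightarrow> k \<noteq> 0 \<longrightarrow> V (rmul F h k) = V h + V k) \<and>
     (\<forall>h k. h \<noteq> 0 \<longrightarrow> k \<noteq> 0 \<longrightarrow> h + k \<noteq> 0 \<longrightarrow> V (h + k) \<ge> min (V h) (V k)) \<and>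
     (\<forall>a. a \<noteq> 0 \<longrightarrow> V (cf a, 0) = 0)"

text \<open>\<open>vpos\<close> is membership in the maximal ideal, \<open>vnn\<close> membership in
  the valuation ring. The zero function is listed separately because \<open>V\<close> says nothing
  about it.\<close>

definition vpos :: "(ratfun \<Rightarrow> int) \<Rightarrow> ratfun \<Rightarrow> bool" where
  "vpos V h \<longleftrightarrow> h = 0 \<or> V h > 0"

definition vnn :: "(ratfun \<Rightarrow> int) \<Rightarrow> ratfun \<Rightarrow> bool" where
  "vnn V h \<longleftrightarrow> h = 0 \<or> V h \<ge> 0"

locale valuation = function_field +
  fixes V :: "ratfun \<Rightarrow> int"
  assumes V: "is_val F V"
begin

lemma V_mult: "h \<noteq> 0 \<Longrightarrow> k \<noteq> 0 \<Longrightarrow> V (h \<diamondop> k) = V h + V k"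
  using V unfolding is_val_def by blast

lemma V_add: "h \<noteq> 0 \<Longrightarrow> k \<noteq> 0 \<Longrightarrow> h + k \<noteq> 0 \<Longrightarrow> V (h + k) \<ge> min (V h) (V k)"
  using V unfolding is_val_def by blast

lemma V_cf: "a \<noteq> 0 \<Longrightarrow> V (cf a, 0) = 0"
  using V by (auto simp: is_val_def)

lemma V_one: "V (1, 0) = 0"
  using V_cf[of 1] by simp

lemma V_uminus: "V (- h) = V h"
proof (cases "h = 0")
  case False
  have "V ((cf (-1), 0) \<diamondop> h) = V h"
    using False V_cf[of "-1"] by (subst V_mult) (auto simp: prod_eq_iff)
  moreover have "(cf (-1), 0) \<diamondop> h = - h" by (simp add: rmul_x cf_minus prod_eq_iff)
  ultimately show ?thesis by simp
qed simp

lemma V_rinv: "h \<noteq> 0 \<Longrightarrow> V (rinv F h) = - V h"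
  using V_mult[of h "rinv F h"] by (simp add: rinv_right rinv_nz V_one)

lemma V_add_less: "h \<noteq> 0 \<Longrightarrow> k \<noteq> 0 \<Longrightarrow> V h < V k \<Longrightarrow> V (h + k) = V h"
proof -
  assume *: "h \<noteq> 0" "k \<noteq> 0" "V h < V k"
  have nz: "h + k \<noteq> 0"
  proof
    assume "h + k = 0"
    then have "h = - k" by (simp add: add_eq_0_iff2)
    with *(3) show False by (simp add: V_uminus)
  qed
  have "V (h + k) \<ge> V h" using V_add[OF *(1,2) nz] * by simp
  moreover have "V h \<ge> min (V (h + k)) (V (- k))" using V_add[of "h + k" "- k"] * nz by simp
  ultimately show ?thesis using * by (simp add: V_uminus)
qed

lemma vpos_add: "vpos V h \<Longrightarrow> vpos V k \<Longrightarrow> vpos V (h + k)"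
  using V_add[of h k] by (cases "h = 0 \<or> k = 0 \<or> h + k = 0") (auto simp: vpos_def)

lemma vnn_add: "vnn V h \<Longrightarrow> vnn V k \<Longrightarrow> vnn V (h + k)"
  using V_add[of h k] by (cases "h = 0 \<or> k = 0 \<or> h + k = 0") (auto simp: vnn_def)

lemma vpos_mult: "vpos V h \<Longrightarrow> vnn V k \<Longrightarrow> vpos V (h \<diamondop> k)"
  using V_mult[of h k] by (cases "h = 0 \<or> k = 0") (auto simp: vpos_def vnn_def)

lemma vnn_mult: "vnn V h \<Longrightarrow> vnn V k \<Longrightarrow> vnn V (h \<diamondop> k)"
  using V_mult[of h k] by (cases "h = 0 \<or> k = 0") (auto simp: vnn_def)

lemma vpos_uminus: "vpos V (- h) = vpos V h"
  by (simp add: vpos_def V_uminus)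

lemma vpos_diff: "vpos V h \<Longrightarrow> vpos V k \<Longrightarrow> vpos V (h - k)"
  using vpos_add[of h "- k"] by (simp add: vpos_uminus)

lemma vpos_imp_vnn: "vpos V h \<Longrightarrow> vnn V h"
  by (auto simp: vpos_def vnn_def)

lemma vnn_cf: "vnn V (cf a, 0)"
  by (cases "a = 0") (auto simp: vnn_def V_cf zero_prod_def)

lemma V_unit: "vpos V (h - (cf a, 0)) \<Longrightarrow> a \<noteq> 0 \<Longrightarrow> h \<noteq> 0 \<and> V h = 0"
proof -
  assume *: "vpos V (h - (cf a, 0))" "a \<noteq> 0"
  have nz: "(cf a, 0) \<noteq> (0 :: ratfun)" using * by (simp add: prod_eq_iff)
  have h: "h \<noteq> 0" using * V_cf[of a] V_uminus[of "(cf a, 0)"]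
    by (auto simp: vpos_def zero_prod_def)
  show ?thesis
  proof (cases "h - (cf a, 0) = 0")
    case True
    then show ?thesis using V_cf[of a] * h by auto
  next
    case False
    then have "V ((cf a, 0) + (h - (cf a, 0))) = V (cf a, 0)"
      using * nz V_cf[of a] by (intro V_add_less) (auto simp: vpos_def)
    then show ?thesis using V_cf[of a] * h by simp
  qed
qed

lemma kval_V: "kval (\<lambda>A. V (A, 0))"
  unfolding kval_def
proof (intro conjI allI impI)
  fix A B :: "qbar poly fract" assume "A \<noteq> 0" "B \<noteq> 0"
  then have nz: "(A, 0) \<noteq> (0::ratfun)" "(B, 0) \<noteq> (0::ratfun)" by (auto simp: zero_prod_def)
  from V_mult[OF nz] show "V (A * B, 0) = V (A, 0) + V (B, 0)" by (simp add: rmul_x mult.commute)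
  assume "A + B \<noteq> 0"
  then have "(A, 0) + (B, 0) \<noteq> (0::ratfun)" by (auto simp: zero_prod_def)
  from V_add[OF nz this] show "V (A + B, 0) \<ge> min (V (A, 0)) (V (B, 0))" by simp
qed (use V_cf in auto)

lemma V_x_eq_nu:
  assumes "place \<pi>" "V (\<pi>, 0) > 0" "A \<noteq> 0"
  shows "V (A, 0) = V (\<pi>, 0) * nu \<pi> A"
proof -
  interpret p: place_loc \<pi> by standard (rule assms)
  from p.kval_eq_nu[OF kval_V assms(2,3)] show ?thesis by simp
qed

text \<open>The element (0, \<beta>) squares to \<open>\<beta>^2 * F\<close>, which has order 1 in
  the field below. Hence its value is half of that of \<pi>, the two components of \<open>h\<close>
  have values of different parity in this unit, and no cancellation can occur.\<close>

lemma ramified_formula: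
  assumes pl: "place \<pi>" and pos: "V (\<pi>, 0) > 0" and b: "\<beta> \<noteq> 0" and n1: "nu \<pi> (\<beta>\<^sup>2 * to_fract F) = 1"
  shows "V (\<pi>, 0) = 2 * V (0, \<beta>)"
    and "h \<noteq> 0 \<Longrightarrow> V h = V (0, \<beta>) *
      (if snd h = 0 then 2 * nu \<pi> (fst h) else if fst h = 0 then 2 * nu \<pi> (snd h / \<beta>) + 1
       else min (2 * nu \<pi> (fst h)) (2 * nu \<pi> (snd h / \<beta>) + 1))"
proof -
  have z: "(0, \<beta>) \<noteq> (0::ratfun)" using b by (simp add: zero_prod_def)
  have F: "\<beta>\<^sup>2 * to_fract F \<noteq> 0" using b nonsq[of 0] by auto
  have "V ((0, \<beta>) \<diamondop> (0, \<beta>)) = 2 * V (0, \<beta>)" using z by (simp add: V_mult)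
  moreover have "(0, \<beta>) \<diamondop> (0, \<beta>) = (\<beta>\<^sup>2 * to_fract F, 0)"
    by (simp add: rmul_def power2_eq_square algebra_simps)
  ultimately show e: "V (\<pi>, 0) = 2 * V (0, \<beta>)"
    using V_x_eq_nu[OF pl pos F] n1 by simp
  then have zp: "V (0, \<beta>) > 0" using pos by simp
  have x: "V (A, 0) = V (0, \<beta>) * (2 * nu \<pi> A)" if "A \<noteq> 0" for A
    using V_x_eq_nu[OF pl pos that] e by simp
  have y: "V (0, B) = V (0, \<beta>) * (2 * nu \<pi> (B / \<beta>) + 1)" if "B \<noteq> 0" for B
  proof -
    have "(0, B) = (B / \<beta>, 0) \<diamondop> (0, \<beta>)" using b by (simp add: rmul_x)
    moreover have "(B / \<beta>, 0) \<noteq> (0::ratfun)" using that b by (simp add: zero_prod_def)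
    ultimately have "V (0, B) = V (B / \<beta>, 0) + V (0, \<beta>)" using V_mult z by metis
    then show ?thesis using x[of "B / \<beta>"] that b by (simp add: algebra_simps)
  qed
  assume h: "h \<noteq> 0"
  show "V h = V (0, \<beta>) *
      (if snd h = 0 then 2 * nu \<pi> (fst h) else if fst h = 0 then 2 * nu \<pi> (snd h / \<beta>) + 1
       else min (2 * nu \<pi> (fst h)) (2 * nu \<pi> (snd h / \<beta>) + 1))"
  proof (cases "snd h = 0 \<or> fst h = 0")
    case True
    then show ?thesis using h x[of "fst h"] y[of "snd h"] by (cases h) (auto simp: zero_prod_def)
  next
    case False
    define m n where "m = nu \<pi> (fst h)" and "n = nu \<pi> (snd h / \<beta>)"
    have nz: "(fst h, 0) \<noteq> (0::ratfun)" "(0, snd h) \<noteq> (0::ratfun)" using False by (auto simp: zero_prod_def)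
    have hh: "h = (fst h, 0) + (0, snd h)" "h = (0, snd h) + (fst h, 0)" by (auto simp: prod_eq_iff)
    have vx: "V (fst h, 0) = V (0, \<beta>) * (2 * m)" and vy: "V (0, snd h) = V (0, \<beta>) * (2 * n + 1)"
      using x y False by (auto simp: m_def n_def)
    show ?thesis
    proof (cases "2 * m < 2 * n + 1")
      case True
      then have "V (fst h, 0) < V (0, snd h)" using vx vy zp by simp
      then have "V h = V (fst h, 0)" using V_add_less[OF nz] hh(1) by simp
      with False True vx show ?thesis by (simp add: m_def n_def)
    next
      case lt: False
      then have "2 * n + 1 < 2 * m" by presburger
      moreover from this have "V (0, snd h) < V (fst h, 0)" using vx vy zp by simp
      then have "V h = V (0, snd h)" using V_add_less[OF nz(2,1)] hh(2) by simp
      ultimately show ?thesis using False vy by (simp add: m_def n_def)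
    qed
  qed
qed

lemma V_z_unit:
  assumes "vpos V ((0, \<beta>) - (cf z\<^sub>0, 0))" "z\<^sub>0 \<noteq> 0"
  shows "V (0, \<beta>) = 0"
  using V_unit[OF assms] by simp

end

text \<open>After scaling, \<open>h\<close> and its conjugate have residues a + b z0 and a - b z0,
  which cannot both vanish. So either \<open>h\<close> is a unit, or its conjugate is one and the
  norm, a function of x alone, carries the whole order.\<close>

lemma (in function_field) unramified_compare:
  assumes V: "is_val F V" and V': "is_val F V'"
    and pl: "place \<pi>" and b: "\<beta> \<noteq> 0" and z0: "z\<^sub>0 \<noteq> 0"
    and c: "V (\<pi>, 0) > 0" "vpos V ((0, \<beta>) - (cf z\<^sub>0, 0))"
    and c': "V' (\<pi>, 0) > 0" "vpos V' ((0, \<beta>) - (cf z\<^sub>0, 0))"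
    and h: "h \<noteq> 0"
  shows "V h * V' (\<pi>, 0) = V' h * V (\<pi>, 0)"
proof -
  interpret v: valuation F V by standard (rule V)
  interpret v': valuation F V' by standard (rule V')
  interpret p: place_loc \<pi> by standard (rule pl)
  obtain A B where AB: "h = (A, \<beta> * B)"
    using b by (cases h) (metis mult.commute nonzero_eq_divide_eq)
  define n where "n = (if B = 0 then nu \<pi> A else if A = 0 then nu \<pi> B else min (nu \<pi> A) (nu \<pi> B))"
  \<comment> \<open>Scaling by the lower of the two orders leaves both components integral and at
    least one of them a unit.\<close>
  define q where "q = \<pi> powi (- n)"
  have q: "q \<noteq> 0" by (simp add: q_def)
  have nq: "nu \<pi> q = - n" unfolding q_def by (rule p.nu_eqI[of 1 1]) auto
  have A: "A = 0 \<or> nu \<pi> (q * A) \<ge> 0" and B: "B = 0 \<or> nu \<pi> (q * B) \<ge> 0"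
    using q nq p.nu_mult[OF q, of A] p.nu_mult[OF q, of B]
    by (cases "A = 0"; cases "B = 0"; simp add: n_def)+
  have AB0: "(A \<noteq> 0 \<and> nu \<pi> (q * A) = 0) \<or> (B \<noteq> 0 \<and> nu \<pi> (q * B) = 0)"
    using h AB q nq p.nu_mult[OF q, of A] p.nu_mult[OF q, of B]
    by (cases "A = 0"; cases "B = 0"; simp add: n_def zero_prod_def min_def)
  obtain a where a: "q * A = cf a \<or> nu \<pi> (q * A - cf a) > 0" "q * A \<noteq> 0 \<and> nu \<pi> (q * A) = 0 \<Longrightarrow> a \<noteq> 0"
    using p.residue[of "q * A"] A by auto
  obtain b' where b': "q * B = cf b' \<or> nu \<pi> (q * B - cf b') > 0" "q * B \<noteq> 0 \<and> nu \<pi> (q * B) = 0 \<Longrightarrow> b' \<noteq> 0"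
    using p.residue[of "q * B"] B by auto
  have ab: "a \<noteq> 0 \<or> b' \<noteq> 0" using AB0 a(2) b'(2) q by auto
  define g where "g = (q, 0) \<diamondop> h"
  have "(q, 0) \<noteq> (0 :: ratfun)" using q by (simp add: zero_prod_def)
  then have g: "g \<noteq> 0" using h by (simp add: g_def)
  have geq: "g = (q * A, \<beta> * (q * B))" by (simp add: g_def AB rmul_x algebra_simps)
  have key: "vpos W (g - (cf (a + b' * z\<^sub>0), 0)) \<and> vpos W (rconj g - (cf (a - b' * z\<^sub>0), 0))"
    if W: "is_val F W" "W (\<pi>, 0) > 0" "vpos W ((0, \<beta>) - (cf z\<^sub>0, 0))" for W
  proof -
    interpret w: valuation F W by standard (rule W)
    have 1: "vpos W (q * A - cf a, 0)"
    proof (cases "q * A = cf a")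
      case False
      then show ?thesis using a w.V_x_eq_nu[OF pl W(2), of "q * A - cf a"] W(2) by (auto simp: vpos_def)
    qed (simp add: vpos_def zero_prod_def)
    have 2: "vpos W (q * B - cf b', 0)"
    proof (cases "q * B = cf b'")
      case False
      then show ?thesis using b' w.V_x_eq_nu[OF pl W(2), of "q * B - cf b'"] W(2) by (auto simp: vpos_def)
    qed (simp add: vpos_def zero_prod_def)
    have z: "vnn W (0, \<beta>)" using w.V_z_unit[OF W(3) z0] by (simp add: vnn_def)
    have 3: "vpos W ((q * B - cf b', 0) \<diamondop> (0, \<beta>))" by (rule w.vpos_mult[OF 2 z])
    have 4: "vpos W (((0, \<beta>) - (cf z\<^sub>0, 0)) \<diamondop> (cf b', 0))" by (rule w.vpos_mult[OF W(3) w.vnn_cf])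
    have "g - (cf (a + b' * z\<^sub>0), 0) =
       (q * A - cf a, 0) + ((q * B - cf b', 0) \<diamondop> (0, \<beta>) + ((0, \<beta>) - (cf z\<^sub>0, 0)) \<diamondop> (cf b', 0))"
      by (simp add: geq rmul_x cf_add cf_mult algebra_simps)
    then have g1: "vpos W (g - (cf (a + b' * z\<^sub>0), 0))" using w.vpos_add 1 3 4 by metis
    have "rconj g - (cf (a - b' * z\<^sub>0), 0) =
       (q * A - cf a, 0) - ((q * B - cf b', 0) \<diamondop> (0, \<beta>) + ((0, \<beta>) - (cf z\<^sub>0, 0)) \<diamondop> (cf b', 0))"
      by (simp add: geq rmul_x rconj_def cf_add cf_diff cf_mult algebra_simps)
    then show ?thesis using g1 w.vpos_add w.vpos_diff 1 3 4 by metis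
  qed
  have main: "W g = (if a + b' * z\<^sub>0 \<noteq> 0 then 0 else W (\<pi>, 0) * nu \<pi> (rnorm F g))"
    if W: "is_val F W" "W (\<pi>, 0) > 0" "vpos W ((0, \<beta>) - (cf z\<^sub>0, 0))" for W
  proof -
    interpret w: valuation F W by standard (rule W)
    show ?thesis
    proof (cases "a + b' * z\<^sub>0 = 0")
      case False
      then show ?thesis using w.V_unit[OF conjunct1[OF key[OF W]] False] by simp
    next
      case True
      \<comment> \<open>Characteristic 0 enters here: if both residues vanished, then 2 a = 0 and a
        = b' = 0.\<close>
      have "a - b' * z\<^sub>0 \<noteq> 0"
      proof
        assume *: "a - b' * z\<^sub>0 = 0"
        with True have "2 * a = 0" by (simp add: algebra_simps)
        with * ab z0 show False by auto
      qed
      then have "W (rconj g) = 0" using key[OF W] w.V_unit by blast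
      moreover have "W (g \<diamondop> rconj g) = W g + W (rconj g)" using g by (intro w.V_mult) auto
      ultimately have "W g = W (rnorm F g, 0)" by (simp add: rmul_rconj)
      then show ?thesis using True w.V_x_eq_nu[OF pl W(2), of "rnorm F g"] g by simp
    qed
  qed
  have gh: "W g = W h - n * W (\<pi>, 0)"
    if W: "is_val F W" "W (\<pi>, 0) > 0" "vpos W ((0, \<beta>) - (cf z\<^sub>0, 0))" for W
  proof -
    interpret w: valuation F W by standard (rule W)
    have "W g = W (q, 0) + W h" unfolding g_def using q h by (intro w.V_mult) (auto simp: zero_prod_def)
    then show ?thesis using w.V_x_eq_nu[OF pl W(2) q] nq by simp
  qed
  have "V h = n * V (\<pi>, 0) + V g" "V' h = n * V' (\<pi>, 0) + V' g"
    using gh[OF V c] gh[OF V' c'] by auto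
  moreover have "V g * V' (\<pi>, 0) = V' g * V (\<pi>, 0)"
    using main[OF V c] main[OF V' c'] by (simp add: algebra_simps)
  ultimately show ?thesis by (simp add: algebra_simps)
qed

section \<open>Charts, uniformizers and centres at a point of the curve\<close>

fun loc_par :: "point \<Rightarrow> qbar poly fract" where
  "loc_par (Aff x y) = to_fract [:- x, 1:]"
| "loc_par (Infty s) = 1 / fx"

text \<open>\<open>(0, loc_b d P)\<close> is the second chart coordinate around \<open>P\<close>: y
  at an affine point, s = y / x^d at infinity. \<open>loc_val P\<close> is its value at
  \<open>P\<close>.\<close>

fun loc_b :: "nat \<Rightarrow> point \<Rightarrow> qbar poly fract" where
  "loc_b d (Aff x y) = 1"
| "loc_b d (Infty s) = 1 / fx ^ d"

fun loc_val :: "point \<Rightarrow> qbar" where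
  "loc_val (Aff x y) = y"
| "loc_val (Infty s) = s"

text \<open>Where the second coordinate vanishes, the projection to the x-line is ramified and that
  coordinate is the uniformizer; elsewhere the coordinate of the line is one.\<close>

definition loc_unif :: "nat \<Rightarrow> point \<Rightarrow> ratfun" where
  "loc_unif d P = (if loc_val P = 0 then (0, loc_b d P) else (loc_par P, 0))"

text \<open>Both chart coordinates around \<open>P\<close> have at \<open>V\<close> the residues
  that they take at \<open>P\<close>.\<close>

definition centred :: "qbar poly \<Rightarrow> nat \<Rightarrow> (ratfun \<Rightarrow> int) \<Rightarrow> point \<Rightarrow> bool" where
  "centred F d V P \<longleftrightarrow> is_val F V \<and> V (loc_par P, 0) > 0 \<and>
     vpos V ((0, loc_b d P) - (cf (loc_val P), 0))"

lemma place_loc_par: "place (loc_par P)"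
  by (cases P) (auto simp: place_affine place_infinity)

lemma loc_b_nz [simp]: "loc_b d P \<noteq> 0"
  by (cases P) auto

section \<open>Orders of vanishing as centred valuations\<close>

lemma to_fract_power: "to_fract (p ^ n) = to_fract p ^ n"
  by (induction n) auto

lemma nu_affine: "p \<noteq> 0 \<Longrightarrow> nu (to_fract [:- a, 1:]) (to_fract p) = int (Polynomial.order a p)"
proof -
  assume p: "p \<noteq> 0"
  interpret l: place_loc "to_fract [:- a, 1:]" by standard (rule place_affine)
  obtain q where q: "p = [:- a, 1:] ^ Polynomial.order a p * q" "\<not> [:- a, 1:] dvd q"
    using order_decomp[OF p] by blast
  have "to_fract q = l.E (pcompose q [:a, 1:])"
    by (simp add: poly_map_cf_to_fract pcompose_pCons flip: pcompose_assoc)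
  moreover have "to_fract p = to_fract [:- a, 1:] ^ Polynomial.order a p * to_fract q"
    by (subst q(1)) (simp add: to_fract_mult to_fract_power)
  ultimately show ?thesis using q(2)
    by (intro l.nu_eqI[of "pcompose q [:a, 1:]" 1]) (auto simp: poly_pcompose poly_eq_0_iff_dvd)
qed

lemma reflect_poly_map_poly: "c 0 = 0 \<Longrightarrow> (\<And>x. c x = 0 \<Longrightarrow> x = 0) \<Longrightarrow>
  reflect_poly (map_poly c p) = map_poly c (reflect_poly p)"
proof (rule poly_eqI)
  assume c: "c 0 = 0" "\<And>x. c x = 0 \<Longrightarrow> x = 0"
  have "Polynomial.degree (map_poly c p) = Polynomial.degree p" using c by (intro degree_map_poly) auto
  then show "coeff (reflect_poly (map_poly c p)) n = coeff (map_poly c (reflect_poly p)) n" for n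
    using c by (simp add: coeff_reflect_poly coeff_map_poly)
qed

lemma to_fract_reflect:
  fixes p :: "'a::field poly"
  shows "to_fract p = fx ^ Polynomial.degree p * poly (map_poly cf (reflect_poly p)) (1 / fx)"
proof -
  have "poly (map_poly cf (reflect_poly p)) (1 / fx) = poly (reflect_poly (map_poly cf p)) (1 / fx)"
    by (subst reflect_poly_map_poly) auto
  also have "\<dots> = (1 / fx) ^ Polynomial.degree p * poly (map_poly cf p) fx"
    by (subst poly_reflect_poly_nz) (auto simp: degree_map_poly inverse_eq_divide)
  finally show ?thesis by (simp add: to_fract_poly[of p] power_one_over)
qed

lemma nu_inf:
  fixes p :: "'a::field poly"
  shows "p \<noteq> 0 \<Longrightarrow> nu (1 / fx) (to_fract p) = - int (Polynomial.degree p)"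
proof -
  assume p: "p \<noteq> 0"
  interpret l: place_loc "1 / fx :: 'a poly fract" by standard (rule place_infinity)
  have "(1 / fx :: 'a poly fract) powi (- int (Polynomial.degree p)) = fx ^ Polynomial.degree p"
    by (simp add: power_int_minus power_one_over inverse_eq_divide)
  then show ?thesis using p
    by (intro l.nu_eqI[of "reflect_poly p" 1]) (auto simp: to_fract_reflect[of p])
qed

lemma fls_const_hom: "hom_evaluation (fls_const :: 'a::field \<Rightarrow> _)"
  by standard (auto simp: fls_plus_const)

text \<open>Over an algebraically closed field linear factors split off one at a time, and one of
  them must vanish at \<xi>: the constants are algebraically closed in the Laurent series.\<close>

lemma algebraic_fls_const:
  fixes \<xi> :: "'a::alg_closed_field fls"
  assumes "p \<noteq> 0" "poly (map_poly fls_const p) \<xi> = 0"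
  shows "\<exists>a. \<xi> = fls_const a"
  using assms
proof (induction "Polynomial.degree p" arbitrary: p)
  case 0
  then obtain a where "p = [:a:]" by (metis degree_eq_zeroE)
  then show ?case using 0 by (simp add: map_poly_pCons)
next
  case (Suc n)
  interpret e: hom_evaluation fls_const \<xi> by (rule fls_const_hom)
  obtain a where "poly p a = 0" using alg_closed_imp_poly_has_root[of p] Suc(2) by auto
  then obtain q where q: "p = [:- a, 1:] * q" by (auto simp: poly_eq_0_iff_dvd dvd_def)
  have qnz: "q \<noteq> 0" using q Suc by auto
  have "n = Polynomial.degree q" using Suc(2) qnz degree_mult_eq[of "[:- a, 1:]" q] q by simp
  moreover have "e.E p = (\<xi> - fls_const a) * e.E q" unfolding q by (simp only: e.E_mult) (simp add: e.E_pCons map_poly_pCons)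
  ultimately show ?case using Suc qnz by (cases "\<xi> = fls_const a") auto
qed

lemma fps_sqrt_exists:
  fixes a :: "'a::field_char_0 fps"
  assumes "fps_nth a 0 = y\<^sup>2" "y \<noteq> 0"
  obtains s where "s\<^sup>2 = a" "fps_nth s 0 = y"
proof
  let ?s = "fps_radical (\<lambda>_ _. y) (Suc 1) a"
  show "?s\<^sup>2 = a" using power_radical[of a "\<lambda>_ _. y" 1] assms by (simp add: power2_eq_square)
  show "fps_nth ?s 0 = y" by simp
qed

lemma poly_fps_to_fls:
  "poly (map_poly fls_const p) (fps_to_fls x) = fps_to_fls (poly (map_poly fps_const p) x)"
  by (induction p) (auto simp: map_poly_pCons fls_times_fps_to_fls)

lemma poly_fps_nth_0: "fps_nth (poly (map_poly fps_const p) x) 0 = poly p (fps_nth x 0)"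
  by (induction p) (auto simp: map_poly_pCons)

text \<open>Simple roots in the algebraic closure are the form of squarefreeness that local
  arguments use. The genus will be \<open>d - 1\<close>, so \<open>d = 2\<close> serves the elliptic
  curves and \<open>d = 3\<close> the curve C.\<close>

locale curve =
  fixes f :: "rat poly" and d :: nat
  assumes simple: "poly (base_change f) x = 0 \<Longrightarrow> poly (pderiv (base_change f)) x \<noteq> 0"
    and deg: "Polynomial.degree f = 2 * d \<or> Polynomial.degree f + 1 = 2 * d"
    and d: "d \<ge> 2"
begin

abbreviation F where "F \<equiv> base_change f"

lemma half_deg: "half_deg f = d"
  using deg d by (auto simp: half_deg_def)

lemma degF: "Polynomial.degree F = Polynomial.degree f"
  unfolding base_change_def by (rule degree_map_poly) simp

lemma degF': "Polynomial.degree F = 2 * d \<or> Polynomial.degree F + 1 = 2 * d"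
  using deg degF by simp

lemma F_nz [simp]: "F \<noteq> 0"
  using degF' d by auto

lemma order_F: "poly F x = 0 \<Longrightarrow> Polynomial.order x F = 1"
  using simple[of x] order_root[of F x] order_pderiv[of F x] F_nz order_root[of "pderiv F" x]
  by (metis One_nat_def order_0I order_pderiv2 degF' d pderiv_eq_0_iff)

text \<open>At a root of \<open>F\<close> the order of a square is even, whereas that of
  \<open>F\<close> is 1.\<close>

lemma fract_nonsq: "A\<^sup>2 \<noteq> to_fract F"
proof
  assume A: "A\<^sup>2 = to_fract F"
  have "Polynomial.degree F > 0" using degF' d by auto
  then obtain x where x: "poly F x = 0" using alg_closed_imp_poly_has_root by blast
  interpret l: place_loc "to_fract [:- x, 1:]" by standard (rule place_affine)
  have "A \<noteq> 0" using A by auto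
  then have "nu (to_fract [:- x, 1:]) (A\<^sup>2) = 2 * nu (to_fract [:- x, 1:]) A"
    by (simp add: power2_eq_square l.nu_mult)
  moreover have "nu (to_fract [:- x, 1:]) (A\<^sup>2) = 1"
    unfolding A by (simp add: nu_affine order_F[OF x])
  ultimately show False by presburger
qed

sublocale function_field F
  by standard (rule fract_nonsq)

abbreviation rmul_F (infixl "\<diamondop>" 70) where "h \<diamondop> k \<equiv> rmul F h k"

text \<open>At a finite branch point this is simplicity of the root. At infinity
  \<open>loc_val P = 0\<close> forces degree 2d - 1, so \<open>F\<close> divided by x^(2d) vanishes
  to order 1.\<close>

lemma Z_ramified:
  assumes P: "P \<in> points f" and z: "loc_val P = 0"
  shows "nu (loc_par P) ((loc_b d P)\<^sup>2 * to_fract F) = 1"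
proof (cases P)
  case (Aff x y)
  then have "poly F x = 0" using P z by (auto simp: points_def)
  then show ?thesis using Aff by (simp add: nu_affine order_F)
next
  case (Infty s)
  interpret l: place_loc "1 / fx :: qbar poly fract" by standard (rule place_infinity)
  have "coeff F (2 * d) = 0" using P z Infty by (auto simp: points_def half_deg)
  then have dF: "Polynomial.degree F + 1 = 2 * d" using degF' F_nz by (metis leading_coeff_0_iff)
  have "nu (1 / fx) ((1 / fx ^ d :: qbar poly fract)\<^sup>2) = 2 * int d"
    by (rule l.nu_eqI[of 1 1]) (auto simp: power_int_def power_one_over power_mult mult.commute nat_mult_distrib)
  then show ?thesis using Infty dF by (simp add: l.nu_mult nu_inf)
qed

lemma centredD:
  assumes "centred F d V P"
  shows "is_val F V" "V (loc_par P, 0) > 0" "vpos V ((0, loc_b d P) - (cf (loc_val P), 0))"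
  using assms by (auto simp: centred_def)

lemma centred_unif_pos:
  assumes "P \<in> points f" "centred F d V P"
  shows "V (loc_unif d P) > 0"
proof -
  interpret v: valuation F V by standard (rule centredD[OF assms(2)])
  show ?thesis
    using v.ramified_formula(1)[OF place_loc_par _ loc_b_nz Z_ramified[OF assms(1)]] centredD[OF assms(2)]
    by (auto simp: loc_unif_def)
qed

text \<open>A centre determines the valuation up to a positive factor, measured on the uniformizer;
  cross multiplication keeps the comparison in the integers.\<close>

theorem centred_compare:
  assumes P: "P \<in> points f" and V: "centred F d V P" and V': "centred F d V' P" and h: "h \<noteq> 0"
  shows "V h * V' (loc_unif d P) = V' h * V (loc_unif d P)"
proof (cases "loc_val P = 0")
  case False
  then show ?thesis
    using unramified_compare[OF centredD(1)[OF V] centredD(1)[OF V'] place_loc_par loc_b_nz False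
       centredD(2,3)[OF V] centredD(2,3)[OF V'] h] by (simp add: loc_unif_def)
next
  case True
  interpret v: valuation F V by standard (rule centredD[OF V])
  interpret v': valuation F V' by standard (rule centredD[OF V'])
  show ?thesis
    using v.ramified_formula(2)[OF place_loc_par centredD(2)[OF V] loc_b_nz Z_ramified[OF P True] h]
      v'.ramified_formula(2)[OF place_loc_par centredD(2)[OF V'] loc_b_nz Z_ramified[OF P True] h] True
    by (simp add: loc_unif_def)
qed

text \<open>Normalisation criterion suited to a nonzero tangent vector, which says that one chart
  coordinate has order 1. At a branch point the line coordinate has even value, so it must be the
  other one. Elsewhere z - z0 differs by the unit z + z0 from a function of x, so its value is a
  multiple of that of the line coordinate.\<close>

lemma centred_unif_1:
  assumes P: "P \<in> points f" and V: "centred F d V P"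
    and t: "V (loc_par P, 0) = 1 \<or> V ((0, loc_b d P) - (cf (loc_val P), 0)) = 1"
  shows "V (loc_unif d P) = 1"
proof -
  interpret v: valuation F V by standard (rule centredD[OF V])
  define \<pi> \<beta> z where "\<pi> = loc_par P" and "\<beta> = loc_b d P" and "z = loc_val P"
  note c = centredD[OF V, folded \<pi>_def \<beta>_def z_def]
  have b: "\<beta> \<noteq> 0" by (simp add: \<beta>_def)
  show ?thesis
  proof (cases "z = 0")
    case True
    then have "V (\<pi>, 0) = 2 * V (0, \<beta>)"
      using v.ramified_formula(1)[OF place_loc_par _ loc_b_nz Z_ramified[OF P]] c
      by (auto simp: \<pi>_def \<beta>_def z_def)
    then have "V (\<pi>, 0) \<noteq> 1" by presburger
    then show ?thesis using t True by (auto simp: \<pi>_def \<beta>_def z_def loc_unif_def zero_prod_def)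
  next
    case False
    have nz: "(0, \<beta>) - (cf z, 0) \<noteq> (0::ratfun)" "(0, \<beta>) + (cf z, 0) \<noteq> (0::ratfun)"
      using b by (auto simp: zero_prod_def)
    have "((0, \<beta>) + (cf z, 0)) - (cf (2 * z), 0) = (0, \<beta>) - (cf z, 0)"
      by (simp add: cf_mult cf_numeral)
    then have "V ((0, \<beta>) + (cf z, 0)) = 0"
      using v.V_unit[of "(0, \<beta>) + (cf z, 0)" "2 * z"] c(3) False by (metis mult_eq_0_iff zero_neq_numeral)
    then have "V ((0, \<beta>) - (cf z, 0)) = V (((0, \<beta>) - (cf z, 0)) \<diamondop> ((0, \<beta>) + (cf z, 0)))"
      using nz by (simp add: v.V_mult)
    also have "((0, \<beta>) - (cf z, 0)) \<diamondop> ((0, \<beta>) + (cf z, 0)) = (\<beta>\<^sup>2 * to_fract F - (cf z)\<^sup>2, 0)"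
      by (simp add: rmul_def power2_eq_square algebra_simps)
    finally have e: "V ((0, \<beta>) - (cf z, 0)) = V (\<beta>\<^sup>2 * to_fract F - (cf z)\<^sup>2, 0)" .
    have "\<beta>\<^sup>2 * to_fract F - (cf z)\<^sup>2 \<noteq> 0"
      using nonsq[of "cf z / \<beta>"] b by (auto simp: field_simps power_divide)
    then have "V ((0, \<beta>) - (cf z, 0)) = V (\<pi>, 0) * nu \<pi> (\<beta>\<^sup>2 * to_fract F - (cf z)\<^sup>2)"
      unfolding e by (rule v.V_x_eq_nu[OF place_loc_par[of P, folded \<pi>_def] c(2)])
    then have "V (\<pi>, 0) dvd 1" using t by (metis \<pi>_def \<beta>_def z_def dvd_triv_left dvd_refl)
    then have "V (\<pi>, 0) = 1" using c(2) by simp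
    then show ?thesis using False by (simp add: loc_unif_def \<pi>_def z_def)
  qed
qed

subsection \<open>Local parametrisations\<close>

text \<open>Off the branch points x - x0 is the parameter and y is a square root of a power series
  with nonzero constant term. At a root of \<open>F\<close> one puts x = x0 + T^2 and extracts T
  from the square root. The charts at infinity are treated in the same way with the reflected
  polynomial.\<close>

lemma param_exists:
  assumes "P \<in> points f"
  shows "\<exists>\<xi> \<eta>. local_param f P (\<xi>, \<eta>)"
proof (cases P)
  case (Aff x y)
  have y: "y\<^sup>2 = poly F x" using assms Aff by (auto simp: points_def)
  show ?thesis
  proof (cases "y = 0")
    case False
    let ?x = "fps_const x + fps_X"
    obtain s where s: "s\<^sup>2 = poly (map_poly fps_const F) ?x" "fps_nth s 0 = y"
      using fps_sqrt_exists[of "poly (map_poly fps_const F) ?x" y] False y by (auto simp: poly_fps_nth_0)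
    have "local_param f P (fps_to_fls ?x, fps_to_fls s)"
      using s by (auto simp: Aff branch_at_def poly_fps_to_fls fls_subdegree_fls_to_fps_gt0 power2_eq_square
          simp flip: fls_times_fps_to_fls simp del: fps_to_fls_plus)
    then show ?thesis by blast
  next
    case True
    then have "poly F x = 0" using y by simp
    then obtain G where G: "F = [:- x, 1:] * G" by (auto simp: poly_eq_0_iff_dvd dvd_def)
    have "poly G x \<noteq> 0" using simple[OF \<open>poly F x = 0\<close>]
      unfolding G pderiv_mult by (simp add: pderiv_pCons)
    obtain r where r: "r\<^sup>2 = poly G x" using nth_root_exists[of 2 "poly G x"] by auto
    with \<open>poly G x \<noteq> 0\<close> have "r \<noteq> 0" by auto
    let ?x = "fps_const x + fps_X\<^sup>2"
    obtain s where s: "s\<^sup>2 = poly (map_poly fps_const G) ?x" "fps_nth s 0 = r"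
      using fps_sqrt_exists[of "poly (map_poly fps_const G) ?x" r] r \<open>r \<noteq> 0\<close> by (auto simp: poly_fps_nth_0)
    interpret e: hom_evaluation fls_const "fps_to_fls ?x" by (rule fls_const_hom)
    have "e.E F = (fps_to_fls ?x - fls_const x) * e.E G"
      unfolding G by (simp only: e.E_mult) (simp add: e.E_pCons map_poly_pCons)
    also have "e.E G = (fps_to_fls s)\<^sup>2"
      by (simp only: poly_fps_to_fls flip: s(1) fps_to_fls_power)
    also have "fps_to_fls ?x - fls_const x = (fls_X :: qbar fls)\<^sup>2"
      by (simp add: power2_eq_square fls_times_fps_to_fls)
    finally have E: "e.E F = (fls_X * fps_to_fls s)\<^sup>2" by (simp add: power_mult_distrib)
    have X: "fls_X * fps_to_fls s = fps_to_fls (fps_X * s)"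
      by (simp add: fls_times_fps_to_fls)
    have "local_param f P (fps_to_fls ?x, fls_X * fps_to_fls s)"
      using s \<open>r \<noteq> 0\<close> True E by (auto simp: Aff branch_at_def fls_subdegree_fls_to_fps_gt0 X simp del: fps_to_fls_plus)
    then show ?thesis by blast
  qed
next
  case (Infty s)
  have s: "s\<^sup>2 = coeff F (2 * d)" using assms Infty by (auto simp: points_def half_deg)
  let ?R = "reflect_poly F"
  have R0: "poly ?R 0 = lead_coeff F" by simp
  have inv: "poly (map_poly fls_const F) (inverse w) = poly (map_poly fls_const ?R) w / w ^ Polynomial.degree F"
    if "w \<noteq> 0" for w :: "qbar fls"
  proof -
    have "poly (map_poly fls_const ?R) w = poly (reflect_poly (map_poly fls_const F)) w"
      by (subst reflect_poly_map_poly) auto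
    then show ?thesis using that by (simp add: poly_reflect_poly_nz degree_map_poly)
  qed
  have X0: "fls_X \<noteq> (0 :: qbar fls)" by simp
  have inv1: "1 / inverse x = x" for x :: "qbar fls"
    by (simp only: divide_inverse inverse_inverse_eq mult_1_left)
  have inv2: "(a / x ^ n) / inverse x ^ n = a" if "x \<noteq> 0" for a x :: "qbar fls" and n
    using that by (simp add: field_simps)
  have inv3: "(a / x ^ m) / inverse (x\<^sup>2) ^ n = x * a" if "x \<noteq> 0" "m + 1 = 2 * n" for a x :: "qbar fls" and m n
  proof -
    have "(x\<^sup>2) ^ n = x * x ^ m" using that(2) by (metis add.commute plus_1_eq_Suc power_Suc power_mult)
    then show ?thesis using that(1) by (simp add: field_simps)
  qed
  show ?thesis
  proof (cases "s = 0")
    case False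
    have dF: "Polynomial.degree F = 2 * d" using s False degF'
      by (metis add_eq_self_zero coeff_eq_0 less_add_one power_eq_0_iff zero_neq_one)
    obtain r where r: "r\<^sup>2 = poly (map_poly fps_const ?R) fps_X" "fps_nth r 0 = s"
      using fps_sqrt_exists[of "poly (map_poly fps_const ?R) fps_X" s] False s dF R0 by (auto simp: poly_fps_nth_0)
    have e: "poly (map_poly fls_const ?R) fls_X = (fps_to_fls r)\<^sup>2"
      using poly_fps_to_fls[of ?R fps_X] r(1) by (simp add: power2_eq_square fls_times_fps_to_fls flip: r(1))
    have "(fps_to_fls r / fls_X ^ d)\<^sup>2 = poly (map_poly fls_const F) (inverse fls_X)"
      by (simp only: inv[OF X0] e dF power_divide power_mult[symmetric] mult.commute)
    moreover have "branch_at (1 / inverse fls_X) ((fps_to_fls r / fls_X ^ d) / inverse fls_X ^ d) 0 s"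
      unfolding inv1 inv2[OF X0] using r(2)
      by (simp add: branch_at_def fls_subdegree_fls_to_fps_gt0)
    ultimately have "local_param f P (inverse fls_X, fps_to_fls r / fls_X ^ d)"
      unfolding Infty local_param.simps half_deg by blast
    then show ?thesis by blast
  next
    case True
    have "coeff F (2 * d) = 0" using s True by simp
    then have dF: "Polynomial.degree F + 1 = 2 * d" using degF' F_nz by (metis leading_coeff_0_iff)
    obtain l where l: "l\<^sup>2 = lead_coeff F" using nth_root_exists[of 2 "lead_coeff F"] by auto
    then have "l \<noteq> 0" by auto
    obtain r where r: "r\<^sup>2 = poly (map_poly fps_const ?R) (fps_X\<^sup>2)" "fps_nth r 0 = l"
      using fps_sqrt_exists[of "poly (map_poly fps_const ?R) (fps_X\<^sup>2)" l] l \<open>l \<noteq> 0\<close> R0 by (auto simp: poly_fps_nth_0)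
    have e: "poly (map_poly fls_const ?R) (fls_X\<^sup>2) = (fps_to_fls r)\<^sup>2"
      using poly_fps_to_fls[of ?R "fps_X\<^sup>2"] unfolding r(1)[symmetric] fps_to_fls_power by simp
    let ?w = "fls_X\<^sup>2 :: qbar fls"
    have w0: "?w \<noteq> 0" by simp
    have k: "?w ^ Polynomial.degree F = (fls_X ^ Polynomial.degree F)\<^sup>2"
      by (simp add: power_mult[symmetric] mult.commute)
    have "(fps_to_fls r / fls_X ^ Polynomial.degree F)\<^sup>2 = poly (map_poly fls_const F) (inverse ?w)"
      by (simp only: inv[OF w0] e k power_divide)
    moreover have "branch_at (1 / inverse ?w) ((fps_to_fls r / fls_X ^ Polynomial.degree F) / inverse ?w ^ d) 0 s"
    proof -
      have "?w = fps_to_fls (fps_X\<^sup>2)" by (simp add: fps_to_fls_power)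
      moreover have "fls_X * fps_to_fls r = fps_to_fls (fps_X * r)" by (simp add: fls_times_fps_to_fls)
      ultimately show ?thesis
        unfolding inv1 inv3[OF X0 dF] using r(2) True \<open>l \<noteq> 0\<close>
        by (simp add: branch_at_def fls_subdegree_fls_to_fps_gt0)
    qed
    ultimately have "local_param f P (inverse ?w, fps_to_fls r / fls_X ^ Polynomial.degree F)"
      unfolding Infty local_param.simps half_deg by blast
    then show ?thesis by blast
  qed
qed

lemma fls_const_divide: "fls_const a / fls_const b = fls_const (a / b :: qbar)"
proof (cases "b = 0")
  case False
  then have "fls_const (a / b) * fls_const b = fls_const a" by simp
  with False show ?thesis by (metis fls_const_nonzero nonzero_eq_divide_eq)
qed simp

text \<open>If \<xi> were algebraic, both \<xi> and \<eta> would be constant, against the nonzero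
  tangent vector in \<open>branch_at\<close>.\<close>

lemma param_transcendental:
  assumes "local_param f P (\<xi>, \<eta>)" "p \<noteq> 0"
  shows "poly (map_poly fls_const p) \<xi> \<noteq> 0"
proof
  assume *: "poly (map_poly fls_const p) \<xi> = 0"
  then obtain a where a: "\<xi> = fls_const a" using algebraic_fls_const assms by blast
  have eq: "\<eta>\<^sup>2 = poly (map_poly fls_const F) \<xi>" using assms by (cases P) auto
  have c: "poly (map_poly fls_const F) (fls_const a) = fls_const (poly F a)"
  proof -
    have "poly (map_poly fls_const q) (fls_const a) = fls_const (poly q a)" for q :: "qbar poly"
      by (induction q) (auto simp: map_poly_pCons fls_plus_const)
    then show ?thesis .
  qed
  have "poly (map_poly fls_const [:- poly F a, 0, 1:]) \<eta> = 0"
    using eq a c by (simp add: map_poly_pCons power2_eq_square)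
  then obtain b where b: "\<eta> = fls_const b" using algebraic_fls_const[of "[:- poly F a, 0, 1:]" \<eta>] by auto
  show False using assms(1)
    by (cases P) (auto simp: a b branch_at_def fls_const_divide fls_const_divide[of 1, simplified] simp flip: fls_const_power)
qed

lemma param_rat_evaluation:
  assumes "local_param f P (\<xi>, \<eta>)"
  shows "rat_evaluation fls_const \<xi>"
proof -
  interpret hom_evaluation fls_const \<xi> by (rule fls_const_hom)
  show ?thesis by standard (rule param_transcendental[OF assms])
qed

lemma expand_param:
  assumes "P \<in> points f"
  obtains \<xi> \<eta> where "local_param f P (\<xi>, \<eta>)"
    "\<forall>h. expand f P h = rat_eval fls_const \<xi> (fst h) + rat_eval fls_const \<xi> (snd h) * \<eta>"
proof -
  obtain \<xi> \<eta> where *: "(SOME \<theta>. local_param f P \<theta>) = (\<xi>, \<eta>)" by (metis surj_pair)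
  have "local_param f P (\<xi>, \<eta>)"
    using param_exists[OF assms] someI_ex[of "local_param f P"] * by auto
  moreover have "expand f P h = rat_eval fls_const \<xi> (fst h) + rat_eval fls_const \<xi> (snd h) * \<eta>" for h
    by (simp add: expand_def * eval_fract_def rat_eval_def)
  ultimately show ?thesis using that by blast
qed

lemma
  assumes P: "P \<in> points f"
  shows expand_add: "expand f P (h + k) = expand f P h + expand f P k"
    and expand_mult: "expand f P (h \<diamondop> k) = expand f P h * expand f P k"
    and expand_cf: "expand f P (cf a, 0) = fls_const a"
    and expand_eq_0_iff: "expand f P h = 0 \<longleftrightarrow> h = 0"
proof -
  obtain \<xi> \<eta> where lp: "local_param f P (\<xi>, \<eta>)"
    and ex': "\<forall>h. expand f P h = rat_eval fls_const \<xi> (fst h) + rat_eval fls_const \<xi> (snd h) * \<eta>"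
    by (rule expand_param[OF P])
  note ex = ex'[rule_format]
  interpret e: rat_evaluation fls_const \<xi> by (rule param_rat_evaluation[OF lp])
  have eq: "\<eta>\<^sup>2 = e.ev (to_fract F)" using lp by (cases P) (auto simp: e.ev_to_fract)
  show "expand f P (h + k) = expand f P h + expand f P k"
    by (simp add: ex e.ev_add algebra_simps)
  show m: "expand f P (h \<diamondop> k) = expand f P h * expand f P k" for h k
    by (simp add: ex rmul_def e.ev_add e.ev_mult algebra_simps power2_eq_square flip: eq)
  show "expand f P (cf a, 0) = fls_const a"
    by (simp add: ex cf_def e.ev_to_fract e.E_pCons)
  show "expand f P h = 0 \<longleftrightarrow> h = 0"
  proof
    assume "expand f P h = 0"
    \<comment> \<open>Multiplying by the conjugate moves the question to the norm, a function of x,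
      on which evaluation is injective.\<close>
    then have "expand f P (h \<diamondop> rconj h) = 0" by (simp add: m)
    then have "e.ev (rnorm F h) = 0" by (simp add: rmul_rconj ex)
    then show "h = 0" by simp
  qed (simp add: ex)
qed

lemma is_val_ord_at:
  assumes P: "P \<in> points f"
  shows "is_val F (ord_at f P)"
  unfolding is_val_def
proof (intro conjI allI impI)
  fix h k :: ratfun assume *: "h \<noteq> 0" "k \<noteq> 0"
  then show "ord_at f P (h \<diamondop> k) = ord_at f P h + ord_at f P k"
    by (simp add: ord_at_def expand_mult[OF P] expand_eq_0_iff[OF P])
  assume "h + k \<noteq> 0"
  then have "expand f P h + expand f P k \<noteq> 0" by (metis expand_add[OF P] expand_eq_0_iff[OF P])
  then show "ord_at f P (h + k) \<ge> min (ord_at f P h) (ord_at f P k)"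
    by (simp add: ord_at_def expand_add[OF P] fls_plus_subdegree)
qed (simp add: ord_at_def expand_cf[OF P])

lemma subdegree_pos:
  assumes "fls_subdegree \<xi> \<ge> 0" "fls_nth \<xi> 0 = x" "\<xi> - fls_const x \<noteq> 0"
  shows "fls_subdegree (\<xi> - fls_const x) > 0"
    and "fls_nth \<xi> 1 \<noteq> 0 \<Longrightarrow> fls_subdegree (\<xi> - fls_const x) = 1"
proof -
  have z: "fls_nth (\<xi> - fls_const x) k = 0" if "k \<le> 0" for k
    using that assms by (cases "k = 0") auto
  show "fls_subdegree (\<xi> - fls_const x) > 0" using assms z by (intro fls_subdegree_greaterI) auto
  show "fls_subdegree (\<xi> - fls_const x) = 1" if "fls_nth \<xi> 1 \<noteq> 0"
    using that z by (intro fls_subdegree_eqI) auto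
qed

text \<open>With \<open>centred_compare\<close> this makes \<open>ord_at\<close> independent of the
  parametrisation that \<open>SOME\<close> selects; later arguments use only these two
  properties.\<close>

theorem centred_ord_at:
  assumes P: "P \<in> points f"
  shows "centred F d (ord_at f P) P" and "ord_at f P (loc_unif d P) = 1"
proof -
  obtain \<xi> \<eta> where lp: "local_param f P (\<xi>, \<eta>)"
    and ex': "\<forall>h. expand f P h = rat_eval fls_const \<xi> (fst h) + rat_eval fls_const \<xi> (snd h) * \<eta>"
    by (rule expand_param[OF P])
  note ex = ex'[rule_format]
  interpret e: rat_evaluation fls_const \<xi> by (rule param_rat_evaluation[OF lp])
  interpret pl: place_loc "loc_par P" by standard (rule place_loc_par)
  define z where "z = (0, loc_b d P) - (cf (loc_val P), 0)"
  have znz: "z \<noteq> 0" by (auto simp: z_def zero_prod_def)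
  have pnz: "(loc_par P, 0) \<noteq> (0 :: ratfun)" by (auto simp: zero_prod_def)
  have cfc: "e.ev (cf a) = fls_const a" for a by (simp add: cf_def e.ev_to_fract e.E_pCons)
  have "ord_at f P (loc_par P, 0) > 0 \<and> ord_at f P z > 0 \<and> (ord_at f P (loc_par P, 0) = 1 \<or> ord_at f P z = 1)"
  proof (cases P)
    case (Aff x y)
    have 1: "expand f P (loc_par P, 0) = \<xi> - fls_const x"
      unfolding ex by (simp add: Aff e.ev_to_fract e.E_pCons)
    have 2: "expand f P z = \<eta> - fls_const y"
      unfolding ex by (simp add: z_def Aff e.ev_minus cfc)
    have b: "branch_at \<xi> \<eta> x y" using lp Aff by simp
    have nz: "\<xi> - fls_const x \<noteq> 0" "\<eta> - fls_const y \<noteq> 0"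
      using 1 2 znz pnz expand_eq_0_iff[OF P] by metis+
    show ?thesis using b nz subdegree_pos[of \<xi> x] subdegree_pos[of \<eta> y]
      by (auto simp: ord_at_def 1 2 branch_at_def)
  next
    case (Infty s)
    have 1: "expand f P (loc_par P, 0) = 1 / \<xi> - fls_const 0"
      unfolding ex by (simp add: Infty e.ev_to_fract e.E_pCons e.ev_divide)
    have 2: "expand f P z = \<eta> / \<xi> ^ d - fls_const s"
      unfolding ex by (simp add: z_def Infty e.ev_minus cfc e.ev_divide e.ev_power e.ev_to_fract e.E_pCons)
    have b: "branch_at (1 / \<xi>) (\<eta> / \<xi> ^ d) 0 s" using lp Infty by (simp add: half_deg)
    have nz: "1 / \<xi> - fls_const 0 \<noteq> 0" "\<eta> / \<xi> ^ d - fls_const s \<noteq> 0"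
      using 1 2 znz pnz expand_eq_0_iff[OF P] by metis+
    show ?thesis using b nz subdegree_pos[of "1 / \<xi>" 0] subdegree_pos[of "\<eta> / \<xi> ^ d" s]
      by (auto simp: ord_at_def 1 2 branch_at_def)
  qed
  note * = this
  show c: "centred F d (ord_at f P) P"
    using * is_val_ord_at[OF P] by (auto simp: centred_def vpos_def z_def)
  show "ord_at f P (loc_unif d P) = 1"
    by (rule centred_unif_1[OF P c]) (use * in \<open>auto simp: z_def\<close>)
qed

text \<open>The device for transporting orders: after an involution, a map or an automorphism, only
  the centre of the transported valuation has to be checked.\<close>

theorem centred_eq_ord_at:
  assumes "P \<in> points f" "centred F d V P" "h \<noteq> 0"
  shows "V h = V (loc_unif d P) * ord_at f P h"
  using centred_compare[OF assms(1,2) centred_ord_at(1)[OF assms(1)] assms(3)] centred_ord_at(2)[OF assms(1)]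
  by (simp add: mult.commute)

lemma value_at_eqI:
  assumes P: "P \<in> points f" and v: "vpos (ord_at f P) (h - (cf a, 0))"
  shows "regular_at f P h" "value_at f P h = a"
proof -
  interpret v: valuation F "ord_at f P" by standard (rule is_val_ord_at[OF P])
  have "vnn (ord_at f P) ((h - (cf a, 0)) + (cf a, 0))"
    by (intro v.vnn_add v.vpos_imp_vnn v v.vnn_cf)
  then show "regular_at f P h" by (simp add: regular_at_def vnn_def)
  have "expand f P h = expand f P ((h - (cf a, 0)) + (cf a, 0))" by simp
  also have "\<dots> = expand f P (h - (cf a, 0)) + fls_const a"
    by (simp only: expand_add[OF P] expand_cf[OF P])
  finally have "value_at f P h = fls_nth (expand f P (h - (cf a, 0))) 0 + a"
    by (simp add: value_at_def)
  moreover have "fls_nth (expand f P (h - (cf a, 0))) 0 = 0"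
  proof (cases "h - (cf a, 0) = 0")
    case True
    then show ?thesis using expand_eq_0_iff[OF P] by (metis fls_zero_nth)
  qed (use v in \<open>auto simp: vpos_def ord_at_def\<close>)
  ultimately show "value_at f P h = a" by simp
qed

end

section \<open>Principal divisors have degree zero\<close>

lemma div_degree_eq_sum: "finite S \<Longrightarrow> Poly_Mapping.keys D \<subseteq> S \<Longrightarrow> div_degree D = (\<Sum>P\<in>S. Poly_Mapping.lookup D P)"
proof -
  assume "finite S" "Poly_Mapping.keys D \<subseteq> S"
  then show ?thesis
    unfolding div_degree_def by (intro sum.mono_neutral_left) (simp_all add: in_keys_iff)
qed

lemma div_degree_add: "div_degree (D + E) = div_degree D + div_degree E"
proof -
  let ?S = "Poly_Mapping.keys D \<union> Poly_Mapping.keys E"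
  have "div_degree (D + E) = (\<Sum>P\<in>?S. Poly_Mapping.lookup (D + E) P)"
    by (rule div_degree_eq_sum) (auto dest: set_mp[OF Poly_Mapping.keys_add])
  moreover have "div_degree D = (\<Sum>P\<in>?S. Poly_Mapping.lookup D P)" by (rule div_degree_eq_sum) auto
  moreover have "div_degree E = (\<Sum>P\<in>?S. Poly_Mapping.lookup E P)" by (rule div_degree_eq_sum) auto
  ultimately show ?thesis by (simp add: lookup_add sum.distrib)
qed

lemma div_degree_uminus: "div_degree (- D) = - div_degree D"
  by (simp add: div_degree_def sum_negf)

lemma div_degree_diff: "div_degree (D - E) = div_degree D - div_degree E"
  using div_degree_add[of D "- E"] by (simp add: div_degree_uminus)

lemma div_degree_zero [simp]: "div_degree 0 = 0" by (simp add: div_degree_def)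
lemma div_degree_frag_of [simp]: "div_degree (frag_of P) = 1" by (simp add: div_degree_def)

lemma order_linear_poly: "Polynomial.order b [:- a, 1:] = (if b = a then 1 else (0::nat))" for a :: "'a::field"
  using order_power_n_n[of a 1] by (auto simp: order_0I)

lemma sum_order_eq_degree:
  fixes p :: "'a::alg_closed_field poly"
  assumes "p \<noteq> 0" "finite XS" "{a. poly p a = 0} \<subseteq> XS"
  shows "(\<Sum>a\<in>XS. Polynomial.order a p) = Polynomial.degree p"
  using assms
proof (induction "Polynomial.degree p" arbitrary: p)
  case 0
  then obtain c where "p = [:c:]" "c \<noteq> 0" by (metis degree_eq_zeroE pCons_0_0)
  then show ?case by (simp add: order_0I)
next
  case (Suc n)
  obtain a where a: "poly p a = 0" using alg_closed_imp_poly_has_root[of p] Suc(2) by auto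
  then obtain q where q: "p = [:- a, 1:] * q" by (auto simp: poly_eq_0_iff_dvd dvd_def)
  have qnz: "q \<noteq> 0" using q Suc by auto
  have n: "Polynomial.degree p = Suc (Polynomial.degree q)" using qnz degree_mult_eq[of "[:- a, 1:]" q] q by simp
  have sub: "{a. poly q a = 0} \<subseteq> XS" using Suc.prems(3) q by auto
  have "Polynomial.order b p = (if b = a then 1 else 0) + Polynomial.order b q" for b
    unfolding q using qnz q Suc.prems(1) by (subst order_mult) (auto simp: order_linear_poly)
  then have "(\<Sum>b\<in>XS. Polynomial.order b p) = (\<Sum>b\<in>XS. if b = a then 1 else 0) + (\<Sum>b\<in>XS. Polynomial.order b q)"
    by (simp add: sum.distrib)
  moreover have "a \<in> XS" using a Suc.prems by auto
  moreover have "(\<Sum>b\<in>XS. Polynomial.order b q) = Polynomial.degree q"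
    using Suc.hyps(1)[of q] Suc.hyps(2) n qnz Suc.prems(2) sub by simp
  ultimately show ?case using n Suc.prems(2) by simp
qed

lemma order_le_imp_dvd:
  fixes p q :: "'a::alg_closed_field poly"
  assumes "p \<noteq> 0" "q \<noteq> 0" "\<And>a. Polynomial.order a q \<le> Polynomial.order a p"
  shows "q dvd p"
  using assms
proof (induction "Polynomial.degree q" arbitrary: p q)
  case 0
  then obtain c where "q = [:c:]" "c \<noteq> 0" by (metis degree_eq_zeroE pCons_0_0)
  then show ?case by (simp add: const_poly_dvd_iff dvd_field_iff)
next
  case (Suc n)
  obtain a where a: "poly q a = 0" using alg_closed_imp_poly_has_root[of q] Suc(2) by auto
  then have "Polynomial.order a q > 0" using Suc.prems by (simp add: order_root)
  then have "Polynomial.order a p > 0" using Suc.prems(3)[of a] by simp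
  then have "poly p a = 0" by (simp add: order_root)
  then obtain p' where p': "p = [:- a, 1:] * p'" by (auto simp: poly_eq_0_iff_dvd dvd_def)
  obtain q' where q': "q = [:- a, 1:] * q'" using a by (auto simp: poly_eq_0_iff_dvd dvd_def)
  have nz: "p' \<noteq> 0" "q' \<noteq> 0" using p' q' Suc.prems by auto
  have n: "Polynomial.degree q = Suc (Polynomial.degree q')" using nz degree_mult_eq[of "[:- a, 1:]" q'] q' by simp
  have "Polynomial.order b q' \<le> Polynomial.order b p'" for b
    using Suc.prems(3)[of b] Suc.prems(1,2) order_mult[of "[:- a, 1:]" p' b] order_mult[of "[:- a, 1:]" q' b]
    unfolding p' q' by linarith
  then have "q' dvd p'" using Suc.hyps(1)[of q' p'] Suc.hyps(2) n nz by auto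
  then show ?case unfolding p' q' by (rule mult_dvd_mono[OF dvd_refl])
qed

text \<open>The image of a point on the projective line, with \<open>None\<close> for
  infinity.\<close>

fun xc :: "point \<Rightarrow> qbar option" where
  "xc (Aff x y) = Some x" | "xc (Infty s) = None"

fun lpx :: "qbar option \<Rightarrow> qbar poly fract" where
  "lpx (Some a) = to_fract [:- a, 1:]" | "lpx None = 1 / fx"

lemma loc_par_lpx: "loc_par P = lpx (xc P)" by (cases P) auto

lemma place_lpx: "place (lpx a)" by (cases a) (auto simp: place_affine place_infinity)

lemma nu_Fract:
  assumes "p \<noteq> 0" "q \<noteq> 0"
  shows "nu (lpx (Some a)) (Fraction_Field.Fract p q) = int (Polynomial.order a p) - int (Polynomial.order a q)"
    and "nu (lpx None) (Fraction_Field.Fract p q) = int (Polynomial.degree q) - int (Polynomial.degree p)"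
proof -
  have m: "Fraction_Field.Fract p q * to_fract q = to_fract p" "Fraction_Field.Fract p q \<noteq> 0" "to_fract q \<noteq> 0"
    using assms by (auto simp: to_fract_def eq_fract Zero_fract_def)
  interpret l: place_loc "lpx (Some a)" by standard (rule place_lpx)
  show "nu (lpx (Some a)) (Fraction_Field.Fract p q) = int (Polynomial.order a p) - int (Polynomial.order a q)"
    using l.nu_mult[OF m(2,3)] assms m(1) by (simp add: nu_affine)
  interpret l': place_loc "lpx None" by standard (rule place_lpx)
  show "nu (lpx None) (Fraction_Field.Fract p q) = int (Polynomial.degree q) - int (Polynomial.degree p)"
    using l'.nu_mult[OF m(2,3)] assms m(1) by (simp add: nu_inf)
qed

lemma finite_nu: "A \<noteq> 0 \<Longrightarrow> finite {a. nu (lpx a) A \<noteq> 0}"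
proof (cases A)
  fix p q assume A: "A \<noteq> 0" "A = Fraction_Field.Fract p q" "q \<noteq> 0"
  then have p: "p \<noteq> 0" by (auto simp: eq_fract Zero_fract_def)
  have "{a. nu (lpx a) A \<noteq> 0} \<subseteq> insert None (Some ` ({a. poly p a = 0} \<union> {a. poly q a = 0}))"
  proof
    fix a assume "a \<in> {a. nu (lpx a) A \<noteq> 0}"
    then show "a \<in> insert None (Some ` ({a. poly p a = 0} \<union> {a. poly q a = 0}))"
      using nu_Fract(1)[OF p A(3)] A(2) order_0I[of p] order_0I[of q] by (cases a) fastforce+
  qed
  moreover have "finite (insert None (Some ` ({a. poly p a = 0} \<union> {a. poly q a = 0})))"
    using p A(3) by (simp add: poly_roots_finite)
  ultimately show ?thesis by (rule finite_subset)
qed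

text \<open>The degree of a principal divisor on the projective line: over an algebraically closed
  field the finite orders add up to deg p - deg q, which the order at infinity cancels.\<close>

lemma sum_nu:
  assumes "A \<noteq> 0" "finite XS" "{a. nu (lpx a) A \<noteq> 0} \<subseteq> XS"
  shows "(\<Sum>a\<in>XS. nu (lpx a) A) = 0"
proof (cases A)
  fix p q assume A: "A = Fraction_Field.Fract p q" "q \<noteq> 0"
  then have p: "p \<noteq> 0" using assms by (auto simp: eq_fract Zero_fract_def)
  let ?R = "{a. poly p a = 0} \<union> {a. poly q a = 0}"
  define Y where "Y = insert None (Some ` (?R \<union> {a. Some a \<in> XS}))"
  have fin: "finite (?R \<union> {a. Some a \<in> XS})"
    using p A(2) assms(2) by (auto simp: poly_roots_finite intro!: finite_vimageI[of XS Some, unfolded vimage_def])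
  have XY: "XS \<subseteq> Y"
  proof
    fix a assume "a \<in> XS" then show "a \<in> Y" by (cases a) (auto simp: Y_def)
  qed
  have "(\<Sum>a\<in>XS. nu (lpx a) A) = (\<Sum>a\<in>Y. nu (lpx a) A)"
    by (rule sum.mono_neutral_left) (use XY fin assms(3) in \<open>auto simp: Y_def\<close>)
  also have "\<dots> = nu (lpx None) A + (\<Sum>a\<in>?R \<union> {a. Some a \<in> XS}. nu (lpx (Some a)) A)"
    unfolding Y_def using fin by (simp add: sum.reindex)
  also have "\<dots> = int (Polynomial.degree q) - int (Polynomial.degree p) +
      (int (\<Sum>a\<in>?R \<union> {a. Some a \<in> XS}. Polynomial.order a p) - int (\<Sum>a\<in>?R \<union> {a. Some a \<in> XS}. Polynomial.order a q))"
    unfolding A(1) nu_Fract[OF p A(2)] by (simp add: sum_subtractf)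
  also have "\<dots> = 0"
    using sum_order_eq_degree[OF p fin] sum_order_eq_degree[OF A(2) fin] by (simp only: Un_upper1 le_supI1 Un_upper2)
  finally show ?thesis .
qed

text \<open>The hyperelliptic involution; on an elliptic curve it is negation.\<close>

primrec pconj :: "point \<Rightarrow> point" where
  "pconj (Aff x y) = Aff x (- y)" | "pconj (Infty s) = Infty (- s)"

lemma pconj_pconj [simp]: "pconj (pconj P) = P" by (cases P) auto
lemma xc_pconj [simp]: "xc (pconj P) = xc P" by (cases P) auto
lemma loc_pconj [simp]: "loc_par (pconj P) = loc_par P" "loc_b d (pconj P) = loc_b d P" "loc_val (pconj P) = - loc_val P"
  by (cases P; simp)+

context curve
begin

lemma pconj_in_points [simp]: "pconj P \<in> points f \<longleftrightarrow> P \<in> points f"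
  by (cases P) (auto simp: points_def)

text \<open>Ramification index of the projection to the x-line.\<close>

definition ram :: "point \<Rightarrow> int" where "ram P = (if loc_val P = 0 then 2 else 1)"

lemma valuation_ord: "P \<in> points f \<Longrightarrow> valuation F (ord_at f P)"
  by standard (rule is_val_ord_at)

lemma ord_loc_par: "P \<in> points f \<Longrightarrow> ord_at f P (loc_par P, 0) = ram P"
proof -
  assume P: "P \<in> points f"
  interpret v: valuation F "ord_at f P" by (rule valuation_ord[OF P])
  show ?thesis
    using centred_ord_at[OF P] v.ramified_formula(1)[OF place_loc_par centredD(2)[OF centred_ord_at(1)[OF P]] loc_b_nz Z_ramified[OF P]]
    by (auto simp: ram_def loc_unif_def)
qed

lemma ord_x: "P \<in> points f \<Longrightarrow> A \<noteq> 0 \<Longrightarrow> ord_at f P (A, 0) = ram P * nu (loc_par P) A"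
  using valuation.V_x_eq_nu[OF valuation_ord place_loc_par centredD(2)[OF centred_ord_at(1)]]
  by (simp add: ord_loc_par)

lemma ord_z: "P \<in> points f \<Longrightarrow> ord_at f P (0, loc_b d P) = (if loc_val P = 0 then 1 else 0)"
proof -
  assume P: "P \<in> points f"
  interpret v: valuation F "ord_at f P" by (rule valuation_ord[OF P])
  show ?thesis
    using centred_ord_at[OF P] v.V_z_unit[OF centredD(3)[OF centred_ord_at(1)[OF P]]]
    by (auto simp: loc_unif_def)
qed

lemma ord_mult: "P \<in> points f \<Longrightarrow> h \<noteq> 0 \<Longrightarrow> k \<noteq> 0 \<Longrightarrow> ord_at f P (h \<diamondop> k) = ord_at f P h + ord_at f P k"
  by (rule valuation.V_mult[OF valuation_ord])

lemma ord_add: "P \<in> points f \<Longrightarrow> h \<noteq> 0 \<Longrightarrow> k \<noteq> 0 \<Longrightarrow> h + k \<noteq> 0 \<Longrightarrow>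
    ord_at f P (h + k) \<ge> min (ord_at f P h) (ord_at f P k)"
  by (rule valuation.V_add[OF valuation_ord])

lemma ord_y_part: "P \<in> points f \<Longrightarrow> B \<noteq> 0 \<Longrightarrow>
    ord_at f P (0, B) = ram P * nu (loc_par P) (B / loc_b d P) + (if loc_val P = 0 then 1 else 0)"
proof -
  assume P: "P \<in> points f" and B: "B \<noteq> 0"
  have "(0, B) = (B / loc_b d P, 0) \<diamondop> (0, loc_b d P)" by (simp add: rmul_x)
  then show ?thesis using B by (simp add: ord_mult[OF P] ord_x[OF P] ord_z[OF P] zero_prod_def)
qed

text \<open>Taking the order at \<open>P\<close> of the conjugate function is a valuation centred at
  \<open>pconj P\<close> with value 1 on the uniformizer, hence the order there.\<close>

lemma ord_pconj:
  assumes P: "P \<in> points f" and h: "h \<noteq> 0"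
  shows "ord_at f (pconj P) h = ord_at f P (rconj h)"
proof -
  interpret v: valuation F "ord_at f P" by (rule valuation_ord[OF P])
  let ?V = "\<lambda>h. ord_at f P (rconj h)"
  have pc: "rconj (A, 0) = (A, 0)" for A by (simp add: rconj_def)
  have z: "rconj ((0, loc_b d P) - (cf (loc_val (pconj P)), 0)) = - ((0, loc_b d P) - (cf (loc_val P), 0))"
    by (simp add: rconj_def cf_minus)
  have "is_val F ?V" unfolding is_val_def
  proof (intro conjI allI impI)
    fix h k :: ratfun assume "h \<noteq> 0" "k \<noteq> 0"
    then show "ord_at f P (rconj (h \<diamondop> k)) = ord_at f P (rconj h) + ord_at f P (rconj k)"
      by (simp add: rconj_rmul v.V_mult)
    assume "h + k \<noteq> 0"
    then show "min (ord_at f P (rconj h)) (ord_at f P (rconj k)) \<le> ord_at f P (rconj (h + k))"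
      using \<open>h \<noteq> 0\<close> \<open>k \<noteq> 0\<close> v.V_add[of "rconj h" "rconj k"] by (metis rconj_add rconj_eq_0_iff)
  qed (simp add: pc v.V_cf)
  moreover have "vpos ?V ((0, loc_b d P) - (cf (loc_val (pconj P)), 0))"
    using centredD(3)[OF centred_ord_at(1)[OF P]]
    unfolding vpos_def z v.V_uminus by (metis neg_equal_0_iff_equal rconj_eq_0_iff z)
  ultimately have c: "centred F d ?V (pconj P)"
    using centredD[OF centred_ord_at(1)[OF P]] by (auto simp: centred_def pc)
  have "rconj (loc_unif d (pconj P)) = loc_unif d P \<or> rconj (loc_unif d (pconj P)) = - loc_unif d P"
    by (auto simp: loc_unif_def rconj_def)
  then have "?V (loc_unif d (pconj P)) = 1" using centred_ord_at(2)[OF P] v.V_uminus by metis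
  then show ?thesis using centred_eq_ord_at[OF _ c h] P by simp
qed

lemma ord_norm:
  assumes P: "P \<in> points f" and h: "h \<noteq> 0"
  shows "ord_at f P h + ord_at f (pconj P) h = ram P * nu (loc_par P) (rnorm F h)"
proof -
  have "ord_at f P h + ord_at f (pconj P) h = ord_at f P (h \<diamondop> rconj h)"
    using h by (simp add: ord_pconj[OF P] ord_mult[OF P])
  also have "\<dots> = ram P * nu (loc_par P) (rnorm F h)"
    using h by (simp add: rmul_rconj ord_x[OF P])
  finally show ?thesis .
qed

lemma fibre: 
  obtains P where "P \<in> points f" "{Q \<in> points f. xc Q = a} = {P, pconj P}" "xc P = a"
proof (cases a)
  case (Some x)
  obtain y where y: "y\<^sup>2 = poly F x" using nth_root_exists[of 2 "poly F x"] by auto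
  have y': "w\<^sup>2 = poly F x \<longleftrightarrow> w = y \<or> w = - y" for w
    unfolding y[symmetric] by (rule power2_eq_iff)
  have "Q \<in> points f \<and> xc Q = a \<longleftrightarrow> Q = Aff x y \<or> Q = Aff x (- y)" for Q
    using Some by (cases Q) (auto simp: points_def y')
  then show ?thesis using that[of "Aff x y"] Some y by (auto simp: points_def)
next
  case None
  obtain s where s: "s\<^sup>2 = coeff F (2 * d)" using nth_root_exists[of 2 "coeff F (2 * d)"] by auto
  have s': "w\<^sup>2 = coeff F (2 * d) \<longleftrightarrow> w = s \<or> w = - s" for w
    unfolding s[symmetric] by (rule power2_eq_iff)
  have "Q \<in> points f \<and> xc Q = a \<longleftrightarrow> Q = Infty s \<or> Q = Infty (- s)" for Q
    using None by (cases Q) (auto simp: points_def s' half_deg)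
  then show ?thesis using that[of "Infty s"] None s by (auto simp: points_def half_deg)
qed

lemma pconj_eq_iff: "pconj P = P \<longleftrightarrow> loc_val P = 0"
  by (cases P) (auto simp: eq_neg_iff_add_eq_0 neg_eq_iff_add_eq_0 simp flip: mult_2)

lemma finite_fibre: "finite {Q \<in> points f. xc Q = a}"
  by (rule fibre[of a]) auto

lemma sum_ram_fibre: "(\<Sum>Q | Q \<in> points f \<and> xc Q = a. ram Q) = 2"
proof (rule fibre[of a])
  fix P assume P: "{Q \<in> points f. xc Q = a} = {P, pconj P}"
  show ?thesis unfolding P
    using pconj_eq_iff[of P] by (cases "loc_val P = 0") (auto simp: ram_def)
qed

text \<open>Away from infinity, the branch points, and the zeros and poles of the components and of
  the norm, both \<open>h\<close> and its conjugate are integral while their orders add up to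
  0.\<close>

lemma finite_support: 
  assumes h: "h \<noteq> 0"
  shows "finite {P \<in> points f. ord_at f P h \<noteq> 0}"
proof -
  define N where "N A = (if A = 0 then {} else {a. nu (lpx a) A \<noteq> 0})" for A :: "qbar poly fract"
  define XS where "XS = N (fst h) \<union> N (snd h) \<union> N (rnorm F h) \<union> insert None (Some ` {a. poly F a = 0})"
  have fN: "finite (N A)" for A by (simp add: N_def finite_nu)
  have fXS: "finite XS" by (simp add: XS_def fN poly_roots_finite)
  have "{P \<in> points f. ord_at f P h \<noteq> 0} \<subseteq> (\<Union>a\<in>XS. {Q \<in> points f. xc Q = a})"
  proof
    fix P assume P: "P \<in> {P \<in> points f. ord_at f P h \<noteq> 0}"
    then have Pp: "P \<in> points f" by simp
    show "P \<in> (\<Union>a\<in>XS. {Q \<in> points f. xc Q = a})"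
    proof (rule ccontr)
      assume "P \<notin> (\<Union>a\<in>XS. {Q \<in> points f. xc Q = a})"
      then have nX: "xc P \<notin> XS" using Pp by auto
      then obtain a y where Pa: "P = Aff a y" by (cases P) (auto simp: XS_def)
      have y: "y \<noteq> 0" using nX Pp Pa by (auto simp: XS_def points_def)
      have nu0: "nu (loc_par P) A = 0" if "A = fst h \<or> A = snd h \<or> A = rnorm F h" "A \<noteq> 0" for A
        using nX that by (auto simp: XS_def N_def loc_par_lpx split: if_splits)
      have ge: "vnn (ord_at f Q) h" if Q: "Q \<in> points f" "loc_par Q = loc_par P" "loc_b d Q = 1" "loc_val Q \<noteq> 0" for Q
      proof -
        interpret v: valuation F "ord_at f Q" by (rule valuation_ord[OF Q(1)])
        have "vnn (ord_at f Q) (fst h, 0)"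
          using nu0[of "fst h"] by (cases "fst h = 0") (auto simp: vnn_def zero_prod_def ord_x[OF Q(1)] Q)
        moreover have "vnn (ord_at f Q) (0, snd h)"
          using nu0[of "snd h"] by (cases "snd h = 0") (auto simp: vnn_def zero_prod_def ord_y_part[OF Q(1)] Q)
        ultimately have "vnn (ord_at f Q) ((fst h, 0) + (0, snd h))" by (rule v.vnn_add)
        then show ?thesis by simp
      qed
      have "ord_at f P h \<ge> 0" "ord_at f (pconj P) h \<ge> 0"
        using ge[OF Pp] ge[of "pconj P"] Pp Pa y h pconj_in_points[of P] by (auto simp: vnn_def)
      moreover have "ord_at f P h + ord_at f (pconj P) h = 0"
        using ord_norm[OF Pp h] nu0[of "rnorm F h"] h by simp
      ultimately show False using P by simp
    qed
  qed
  moreover have "finite (\<Union>a\<in>XS. {Q \<in> points f. xc Q = a})" using fXS finite_fibre by blast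
  ultimately show ?thesis by (rule finite_subset)
qed

section \<open>Divisors of functions and the group of principal divisors\<close>

definition fdiv :: "ratfun \<Rightarrow> (point \<Rightarrow>\<^sub>0 int)" where
  "fdiv h = Abs_poly_mapping (\<lambda>P. if P \<in> points f \<and> h \<noteq> 0 then ord_at f P h else 0)"

lemma lookup_fdiv: "Poly_Mapping.lookup (fdiv h) P = (if P \<in> points f \<and> h \<noteq> 0 then ord_at f P h else 0)"
proof -
  have "finite {P. (if P \<in> points f \<and> h \<noteq> 0 then ord_at f P h else 0) \<noteq> 0}"
    using finite_support[of h] by (cases "h = 0") (auto elim!: rev_finite_subset)
  then show ?thesis unfolding fdiv_def by (simp add: Abs_poly_mapping_inverse)
qed

lemma keys_fdiv: "Poly_Mapping.keys (fdiv h) \<subseteq> points f"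
  by (auto simp: in_keys_iff lookup_fdiv split: if_splits)

lemma fdiv_mult: "h \<noteq> 0 \<Longrightarrow> k \<noteq> 0 \<Longrightarrow> fdiv (h \<diamondop> k) = fdiv h + fdiv k"
  by (rule poly_mapping_eqI) (simp add: lookup_add lookup_fdiv ord_mult)

lemma fdiv_one: "fdiv (1, 0) = 0"
  by (rule poly_mapping_eqI) (simp add: lookup_fdiv valuation.V_one[OF valuation_ord])

lemma fdiv_rinv: "h \<noteq> 0 \<Longrightarrow> fdiv (rinv F h) = - fdiv h"
  using fdiv_mult[of h "rinv F h"] by (simp add: rinv_right rinv_nz fdiv_one eq_neg_iff_add_eq_0 add.commute)

lemma div_degree_fibres:
  assumes "Poly_Mapping.keys D \<subseteq> points f" "finite XS" "xc ` Poly_Mapping.keys D \<subseteq> XS"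
  shows "div_degree D = (\<Sum>a\<in>XS. \<Sum>Q | Q \<in> points f \<and> xc Q = a. Poly_Mapping.lookup D Q)"
proof -
  have "div_degree D = (\<Sum>Q\<in>(\<Union>a\<in>XS. {Q \<in> points f. xc Q = a}). Poly_Mapping.lookup D Q)"
    using assms finite_fibre by (intro div_degree_eq_sum) auto
  also have "\<dots> = (\<Sum>a\<in>XS. \<Sum>Q | Q \<in> points f \<and> xc Q = a. Poly_Mapping.lookup D Q)"
    using assms(2) finite_fibre by (intro sum.UNION_disjoint) auto
  finally show ?thesis .
qed

text \<open>Summed over a fibre of the projection, the orders of \<open>h\<close> give the order of
  its norm on the line, so the claim reduces to \<open>sum_nu\<close>.\<close>

theorem div_degree_fdiv: "div_degree (fdiv h) = 0"
proof (cases "h = 0")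
  case True
  then have "fdiv h = 0" by (intro poly_mapping_eqI) (simp add: lookup_fdiv)
  then show ?thesis by simp
next
  case h: False
  define XS where "XS = xc ` Poly_Mapping.keys (fdiv h) \<union> {a. nu (lpx a) (rnorm F h) \<noteq> 0}"
  have fXS: "finite XS" using h by (simp add: XS_def finite_nu)
  \<comment> \<open>Doubling allows each point to be paired with its conjugate, whose orders
    together are the order of the norm times the ramification index; those indices add up to
    2.\<close>
  have inner: "2 * (\<Sum>Q | Q \<in> points f \<and> xc Q = a. Poly_Mapping.lookup (fdiv h) Q) = 2 * nu (lpx a) (rnorm F h)" for a
  proof -
    let ?S = "{Q. Q \<in> points f \<and> xc Q = a}"
    have "(\<Sum>Q\<in>?S. Poly_Mapping.lookup (fdiv h) (pconj Q)) = (\<Sum>Q\<in>?S. Poly_Mapping.lookup (fdiv h) Q)"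
      by (rule sum.reindex_bij_witness[of _ pconj pconj]) auto
    then have "2 * (\<Sum>Q\<in>?S. Poly_Mapping.lookup (fdiv h) Q) =
        (\<Sum>Q\<in>?S. Poly_Mapping.lookup (fdiv h) Q + Poly_Mapping.lookup (fdiv h) (pconj Q))"
      by (simp add: sum.distrib)
    also have "\<dots> = (\<Sum>Q\<in>?S. ram Q * nu (lpx a) (rnorm F h))"
      using h by (intro sum.cong) (auto simp: lookup_fdiv ord_norm loc_par_lpx)
    also have "\<dots> = 2 * nu (lpx a) (rnorm F h)"
      using sum_ram_fibre[of a] by (simp flip: sum_distrib_right)
    finally show ?thesis .
  qed
  have "div_degree (fdiv h) = (\<Sum>a\<in>XS. \<Sum>Q | Q \<in> points f \<and> xc Q = a. Poly_Mapping.lookup (fdiv h) Q)"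
    by (rule div_degree_fibres) (use keys_fdiv fXS in \<open>auto simp: XS_def\<close>)
  also have "\<dots> = (\<Sum>a\<in>XS. nu (lpx a) (rnorm F h))"
    using inner by (intro sum.cong) auto
  also have "\<dots> = 0" using h fXS by (intro sum_nu) (auto simp: XS_def)
  finally show ?thesis .
qed

lemma principal_iff: "D \<in> principal f \<longleftrightarrow> (\<exists>h. h \<noteq> 0 \<and> D = fdiv h)"
proof
  assume "D \<in> principal f"
  then obtain h where h: "Poly_Mapping.keys D \<subseteq> points f" "h \<noteq> 0" "\<forall>P\<in>points f. Poly_Mapping.lookup D P = ord_at f P h"
    by (auto simp: principal_def)
  have "D = fdiv h" 
  proof (rule poly_mapping_eqI)
    fix P show "Poly_Mapping.lookup D P = Poly_Mapping.lookup (fdiv h) P"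
      using h by (cases "P \<in> points f") (auto simp: lookup_fdiv in_keys_iff)
  qed
  with h show "\<exists>h. h \<noteq> 0 \<and> D = fdiv h" by blast
next
  assume "\<exists>h. h \<noteq> 0 \<and> D = fdiv h"
  then obtain h where h: "h \<noteq> 0" "D = fdiv h" by blast
  then have "\<forall>P\<in>points f. Poly_Mapping.lookup D P = ord_at f P h" by (simp add: lookup_fdiv)
  then show "D \<in> principal f" unfolding principal_def
    using keys_fdiv[of h] h by (intro CollectI conjI exI[of _ h]) simp_all
qed

lemma principal_zero: "0 \<in> principal f"
  unfolding principal_iff using fdiv_one by (intro exI[of _ "(1, 0)"]) (auto simp: zero_prod_def)

lemma principal_add: "D \<in> principal f \<Longrightarrow> E \<in> principal f \<Longrightarrow> D + E \<in> principal f"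
  unfolding principal_iff using fdiv_mult rmul_eq_0_iff by metis

lemma principal_uminus: "D \<in> principal f \<Longrightarrow> - D \<in> principal f"
  unfolding principal_iff using fdiv_rinv rinv_nz by metis

lemma principal_diff: "D \<in> principal f \<Longrightarrow> E \<in> principal f \<Longrightarrow> D - E \<in> principal f"
  using principal_add[of D "- E"] principal_uminus by simp

lemma principal_degree: "D \<in> principal f \<Longrightarrow> div_degree D = 0"
  unfolding principal_iff using div_degree_fdiv by blast

lemma principal_keys: "D \<in> principal f \<Longrightarrow> Poly_Mapping.keys D \<subseteq> points f"
  unfolding principal_iff using keys_fdiv by blast

end

section \<open>Riemann's inequality and the genus\<close>

global_interpretation rs: vector_space scale_fun
  by (rule vector_space_scale_fun)

text \<open>\<open>rs.dim\<close> counts a basis with \<open>card\<close> and so gives 0 in infinite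
  dimension; finiteness is therefore carried along separately.\<close>

definition fin_dim :: "ratfun set \<Rightarrow> bool" where
  "fin_dim W \<longleftrightarrow> (\<exists>B. finite B \<and> \<not> rs.dependent B \<and> rs.span B = W)"

lemma dim_eq_card_basis: "\<not> rs.dependent B \<Longrightarrow> rs.span B = W \<Longrightarrow> rs.dim W = card B"
  using rs.dim_eq_card[of B W] rs.span_span by metis

lemma fin_dim_subset:
  assumes "rs.subspace W" "W \<subseteq> V" "fin_dim V"
  shows "fin_dim W" "rs.dim W \<le> rs.dim V"
proof -
  obtain T where T: "finite T" "\<not> rs.dependent T" "rs.span T = V" using assms by (auto simp: fin_dim_def)
  obtain B where B: "B \<subseteq> W" "\<not> rs.dependent B" "W \<subseteq> rs.span B" "card B = rs.dim W"
    by (rule rs.basis_exists)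
  have "rs.span B = W" using B assms(1) by (metis rs.span_subspace)
  moreover have fB: "finite B \<and> card B \<le> card T"
    using rs.independent_span_bound[OF T(1) B(2)] B(1) assms(2) T(3) by auto
  ultimately show "fin_dim W" using B by (auto simp: fin_dim_def)
  show "rs.dim W \<le> rs.dim V" using fB B(4) dim_eq_card_basis[OF T(2,3)] by simp
qed

lemma fin_dim_step:
  assumes W: "fin_dim W" and V: "rs.subspace V" "W \<subseteq> V" and v: "v \<in> V" "v \<notin> W"
    and c: "\<And>x. x \<in> V \<Longrightarrow> \<exists>c. x - scale_fun c v \<in> W"
  shows "fin_dim V" "rs.dim V = rs.dim W + 1"
proof -
  obtain B where B: "finite B" "\<not> rs.dependent B" "rs.span B = W" using W by (auto simp: fin_dim_def)
  have vB: "v \<notin> B" using v B rs.span_base by blast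
  have ind: "\<not> rs.dependent (insert v B)" using B v vB by (simp add: rs.independent_insert)
  have "V \<subseteq> rs.span (insert v B)"
  proof
    fix x assume "x \<in> V"
    then obtain a where "x - scale_fun a v \<in> rs.span B" using c B by blast
    then have "x - scale_fun a v \<in> rs.span (insert v B)" using rs.span_mono[of B "insert v B"] by blast
    moreover have "scale_fun a v \<in> rs.span (insert v B)" by (simp add: rs.span_scale rs.span_base)
    ultimately have "(x - scale_fun a v) + scale_fun a v \<in> rs.span (insert v B)" by (rule rs.span_add)
    then show "x \<in> rs.span (insert v B)" by simp
  qed
  moreover have "rs.span (insert v B) \<subseteq> V"
    using B V v rs.span_superset by (intro rs.span_minimal) blast+
  ultimately have s: "rs.span (insert v B) = V" by blast
  then show "fin_dim V" using B ind by (auto simp: fin_dim_def intro!: exI[of _ "insert v B"])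
  show "rs.dim V = rs.dim W + 1"
    using dim_eq_card_basis[OF ind s] dim_eq_card_basis[OF B(2,3)] B(1) vB by simp
qed

text \<open>The bounds are put on coefficients rather than on degrees so that the bound 0 leaves
  only the zero polynomial.\<close>

definition poly_pairs :: "nat \<Rightarrow> nat \<Rightarrow> ratfun set" where
  "poly_pairs a b = {(to_fract p, to_fract q) | p q. (\<forall>i\<ge>a. coeff p i = 0) \<and> (\<forall>i\<ge>b. coeff q i = 0)}"

lemma scale_fun_cf: "scale_fun c h = (cf c * fst h, cf c * snd h)"
  by (simp add: scale_fun_def cf_def)

lemma scale_fun_to_fract: "scale_fun c (to_fract p, to_fract q) = (to_fract (smult c p), to_fract (smult c q))"
  by (simp add: scale_fun_def flip: to_fract_mult)

lemma poly_pairsI: "(\<forall>i\<ge>a. coeff p i = 0) \<Longrightarrow> (\<forall>i\<ge>b. coeff q i = 0) \<Longrightarrow> (to_fract p, to_fract q) \<in> poly_pairs a b"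
  by (auto simp: poly_pairs_def)

lemma poly_pairs_iff: "(to_fract p, to_fract q) \<in> poly_pairs a b \<longleftrightarrow> (\<forall>i\<ge>a. coeff p i = 0) \<and> (\<forall>i\<ge>b. coeff q i = 0)"
  by (auto simp: poly_pairs_def)

lemma subspace_poly_pairs: "rs.subspace (poly_pairs a b)"
proof (rule rs.subspaceI)
  show "0 \<in> poly_pairs a b" using poly_pairsI[of a 0 b 0] by (simp add: zero_prod_def)
  show "h + k \<in> poly_pairs a b" if hk: "h \<in> poly_pairs a b" "k \<in> poly_pairs a b" for h k
  proof -
    obtain p q r s where *: "h = (to_fract p, to_fract q)" "k = (to_fract r, to_fract s)"
      using hk by (auto simp: poly_pairs_def)
    then have "h + k = (to_fract (p + r), to_fract (q + s))" by simp
    then show ?thesis using hk unfolding * by (simp only: poly_pairs_iff) simp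
  qed
  show "scale_fun c h \<in> poly_pairs a b" if h: "h \<in> poly_pairs a b" for c h
  proof -
    obtain p q where *: "h = (to_fract p, to_fract q)" using h by (auto simp: poly_pairs_def)
    then show ?thesis using h by (auto simp: scale_fun_to_fract poly_pairs_iff)
  qed
qed

lemma poly_pairs_0: "poly_pairs 0 0 = {0}"
proof -
  have "h \<in> poly_pairs 0 0 \<Longrightarrow> h = 0" for h
  proof -
    assume "h \<in> poly_pairs 0 0"
    then obtain p q where "h = (to_fract p, to_fract q)" "\<forall>i. coeff p i = 0" "\<forall>i. coeff q i = 0"
      by (auto simp: poly_pairs_def)
    then show "h = 0" by (metis leading_coeff_0_iff to_fract_0 zero_prod_def)
  qed
  then show ?thesis using rs.subspace_0[OF subspace_poly_pairs] by blast
qed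

lemma fin_dim_poly_pairs: "fin_dim (poly_pairs a b) \<and> rs.dim (poly_pairs a b) = a + b"
proof (induction a)
  case 0
  show ?case
  proof (induction b)
    case 0
    have "rs.span {} = {0}" by simp
    then show ?case using dim_eq_card_basis[of "{}" "{0}"]
      by (auto simp: poly_pairs_0 fin_dim_def rs.independent_empty intro!: exI[of _ "{}"])
  next
    case (Suc b)
    let ?v = "(to_fract 0, to_fract (monom 1 b)) :: ratfun"
    have "\<exists>c. x - scale_fun c ?v \<in> poly_pairs 0 b" if xm: "x \<in> poly_pairs 0 (Suc b)" for x
    proof -
      obtain p q where x: "x = (to_fract p, to_fract q)" "\<forall>i. coeff p i = 0" "\<forall>i\<ge>Suc b. coeff q i = 0"
        using xm by (auto simp: poly_pairs_def)
      have e: "x - scale_fun (coeff q b) ?v = (to_fract p, to_fract (q - smult (coeff q b) (monom 1 b)))"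
        by (simp add: x scale_fun_to_fract del: to_fract_0)
      have c: "coeff (q - smult (coeff q b) (monom 1 b)) i = 0" if "i \<ge> b" for i
        using that x(3)[rule_format, of i] by (cases "i = b") auto
      have "x - scale_fun (coeff q b) ?v \<in> poly_pairs 0 b"
        unfolding e poly_pairs_iff using c x(2) by blast
      then show ?thesis by blast
    qed
    moreover have "poly_pairs 0 b \<subseteq> poly_pairs 0 (Suc b)" by (auto simp: poly_pairs_def)
    moreover have "?v \<in> poly_pairs 0 (Suc b)" "?v \<notin> poly_pairs 0 b" unfolding poly_pairs_iff by auto
    ultimately show ?case using fin_dim_step[of "poly_pairs 0 b" "poly_pairs 0 (Suc b)" ?v] subspace_poly_pairs Suc by auto
  qed
next
  case (Suc a)
  let ?v = "(to_fract (monom 1 a), to_fract 0) :: ratfun"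
  have "\<exists>c. x - scale_fun c ?v \<in> poly_pairs a b" if xm: "x \<in> poly_pairs (Suc a) b" for x
  proof -
    obtain p q where x: "x = (to_fract p, to_fract q)" "\<forall>i\<ge>Suc a. coeff p i = 0" "\<forall>i\<ge>b. coeff q i = 0"
      using xm by (auto simp: poly_pairs_def)
    have e: "x - scale_fun (coeff p a) ?v = (to_fract (p - smult (coeff p a) (monom 1 a)), to_fract q)"
      by (simp add: x scale_fun_to_fract del: to_fract_0)
    have c: "coeff (p - smult (coeff p a) (monom 1 a)) i = 0" if "i \<ge> a" for i
      using that x(2)[rule_format, of i] by (cases "i = a") auto
    have "x - scale_fun (coeff p a) ?v \<in> poly_pairs a b"
      unfolding e poly_pairs_iff using c x(3) by blast
    then show ?thesis by blast
  qed
  moreover have "poly_pairs a b \<subseteq> poly_pairs (Suc a) b" by (auto simp: poly_pairs_def)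
  moreover have "?v \<in> poly_pairs (Suc a) b" "?v \<notin> poly_pairs a b" unfolding poly_pairs_iff by auto
  ultimately show ?case using fin_dim_step[of "poly_pairs a b" "poly_pairs (Suc a) b" ?v] subspace_poly_pairs Suc by auto
qed

lemma sum_mapping_pos:
  fixes D :: "'a \<Rightarrow>\<^sub>0 int"
  assumes "\<And>P. Poly_Mapping.lookup D P \<ge> 0" "D \<noteq> 0"
  obtains P where "Poly_Mapping.lookup D P > 0"
  using assms by (metis less_le lookup_zero poly_mapping_eqI)

lemma div_degree_nonneg: "(\<And>P. Poly_Mapping.lookup D P \<ge> 0) \<Longrightarrow> div_degree D \<ge> 0"
  unfolding div_degree_def by (rule sum_nonneg) auto

lemma div_degree_0_eff: 
  assumes "\<And>P. Poly_Mapping.lookup D P \<ge> 0" "div_degree D = 0" shows "D = 0"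
proof (rule poly_mapping_eqI)
  fix P
  have "\<forall>P\<in>Poly_Mapping.keys D. Poly_Mapping.lookup D P = 0"
    using assms unfolding div_degree_def by (subst sum_nonneg_eq_0_iff[symmetric]) auto
  then show "Poly_Mapping.lookup D P = Poly_Mapping.lookup 0 P" by (auto simp: in_keys_iff)
qed

lemma div_degree_1_eff:
  assumes "\<And>P. Poly_Mapping.lookup D P \<ge> 0" "div_degree D = int (Suc n)"
  obtains P E where "D = frag_of P + E" "\<forall>P. Poly_Mapping.lookup E P \<ge> 0" "div_degree E = int n"
    "P \<in> Poly_Mapping.keys D"
proof -
  have "D \<noteq> 0" using assms(2) by auto
  then obtain P where P: "Poly_Mapping.lookup D P > 0" using sum_mapping_pos assms(1) by blast
  show ?thesis
  proof (rule that[of P "D - frag_of P"])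
    show "\<forall>Q. Poly_Mapping.lookup (D - frag_of P) Q \<ge> 0"
    proof
      show "Poly_Mapping.lookup (D - frag_of P) Q \<ge> 0" for Q
        using assms(1)[of Q] P by (auto simp: lookup_minus)
    qed
    show "div_degree (D - frag_of P) = int n" using assms(2) by (simp add: div_degree_diff)
    show "P \<in> Poly_Mapping.keys D" using P by (simp add: in_keys_iff)
  qed simp
qed

context curve
begin

lemma ord_scale: "P \<in> points f \<Longrightarrow> c \<noteq> 0 \<Longrightarrow> ord_at f P (scale_fun c h) = ord_at f P h"
proof (cases "h = 0")
  case True
  then show ?thesis by (simp add: rs.scale_zero_right)
next
  case False
  assume P: "P \<in> points f" and c: "c \<noteq> 0"
  have "scale_fun c h = (cf c, 0) \<diamondop> h" by (simp add: scale_fun_cf rmul_x)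
  then show ?thesis using c False valuation.V_cf[OF valuation_ord[OF P]] by (simp add: ord_mult[OF P] zero_prod_def)
qed

lemma subspace_rr: "rs.subspace (rr_space f D)"
proof (rule rs.subspaceI)
  show "0 \<in> rr_space f D" by (simp add: rr_space_def)
  show "h + k \<in> rr_space f D" if "h \<in> rr_space f D" "k \<in> rr_space f D" for h k
  proof (cases "h = 0 \<or> k = 0 \<or> h + k = 0")
    case False
    then have "ord_at f P (h + k) \<ge> - Poly_Mapping.lookup D P" if "P \<in> points f" for P
      using ord_add[OF that, of h k] \<open>h \<in> _\<close> \<open>k \<in> _\<close> that unfolding rr_space_def by fastforce
    then show ?thesis by (simp add: rr_space_def)
  qed (use that in \<open>auto simp: rr_space_def\<close>)
  show "scale_fun c h \<in> rr_space f D" if "h \<in> rr_space f D" for c h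
    using that by (cases "c = 0") (auto simp: rr_space_def ord_scale)
qed

text \<open>The coefficient of index \<open>- lookup D P - 1\<close> in the expansion at
  \<open>P\<close> is the lowest one that L(D + P) permits and L(D) does not. As a linear functional
  on L(D + P) it has kernel L(D).\<close>

lemma rr_step:
  assumes P: "P \<in> points f" and fd: "fin_dim (rr_space f (D + frag_of P))"
  shows "fin_dim (rr_space f D)" "rs.dim (rr_space f (D + frag_of P)) \<le> rs.dim (rr_space f D) + 1"
proof -
  let ?W = "rr_space f D" and ?V = "rr_space f (D + frag_of P)"
  have sub: "?W \<subseteq> ?V"
    unfolding rr_space_def by (auto simp: lookup_add lookup_frag_of)
  show fW: "fin_dim ?W" by (rule fin_dim_subset(1)[OF subspace_rr sub fd])
  define n where "n = - Poly_Mapping.lookup D P - 1"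
  have V: "fls_nth (expand f P h) k = 0" if "h \<in> ?V" "k < n" for h k
    using that P expand_eq_0_iff[OF P, of h] by (cases "h = 0")
      (auto simp: rr_space_def lookup_add lookup_frag_of n_def ord_at_def)
  have W: "h \<in> ?W" if h: "h \<in> ?V" "fls_nth (expand f P h) n = 0" for h
  proof (cases "h = 0")
    case False
    have "fls_subdegree (expand f P h) > n"
      using V[OF h(1)] h(2) False expand_eq_0_iff[OF P, of h]
      by (intro fls_subdegree_greaterI) (auto simp: le_less)
    then have "ord_at f P h \<ge> - Poly_Mapping.lookup D P" by (simp add: ord_at_def n_def)
    moreover have "ord_at f Q h \<ge> - Poly_Mapping.lookup D Q" if "Q \<in> points f" "Q \<noteq> P" for Q
      using h False that by (auto simp: rr_space_def lookup_add lookup_frag_of)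
    ultimately show ?thesis by (auto simp: rr_space_def)
  qed (simp add: rr_space_def)
  show "rs.dim ?V \<le> rs.dim ?W + 1"
  proof (cases "?V \<subseteq> ?W")
    case True
    then show ?thesis using sub by (metis le_add1 subset_antisym)
  next
    case False
    then obtain v where v: "v \<in> ?V" "v \<notin> ?W" by blast
    then have c: "fls_nth (expand f P v) n \<noteq> 0" using W by blast
    have "\<exists>c. x - scale_fun c v \<in> ?W" if x: "x \<in> ?V" for x
    proof -
      let ?c = "fls_nth (expand f P x) n / fls_nth (expand f P v) n"
      have "x - scale_fun ?c v = x + (cf (- ?c), 0) \<diamondop> v" by (simp add: scale_fun_cf rmul_x cf_minus prod_eq_iff)
      then have "expand f P (x - scale_fun ?c v) = expand f P x + fls_const (- ?c) * expand f P v"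
        by (simp only: expand_add[OF P] expand_mult[OF P] expand_cf[OF P])
      then have "fls_nth (expand f P (x - scale_fun ?c v)) n = 0" using c by simp
      moreover have "x - scale_fun ?c v \<in> ?V" using x v subspace_rr by (meson rs.subspace_diff rs.subspace_scale)
      ultimately show ?thesis using W by blast
    qed
    from fin_dim_step(2)[OF fW subspace_rr sub v this] show ?thesis by simp
  qed
qed

text \<open>Points are added one at a time: each raises the degree by 1 and the dimension by at most
  1.\<close>

lemma rr_mono:
  assumes "Poly_Mapping.keys D' \<subseteq> points f" "\<And>P. Poly_Mapping.lookup D P \<le> Poly_Mapping.lookup D' P"
    "Poly_Mapping.keys D \<subseteq> points f" "fin_dim (rr_space f D')"
  shows "fin_dim (rr_space f D) \<and> div_degree D - int (rs.dim (rr_space f D)) \<le> div_degree D' - int (rs.dim (rr_space f D'))"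
  using assms
proof (induction "nat (div_degree (D' - D))" arbitrary: D')
  case 0
  have "div_degree (D' - D) \<ge> 0" using 0 by (intro div_degree_nonneg) (simp add: lookup_minus)
  then have "D' - D = 0" using 0 by (intro div_degree_0_eff) (auto simp: lookup_minus)
  then show ?case using 0 by simp
next
  case (Suc n)
  have dd: "div_degree (D' - D) = int (Suc n)" using Suc.hyps(2) by simp
  have nn: "Poly_Mapping.lookup (D' - D) Q \<ge> 0" for Q using Suc.prems(2)[of Q] by (simp add: lookup_minus)
  obtain P E where PE: "D' - D = frag_of P + E" "\<forall>Q. Poly_Mapping.lookup E Q \<ge> 0" "div_degree E = int n"
      "P \<in> Poly_Mapping.keys (D' - D)"
    by (rule div_degree_1_eff[OF nn dd])
  have D': "D' = (D + E) + frag_of P" using PE(1) by (simp add: algebra_simps)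
  have "P \<in> points f" using PE(4) Suc.prems(1,3) keys_diff[of D' D] by blast
  note st = rr_step[OF this, of "D + E", folded D', OF Suc.prems(4)]
  have keys: "Poly_Mapping.keys (D + E) \<subseteq> points f"
  proof -
    have "D + E = D' - frag_of P" using D' by simp
    then show ?thesis using keys_diff[of D' "frag_of P"] Suc.prems(1) \<open>P \<in> points f\<close> by auto
  qed
  have IH: "fin_dim (rr_space f D) \<and> div_degree D - int (rs.dim (rr_space f D)) \<le> div_degree (D + E) - int (rs.dim (rr_space f (D + E)))"
    using Suc.hyps(1)[of "D + E"] PE(2,3) keys Suc.prems(3) st(1) by (simp add: lookup_add)
  have "div_degree D' = div_degree (D + E) + 1" using D' by (simp add: div_degree_add)
  then show ?case using IH st(2) by auto
qed

text \<open>Pullback of a point of the projective line as a divisor. All these pullbacks are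
  linearly equivalent, which makes the fibre at infinity a standard divisor of degree 2.\<close>

definition pstar :: "qbar option \<Rightarrow> (point \<Rightarrow>\<^sub>0 int)" where
  "pstar a = Abs_poly_mapping (\<lambda>Q. if Q \<in> points f \<and> xc Q = a then ram Q else 0)"

lemma ram_pos: "ram P > 0" by (simp add: ram_def)

lemma lookup_pstar: "Poly_Mapping.lookup (pstar a) Q = (if Q \<in> points f \<and> xc Q = a then ram Q else 0)"
proof -
  have "finite {Q. (if Q \<in> points f \<and> xc Q = a then ram Q else 0) \<noteq> 0}"
    by (rule finite_subset[OF _ finite_fibre[of a]]) auto
  then show ?thesis unfolding pstar_def by (simp add: Abs_poly_mapping_inverse)
qed

lemma keys_pstar: "Poly_Mapping.keys (pstar a) \<subseteq> points f"
  by (auto simp: in_keys_iff lookup_pstar split: if_splits)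

lemma same_fibre: "P \<in> points f \<Longrightarrow> Q \<in> points f \<Longrightarrow> xc Q = xc P \<longleftrightarrow> Q = P \<or> Q = pconj P"
proof -
  assume P: "P \<in> points f" and Q: "Q \<in> points f"
  obtain R where R: "{Q \<in> points f. xc Q = xc P} = {R, pconj R}" using fibre[of "xc P"] by blast
  have "P \<in> {R, pconj R}" using P unfolding R[symmetric] by simp
  then have "{R, pconj R} = {P, pconj P}" by auto
  moreover have "xc Q = xc P \<longleftrightarrow> Q \<in> {R, pconj R}" using Q unfolding R[symmetric] by simp
  ultimately show ?thesis by simp
qed

lemma pstar_eq: "P \<in> points f \<Longrightarrow> pstar (xc P) = frag_of P + frag_of (pconj P)"
proof (rule poly_mapping_eqI)
  fix Q assume P: "P \<in> points f"
  show "Poly_Mapping.lookup (pstar (xc P)) Q = Poly_Mapping.lookup (frag_of P + frag_of (pconj P)) Q"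
    using same_fibre[OF P, of Q] P pconj_eq_iff[of P] pconj_in_points[of P] loc_pconj(3)[of P]
    by (auto simp: lookup_pstar lookup_add lookup_frag_of ram_def)
qed

lemma div_degree_pstar: "div_degree (pstar a) = 2"
proof -
  obtain P where "P \<in> points f" "xc P = a" by (metis fibre)
  then show ?thesis using pstar_eq[of P] by (simp add: div_degree_add)
qed

abbreviation dinf :: "nat \<Rightarrow> (point \<Rightarrow>\<^sub>0 int)" where
  "dinf n \<equiv> frag_cmul (int n) (pstar None)"

lemma keys_dinf: "Poly_Mapping.keys (dinf n) \<subseteq> points f"
  using keys_pstar[of None] by (auto simp: in_keys_iff)

lemma div_degree_dinf: "div_degree (dinf n) = 2 * int n"
proof -
  have "div_degree (dinf n) = (\<Sum>P\<in>Poly_Mapping.keys (pstar None). Poly_Mapping.lookup (dinf n) P)"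
    by (rule div_degree_eq_sum) (auto simp: in_keys_iff)
  also have "\<dots> = int n * div_degree (pstar None)" by (simp add: div_degree_def sum_distrib_left)
  finally show ?thesis by (simp add: div_degree_pstar)
qed

lemma nu_inf_times: "q \<noteq> 0 \<Longrightarrow> nu (1 / fx) (to_fract q / (1 / fx ^ d)) = - int (Polynomial.degree q + d)"
  for q :: "qbar poly"
proof -
  assume q: "q \<noteq> 0"
  have "to_fract q / (1 / fx ^ d) = to_fract (q * [:0, 1:] ^ d)" by (simp add: to_fract_power)
  moreover have "Polynomial.degree (q * [:0, 1:] ^ d) = Polynomial.degree q + d"
    using q by (simp add: degree_mult_eq degree_power_eq)
  moreover have "q * [:0, 1:] ^ d \<noteq> 0" using q by simp
  ultimately show ?thesis by (metis nu_inf)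
qed

lemma nu_nonneg_imp_poly:
  assumes "A \<noteq> 0" "\<And>a. nu (to_fract [:- a, 1:]) A \<ge> 0"
  obtains p where "A = to_fract p" "p \<noteq> (0 :: qbar poly)"
proof (cases A)
  fix p q assume A: "A = Fraction_Field.Fract p q" "q \<noteq> 0"
  then have p: "p \<noteq> 0" using assms by (auto simp: eq_fract Zero_fract_def)
  have "Polynomial.order a q \<le> Polynomial.order a p" for a
    using assms(2)[of a] nu_Fract(1)[OF p A(2), of a] A(1) by simp
  then have "q dvd p" using order_le_imp_dvd p A(2) by blast
  then obtain r where "p = q * r" by blast
  then have "A = to_fract r" "r \<noteq> 0" using A p by (auto simp: to_fract_def eq_fract)
  then show ?thesis using that by blast
qed

text \<open>The divisor is invariant under conjugation, so with A + B y both A and B y lie in the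
  space. Neither A nor B has a finite pole, hence they are polynomials; the orders at infinity bound
  their degrees, with y counting as x^d.\<close>

theorem rr_dinf: "rr_space f (dinf n) = poly_pairs (n + 1) (n + 1 - d)"
proof (intro equalityI subsetI)
  fix h assume h: "h \<in> poly_pairs (n + 1) (n + 1 - d)"
  then obtain p q where pq: "h = (to_fract p, to_fract q)" "\<forall>i\<ge>n + 1. coeff p i = 0" "\<forall>i\<ge>n + 1 - d. coeff q i = 0"
    by (auto simp: poly_pairs_def)
  have "(to_fract p, 0) \<in> rr_space f (dinf n)"
  proof (cases "p = 0")
    case False
    have "\<not> Polynomial.degree p \<ge> n + 1" using pq(2) False leading_coeff_0_iff by blast
    then have deg: "Polynomial.degree p \<le> n" by simp
    have "ord_at f P (to_fract p, 0) \<ge> - Poly_Mapping.lookup (dinf n) P" if P: "P \<in> points f" for P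
    proof -
      have "ram P * int (Polynomial.degree p) \<le> ram P * int n" using deg ram_pos[of P] by (intro mult_left_mono) auto
      then show ?thesis
        using P False ram_pos[of P] by (cases P) (auto simp: ord_x lookup_pstar nu_affine nu_inf mult.commute)
    qed
    then show ?thesis by (simp add: rr_space_def)
  qed (simp add: rr_space_def zero_prod_def)
  moreover have "(0, to_fract q) \<in> rr_space f (dinf n)"
  proof (cases "q = 0")
    case False
    have "\<not> Polynomial.degree q \<ge> n + 1 - d" using pq(3) False leading_coeff_0_iff by blast
    then have deg: "Polynomial.degree q + d \<le> n" by simp
    have "ord_at f P (0, to_fract q) \<ge> - Poly_Mapping.lookup (dinf n) P" if P: "P \<in> points f" for P
    proof (cases P)
      case (Aff x y)
      then show ?thesis using P False ram_pos[of P] by (simp add: ord_y_part lookup_pstar nu_affine)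
    next
      case (Infty s)
      have "ram P * int (Polynomial.degree q + d) \<le> ram P * int n" using deg ram_pos[of P] by (intro mult_left_mono) auto
      moreover have "ord_at f P (0, to_fract q) \<ge> - (ram P * int (Polynomial.degree q + d))"
        using ord_y_part[OF P, of "to_fract q"] False nu_inf_times[OF False] by (simp add: Infty del: of_nat_add)
      moreover have "Poly_Mapping.lookup (dinf n) P = ram P * int n" using P Infty by (simp add: lookup_pstar)
      ultimately show ?thesis by linarith
    qed
    then show ?thesis by (simp add: rr_space_def)
  qed (simp add: rr_space_def zero_prod_def)
  ultimately have "(to_fract p, 0) + (0, to_fract q) \<in> rr_space f (dinf n)" by (rule rs.subspace_add[OF subspace_rr])
  then show "h \<in> rr_space f (dinf n)" by (simp add: pq)
next
  fix h assume h: "h \<in> rr_space f (dinf n)"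
  have "rconj h \<in> rr_space f (dinf n)"
  proof (cases "h = 0")
    case False
    have "ord_at f P (rconj h) \<ge> - Poly_Mapping.lookup (dinf n) P" if P: "P \<in> points f" for P
    proof -
      have "ord_at f (pconj P) h \<ge> - Poly_Mapping.lookup (dinf n) (pconj P)"
        using h False P by (auto simp: rr_space_def)
      moreover have "Poly_Mapping.lookup (dinf n) (pconj P) = Poly_Mapping.lookup (dinf n) P"
        using P by (simp add: lookup_pstar ram_def)
      ultimately show ?thesis using ord_pconj[OF P False] by linarith
    qed
    then show ?thesis by (simp add: rr_space_def)
  qed (simp add: rconj_def rr_space_def zero_prod_def)
  then have sm: "h + rconj h \<in> rr_space f (dinf n)" "h - rconj h \<in> rr_space f (dinf n)"
    using h subspace_rr by (meson rs.subspace_add rs.subspace_diff)+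
  have half: "cf (1/2) * 2 = (1 :: qbar poly fract)"
    using cf_mult[of "1/2" "2 :: qbar"] by (simp add: cf_numeral)
  have A: "(fst h, 0) \<in> rr_space f (dinf n)"
  proof -
    have "(fst h, 0) = scale_fun (1/2) (h + rconj h)" by (simp add: scale_fun_cf rconj_def distrib_left half)
    then show ?thesis using sm rs.subspace_scale[OF subspace_rr] by metis
  qed
  have B: "(0, snd h) \<in> rr_space f (dinf n)"
  proof -
    have "(0, snd h) = scale_fun (1/2) (h - rconj h)" by (simp add: scale_fun_cf rconj_def distrib_left half)
    then show ?thesis using sm rs.subspace_scale[OF subspace_rr] by metis
  qed
  obtain Pi where Pi: "Pi \<in> points f" "xc Pi = None" by (metis fibre)
  then obtain s where s: "Pi = Infty s" by (cases Pi) auto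
  obtain p where p: "fst h = to_fract p" "\<forall>i\<ge>n + 1. coeff p i = 0"
  proof (cases "fst h = 0")
    case False
    have ordA: "ord_at f P (fst h, 0) \<ge> - Poly_Mapping.lookup (dinf n) P" if "P \<in> points f" for P
      using A False that by (auto simp: rr_space_def zero_prod_def)
    have nn: "nu (to_fract [:- a, 1:]) (fst h) \<ge> 0" for a
    proof -
      obtain P where P: "P \<in> points f" "xc P = Some a" by (metis fibre)
      then have "ram P * nu (to_fract [:- a, 1:]) (fst h) \<ge> 0"
        using ordA[OF P(1)] ord_x[OF P(1) False] by (simp add: lookup_pstar loc_par_lpx)
      then show ?thesis using ram_pos[of P] by (simp add: zero_le_mult_iff)
    qed
    obtain p where p: "fst h = to_fract p" "p \<noteq> 0" by (rule nu_nonneg_imp_poly[OF False nn])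
    have "- (ram Pi * int (Polynomial.degree p)) \<ge> - (int n * ram Pi)"
      using ordA[OF Pi(1)] ord_x[OF Pi(1) False] Pi by (simp add: lookup_pstar p nu_inf loc_par_lpx)
    then have "Polynomial.degree p \<le> n" using ram_pos[of Pi] by (simp add: mult.commute)
    then show ?thesis using that[of p] p by (auto simp: coeff_eq_0)
  qed (use that[of 0] in auto)
  obtain q where q: "snd h = to_fract q" "\<forall>i\<ge>n + 1 - d. coeff q i = 0"
  proof (cases "snd h = 0")
    case False
    have ordB: "ord_at f P (0, snd h) \<ge> - Poly_Mapping.lookup (dinf n) P" if "P \<in> points f" for P
      using B False that by (auto simp: rr_space_def zero_prod_def)
    have nn: "nu (to_fract [:- a, 1:]) (snd h) \<ge> 0" for a
    proof -
      obtain P where P: "P \<in> points f" "xc P = Some a" by (metis fibre)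
      then have "loc_b d P = 1" "loc_par P = to_fract [:- a, 1:]" by (cases P; simp)+
      then have "ram P * nu (to_fract [:- a, 1:]) (snd h) + (if loc_val P = 0 then 1 else 0) \<ge> 0"
        using ordB[OF P(1)] ord_y_part[OF P(1) False] P by (simp add: lookup_pstar)
      \<comment> \<open>At a branch point the order is 2 nu + 1, and its nonnegativity still forces
        nu \<ge> 0.\<close>
      then show ?thesis by (cases "loc_val P = 0") (auto simp: ram_def)
    qed
    obtain q where q: "snd h = to_fract q" "q \<noteq> 0" by (rule nu_nonneg_imp_poly[OF False nn])
    have "- (ram Pi * int (Polynomial.degree q + d)) + (if loc_val Pi = 0 then 1 else 0) \<ge> - (int n * ram Pi)"
      using ordB[OF Pi(1)] ord_y_part[OF Pi(1) False] Pi nu_inf_times[OF q(2)]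
      by (simp add: lookup_pstar q s del: of_nat_add)
    \<comment> \<open>The extra 1 at a ramified point at infinity is less than the ramification
      index 2, so integrality absorbs it.\<close>
    then have "Polynomial.degree q + d \<le> n" by (cases "loc_val Pi = 0") (auto simp: ram_def)
    then show ?thesis using that[of q] q by (auto simp: coeff_eq_0)
  qed (use that[of 0] in auto)
  show "h \<in> poly_pairs (n + 1) (n + 1 - d)" using p q poly_pairsI[of "n+1" p "n+1-d" q] by (metis prod.collapse)
qed

lemma fdiv_linear: "fdiv (to_fract [:- a, 1:], 0) = pstar (Some a) - pstar None"
proof (rule poly_mapping_eqI)
  fix P
  have nz: "(to_fract [:- a, 1:], 0) \<noteq> (0::ratfun)" by (simp add: zero_prod_def)
  show "Poly_Mapping.lookup (fdiv (to_fract [:- a, 1:], 0)) P = Poly_Mapping.lookup (pstar (Some a) - pstar None) P"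
  proof (cases "P \<in> points f")
    case True
    then show ?thesis using nz by (cases P) (auto simp: lookup_fdiv lookup_minus lookup_pstar ord_x nu_affine nu_inf order_linear_poly)
  qed (simp add: lookup_fdiv lookup_minus lookup_pstar)
qed

lemma pstar_equiv: "pstar a - pstar b \<in> principal f"
proof -
  have *: "pstar a - pstar None \<in> principal f" for a
  proof (cases a)
    case (Some x)
    then show ?thesis unfolding principal_iff using fdiv_linear[of x]
      by (intro exI[of _ "(to_fract [:- x, 1:], 0)"]) (simp add: zero_prod_def)
  qed (simp add: principal_zero)
  show ?thesis using principal_diff[OF *[of a] *[of b]] by simp
qed

lemma rr_principal_shift:
  assumes k: "k \<noteq> 0" and h: "h \<in> rr_space f D" and A: "fdiv k = D - E"
  shows "k \<diamondop> h \<in> rr_space f E"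
proof (cases "h = 0")
  case False
  have "ord_at f P (k \<diamondop> h) \<ge> - Poly_Mapping.lookup E P" if P: "P \<in> points f" for P
  proof -
    have "ord_at f P k = Poly_Mapping.lookup D P - Poly_Mapping.lookup E P"
      using arg_cong[OF A, of "\<lambda>D. Poly_Mapping.lookup D P"] P k by (simp add: lookup_fdiv lookup_minus)
    moreover have "ord_at f P h \<ge> - Poly_Mapping.lookup D P" using h False P by (auto simp: rr_space_def)
    ultimately show ?thesis using ord_mult[OF P k False] by simp
  qed
  then show ?thesis by (simp add: rr_space_def)
qed (simp add: rr_space_def)

lemma fin_dim_image:
  assumes k: "k \<noteq> 0" and W: "fin_dim W"
  shows "fin_dim ((\<lambda>h. k \<diamondop> h) ` W)" "rs.dim ((\<lambda>h. k \<diamondop> h) ` W) = rs.dim W"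
proof -
  obtain B where B: "finite B" "\<not> rs.dependent B" "rs.span B = W" using W by (auto simp: fin_dim_def)
  let ?T = "\<lambda>h. k \<diamondop> h"
  have inj: "inj ?T"
  proof (rule injI)
    fix x y assume "k \<diamondop> x = k \<diamondop> y"
    then have "k \<diamondop> (x - y) = 0" by (simp add: rmul_diff)
    then show "x = y" using k by simp
  qed
  interpret T: Vector_Spaces.linear scale_fun scale_fun ?T
    by unfold_locales (simp_all add: rmul_add scale_fun_cf rmul_def algebra_simps)
  have ind: "\<not> rs.dependent (?T ` B)"
    using T.independent_injective_image[OF B(2)] inj by (metis inj_on_subset subset_UNIV)
  have sp: "rs.span (?T ` B) = ?T ` W" using T.span_image[of B] B(3) by simp
  show "fin_dim (?T ` W)" using B ind sp by (auto simp: fin_dim_def intro!: exI[of _ "?T ` B"])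
  show "rs.dim (?T ` W) = rs.dim W"
    using dim_eq_card_basis[OF ind sp] dim_eq_card_basis[OF B(2,3)] card_image[of ?T B] inj
    by (metis inj_on_subset subset_UNIV)
qed

lemma rr_dim_equiv:
  assumes "D - E \<in> principal f" "fin_dim (rr_space f D)"
  shows "fin_dim (rr_space f E)" "rs.dim (rr_space f E) = rs.dim (rr_space f D)"
proof -
  obtain k where k: "k \<noteq> 0" "fdiv k = D - E" using assms(1) by (auto simp: principal_iff)
  have "rr_space f E \<subseteq> (\<lambda>h. k \<diamondop> h) ` rr_space f D"
  proof
    fix h assume "h \<in> rr_space f E"
    then have "rinv F k \<diamondop> h \<in> rr_space f D"
      by (rule rr_principal_shift[OF rinv_nz[OF k(1)]]) (simp add: fdiv_rinv k)
    moreover have "h = k \<diamondop> (rinv F k \<diamondop> h)" using k by (simp add: rmul_assoc rinv_right)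
    ultimately show "h \<in> (\<lambda>h. k \<diamondop> h) ` rr_space f D" by blast
  qed
  moreover have "(\<lambda>h. k \<diamondop> h) ` rr_space f D \<subseteq> rr_space f E"
    using rr_principal_shift[OF k(1) _ k(2)] by blast
  ultimately have "rr_space f E = (\<lambda>h. k \<diamondop> h) ` rr_space f D" by blast
  then show "fin_dim (rr_space f E)" "rs.dim (rr_space f E) = rs.dim (rr_space f D)"
    using fin_dim_image[OF k(1) assms(2)] by simp_all
qed

text \<open>A point lies below its own fibre, which is equivalent to the fibre at infinity. Absolute
  values are bounded because the induction on divisors forms differences.\<close>

lemma bounded_by_dinf:
  assumes "Poly_Mapping.keys D \<subseteq> points f"
  shows "\<exists>n E. E \<in> principal f \<and> (\<forall>P. \<bar>Poly_Mapping.lookup D P\<bar> \<le> Poly_Mapping.lookup (dinf n + E) P)"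
  using assms
proof (induction D rule: frag_induction)
  case zero
  have "\<forall>P. \<bar>Poly_Mapping.lookup 0 P\<bar> \<le> Poly_Mapping.lookup (dinf 0 + 0 :: point \<Rightarrow>\<^sub>0 int) P" by simp
  then show ?case using principal_zero by blast
next
  case (one P)
  let ?E = "pstar (xc P) - pstar None"
  have "dinf 1 + ?E = pstar (xc P)" by simp
  moreover have "\<bar>Poly_Mapping.lookup (frag_of P) Q\<bar> \<le> Poly_Mapping.lookup (pstar (xc P)) Q" for Q
    using one by (auto simp: lookup_pstar ram_def)
  ultimately show ?case using pstar_equiv by metis
next
  case (diff D1 D2)
  then obtain n1 E1 n2 E2 where
    1: "E1 \<in> principal f" "\<forall>P. \<bar>Poly_Mapping.lookup D1 P\<bar> \<le> Poly_Mapping.lookup (dinf n1 + E1) P" and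
    2: "E2 \<in> principal f" "\<forall>P. \<bar>Poly_Mapping.lookup D2 P\<bar> \<le> Poly_Mapping.lookup (dinf n2 + E2) P" by blast
  have "\<bar>Poly_Mapping.lookup (D1 - D2) P\<bar> \<le> Poly_Mapping.lookup (dinf (n1 + n2) + (E1 + E2)) P" for P
    using 1(2)[rule_format, of P] 2(2)[rule_format, of P]
    by (simp add: lookup_minus lookup_add frag_cmul_distrib)
  then show ?case using principal_add[OF 1(1) 2(1)] by blast
qed

text \<open>The defect deg D + 1 - dim L(D) grows with D, and every D lies below a divisor
  equivalent to a multiple of the fibre at infinity, whose space is known explicitly.\<close>

theorem riemann_inequality:
  assumes D: "Poly_Mapping.keys D \<subseteq> points f"
  shows "fin_dim (rr_space f D)" "div_degree D + 1 - int (rs.dim (rr_space f D)) \<le> int d - 1"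
proof -
  obtain n E where E: "E \<in> principal f" "\<forall>P. \<bar>Poly_Mapping.lookup D P\<bar> \<le> Poly_Mapping.lookup (dinf n + E) P"
    using bounded_by_dinf[OF D] by blast
  \<comment> \<open>The additional \<open>d\<close> keeps the truncated subtraction in
    \<open>rr_dinf\<close> exact: the dimension is (n + d + 1) + (n + 1), which gives the defect d -
    1.\<close>
  let ?D' = "dinf (n + d) + E"
  have le: "Poly_Mapping.lookup D P \<le> Poly_Mapping.lookup ?D' P" for P
  proof -
    have "int d * ram P \<ge> 0" using ram_pos[of P] by simp
    then show ?thesis using E(2)[rule_format, of P]
      by (cases "P \<in> points f \<and> xc P = None") (auto simp: lookup_add lookup_pstar algebra_simps)
  qed
  have keys: "Poly_Mapping.keys ?D' \<subseteq> points f"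
    using keys_dinf[of "n + d"] principal_keys[OF E(1)] Poly_Mapping.keys_add[of "dinf (n + d)" E] by blast
  have dim: "fin_dim (rr_space f (dinf (n + d)))" "rs.dim (rr_space f (dinf (n + d))) = (n + d + 1) + (n + 1)"
    using fin_dim_poly_pairs[of "n + d + 1" "n + 1"] rr_dinf[of "n + d"] by simp_all
  have "dinf (n + d) - ?D' \<in> principal f" using principal_uminus[OF E(1)] by simp
  note eq = rr_dim_equiv[OF this dim(1)]
  have "div_degree ?D' = 2 * int (n + d)" using principal_degree[OF E(1)] div_degree_dinf[of "n + d"]
    by (simp add: div_degree_add)
  then show "fin_dim (rr_space f D)" "div_degree D + 1 - int (rs.dim (rr_space f D)) \<le> int d - 1"
    using rr_mono[OF keys le D eq(1)] eq(2) dim(2) by auto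
qed

text \<open>The supremum is attained at \<open>dinf d\<close>, of degree 2d with a space of
  dimension d + 2.\<close>

theorem genus_eq: "genus f = int d - 1"
  unfolding genus_def
proof (rule cSup_eq_maximum)
  let ?g = "\<lambda>D. div_degree D + 1 - int (vector_space.dim scale_fun (rr_space f D))"
  have "rs.dim (rr_space f (dinf d)) = d + 2"
    using fin_dim_poly_pairs[of "d + 1" 1] rr_dinf[of d] by simp
  then have g: "int d - 1 = ?g (dinf d)" by (simp add: div_degree_dinf)
  have "dinf d \<in> carrier (divisors f)" using keys_dinf by simp
  then show "int d - 1 \<in> ?g ` carrier (divisors f)" by (rule image_eqI[where f = ?g, OF g])
  show "y \<le> int d - 1" if "y \<in> ?g ` carrier (divisors f)" for y
    using that riemann_inequality(2) by auto
qed

text \<open>In this degree Riemann's inequality leaves a nonzero function in L(D), and adding its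
  divisor to \<open>D\<close> makes \<open>D\<close> effective.\<close>

lemma effective_representative:
  assumes D: "Poly_Mapping.keys D \<subseteq> points f" and deg: "div_degree D \<ge> int d - 1"
  obtains E where "Poly_Mapping.keys E \<subseteq> points f" "\<And>P. Poly_Mapping.lookup E P \<ge> 0"
    "E - D \<in> principal f" "div_degree E = div_degree D"
proof -
  have "rs.dim (rr_space f D) \<noteq> 0" using riemann_inequality(2)[OF D] deg by auto
  moreover have "rs.dim {0} = 0" using dim_eq_card_basis[of "{}" "{0}"] by (simp add: rs.independent_empty)
  ultimately have "rr_space f D \<noteq> {0}" by metis
  then obtain h where h: "h \<in> rr_space f D" "h \<noteq> 0" using rs.subspace_0[OF subspace_rr] by blast
  show ?thesis
  proof (rule that[of "D + fdiv h"])
    show "Poly_Mapping.keys (D + fdiv h) \<subseteq> points f"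
      using D keys_fdiv Poly_Mapping.keys_add[of D "fdiv h"] by blast
    show "Poly_Mapping.lookup (D + fdiv h) P \<ge> 0" for P
    proof (cases "P \<in> points f")
      case True
      then have "ord_at f P h \<ge> - Poly_Mapping.lookup D P" using h by (auto simp: rr_space_def)
      with True h show ?thesis by (simp add: lookup_add lookup_fdiv)
    next
      case False
      then have "Poly_Mapping.lookup D P = 0" using D by (auto simp: in_keys_iff)
      with False show ?thesis by (simp add: lookup_add lookup_fdiv)
    qed
    show "D + fdiv h - D \<in> principal f" unfolding principal_iff using h by (intro exI[of _ h]) simp
    show "div_degree (D + fdiv h) = div_degree D" by (simp add: div_degree_add div_degree_fdiv)
  qed
qed

text \<open>A function with divisor P - Q, multiplied by x - x(Q), has poles at most along one fibre
  at infinity, where L consists of functions of x because \<open>d \<ge> 2\<close>. So the function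
  is invariant under conjugation: a simple pole at Q would recur at the conjugate of Q, or have even
  order at a branch point.\<close>

theorem principal_point_diff:
  assumes P: "P \<in> points f" and Q: "Q \<in> points f" and pr: "frag_of P - frag_of Q \<in> principal f"
  shows "P = Q"
proof (rule ccontr)
  assume ne: "P \<noteq> Q"
  obtain h where h: "h \<noteq> 0" "frag_of P - frag_of Q = fdiv h" using pr by (auto simp: principal_iff)
  have ordh: "ord_at f R h = (if R = P then 1 else 0) - (if R = Q then 1 else 0)" if "R \<in> points f" for R
    using arg_cong[OF h(2), of "\<lambda>D. Poly_Mapping.lookup D R"] that h(1) by (simp add: lookup_fdiv lookup_minus)
  have "pstar (xc Q) - pstar None \<in> principal f" by (rule pstar_equiv)
  have "\<exists>k A. k \<noteq> 0 \<and> fdiv k = pstar (xc Q) - pstar None \<and> k = (A, 0)"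
  proof (cases "xc Q")
    case None
    then show ?thesis using fdiv_one by (intro exI[of _ "(1,0)"] exI[of _ 1]) (simp add: zero_prod_def)
  next
    case (Some a)
    then show ?thesis using fdiv_linear[of a]
      by (intro exI[of _ "(to_fract [:- a, 1:], 0)"] exI[of _ "to_fract [:- a, 1:]"]) (simp add: zero_prod_def)
  qed
  then obtain A where A: "(A, 0) \<noteq> (0::ratfun)" "fdiv (A, 0) = pstar (xc Q) - pstar None" by blast
  have "fdiv ((A, 0) \<diamondop> h) = frag_of P + frag_of (pconj Q) - pstar None"
    unfolding fdiv_mult[OF A(1) h(1)] A(2) h(2)[symmetric] pstar_eq[OF Q] by simp
  then have ordk: "ord_at f R ((A, 0) \<diamondop> h) = Poly_Mapping.lookup (frag_of P + frag_of (pconj Q) - pstar None) R"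
    if "R \<in> points f" for R
    using that A(1) h(1) lookup_fdiv[of "(A, 0) \<diamondop> h" R] by simp
  then have "(A, 0) \<diamondop> h \<in> rr_space f (dinf 1)"
    by (auto simp: rr_space_def lookup_add lookup_minus)
  then have "(A, 0) \<diamondop> h \<in> poly_pairs (1 + 1) (1 + 1 - d)" unfolding rr_dinf .
  then have "(A, 0) \<diamondop> h \<in> poly_pairs 2 0" using d by (simp add: numeral_2_eq_2)
  then have "snd ((A, 0) \<diamondop> h) = 0" by (auto simp: poly_pairs_def poly_eq_iff)
  then have sh: "snd h = 0" using A(1) by (simp add: rmul_x zero_prod_def)
  then have hh: "h = (fst h, 0)" "fst h \<noteq> 0" using h(1) by (auto simp: prod_eq_iff)
  have "ord_at f Q h = ram Q * nu (loc_par Q) (fst h)" using ord_x[OF Q hh(2)] hh(1) by simp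
  then have r: "ram Q * nu (loc_par Q) (fst h) = - 1" using ordh[OF Q] ne by simp
  have "loc_val Q \<noteq> 0"
  proof
    assume "loc_val Q = 0"
    then have "2 * nu (loc_par Q) (fst h) = - 1" using r by (simp add: ram_def)
    then show False by presburger
  qed
  then have "pconj Q \<noteq> Q" by (simp add: pconj_eq_iff)
  moreover have "ord_at f (pconj Q) h = ord_at f Q h"
  proof -
    have "rconj h = h" using sh by (simp add: rconj_def prod_eq_iff)
    then show ?thesis using ord_pconj[OF Q h(1)] by simp
  qed
  ultimately show False using ordh[OF Q] ordh[of "pconj Q"] Q ne by (simp split: if_splits)
qed

end

section \<open>The Jacobian\<close>

lemma keys_diff_subset: "Poly_Mapping.keys D \<subseteq> S \<Longrightarrow> Poly_Mapping.keys E \<subseteq> S \<Longrightarrow> Poly_Mapping.keys (D - E) \<subseteq> S"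
  for D E :: "'a \<Rightarrow>\<^sub>0 int"
  using keys_diff[of D E] by blast

lemma keys_add_subset: "Poly_Mapping.keys D \<subseteq> S \<Longrightarrow> Poly_Mapping.keys E \<subseteq> S \<Longrightarrow> Poly_Mapping.keys (D + E) \<subseteq> S"
  for D E :: "'a \<Rightarrow>\<^sub>0 int"
  using Poly_Mapping.keys_add[of D E] by blast

context curve
begin

lemma carrier_divisors0: "carrier (divisors0 f) = {D. Poly_Mapping.keys D \<subseteq> points f \<and> div_degree D = 0}"
  by (auto simp: divisors0_def)

lemma mult_divisors0 [simp]: "D \<otimes>\<^bsub>divisors0 f\<^esub> E = D + E"
  by (simp add: divisors0_def)

lemma one_divisors0 [simp]: "\<one>\<^bsub>divisors0 f\<^esub> = 0"
  by (simp add: divisors0_def)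

lemma comm_group_divisors0: "comm_group (divisors0 f)"
proof (rule comm_groupI)
  show "\<exists>y\<in>carrier (divisors0 f). y \<otimes>\<^bsub>divisors0 f\<^esub> x = \<one>\<^bsub>divisors0 f\<^esub>" if "x \<in> carrier (divisors0 f)" for x
    using that by (intro bexI[of _ "- x"]) (auto simp: carrier_divisors0 div_degree_uminus)
qed (auto simp: carrier_divisors0 div_degree_add algebra_simps dest: set_mp[OF Poly_Mapping.keys_add])

lemma principal_in_divisors0: "D \<in> principal f \<Longrightarrow> D \<in> carrier (divisors0 f)"
  using principal_keys principal_degree by (simp add: carrier_divisors0)

lemma inv_divisors0: "D \<in> carrier (divisors0 f) \<Longrightarrow> inv\<^bsub>divisors0 f\<^esub> D = - D"
proof -
  assume D: "D \<in> carrier (divisors0 f)"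
  interpret comm_group "divisors0 f" by (rule comm_group_divisors0)
  show ?thesis using D by (intro inv_equality) (auto simp: carrier_divisors0 div_degree_uminus)
qed

lemma subgroup_principal: "subgroup (principal f) (divisors0 f)"
proof -
  interpret comm_group "divisors0 f" by (rule comm_group_divisors0)
  show ?thesis
    by (intro subgroupI) (use principal_in_divisors0 principal_zero principal_add principal_uminus in \<open>auto simp: inv_divisors0\<close>)
qed

lemma normal_principal: "principal f \<lhd> divisors0 f"
  using comm_group.subgroup_imp_normal[OF comm_group_divisors0 subgroup_principal] .

lemma comm_group_jacobian: "comm_group (jacobian f)"
  unfolding jacobian_def
  by (rule comm_group.abelian_FactGroup[OF comm_group_divisors0 subgroup_principal])

lemma carrier_jacobian: "carrier (jacobian f) = div_class f ` carrier (divisors0 f)"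
  by (simp add: jacobian_def carrier_FactGroup div_class_def)

lemma one_jacobian: "\<one>\<^bsub>jacobian f\<^esub> = div_class f 0"
  by (auto simp: jacobian_def div_class_def r_coset_def)

lemma div_class_eq: "div_class f D = {E. E - D \<in> principal f}"
  unfolding div_class_def r_coset_def
proof (intro equalityI subsetI)
  fix E assume "E \<in> {E. E - D \<in> principal f}"
  then show "E \<in> (\<Union>h\<in>principal f. {h \<otimes>\<^bsub>divisors0 f\<^esub> D})" by (intro UN_I[of "E - D"]) auto
qed auto

lemma div_class_eq_iff: "div_class f D = div_class f E \<longleftrightarrow> D - E \<in> principal f"
proof
  assume "div_class f D = div_class f E"
  moreover have "D \<in> div_class f D" by (simp add: div_class_eq principal_zero)
  ultimately show "D - E \<in> principal f" by (simp add: div_class_eq)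
next
  assume *: "D - E \<in> principal f"
  have "X1 - E \<in> principal f" if "X1 - D \<in> principal f" for X1 using principal_add[OF that *] by simp
  moreover have "X1 - D \<in> principal f" if "X1 - E \<in> principal f" for X1 using principal_diff[OF that *] by simp
  ultimately show "div_class f D = div_class f E" by (auto simp: div_class_eq)
qed

lemma div_class_mult:
  assumes "D \<in> carrier (divisors0 f)" "E \<in> carrier (divisors0 f)"
  shows "div_class f D \<otimes>\<^bsub>jacobian f\<^esub> div_class f E = div_class f (D + E)"
  using normal.rcos_sum[OF normal_principal assms] by (simp add: jacobian_def div_class_def)

lemma div_class_cases:
  assumes "c \<in> carrier (jacobian f)"
  obtains D where "D \<in> carrier (divisors0 f)" "c = div_class f D"
  using assms by (auto simp: carrier_jacobian)

lemma point_diff_divisors0: "P \<in> points f \<Longrightarrow> Q \<in> points f \<Longrightarrow> frag_of P - frag_of Q \<in> carrier (divisors0 f)"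
  using keys_diff_subset[of "frag_of P" "points f" "frag_of Q"] by (auto simp: carrier_divisors0 div_degree_diff)

lemma pconj_sum_principal: "P \<in> points f \<Longrightarrow> frag_of P + frag_of (pconj P) - pstar a \<in> principal f"
  using pstar_equiv[of "xc P" a] by (simp add: pstar_eq)

text \<open>Adding the fibre at infinity gives degree 2, enough for an effective representative P +
  R. The conjugate of R then takes the place of -R, since a point and its conjugate form a
  fibre.\<close>

lemma genus2_class:
  assumes d3: "d = 3" and c: "c \<in> carrier (jacobian f)"
  obtains P Q where "P \<in> points f" "Q \<in> points f" "c = div_class f (frag_of P - frag_of Q)"
proof -
  obtain D where D: "D \<in> carrier (divisors0 f)" "c = div_class f D" using div_class_cases[OF c] .
  have keys: "Poly_Mapping.keys (D + pstar None) \<subseteq> points f"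
    using D keys_pstar by (intro keys_add_subset) (auto simp: carrier_divisors0)
  have deg: "div_degree (D + pstar None) = int (Suc 1)"
    using D by (simp add: carrier_divisors0 div_degree_add div_degree_pstar)
  obtain E where E: "Poly_Mapping.keys E \<subseteq> points f" "\<And>P. Poly_Mapping.lookup E P \<ge> 0"
    "E - (D + pstar None) \<in> principal f" "div_degree E = int (Suc 1)"
    using effective_representative[OF keys] deg d3 by auto
  obtain P E1 where 1: "E = frag_of P + E1" "\<forall>P. Poly_Mapping.lookup E1 P \<ge> 0" "div_degree E1 = int 1" "P \<in> Poly_Mapping.keys E"
    by (rule div_degree_1_eff[OF E(2,4)])
  have deg1: "div_degree E1 = int (Suc 0)" using 1(3) by simp
  obtain R E2 where 2: "E1 = frag_of R + E2" "\<forall>P. Poly_Mapping.lookup E2 P \<ge> 0" "div_degree E2 = int 0" "R \<in> Poly_Mapping.keys E1"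
    by (rule div_degree_1_eff[OF _ deg1]) (use 1(2) in auto)
  have "E2 = 0" using 2 by (intro div_degree_0_eff) auto
  then have EE: "E = frag_of P + frag_of R" using 1 2 by simp
  have P: "P \<in> points f" using 1(4) E(1) by blast
  have "Poly_Mapping.lookup E R > 0" unfolding EE by (simp add: lookup_add)
  then have R: "R \<in> points f" using E(1) by (auto simp: in_keys_iff)
  have "frag_of P - frag_of (pconj R) - D \<in> principal f"
    using principal_diff[OF E(3) pconj_sum_principal[OF R, of None]] by (simp add: EE algebra_simps)
  then have "div_class f (frag_of P - frag_of (pconj R)) = c" using D by (simp add: div_class_eq_iff)
  then show ?thesis using that[of P "pconj R"] P R by simp
qed

end

section \<open>The group law on an elliptic curve\<close>

lemma (in curve) squarefree_f: "squarefree f"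
    unfolding squarefree_def
proof (intro allI impI)
  fix q assume "q\<^sup>2 dvd f"
  then obtain r where r: "f = q\<^sup>2 * r" by blast
  have nz: "q \<noteq> 0" using r F_nz by (auto simp: base_change_def)
  show "q dvd 1"
  proof (rule ccontr)
    assume "\<not> q dvd 1"
    then have "Polynomial.degree q > 0" using nz is_unit_iff_degree by blast
    moreover have "Polynomial.degree (base_change q) = Polynomial.degree q"
      unfolding base_change_def by (rule degree_map_poly) simp
    ultimately obtain x where x: "poly (base_change q) x = 0"
      using alg_closed_imp_poly_has_root[of "base_change q"] by auto
    interpret h: hom_evaluation "to_ac :: rat \<Rightarrow> qbar" undefined by standard auto
    have m: "base_change (p * q) = base_change p * base_change q" for p q
    proof (intro poly_eqI)
      show "coeff (base_change (p * q)) n = coeff (base_change p * base_change q) n" for n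
        by (simp add: base_change_def coeff_map_poly coeff_mult to_ac_sum)
    qed
    have "F = base_change q * (base_change q * base_change r)"
      by (simp add: r power2_eq_square m mult.assoc)
    then show False using simple[of x] x by (simp add: pderiv_mult)
  qed
qed

locale elliptic = curve f 2 for f :: "rat poly" +
  assumes deg3: "Polynomial.degree f = 3"
begin

abbreviation G where "G \<equiv> ec_group f"
abbreviation Orig where "Orig \<equiv> Infty 0"

lemma O_point [simp]: "Orig \<in> points f"
  using deg3 degF by (auto simp: points_def half_deg coeff_eq_0)

lemma infinity_only: "Infty s \<in> points f \<longleftrightarrow> s = 0"
  using deg3 degF by (auto simp: points_def half_deg coeff_eq_0)

lemma pstar_None: "pstar None = frag_of Orig + frag_of Orig"
  using pstar_eq[OF O_point] by simp

lemma elliptic_curve: "elliptic_curve f"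
  by (simp add: elliptic_curve_def deg3 squarefree_f)

text \<open>P + Q - O has degree 1, and in genus 1 such a class contains an effective divisor, that
  is, a single point.\<close>

lemma sum_exists:
  assumes "P \<in> points f" "Q \<in> points f"
  shows "\<exists>R\<in>points f. frag_of P + frag_of Q - frag_of R - frag_of Orig \<in> principal f"
proof -
  let ?D = "frag_of P + frag_of Q - frag_of Orig"
  have k: "Poly_Mapping.keys ?D \<subseteq> points f" using assms by (intro keys_diff_subset keys_add_subset) auto
  have deg: "div_degree ?D = int (Suc 0)" by (simp add: div_degree_add div_degree_diff)
  obtain E where E: "Poly_Mapping.keys E \<subseteq> points f" "\<And>P. Poly_Mapping.lookup E P \<ge> 0"
    "E - ?D \<in> principal f" "div_degree E = int (Suc 0)"
    using effective_representative[OF k] deg by auto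
  obtain R E1 where 1: "E = frag_of R + E1" "\<forall>P. Poly_Mapping.lookup E1 P \<ge> 0" "div_degree E1 = int 0" "R \<in> Poly_Mapping.keys E"
    by (rule div_degree_1_eff[OF E(2,4)])
  have "E1 = 0" using 1 by (intro div_degree_0_eff) auto
  then have "- (E - ?D) = frag_of P + frag_of Q - frag_of R - frag_of Orig" using 1 by simp
  then have "frag_of P + frag_of Q - frag_of R - frag_of Orig \<in> principal f" using principal_uminus[OF E(3)] by (simp only:)
  then show ?thesis using 1(4) E(1) by blast
qed

lemma sum_unique:
  assumes "R \<in> points f" "S \<in> points f" "frag_of R - D \<in> principal f" "frag_of S - D \<in> principal f"
  shows "R = S"
  using principal_point_diff[OF assms(1,2)] principal_diff[OF assms(3,4)] by simp

lemma carrier_G [simp]: "carrier G = points f" by (simp add: ec_group_def)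
lemma one_G [simp]: "\<one>\<^bsub>G\<^esub> = Orig" by (simp add: ec_group_def)

lemma mult_G:
  assumes "P \<in> points f" "Q \<in> points f"
  shows "P \<otimes>\<^bsub>G\<^esub> Q \<in> points f" "frag_of P + frag_of Q - frag_of (P \<otimes>\<^bsub>G\<^esub> Q) - frag_of Orig \<in> principal f"
proof -
  let ?Q = "\<lambda>R. R \<in> points f \<and> frag_of P + frag_of Q - frag_of R - frag_of Orig \<in> principal f"
  obtain R where R: "?Q R" using sum_exists[OF assms] by blast
  have u: "S = R" if "?Q S" for S
  proof (rule sum_unique[where D = "frag_of P + frag_of Q - frag_of Orig"])
    show "frag_of S - (frag_of P + frag_of Q - frag_of Orig) \<in> principal f"
      using principal_uminus[of "frag_of P + frag_of Q - frag_of S - frag_of Orig"] that by (simp add: algebra_simps)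
    show "frag_of R - (frag_of P + frag_of Q - frag_of Orig) \<in> principal f"
      using principal_uminus[of "frag_of P + frag_of Q - frag_of R - frag_of Orig"] R by (simp add: algebra_simps)
  qed (use R that in auto)
  have "?Q (THE R. ?Q R)" using R u by (rule theI)
  then show "P \<otimes>\<^bsub>G\<^esub> Q \<in> points f" "frag_of P + frag_of Q - frag_of (P \<otimes>\<^bsub>G\<^esub> Q) - frag_of Orig \<in> principal f"
    by (auto simp: ec_group_def)
qed

text \<open>The Abel-Jacobi relation between divisors and points. It is additive in the divisor and
  determines the point, so identities in the group become identities between divisors.\<close>

definition sums_to :: "(point \<Rightarrow>\<^sub>0 int) \<Rightarrow> point \<Rightarrow> bool" where
  "sums_to D R \<longleftrightarrow> R \<in> points f \<and> frag_of R - frag_of Orig - D \<in> principal f"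

lemma sums_to_unique: "sums_to D R \<Longrightarrow> sums_to D S \<Longrightarrow> R = S"
  unfolding sums_to_def by (rule sum_unique[where D = "frag_of Orig + D"]) (auto simp: diff_diff_eq)

lemma sums_to_equiv: "sums_to D R \<Longrightarrow> D - E \<in> principal f \<Longrightarrow> sums_to E R"
  using principal_add[of "frag_of R - frag_of Orig - D" "D - E"] by (auto simp: sums_to_def algebra_simps)

lemma sums_to_0: "sums_to 0 Orig"
  by (simp add: sums_to_def principal_zero)

lemma sums_to_point: "P \<in> points f \<Longrightarrow> sums_to (frag_of P - frag_of Orig) P"
  by (simp add: sums_to_def principal_zero)

lemma sums_to_add: "sums_to D R \<Longrightarrow> sums_to E S \<Longrightarrow> sums_to (D + E) (R \<otimes>\<^bsub>G\<^esub> S)"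
proof -
  assume RS: "sums_to D R" "sums_to E S"
  then have pts: "R \<in> points f" "S \<in> points f" by (auto simp: sums_to_def)
  have "(frag_of R - frag_of Orig - D) + (frag_of S - frag_of Orig - E)
     - (frag_of R + frag_of S - frag_of (R \<otimes>\<^bsub>G\<^esub> S) - frag_of Orig) \<in> principal f"
    using RS by (intro principal_diff[OF principal_add mult_G(2)[OF pts]]) (auto simp: sums_to_def)
  then show ?thesis using mult_G[OF pts] by (simp add: sums_to_def algebra_simps)
qed

lemma sums_to_uminus: "sums_to D R \<Longrightarrow> sums_to (- D) (pconj R)"
proof -
  assume R: "sums_to D R"
  then have p: "R \<in> points f" by (auto simp: sums_to_def)
  have "(frag_of R + frag_of (pconj R) - pstar None) - (frag_of R - frag_of Orig - D) \<in> principal f"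
    using R by (intro principal_diff[OF pconj_sum_principal[OF p]]) (auto simp: sums_to_def)
  then show ?thesis using p by (simp add: sums_to_def pstar_None algebra_simps)
qed

sublocale G: comm_group G
proof (rule comm_groupI)
  fix P Q R assume *: "P \<in> carrier G" "Q \<in> carrier G" "R \<in> carrier G"
  note s = sums_to_point[of P] sums_to_point[of Q] sums_to_point[of R]
  show "P \<otimes>\<^bsub>G\<^esub> Q \<in> carrier G" using mult_G * by simp
  show "P \<otimes>\<^bsub>G\<^esub> Q = Q \<otimes>\<^bsub>G\<^esub> P"
    using s * sums_to_add[of _ P _ Q] sums_to_add[of _ Q _ P] by (metis add.commute carrier_G sums_to_unique)
  show "P \<otimes>\<^bsub>G\<^esub> Q \<otimes>\<^bsub>G\<^esub> R = P \<otimes>\<^bsub>G\<^esub> (Q \<otimes>\<^bsub>G\<^esub> R)"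
  proof (rule sums_to_unique)
    show "sums_to ((frag_of P - frag_of Orig) + (frag_of Q - frag_of Orig) + (frag_of R - frag_of Orig)) (P \<otimes>\<^bsub>G\<^esub> Q \<otimes>\<^bsub>G\<^esub> R)"
      using s * by (intro sums_to_add) auto
    show "sums_to ((frag_of P - frag_of Orig) + (frag_of Q - frag_of Orig) + (frag_of R - frag_of Orig)) (P \<otimes>\<^bsub>G\<^esub> (Q \<otimes>\<^bsub>G\<^esub> R))"
      unfolding add.assoc using s * by (intro sums_to_add) auto
  qed
next
  show "\<one>\<^bsub>G\<^esub> \<in> carrier G" by simp
next
  fix P assume P: "P \<in> carrier G"
  show "\<one>\<^bsub>G\<^esub> \<otimes>\<^bsub>G\<^esub> P = P"
    using sums_to_add[OF sums_to_0 sums_to_point[of P]] sums_to_point[of P] P sums_to_unique by auto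
  have "pconj P \<otimes>\<^bsub>G\<^esub> P = Orig"
    using sums_to_add[OF sums_to_uminus[OF sums_to_point[of P]] sums_to_point[of P]] sums_to_0 P sums_to_unique by auto
  then show "\<exists>y\<in>carrier G. y \<otimes>\<^bsub>G\<^esub> P = \<one>\<^bsub>G\<^esub>" using P by (intro bexI[of _ "pconj P"]) auto
qed

lemma sums_to_carrier: "sums_to D R \<Longrightarrow> R \<in> carrier G" by (simp add: sums_to_def)

lemma inv_G: "P \<in> points f \<Longrightarrow> inv\<^bsub>G\<^esub> P = pconj P"
proof (rule G.inv_equality)
  assume P: "P \<in> points f"
  show "pconj P \<otimes>\<^bsub>G\<^esub> P = \<one>\<^bsub>G\<^esub>"
    using sums_to_add[OF sums_to_uminus[OF sums_to_point[of P]] sums_to_point[of P]] sums_to_0 P sums_to_unique by auto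
qed auto

lemma sums_to_nat_pow: "sums_to D R \<Longrightarrow> sums_to (frag_cmul (int n) D) (R [^]\<^bsub>G\<^esub> n)"
proof (induction n)
  case (Suc n)
  then have "sums_to (frag_cmul (int n) D + D) (R [^]\<^bsub>G\<^esub> n \<otimes>\<^bsub>G\<^esub> R)" by (intro sums_to_add) auto
  then show ?case by (simp add: frag_cmul_distrib add.commute)
qed (use sums_to_0 in simp)

lemma sums_to_int_pow: "sums_to D R \<Longrightarrow> sums_to (frag_cmul (k :: int) D) (R [^]\<^bsub>G\<^esub> k)"
proof (cases k rule: int_cases2)
  case (nonneg n)
  assume "sums_to D R"
  from sums_to_nat_pow[OF this, of n] show ?thesis unfolding nonneg int_pow_int .
next
  case (nonpos n)
  assume R: "sums_to D R"
  have "sums_to (- frag_cmul (int n) D) (pconj (R [^]\<^bsub>G\<^esub> n))"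
    by (rule sums_to_uminus[OF sums_to_nat_pow[OF R]])
  moreover have "- frag_cmul (int n) D = frag_cmul k D" by (intro poly_mapping_eqI) (simp add: nonpos)
  moreover have "pconj (R [^]\<^bsub>G\<^esub> n) = R [^]\<^bsub>G\<^esub> k"
  proof -
    have "R [^]\<^bsub>G\<^esub> k = inv\<^bsub>G\<^esub> (R [^]\<^bsub>G\<^esub> n)"
      unfolding nonpos G.int_pow_neg[OF sums_to_carrier[OF R]] int_pow_int ..
    moreover have "R [^]\<^bsub>G\<^esub> n \<in> points f" using G.nat_pow_closed[OF sums_to_carrier[OF R], of n] by simp
    ultimately show ?thesis using inv_G by metis
  qed
  ultimately show ?thesis by simp
qed

lemma sums_to_finprod:
  assumes "finite A" "\<And>i. i \<in> A \<Longrightarrow> sums_to (D i) (R i)"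
  shows "sums_to (\<Sum>i\<in>A. D i) (finprod G R A)"
  using assms
proof (induction A rule: finite_induct)
  case (insert a A)
  then have "R \<in> A \<rightarrow> carrier G" "R a \<in> carrier G" by (auto simp: sums_to_def)
  then show ?case using insert by (simp del: carrier_G add: sums_to_add)
qed (use sums_to_0 in simp)

lemma sums_to_push_sum:
  assumes "\<And>P. P \<in> Poly_Mapping.keys D \<Longrightarrow> \<phi> P \<in> points f"
  shows "sums_to (frag_extend (\<lambda>P. frag_of (\<phi> P) - frag_of Orig) D) (push_sum f \<phi> D)"
  unfolding push_sum_def frag_extend_def
  using assms by (intro sums_to_finprod sums_to_int_pow sums_to_point) auto

end

lemma frag_extend_const_diff:
  "frag_extend (\<lambda>P. b P - c) D = frag_extend b D - frag_cmul (div_degree D) c"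
proof -
  have "frag_extend (\<lambda>P. b P - c) D = (\<Sum>P\<in>Poly_Mapping.keys D. frag_cmul (Poly_Mapping.lookup D P) (b P) - frag_cmul (Poly_Mapping.lookup D P) c)"
    unfolding frag_extend_def by (intro sum.cong refl poly_mapping_eqI) (simp add: lookup_minus right_diff_distrib)
  also have "\<dots> = frag_extend b D - (\<Sum>P\<in>Poly_Mapping.keys D. frag_cmul (Poly_Mapping.lookup D P) c)"
    by (simp add: sum_subtractf frag_extend_def)
  also have "(\<Sum>P\<in>Poly_Mapping.keys D. frag_cmul (Poly_Mapping.lookup D P) c) = frag_cmul (div_degree D) c"
    unfolding div_degree_def
    by (intro poly_mapping_eqI) (simp add: lookup_sum sum_distrib_right)
  finally show ?thesis .
qed

context elliptic
begin

lemma sums_to_push_sum0: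
  assumes "\<And>P. P \<in> Poly_Mapping.keys D \<Longrightarrow> \<phi> P \<in> points f" "div_degree D = 0"
  shows "sums_to (frag_extend (frag_of \<circ> \<phi>) D) (push_sum f \<phi> D)"
  using sums_to_push_sum[of D \<phi>] assms by (simp add: frag_extend_const_diff o_def)

lemma push_sum_add:
  assumes "\<And>P. P \<in> Poly_Mapping.keys D \<union> Poly_Mapping.keys E \<Longrightarrow> \<phi> P \<in> points f"
  shows "push_sum f \<phi> (D + E) = push_sum f \<phi> D \<otimes>\<^bsub>G\<^esub> push_sum f \<phi> E"
proof (rule sums_to_unique)
  show "sums_to (frag_extend (\<lambda>P. frag_of (\<phi> P) - frag_of Orig) (D + E)) (push_sum f \<phi> (D + E))"
    using assms Poly_Mapping.keys_add[of D E] by (intro sums_to_push_sum) blast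
  show "sums_to (frag_extend (\<lambda>P. frag_of (\<phi> P) - frag_of Orig) (D + E)) (push_sum f \<phi> D \<otimes>\<^bsub>G\<^esub> push_sum f \<phi> E)"
    unfolding frag_extend_add using assms by (intro sums_to_add sums_to_push_sum) auto
qed

end

section \<open>Maps between curves of the form \<open>(x, y) \<mapsto> (u(x), w(x) y)\<close>\<close>

lemma (in rat_evaluation) ev_poly_cf: "ev (poly (map_poly cf p) v) = poly (map_poly c p) (ev v)"
  by (induction p) (auto simp: map_poly_pCons ev_add ev_mult cf_def ev_to_fract E_pCons)

lemma (in rat_evaluation) ev_cf [simp]: "ev (cf a) = c a"
  by (simp add: cf_def ev_to_fract E_pCons)

lemma (in rat_evaluation) ev_fx [simp]: "ev fx = b"
  by (simp add: ev_to_fract E_pCons c_1)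

lemma rat_eval_compose:
  assumes "rat_evaluation c b" "rat_evaluation cf v"
  shows "rat_evaluation c (rat_eval c b v)" "rat_eval c b (rat_eval cf v A) = rat_eval c (rat_eval c b v) A"
proof -
  interpret b: rat_evaluation c b by fact
  interpret v: rat_evaluation cf v by fact
  show 1: "rat_evaluation c (b.ev v)"
  proof
    fix p :: "'a poly" assume "p \<noteq> 0"
    then have "b.ev (v.E p) \<noteq> 0" by simp
    then show "poly (map_poly c p) (b.ev v) \<noteq> 0" by (simp add: b.ev_poly_cf)
  qed
  interpret bv: rat_evaluation c "b.ev v" by fact
  show "b.ev (v.ev A) = bv.ev A"
  proof (cases A)
    fix p q assume "A = Fraction_Field.Fract p q" "q \<noteq> 0"
    then show ?thesis by (simp add: v.ev_Fract bv.ev_Fract b.ev_divide b.ev_poly_cf)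
  qed
qed

lemma (in valuation) vpos_mult_values:
  assumes "vpos V (h - (cf a, 0))" "vpos V (k - (cf b, 0))"
  shows "vpos V (h \<diamondop> k - (cf (a * b), 0))"
proof -
  have "vnn V ((k - (cf b, 0)) + (cf b, 0))" by (intro vnn_add vpos_imp_vnn assms vnn_cf)
  then have k: "vnn V k" by simp
  have "h \<diamondop> k - (cf (a * b), 0) = (h - (cf a, 0)) \<diamondop> k + (k - (cf b, 0)) \<diamondop> (cf a, 0)"
    by (simp add: rmul_def cf_mult algebra_simps prod_eq_iff)
  then show ?thesis using vpos_add vpos_mult[OF assms(1) k] vpos_mult[OF assms(2) vnn_cf] by metis
qed

lemma (in valuation) vpos_inverse_value:
  assumes "vpos V (h - (cf a, 0))" "a \<noteq> 0" "h' \<diamondop> h = (1, 0)"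
  shows "vpos V (h' - (cf (1 / a), 0))"
proof -
  have hu: "h \<noteq> 0" "V h = 0" using V_unit[OF assms(1,2)] by auto
  have "h' \<noteq> 0" using assms(3) by (metis fst_conv fst_zero rmul_zero(2) zero_neq_one)
  then have "V h' = 0" using V_mult[of h' h] hu assms(3) V_one by simp
  then have n: "vnn V h'" by (simp add: vnn_def)
  have "cf (1 / a) * cf a = 1" using assms(2) by (simp flip: cf_mult)
  then have "h' - (cf (1 / a), 0) = - ((h - (cf a, 0)) \<diamondop> (h' \<diamondop> (cf (1 / a), 0)))"
  proof -
    assume *: "cf (1 / a) * cf a = 1"
    have "(h - (cf a, 0)) \<diamondop> (h' \<diamondop> (cf (1 / a), 0)) = (h' \<diamondop> h) \<diamondop> (cf (1/a), 0) - h' \<diamondop> ((cf a, 0) \<diamondop> (cf (1/a), 0))"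
      by (simp add: rmul_def algebra_simps prod_eq_iff)
    also have "\<dots> = (cf (1/a), 0) - h'" using assms(3) * by (simp add: rmul_x mult.commute)
    finally show ?thesis by simp
  qed
  then show ?thesis using vpos_uminus vpos_mult[OF assms(1) vnn_mult[OF n vnn_cf]] by metis
qed

lemma (in valuation) vpos_smult: "vpos V h \<Longrightarrow> vpos V ((cf a, 0) \<diamondop> h)"
  using vpos_mult[of h "(cf a, 0)"] vnn_cf rmul_commute by metis

text \<open>The functions \<open>U, W\<close> (and \<open>U' = 1/U\<close>, \<open>W' = W/U\<^sup>2\<close>, for the chart at infinity) are the
  coordinates of the map \<open>\<phi>\<close> into an elliptic curve.\<close>

definition (in curve) realizes ::
  "rat poly \<Rightarrow> (point \<Rightarrow> point) \<Rightarrow> ratfun \<Rightarrow> ratfun \<Rightarrow> ratfun \<Rightarrow> ratfun \<Rightarrow> bool" where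
  "realizes g \<phi> U W U' W' \<longleftrightarrow> U' \<diamondop> U = (1, 0) \<and> W' = W \<diamondop> (U' \<diamondop> U') \<and>
     (\<forall>Q\<in>points f. \<phi> Q \<in> points g \<and>
        (case \<phi> Q of Aff x y \<Rightarrow> vpos (ord_at f Q) (U - (cf x, 0)) \<and> vpos (ord_at f Q) (W - (cf y, 0))
         | Infty s \<Rightarrow> vpos (ord_at f Q) U' \<and> vpos (ord_at f Q) (W' - (cf s, 0))))"

text \<open>The affine chart serves away from the zeros of \<open>U'\<close>, the chart at infinity
  away from the zeros of \<open>U\<close>; both exceptional sets are finite, and the first or the
  second is avoided by \<open>P\<close> according to its image.\<close>

lemma (in curve) realizes_morphism:
  assumes r: "realizes g \<phi> U W U' W'" and g: "half_deg g = 2"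
    and k: "U \<in> funs_over k" "W \<in> funs_over k" "U' \<in> funs_over k" "W' \<in> funs_over k"
  shows "morphism_over k f g \<phi>"
  unfolding morphism_over_def
proof (intro conjI ballI)
  show "\<phi> ` points f \<subseteq> points g" using r by (auto simp: realizes_def)
  have UU: "U' \<diamondop> U = (1, 0)" and W': "W' = W \<diamondop> (U' \<diamondop> U')" using r by (auto simp: realizes_def)
  have nz: "U \<noteq> 0" "U' \<noteq> 0" using UU by (metis fst_conv fst_zero rmul_zero zero_neq_one)+
  have aff: "vpos (ord_at f Q) (U - (cf x, 0)) \<and> vpos (ord_at f Q) (W - (cf y, 0))" if "Q \<in> points f" "\<phi> Q = Aff x y" for Q x y
    using r that by (force simp: realizes_def)
  have inf: "vpos (ord_at f Q) U' \<and> vpos (ord_at f Q) (W' - (cf s, 0))" if "Q \<in> points f" "\<phi> Q = Infty s" for Q s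
    using r that by (force simp: realizes_def)
  fix P assume P: "P \<in> points f"
  show "\<exists>chart\<in>{Aff, inf_chart (half_deg g)}. \<exists>u\<in>funs_over k. \<exists>v\<in>funs_over k. \<exists>S. finite S \<and> P \<notin> S \<and>
          (\<forall>Q\<in>points f - S. regular_at f Q u \<and> regular_at f Q v \<and> \<phi> Q = chart (value_at f Q u) (value_at f Q v))"
  proof (cases "\<phi> P")
    case (Aff x y)
    let ?S = "{Q \<in> points f. \<exists>s. \<phi> Q = Infty s}"
    have "ord_at f Q U' \<noteq> 0" if "Q \<in> points f" "\<phi> Q = Infty s" for Q s
      using inf[OF that] nz(2) by (simp add: vpos_def)
    then have "?S \<subseteq> {Q \<in> points f. ord_at f Q U' \<noteq> 0}" by blast
    then have fin: "finite ?S" using finite_support[OF nz(2)] finite_subset by blast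
    have "\<forall>Q\<in>points f - ?S. regular_at f Q U \<and> regular_at f Q W \<and> \<phi> Q = Aff (value_at f Q U) (value_at f Q W)"
    proof
      fix Q assume Q: "Q \<in> points f - ?S"
      then obtain x y where xy: "\<phi> Q = Aff x y" by (cases "\<phi> Q") auto
      then show "regular_at f Q U \<and> regular_at f Q W \<and> \<phi> Q = Aff (value_at f Q U) (value_at f Q W)"
        using aff[of Q x y] Q value_at_eqI[of Q U x] value_at_eqI[of Q W y] by auto
    qed
    moreover have "P \<notin> ?S" using Aff by auto
    ultimately show ?thesis using k fin by blast
  next
    case (Infty s)
    let ?S = "{Q \<in> points f. \<exists>y. \<phi> Q = Aff 0 y}"
    have U0: "U - (cf 0, 0) = U" by (simp add: prod_eq_iff)
    have "ord_at f Q U \<noteq> 0" if "Q \<in> points f" "\<phi> Q = Aff 0 y" for Q y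
      using aff[OF that, unfolded U0] nz(1) by (simp add: vpos_def)
    then have "?S \<subseteq> {Q \<in> points f. ord_at f Q U \<noteq> 0}" by blast
    then have fin: "finite ?S" using finite_support[OF nz(1)] finite_subset by blast
    have "\<forall>Q\<in>points f - ?S. regular_at f Q U' \<and> regular_at f Q W' \<and>
       \<phi> Q = inf_chart (half_deg g) (value_at f Q U') (value_at f Q W')"
    proof
      fix Q assume Q: "Q \<in> points f - ?S"
      then have Qp: "Q \<in> points f" by simp
      interpret v: valuation F "ord_at f Q" by (rule valuation_ord[OF Qp])
      show "regular_at f Q U' \<and> regular_at f Q W' \<and> \<phi> Q = inf_chart (half_deg g) (value_at f Q U') (value_at f Q W')"
      proof (cases "\<phi> Q")
        case (Aff x y)
        then have x: "x \<noteq> 0" using Q by auto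
        note a = aff[OF Qp Aff]
        have u: "vpos (ord_at f Q) (U' - (cf (1 / x), 0))"
          by (rule v.vpos_inverse_value[OF _ x UU]) (use a in blast)
        then have w: "vpos (ord_at f Q) (W' - (cf (y * (1 / x * (1 / x))), 0))"
          unfolding W' using a by (intro v.vpos_mult_values) auto
        show ?thesis using value_at_eqI[OF Qp u] value_at_eqI[OF Qp w] x Aff
          by (simp add: inf_chart_def g power2_eq_square)
      next
        case (Infty s)
        have u0: "vpos (ord_at f Q) (U' - (cf 0, 0))" and w0: "vpos (ord_at f Q) (W' - (cf s, 0))"
          using inf[OF Qp Infty] by (auto simp: zero_prod_def[symmetric])
        show ?thesis using value_at_eqI[OF Qp u0] value_at_eqI[OF Qp w0] Infty by (simp add: inf_chart_def)
      qed
    qed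
    moreover have "P \<notin> ?S" using Infty by auto
    ultimately show ?thesis using k fin by blast
  qed
qed

text \<open>Composition of a function with the map (x, y) \<mapsto> (u(x), w(x) y).\<close>

definition pull :: "qbar poly fract \<Rightarrow> qbar poly fract \<Rightarrow> ratfun \<Rightarrow> ratfun" where
  "pull u w h = (rat_eval cf u (fst h), rat_eval cf u (snd h) * w)"

text \<open>\<open>eqn\<close> makes the pullback a homomorphism of function fields, while
  \<open>c1\<close> and \<open>c2\<close> say that the order at \<open>P\<close>, pulled back, is
  centred at \<open>\<phi> P\<close>. Everything about orders follows from the uniqueness of centred
  valuations.\<close>

locale special_map = src: curve f d + tgt: curve g e
  for f d g e +
  fixes u w :: "qbar poly fract" and \<phi> :: "point \<Rightarrow> point"
  assumes tr: "rat_evaluation cf u" and w_nz: "w \<noteq> 0"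
    and eqn: "w\<^sup>2 * to_fract (base_change f) = rat_eval cf u (to_fract (base_change g))"
    and pt: "P \<in> points f \<Longrightarrow> \<phi> P \<in> points g"
    and c1: "P \<in> points f \<Longrightarrow> vpos (ord_at f P) (pull u w (loc_par (\<phi> P), 0))"
    and c2: "P \<in> points f \<Longrightarrow> vpos (ord_at f P) (pull u w ((0, loc_b e (\<phi> P)) - (cf (loc_val (\<phi> P)), 0)))"
begin

interpretation r: rat_evaluation cf u by (rule tr)

abbreviation pb where "pb \<equiv> pull u w"

lemma pb_add: "pb (h + k) = pb h + pb k"
  by (simp add: pull_def r.ev_add algebra_simps)

lemma pb_mult: "pb (rmul (base_change g) h k) = rmul (base_change f) (pb h) (pb k)"
  using eqn by (simp add: pull_def rmul_def r.ev_add r.ev_mult algebra_simps power2_eq_square)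

lemma pb_cf [simp]: "pb (cf a, 0) = (cf a, 0)"
  by (simp add: pull_def)

lemma pb_one [simp]: "pb (1, 0) = (1, 0)"
  by (simp add: pull_def)

lemma pb_diff: "pb (h - k) = pb h - pb k"
  by (simp add: pull_def r.ev_diff algebra_simps)

lemma pb_eq_0_iff [simp]: "pb h = 0 \<longleftrightarrow> h = 0"
  using w_nz by (auto simp: pull_def prod_eq_iff)

lemma pb_centred: "P \<in> points f \<Longrightarrow> centred (base_change g) e (\<lambda>h. ord_at f P (pb h)) (\<phi> P)"
proof -
  assume P: "P \<in> points f"
  interpret v: valuation "base_change f" "ord_at f P" by (rule src.valuation_ord[OF P])
  have "is_val (base_change g) (\<lambda>h. ord_at f P (pb h))"
    unfolding is_val_def
  proof (intro conjI allI impI)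
    fix h k :: ratfun assume "h \<noteq> 0" "k \<noteq> 0"
    then show "ord_at f P (pb (rmul (base_change g) h k)) = ord_at f P (pb h) + ord_at f P (pb k)"
      by (simp add: pb_mult v.V_mult)
    assume "h + k \<noteq> 0"
    then have "pb h + pb k \<noteq> 0" by (simp flip: pb_add)
    then show "min (ord_at f P (pb h)) (ord_at f P (pb k)) \<le> ord_at f P (pb (h + k))"
      using \<open>h \<noteq> 0\<close> \<open>k \<noteq> 0\<close> v.V_add[of "pb h" "pb k"] by (simp add: pb_add)
  qed (simp add: v.V_cf)
  moreover have "(loc_par (\<phi> P), 0) \<noteq> (0 :: ratfun)"
    using place_loc.pi_nz[OF place_loc.intro[OF place_loc_par[of "\<phi> P"]]] by (simp add: zero_prod_def)
  moreover have "vpos (\<lambda>h. ord_at f P (pb h)) h = vpos (ord_at f P) (pb h)" for h by (simp add: vpos_def)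
  ultimately show ?thesis
    using c1[OF P] c2[OF P] by (auto simp: centred_def vpos_def)
qed

definition ram_index :: "point \<Rightarrow> int" where
  "ram_index P = ord_at f P (pb (loc_unif e (\<phi> P)))"

lemma ram_index_pos: "P \<in> points f \<Longrightarrow> ram_index P > 0"
  unfolding ram_index_def using tgt.centred_unif_pos[OF pt pb_centred] by blast

lemma ord_pb: "P \<in> points f \<Longrightarrow> h \<noteq> 0 \<Longrightarrow> ord_at f P (pb h) = ram_index P * ord_at g (\<phi> P) h"
  unfolding ram_index_def using tgt.centred_eq_ord_at[OF pt pb_centred] by blast

lemma vpos_pb: "P \<in> points f \<Longrightarrow> vpos (ord_at g (\<phi> P)) h \<Longrightarrow> vpos (ord_at f P) (pb h)"
  using ord_pb[of P h] ram_index_pos[of P] by (cases "h = 0") (auto simp: vpos_def)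

lemma realizes_compose:
  assumes "tgt.realizes l \<psi> U W U' W'"
  shows "src.realizes l (\<psi> \<circ> \<phi>) (pb U) (pb W) (pb U') (pb W')"
  unfolding src.realizes_def
proof (intro conjI ballI)
  show "rmul (base_change f) (pb U') (pb U) = (1, 0)" "pb W' = rmul (base_change f) (pb W) (rmul (base_change f) (pb U') (pb U'))"
    using assms by (simp_all add: tgt.realizes_def flip: pb_mult)
  fix Q assume Q: "Q \<in> points f"
  then have Q': "\<phi> Q \<in> points g" by (rule pt)
  show "(\<psi> \<circ> \<phi>) Q \<in> points l" using assms Q' by (simp add: tgt.realizes_def)
  show "case (\<psi> \<circ> \<phi>) Q of Aff x y \<Rightarrow> vpos (ord_at f Q) (pb U - (cf x, 0)) \<and> vpos (ord_at f Q) (pb W - (cf y, 0))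
         | Infty s \<Rightarrow> vpos (ord_at f Q) (pb U') \<and> vpos (ord_at f Q) (pb W' - (cf s, 0))"
  proof (cases "\<psi> (\<phi> Q)")
    case (Aff x y)
    then have "vpos (ord_at g (\<phi> Q)) (U - (cf x, 0))" "vpos (ord_at g (\<phi> Q)) (W - (cf y, 0))"
      using assms Q' by (force simp: tgt.realizes_def)+
    from this[THEN vpos_pb[OF Q]] show ?thesis using Aff by (simp add: pb_diff del: diff_Pair)
  next
    case (Infty s)
    then have "vpos (ord_at g (\<phi> Q)) U'" "vpos (ord_at g (\<phi> Q)) (W' - (cf s, 0))"
      using assms Q' by (force simp: tgt.realizes_def)+
    from this[THEN vpos_pb[OF Q]] show ?thesis using Infty by (simp add: pb_diff del: diff_Pair)
  qed
qed

lemma realizes_self: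
  assumes "e = 2"
  shows "src.realizes g \<phi> (u, 0) (0, w) (1 / u, 0) (0, w / u\<^sup>2)"
  unfolding src.realizes_def
proof (intro conjI ballI)
  have u: "u \<noteq> 0" using r.E_eq_0_iff[of "[:0, 1:]"] by (auto simp: map_poly_pCons)
  show "rmul (base_change f) (1 / u, 0) (u, 0) = (1, 0)" using u by (simp add: src.rmul_x)
  show "(0, w / u\<^sup>2) = rmul (base_change f) (0, w) (rmul (base_change f) (1 / u, 0) (1 / u, 0))"
    by (simp add: rmul_def power2_eq_square)
  fix Q assume Q: "Q \<in> points f"
  show "\<phi> Q \<in> points g" by (rule pt[OF Q])
  show "case \<phi> Q of Aff x y \<Rightarrow> vpos (ord_at f Q) ((u, 0) - (cf x, 0)) \<and> vpos (ord_at f Q) ((0, w) - (cf y, 0))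
     | Infty s \<Rightarrow> vpos (ord_at f Q) (1 / u, 0) \<and> vpos (ord_at f Q) ((0, w / u\<^sup>2) - (cf s, 0))"
  proof (cases "\<phi> Q")
    case (Aff x y)
    then show ?thesis using c1[OF Q] c2[OF Q]
      by (simp add: pull_def r.ev_minus r.ev_to_fract map_poly_pCons cf_minus)
  next
    case (Infty s)
    then show ?thesis using c1[OF Q] c2[OF Q] assms
      by (simp add: pull_def r.ev_minus r.ev_divide r.ev_power)
  qed
qed

end

lemma lookup_frag_extend:
  "Poly_Mapping.lookup (frag_extend (frag_of \<circ> \<phi>) D) R = (\<Sum>P | P \<in> Poly_Mapping.keys D \<and> \<phi> P = R. Poly_Mapping.lookup D P)"
proof -
  have "Poly_Mapping.lookup (frag_extend (frag_of \<circ> \<phi>) D) R =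
      (\<Sum>P\<in>Poly_Mapping.keys D. if \<phi> P = R then Poly_Mapping.lookup D P else 0)"
    unfolding frag_extend_def lookup_sum by (intro sum.cong) auto
  also have "\<dots> = (\<Sum>P | P \<in> Poly_Mapping.keys D \<and> \<phi> P = R. Poly_Mapping.lookup D P)"
    by (simp add: sum.If_cases Int_def)
  finally show ?thesis .
qed

lemma lookup_frag_extend_superset:
  assumes "finite T" "{P \<in> Poly_Mapping.keys D. \<phi> P = R} \<subseteq> T" "\<And>P. P \<in> T \<Longrightarrow> \<phi> P = R"
  shows "Poly_Mapping.lookup (frag_extend (frag_of \<circ> \<phi>) D) R = (\<Sum>P\<in>T. Poly_Mapping.lookup D P)"
  unfolding lookup_frag_extend using assms
  by (intro sum.mono_neutral_left) (auto simp: in_keys_iff)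

text \<open>The divisor of \<open>h\<close> goes to the divisor of its norm \<open>h \<cdot> \<iota>\<^sup>*h\<close>.\<close>

lemma (in special_map) push_principal:
  assumes invol: "\<And>P. P \<in> points f \<Longrightarrow> \<iota> P \<in> points f"
    and ord: "\<And>P h. P \<in> points f \<Longrightarrow> h \<noteq> 0 \<Longrightarrow> ord_at f P (iota h) = ord_at f (\<iota> P) h"
    and iz: "\<And>h. h \<noteq> 0 \<Longrightarrow> iota h \<noteq> 0"
    and norm: "\<And>h. \<exists>H. pb H = rmul (base_change f) h (iota h)"
    and fib: "\<And>P Q. P \<in> points f \<Longrightarrow> Q \<in> points f \<Longrightarrow> \<phi> Q = \<phi> P \<longleftrightarrow> Q = P \<or> Q = \<iota> P"
    and surj: "\<And>R. R \<in> points g \<Longrightarrow> \<exists>P\<in>points f. \<phi> P = R"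
    and ri: "\<And>P. P \<in> points f \<Longrightarrow> ram_index P = (if \<iota> P = P then 2 else 1)"
    and D: "D \<in> principal f"
  shows "frag_extend (frag_of \<circ> \<phi>) D \<in> principal g"
proof -
  obtain h where h: "h \<noteq> 0" "D = src.fdiv h" using D by (auto simp: src.principal_iff)
  obtain H where H: "pb H = rmul (base_change f) h (iota h)" using norm by blast
  then have "pb H \<noteq> 0" using h iz by simp
  then have Hnz: "H \<noteq> 0" by (metis pb_eq_0_iff)
  have "frag_extend (frag_of \<circ> \<phi>) D = tgt.fdiv H"
  proof (rule poly_mapping_eqI)
    fix R
    show "Poly_Mapping.lookup (frag_extend (frag_of \<circ> \<phi>) D) R = Poly_Mapping.lookup (tgt.fdiv H) R"
    proof (cases "R \<in> points g")
      case False
      then have e: "{P. P \<in> Poly_Mapping.keys D \<and> \<phi> P = R} = {}"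
        using pt src.keys_fdiv[of h] h by auto
      show ?thesis unfolding lookup_frag_extend e using False by (simp add: tgt.lookup_fdiv)
    next
      case True
      then obtain P where P: "P \<in> points f" "\<phi> P = R" using surj by blast
      have "Poly_Mapping.lookup (frag_extend (frag_of \<circ> \<phi>) D) R = (\<Sum>Q\<in>{P, \<iota> P}. Poly_Mapping.lookup D Q)"
      proof (rule lookup_frag_extend_superset)
        show "{Q \<in> Poly_Mapping.keys D. \<phi> Q = R} \<subseteq> {P, \<iota> P}"
          using fib[OF P(1)] src.keys_fdiv[of h] h P by auto
        show "\<phi> Q = R" if "Q \<in> {P, \<iota> P}" for Q using that fib[OF P(1), of "\<iota> P"] invol P by auto
      qed simp
      also have "\<dots> = (\<Sum>Q\<in>{P, \<iota> P}. ord_at f Q h)"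
        using P invol h by (intro sum.cong) (auto simp: src.lookup_fdiv)
      finally have L: "Poly_Mapping.lookup (frag_extend (frag_of \<circ> \<phi>) D) R = (\<Sum>Q\<in>{P, \<iota> P}. ord_at f Q h)" .
      have "ram_index P * ord_at g R H = ord_at f P h + ord_at f (\<iota> P) h"
        using ord_pb[OF P(1) Hnz] src.ord_mult[OF P(1) h(1) iz[OF h(1)]] ord[OF P(1) h(1)] P(2) H by simp
      \<comment> \<open>Over a fixed point of the involution the fibre is a single point, and the
        ramification index 2 cancels against the doubled order.\<close>
      then have "ord_at g R H = (\<Sum>Q\<in>{P, \<iota> P}. ord_at f Q h)"
        using ri[OF P(1)] by (cases "\<iota> P = P") auto
      then show ?thesis using L True Hnz by (simp add: tgt.lookup_fdiv)
    qed
  qed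
  then show ?thesis using Hnz by (metis tgt.principal_iff)
qed

text \<open>With a two-sided situation every function on the source is a pullback, so the
  ramification index divides the order 1 of a uniformizer.\<close>

lemma (in special_map) iso_ord:
  assumes inv: "special_map g e f d u' w' \<phi>'"
    and pp: "\<And>h. pull u w (pull u' w' h) = h" and pt': "\<And>P. P \<in> points f \<Longrightarrow> \<phi>' (\<phi> P) = P"
    and P: "P \<in> points f" and h: "h \<noteq> 0"
  shows "ord_at g (\<phi> P) (pull u' w' h) = ord_at f P h" "ram_index P = 1"
proof -
  interpret i: special_map g e f d u' w' \<phi>' by (rule inv)
  have *: "ord_at f P k = ram_index P * ord_at g (\<phi> P) (pull u' w' k)" if "k \<noteq> 0" for k
    using ord_pb[OF P, of "pull u' w' k"] that by (simp add: pp)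
  have "loc_unif d P \<noteq> 0"
    using place_loc.pi_nz[OF place_loc.intro[OF place_loc_par[of P]]] by (auto simp: loc_unif_def zero_prod_def)
  from *[OF this] have "ram_index P dvd 1" using src.centred_ord_at(2)[OF P] by (metis dvd_triv_left)
  then show "ram_index P = 1" using ram_index_pos[OF P] by simp
  then show "ord_at g (\<phi> P) (pull u' w' h) = ord_at f P h" using *[OF h] by simp
qed

lemma (in special_map) iso_push_principal:
  assumes inv: "special_map g e f d u' w' \<phi>'"
    and pp: "\<And>h. pull u w (pull u' w' h) = h" and pt': "\<And>P. P \<in> points f \<Longrightarrow> \<phi>' (\<phi> P) = P"
    and pt'': "\<And>R. R \<in> points g \<Longrightarrow> \<phi> (\<phi>' R) = R"
    and D: "D \<in> principal f"
  shows "frag_extend (frag_of \<circ> \<phi>) D \<in> principal g"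
proof -
  interpret i: special_map g e f d u' w' \<phi>' by (rule inv)
  obtain h where h: "h \<noteq> 0" "D = src.fdiv h" using D by (auto simp: src.principal_iff)
  have "frag_extend (frag_of \<circ> \<phi>) D = tgt.fdiv (pull u' w' h)"
  proof (rule poly_mapping_eqI)
    fix R
    show "Poly_Mapping.lookup (frag_extend (frag_of \<circ> \<phi>) D) R = Poly_Mapping.lookup (tgt.fdiv (pull u' w' h)) R"
    proof (cases "R \<in> points g")
      case False
      then have e: "{P. P \<in> Poly_Mapping.keys D \<and> \<phi> P = R} = {}"
        using pt src.keys_fdiv[of h] h by auto
      show ?thesis unfolding lookup_frag_extend e using False by (simp add: tgt.lookup_fdiv)
    next
      case True
      define P where "P = \<phi>' R"
      have P: "P \<in> points f" "\<phi> P = R" using i.pt[OF True] pt''[OF True] by (auto simp: P_def)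
      have "Poly_Mapping.lookup (frag_extend (frag_of \<circ> \<phi>) D) R = (\<Sum>Q\<in>{P}. Poly_Mapping.lookup D Q)"
      proof (rule lookup_frag_extend_superset)
        show "{Q \<in> Poly_Mapping.keys D. \<phi> Q = R} \<subseteq> {P}"
          using pt' src.keys_fdiv[of h] h unfolding P_def by auto
      qed (use P in auto)
      also have "\<dots> = ord_at f P h" using P h by (simp add: src.lookup_fdiv)
      also have "\<dots> = ord_at g R (pull u' w' h)" using iso_ord(1)[OF inv pp pt' P(1) h(1)] P(2) by simp
      finally show ?thesis using True h by (simp add: tgt.lookup_fdiv)
    qed
  qed
  then show ?thesis using h by (metis tgt.principal_iff i.pb_eq_0_iff)
qed

lemma rat_evaluation_to_fract: "Polynomial.degree r > 0 \<Longrightarrow> rat_evaluation cf (to_fract r)"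
  by (rule rat_evaluation_cfI) (auto simp: poly_map_cf_to_fract pcompose_eq_0_iff)

lemma rat_eval_fx: "rat_eval cf fx A = A"
proof -
  interpret rat_evaluation cf "fx :: 'a poly fract" by (rule rat_evaluation_to_fract) simp
  show ?thesis
  proof (cases A)
    fix p q assume "A = Fraction_Field.Fract p q" "q \<noteq> 0"
    then show ?thesis by (simp add: ev_Fract flip: to_fract_poly) (simp add: to_fract_def divide_fract)
  qed
qed

section \<open>Functions with rational coefficients and morphisms up to equality on points\<close>

lemma fracts_overI:
  assumes "q \<noteq> 0" "A = to_fract (base_change p) / to_fract (base_change q)"
  shows "A \<in> fracts_over (range to_ac)"
proof -
  have "base_change q \<noteq> 0" using assms(1) by (auto simp: base_change_def poly_eq_iff coeff_map_poly)
  moreover have "set (Polynomial.coeffs (base_change p)) \<subseteq> range to_ac" for p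
    using set_coeffs_map_poly[of to_ac p] by (auto simp: base_change_def coeffs_map_poly)
  ultimately show ?thesis using assms(2) unfolding fracts_over_def
    by (intro CollectI exI[of _ "base_change p"] exI[of _ "base_change q"]) (auto simp: to_fract_def divide_fract)
qed

lemma base_change_pCons [simp]: "base_change (pCons a p) = pCons (to_ac a) (base_change p)"
  by (simp add: base_change_def map_poly_pCons)

lemma base_change_0 [simp]: "base_change 0 = 0" by (simp add: base_change_def)

lemma zero_fracts_over: "0 \<in> fracts_over (range to_ac)"
  by (rule fracts_overI[of 1 _ 0]) (auto simp: one_pCons)

lemma funs_over_UNIV [simp]: "h \<in> funs_over UNIV"
proof -
  have "A \<in> fracts_over UNIV" for A
    by (cases A) (auto simp: fracts_over_def)
  then show ?thesis by (cases h) (auto simp: funs_over_def)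
qed

lemma morphism_over_cong:
  assumes "morphism_over k f g \<phi>" "\<And>P. P \<in> points f \<Longrightarrow> \<psi> P = \<phi> P"
  shows "morphism_over k f g \<psi>"
proof -
  have "\<psi> ` points f = \<phi> ` points f" using assms(2) by (intro image_cong) auto
  moreover have "(\<forall>Q\<in>points f - S. regular_at f Q u \<and> regular_at f Q v \<and> \<phi> Q = chart (value_at f Q u) (value_at f Q v)) \<longleftrightarrow>
      (\<forall>Q\<in>points f - S. regular_at f Q u \<and> regular_at f Q v \<and> \<psi> Q = chart (value_at f Q u) (value_at f Q v))" for S u v chart
    using assms(2) by auto
  ultimately show ?thesis using assms(1) unfolding morphism_over_def by simp
qed

section \<open>Affine isomorphisms of elliptic curves\<close>

primrec affine_map :: "qbar \<Rightarrow> qbar \<Rightarrow> qbar \<Rightarrow> point \<Rightarrow> point" where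
  "affine_map k m l (Aff x y) = Aff (k * x + m) (l * y)"
| "affine_map k m l (Infty s) = Infty 0"

text \<open>At affine points the chart coordinates are only rescaled. At the origin u has a double
  pole, so 1/u has order 2 and l y / u^2 has order 1.\<close>

lemma affine_special:
  assumes "elliptic f" "elliptic g" and k: "k \<noteq> 0" and l: "l \<noteq> 0"
    and eq: "Polynomial.smult (l\<^sup>2) (base_change f) = pcompose (base_change g) [:m, k:]"
  shows "special_map f 2 g 2 (to_fract [:m, k:]) (cf l) (affine_map k m l)"
proof -
  interpret f: elliptic f by fact
  interpret g: elliptic g by fact
  define u where "u = to_fract [:m, k:]"
  interpret r: rat_evaluation cf u unfolding u_def by (rule rat_evaluation_to_fract) (use k in simp)
  have ut: "r.ev (to_fract p) = to_fract (pcompose p [:m, k:])" for p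
    using r.ev_to_fract[of p] by (simp add: u_def poly_map_cf_to_fract)
  have unz: "u \<noteq> 0" using k by (simp add: u_def)
  show ?thesis unfolding u_def[symmetric]
  proof unfold_locales
    show "cf l \<noteq> 0" using l by simp
    show "(cf l)\<^sup>2 * to_fract f.F = r.ev (to_fract g.F)"
      unfolding ut eq[symmetric] by (simp add: cf_def power2_eq_square flip: to_fract_mult)
  next
    fix P assume P: "P \<in> points f"
    interpret v: valuation f.F "ord_at f P" by (rule f.valuation_ord[OF P])
    note cen = f.centredD[OF f.centred_ord_at(1)[OF P]]
    show pg: "affine_map k m l P \<in> points g"
    proof (cases P)
      case (Aff x y)
      then have "y\<^sup>2 = poly f.F x" using P by (auto simp: points_def)
      moreover have "l\<^sup>2 * poly f.F x = poly g.F (k * x + m)"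
        using arg_cong[OF eq, of "\<lambda>p. poly p x"] by (simp add: poly_pcompose algebra_simps)
      ultimately show ?thesis using Aff by (auto simp: points_def power_mult_distrib)
    qed simp
    show "vpos (ord_at f P) (pull u (cf l) (loc_par (affine_map k m l P), 0))"
    proof (cases P)
      case (Aff x y)
      have "pull u (cf l) (loc_par (affine_map k m l P), 0) = rmul f.F (cf k, 0) (loc_par P, 0)"
        by (simp add: Aff pull_def ut pcompose_pCons f.rmul_x cf_def algebra_simps flip: to_fract_mult)
      then show ?thesis using v.vpos_smult[of "(loc_par P, 0)" k] cen(2) by (simp add: vpos_def)
    next
      case (Infty s)
      then have P0: "P = Infty 0" using P f.infinity_only by simp
      have "ord_at f P (u, 0) = - 2" using f.ord_x[OF P unz] k by (simp add: P0 u_def nu_inf f.ram_def)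
      moreover have "rmul f.F (1 / u, 0) (u, 0) = (1, 0)" using unz by (simp add: f.rmul_x)
      ultimately have "ord_at f P (1 / u, 0) = 2" using v.V_mult[of "(1 / u, 0)" "(u, 0)"] v.V_one unz
        by (simp add: zero_prod_def)
      then show ?thesis using P0 by (simp add: pull_def r.ev_divide vpos_def)
    qed
    show "vpos (ord_at f P) (pull u (cf l) ((0, loc_b 2 (affine_map k m l P)) - (cf (loc_val (affine_map k m l P)), 0)))"
    proof (cases P)
      case (Aff x y)
      have "pull u (cf l) ((0, loc_b 2 (affine_map k m l P)) - (cf (loc_val (affine_map k m l P)), 0)) =
          rmul f.F (cf l, 0) ((0, loc_b 2 P) - (cf (loc_val P), 0))"
        by (simp add: Aff pull_def r.ev_minus r.ev_mult f.rmul_x cf_mult)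
      then show ?thesis using v.vpos_smult[OF cen(3), of l] by simp
    next
      case (Infty s)
      then have P0: "P = Infty 0" using P f.infinity_only by simp
      have "pull u (cf l) ((0, loc_b 2 (affine_map k m l P)) - (cf (loc_val (affine_map k m l P)), 0)) = (0, cf l / u\<^sup>2)"
        by (simp add: P0 pull_def r.ev_divide r.ev_power)
      moreover have "ord_at f P (0, cf l / u\<^sup>2) = 1"
      proof -
        have "nu (1 / fx) ((cf l / u\<^sup>2) / (1 / fx\<^sup>2)) = 0"
        proof -
          have "(cf l / u\<^sup>2) / (1 / fx\<^sup>2) = Fraction_Field.Fract ([:l:] * [:0, 1:]\<^sup>2) ([:m, k:]\<^sup>2)"
            using unz by (simp add: u_def cf_def to_fract_def divide_fract power2_eq_square mult_fract)
          moreover have "Polynomial.degree ([:l:] * [:0, 1:]\<^sup>2) = 2" using l by (simp add: degree_power_eq)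
          moreover have "Polynomial.degree ([:m, k:]\<^sup>2) = 2" using k by (simp add: degree_power_eq)
          moreover have "[:l:] * [:0, 1:]\<^sup>2 \<noteq> 0" "[:m, k:]\<^sup>2 \<noteq> 0" using k l by auto
          ultimately show ?thesis using nu_Fract(2) by simp
        qed
        then show ?thesis using f.ord_y_part[OF P, of "cf l / u\<^sup>2"] unz l by (simp add: P0)
      qed
      ultimately show ?thesis by (simp add: vpos_def)
    qed
  qed
qed

lemma affine_eq_inverse:
  fixes F G :: "qbar poly"
  assumes k: "k \<noteq> 0" and l: "l \<noteq> 0" and eq: "Polynomial.smult (l\<^sup>2) F = pcompose G [:m, k:]"
  shows "Polynomial.smult ((1 / l)\<^sup>2) G = pcompose F [:- m / k, 1 / k:]"
proof -
  have "Polynomial.smult (l\<^sup>2) (pcompose F [:- m / k, 1 / k:]) = pcompose (Polynomial.smult (l\<^sup>2) F) [:- m / k, 1 / k:]"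
    by (simp add: pcompose_smult)
  also have "\<dots> = pcompose G (pcompose [:m, k:] [:- m / k, 1 / k:])" unfolding eq by (rule pcompose_assoc[symmetric])
  also have "pcompose [:m, k:] [:- m / k, 1 / k:] = [:0, 1:]" using k by (simp add: pcompose_pCons)
  finally have "Polynomial.smult (l\<^sup>2) (pcompose F [:- m / k, 1 / k:]) = G" by (simp add: pcompose_idR)
  then have "G = Polynomial.smult (l\<^sup>2) (pcompose F [:- m / k, 1 / k:])" by simp
  then show ?thesis using l by (simp add: power_divide)
qed

lemma base_change_affine:
  assumes "Polynomial.smult (l\<^sup>2) f = pcompose g [:m, k:]"
  shows "Polynomial.smult ((to_ac l)\<^sup>2) (base_change f) = pcompose (base_change g) [:to_ac m, to_ac k:]"
proof -
  have a: "base_change (p + q) = base_change p + base_change q" for p q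
    by (intro poly_eqI) (simp add: base_change_def coeff_map_poly)
  have s: "base_change (Polynomial.smult c p) = Polynomial.smult (to_ac c) (base_change p)" for c p
    by (intro poly_eqI) (simp add: base_change_def coeff_map_poly)
  have t: "base_change (p * q) = base_change p * base_change q" for p q
    by (intro poly_eqI) (simp add: base_change_def coeff_map_poly coeff_mult to_ac_sum)
  have "base_change (pcompose p q) = pcompose (base_change p) (base_change q)" for p q
    by (induction p) (auto simp: pcompose_pCons a t)
  then show ?thesis using arg_cong[OF assms, of base_change] by (simp add: s)
qed

locale affine_iso = f: elliptic f + g: elliptic g for f g +
  fixes k m l :: rat
  assumes k: "k \<noteq> 0" and l: "l \<noteq> 0" and eq: "Polynomial.smult (l\<^sup>2) f = pcompose g [:m, k:]"
begin

lemmas eq_bc = base_change_affine[OF eq]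

abbreviation \<alpha> where "\<alpha> \<equiv> affine_map (to_ac k) (to_ac m) (to_ac l)"
abbreviation \<beta> where "\<beta> \<equiv> affine_map (1 / to_ac k) (- to_ac m / to_ac k) (1 / to_ac l)"

sublocale fw: special_map f 2 g 2 "to_fract [:to_ac m, to_ac k:]" "cf (to_ac l)" \<alpha>
  by (rule affine_special[OF f.elliptic_axioms g.elliptic_axioms _ _ eq_bc]) (use k l in simp_all)

sublocale bw: special_map g 2 f 2 "to_fract [:- to_ac m / to_ac k, 1 / to_ac k:]" "cf (1 / to_ac l)" \<beta>
  by (rule affine_special[OF g.elliptic_axioms f.elliptic_axioms _ _ affine_eq_inverse[OF _ _ eq_bc]])
     (use k l in simp_all)

lemma inverse_points: "P \<in> points f \<Longrightarrow> \<beta> (\<alpha> P) = P" "R \<in> points g \<Longrightarrow> \<alpha> (\<beta> R) = R"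
proof -
  have kl: "to_ac k \<noteq> 0" "to_ac l \<noteq> 0" using k l by simp_all
  show "P \<in> points f \<Longrightarrow> \<beta> (\<alpha> P) = P"
    using kl f.infinity_only by (cases P) (simp_all add: add_divide_distrib)
  show "R \<in> points g \<Longrightarrow> \<alpha> (\<beta> R) = R"
    using kl g.infinity_only by (cases R) (simp_all add: right_diff_distrib)
qed

lemma bij: "bij_betw \<alpha> (points f) (points g)"
  using inverse_points fw.pt bw.pt by (intro bij_betw_byWitness[of _ \<beta>]) auto

lemma pull_pull: "pull (to_fract [:to_ac m, to_ac k:]) (cf (to_ac l))
    (pull (to_fract [:- to_ac m / to_ac k, 1 / to_ac k:]) (cf (1 / to_ac l)) h) = h"
proof -
  let ?u = "to_fract [:to_ac m, to_ac k:]" and ?v = "to_fract [:- to_ac m / to_ac k, 1 / to_ac k:]"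
  interpret u: rat_evaluation cf ?u by (rule fw.tr)
  have "u.ev ?v = fx" using k by (simp add: u.ev_to_fract poly_map_cf_to_fract pcompose_pCons)
  then have "u.ev (rat_eval cf ?v A) = A" for A
    using rat_eval_compose(2)[OF fw.tr bw.tr, of A] by (simp add: rat_eval_fx)
  then show ?thesis using l by (simp add: pull_def u.ev_mult prod_eq_iff mult.assoc flip: cf_mult)
qed

lemma push_principal_iso: "D \<in> principal f \<Longrightarrow> frag_extend (frag_of \<circ> \<alpha>) D \<in> principal g"
  by (rule fw.iso_push_principal[OF bw.special_map_axioms pull_pull inverse_points])

lemma group_hom: "P \<in> points f \<Longrightarrow> Q \<in> points f \<Longrightarrow> \<alpha> (P \<otimes>\<^bsub>ec_group f\<^esub> Q) = \<alpha> P \<otimes>\<^bsub>ec_group g\<^esub> \<alpha> Q"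
proof -
  assume P: "P \<in> points f" and Q: "Q \<in> points f"
  let ?R = "P \<otimes>\<^bsub>ec_group f\<^esub> Q"
  have "frag_extend (frag_of \<circ> \<alpha>) (frag_of P + frag_of Q - frag_of ?R - frag_of (Infty 0)) \<in> principal g"
    by (rule push_principal_iso[OF f.mult_G(2)[OF P Q]])
  then have *: "frag_of (\<alpha> P) + frag_of (\<alpha> Q) - frag_of (\<alpha> ?R) - frag_of (Infty 0) \<in> principal g"
    by (simp add: frag_extend_add frag_extend_diff)
  have "g.sums_to ((frag_of (\<alpha> P) - frag_of (Infty 0)) + (frag_of (\<alpha> Q) - frag_of (Infty 0))) (\<alpha> ?R)"
    unfolding g.sums_to_def using g.principal_uminus[OF *] fw.pt[OF f.mult_G(1)[OF P Q]] by (simp add: algebra_simps)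
  moreover have "g.sums_to ((frag_of (\<alpha> P) - frag_of (Infty 0)) + (frag_of (\<alpha> Q) - frag_of (Infty 0))) (\<alpha> P \<otimes>\<^bsub>ec_group g\<^esub> \<alpha> Q)"
    by (intro g.sums_to_add g.sums_to_point fw.pt P Q)
  ultimately show ?thesis by (rule g.sums_to_unique)
qed

lemma funs_affine:
  assumes "(k'::rat) \<noteq> 0" "K = to_ac k'" "M = to_ac m'" "L = to_ac l'"
  shows "(to_fract [:M, K:], 0) \<in> funs_over (range to_ac)" "(0, cf L) \<in> funs_over (range to_ac)"
    "(1 / to_fract [:M, K:], 0) \<in> funs_over (range to_ac)" "(0, cf L / (to_fract [:M, K:])\<^sup>2) \<in> funs_over (range to_ac)"
proof -
  have "to_fract [:M, K:] \<in> fracts_over (range to_ac)"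
    by (rule fracts_overI[of 1 _ "[:m', k':]"]) (auto simp: assms one_pCons simp flip: cf_def)
  then show "(to_fract [:M, K:], 0) \<in> funs_over (range to_ac)" by (simp add: funs_over_def zero_fracts_over)
  have "cf L \<in> fracts_over (range to_ac)"
    by (rule fracts_overI[of 1 _ "[:l':]"]) (auto simp: assms one_pCons simp flip: cf_def)
  then show "(0, cf L) \<in> funs_over (range to_ac)" by (simp add: funs_over_def zero_fracts_over)
  have "1 / to_fract [:M, K:] \<in> fracts_over (range to_ac)"
    by (rule fracts_overI[of "[:m', k':]" _ 1]) (auto simp: assms one_pCons simp flip: cf_def)
  then show "(1 / to_fract [:M, K:], 0) \<in> funs_over (range to_ac)" by (simp add: funs_over_def zero_fracts_over)
  have "cf L / (to_fract [:M, K:])\<^sup>2 \<in> fracts_over (range to_ac)"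
  proof (rule fracts_overI[of "[:m' * m', 2 * m' * k', k' * k':]" _ "[:l':]"])
    show "[:m' * m', 2 * m' * k', k' * k':] \<noteq> 0" using assms by simp
    have "(to_fract [:M, K:])\<^sup>2 = to_fract ([:M, K:] * [:M, K:])" by (simp only: power2_eq_square to_fract_mult)
    also have "[:M, K:] * [:M, K:] = base_change [:m' * m', 2 * m' * k', k' * k':]" by (simp add: assms)
    finally show "cf L / (to_fract [:M, K:])\<^sup>2 = to_fract (base_change [:l':]) / to_fract (base_change [:m' * m', 2 * m' * k', k' * k':])"
      by (simp only: cf_def base_change_pCons base_change_0 assms(4))
  qed
  then show "(0, cf L / (to_fract [:M, K:])\<^sup>2) \<in> funs_over (range to_ac)" by (simp add: funs_over_def zero_fracts_over)
qed

theorem ec_isomorphism: "ec_isomorphism f g \<alpha>"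
  unfolding ec_isomorphism_def
proof (intro conjI bij)
  show "\<alpha> (Infty 0) = Infty 0" by simp
  show "morphism_over (range to_ac) f g \<alpha>"
    by (rule f.realizes_morphism[OF fw.realizes_self[OF refl] g.half_deg]) (use funs_affine[of k] k in auto)
  have "morphism_over (range to_ac) g f \<beta>"
  proof (rule g.realizes_morphism[OF bw.realizes_self[OF refl] f.half_deg])
    note fa = funs_affine[of "1 / k" "1 / to_ac k" "- to_ac m / to_ac k" "- m / k" "1 / to_ac l" "1 / l"]
    show "(to_fract [:- to_ac m / to_ac k, 1 / to_ac k:], 0) \<in> funs_over (range to_ac)"
      "(0, cf (1 / to_ac l)) \<in> funs_over (range to_ac)"
      "(1 / to_fract [:- to_ac m / to_ac k, 1 / to_ac k:], 0) \<in> funs_over (range to_ac)"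
      "(0, cf (1 / to_ac l) / (to_fract [:- to_ac m / to_ac k, 1 / to_ac k:])\<^sup>2) \<in> funs_over (range to_ac)"
      using fa k by simp_all
  qed
  then show "morphism_over (range to_ac) g f (inv_into (points f) \<alpha>)"
  proof (rule morphism_over_cong)
    show "inv_into (points f) \<alpha> R = \<beta> R" if "R \<in> points g" for R
      using bij bw.pt[OF that] inverse_points(2)[OF that] by (metis bij_betw_def inv_into_f_f)
  qed
qed

end

section \<open>Even and odd rational functions\<close>

abbreviation sqx :: "qbar poly fract" where "sqx \<equiv> to_fract [:0, 0, 1:]"
abbreviation negx :: "qbar poly fract" where "negx \<equiv> to_fract [:0, - 1:]"

lemma sqx_eq: "sqx = fx * fx" by (simp flip: to_fract_mult)
lemma negx_eq: "negx = - fx"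
proof -
  have "negx + fx = 0" by (simp flip: to_fract_add)
  then show ?thesis by (simp add: eq_neg_iff_add_eq_0)
qed

global_interpretation sq: rat_evaluation cf sqx by (rule rat_evaluation_to_fract) simp
global_interpretation ng: rat_evaluation cf negx by (rule rat_evaluation_to_fract) simp
global_interpretation iv: rat_evaluation cf "1 / fx :: qbar poly fract" using place_infinity[where 'a = qbar] by (simp add: place_def)

lemma rat_evaluation_invsq: "rat_evaluation cf (1 / sqx)"
  using rat_eval_compose(1)[OF sq.rat_evaluation_axioms iv.rat_evaluation_axioms] by (simp add: sq.ev_divide)

text \<open>x^2 and 1/x^2 generate the same field, so an even function is also a function of 1/x^2,
  the coordinate that \<open>phi\<close> uses.\<close>

lemma sq_range_invsq: "rat_eval cf sqx A = rat_eval cf (1 / sqx) (rat_eval cf (1 / fx) A)"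
proof -
  interpret i: rat_evaluation cf "1 / sqx" by (rule rat_evaluation_invsq)
  have "i.ev (1 / fx) = sqx" by (simp add: i.ev_divide)
  then show ?thesis using rat_eval_compose(2)[OF rat_evaluation_invsq iv.rat_evaluation_axioms, of A] by simp
qed

lemma ng_sq: "rat_eval cf negx (rat_eval cf sqx A) = rat_eval cf sqx A"
proof -
  have "rat_eval cf negx sqx = sqx"
    by (simp add: ng.ev_to_fract poly_map_cf_to_fract pcompose_pCons)
  then show ?thesis using rat_eval_compose(2)[OF ng.rat_evaluation_axioms sq.rat_evaluation_axioms, of A] by simp
qed

lemma ng_ng: "rat_eval cf negx (rat_eval cf negx A) = A"
proof -
  have "rat_eval cf negx negx = fx"
    by (simp add: ng.ev_to_fract poly_map_cf_to_fract pcompose_pCons)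
  then show ?thesis using rat_eval_compose(2)[OF ng.rat_evaluation_axioms ng.rat_evaluation_axioms, of A] by (simp add: rat_eval_fx)
qed

lemma poly_even_odd: "\<exists>A B. to_fract p = rat_eval cf sqx A + fx * rat_eval cf sqx B" for p :: "qbar poly"
proof (induction p)
  case 0
  show ?case by (intro exI[of _ 0]) simp
next
  case (pCons a p)
  then obtain A B where AB: "to_fract p = rat_eval cf sqx A + fx * rat_eval cf sqx B" by blast
  have "to_fract (pCons a p) = cf a + fx * to_fract p" by (rule to_fract_pCons)
  also have "\<dots> = rat_eval cf sqx (cf a + fx * B) + fx * rat_eval cf sqx A"
    unfolding AB sq.ev_add sq.ev_mult sq.ev_cf sq.ev_fx by (simp add: sqx_eq algebra_simps)
  finally show ?case by blast
qed

text \<open>The denominator is made even by multiplying it with its image under x \<mapsto> -x;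
  \<open>s\<close> is that product written in x^2.\<close>

lemma fract_even_odd: "\<exists>A B. C = rat_eval cf sqx A + fx * rat_eval cf sqx B" for C :: "qbar poly fract"
proof (cases C)
  fix p q assume C: "C = Fraction_Field.Fract p q" "q \<noteq> 0"
  obtain A B where q: "to_fract q = rat_eval cf sqx A + fx * rat_eval cf sqx B" using poly_even_odd by blast
  obtain A' B' where p: "to_fract p = rat_eval cf sqx A' + fx * rat_eval cf sqx B'" using poly_even_odd by blast
  define s where "s = A * A - fx * B * B"
  have s: "rat_eval cf sqx s = to_fract q * (rat_eval cf sqx A - fx * rat_eval cf sqx B)"
    unfolding s_def q sq.ev_diff sq.ev_mult sq.ev_fx by (simp add: sqx_eq algebra_simps)
  have qc: "rat_eval cf sqx A - fx * rat_eval cf sqx B = rat_eval cf negx (to_fract q)"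
    unfolding q ng.ev_add ng.ev_mult ng.ev_fx ng_sq by (simp add: negx_eq)
  have nz: "rat_eval cf sqx A - fx * rat_eval cf sqx B \<noteq> 0" unfolding qc using C by simp
  have "C = to_fract p / to_fract q" using C by (simp add: to_fract_def divide_fract)
  also have "\<dots> = to_fract p * (rat_eval cf sqx A - fx * rat_eval cf sqx B) / rat_eval cf sqx s"
    unfolding s using nz by simp
  also have "\<dots> = rat_eval cf sqx ((A' * A - fx * B' * B) / s) + fx * rat_eval cf sqx ((B' * A - A' * B) / s)"
    unfolding p sq.ev_divide sq.ev_diff sq.ev_mult sq.ev_fx
    by (simp add: sqx_eq algebra_simps diff_divide_distrib add_divide_distrib)
  finally show ?thesis by blast
qed

lemma double_eq_0: "a + a = 0 \<Longrightarrow> a = 0" for a :: "qbar poly fract"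
proof -
  assume "a + a = 0"
  then have "cf 2 * a = 0" by (simp add: cf_numeral)
  then show ?thesis by (metis cf_eq_0_iff mult_eq_0_iff zero_neq_numeral)
qed

lemma even_fract:
  assumes "rat_eval cf negx C = C"
  obtains A where "C = rat_eval cf sqx A"
proof -
  obtain A B where C: "C = rat_eval cf sqx A + fx * rat_eval cf sqx B" using fract_even_odd by blast
  have "rat_eval cf negx C = rat_eval cf sqx A - fx * rat_eval cf sqx B"
    unfolding C ng.ev_add ng.ev_mult ng.ev_fx ng_sq by (simp add: negx_eq)
  with assms C have "fx * rat_eval cf sqx B + fx * rat_eval cf sqx B = 0" by (simp add: algebra_simps)
  then have "fx * rat_eval cf sqx B = 0" by (rule double_eq_0)
  with C that show ?thesis by simp
qed

lemma odd_fract: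
  assumes "rat_eval cf negx C = - C"
  obtains A where "C = fx * rat_eval cf sqx A"
proof -
  obtain A B where C: "C = rat_eval cf sqx A + fx * rat_eval cf sqx B" using fract_even_odd by blast
  have "rat_eval cf negx C = rat_eval cf sqx A - fx * rat_eval cf sqx B"
    unfolding C ng.ev_add ng.ev_mult ng.ev_fx ng_sq by (simp add: negx_eq)
  with assms C have "rat_eval cf sqx A + rat_eval cf sqx A = 0" by (simp add: algebra_simps)
  then have "rat_eval cf sqx A = 0" by (rule double_eq_0)
  with C that show ?thesis by simp
qed

section \<open>The two quotients of a bielliptic curve of genus 2\<close>

lemma reverse_cubic:
  fixes x v :: "'a::comm_ring_1"
  assumes xv: "x * v = 1"
  shows "a3 + x * (a2 + x * (a1 + x * a0)) = x ^ 3 * (a0 + v * (a1 + v * (a2 + v * a3)))"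
    "x * (a2 + 2 * a1 * x + 3 * a0 * x * x) =
      3 * (a3 + x * (a2 + x * (a1 + x * a0))) - x * x * (a1 + 2 * a2 * v + 3 * a3 * v * v)"
proof -
  have "x ^ 3 * (a0 + v * (a1 + v * (a2 + v * a3))) =
     x * x * x * a0 + x * x * (x * v) * a1 + x * (x * v) * (x * v) * a2 + (x * v) * (x * v) * (x * v) * a3"
    by (simp add: algebra_simps power3_eq_cube)
  also have "\<dots> = x * x * x * a0 + x * x * a1 + x * a2 + a3" by (simp only: xv mult_1_right mult_1_left)
  finally show "a3 + x * (a2 + x * (a1 + x * a0)) = x ^ 3 * (a0 + v * (a1 + v * (a2 + v * a3)))"
    by (simp add: algebra_simps)
  have "x * x * (a1 + 2 * a2 * v + 3 * a3 * v * v) = x * x * a1 + 2 * a2 * x * (x * v) + 3 * a3 * ((x * v) * (x * v))"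
    by (simp add: algebra_simps)
  also have "\<dots> = x * x * a1 + 2 * a2 * x + 3 * a3" by (simp only: xv mult_1_right mult_1_left)
  finally show "x * (a2 + 2 * a1 * x + 3 * a0 * x * x) =
      3 * (a3 + x * (a2 + x * (a1 + x * a0))) - x * x * (a1 + 2 * a2 * v + 3 * a3 * v * v)"
    by (simp add: algebra_simps)
qed

text \<open>\<open>g1\<close> belongs to the quotient of C by (x, y) \<mapsto> (-x, y), the reversed
  cubic \<open>g2\<close> to the quotient by (x, y) \<mapsto> (-x, -y). Simplicity of the roots
  passes from \<open>g1\<close> to \<open>fC\<close> and \<open>g2\<close> because no root is
  0.\<close>

locale bielliptic =
  fixes c0 c1 c2 c3 :: rat and fC g1 g2 :: "rat poly"
  assumes c0: "c0 \<noteq> 0" and c3: "c3 \<noteq> 0"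
    and fC: "fC = [:c0, 0, c1, 0, c2, 0, c3:]" and g1: "g1 = [:c0, c1, c2, c3:]" and g2: "g2 = [:c3, c2, c1, c0:]"
    and simple1: "poly (base_change g1) x = 0 \<Longrightarrow> poly (pderiv (base_change g1)) x \<noteq> 0"
begin

lemma poly_fC: "poly (base_change fC) x = poly (base_change g1) (x\<^sup>2)"
  by (simp add: fC g1 algebra_simps power2_eq_square)

lemma poly_g2: "x \<noteq> 0 \<Longrightarrow> poly (base_change g2) x = x ^ 3 * poly (base_change g1) (1 / x)"
proof -
  assume x: "x \<noteq> 0"
  then have "x * (1 / x) = 1" by simp
  from reverse_cubic(1)[OF this] show ?thesis by (simp add: g1 g2)
qed

lemma poly_fC_0: "poly (base_change fC) 0 = to_ac c0" by (simp add: fC)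

lemma poly_fC_g2: "x \<noteq> 0 \<Longrightarrow> poly (base_change fC) x = x ^ 6 * poly (base_change g2) (1 / x\<^sup>2)"
proof -
  assume x: "x \<noteq> 0"
  then have "x ^ 6 * (1 / x\<^sup>2) ^ 3 = 1" by (simp add: power_divide flip: power_mult)
  then show ?thesis using x poly_g2[of "1 / x\<^sup>2"] by (simp add: poly_fC mult.assoc[symmetric])
qed

lemma curve_C: "curve fC 3"
proof
  show "poly (pderiv (base_change fC)) x \<noteq> 0" if "poly (base_change fC) x = 0" for x
  proof -
    have 1: "poly (base_change g1) (x\<^sup>2) = 0" using that by (simp add: poly_fC)
    have x: "x \<noteq> 0" using that c0 by (auto simp: fC)
    have "poly (pderiv (base_change fC)) x = 2 * x * poly (pderiv (base_change g1)) (x\<^sup>2)"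
      by (simp add: fC g1 pderiv_pCons algebra_simps power2_eq_square)
    then show ?thesis using simple1[OF 1] x by simp
  qed
qed (auto simp: fC c3)

lemma elliptic_1: "elliptic g1"
proof unfold_locales
  show "poly (pderiv (base_change g1)) x \<noteq> 0" if "poly (base_change g1) x = 0" for x using simple1[OF that] .
qed (auto simp: g1 c3)

lemma elliptic_2: "elliptic g2"
proof unfold_locales
  show "poly (pderiv (base_change g2)) x \<noteq> 0" if r: "poly (base_change g2) x = 0" for x
  proof -
    have x: "x \<noteq> 0" using r c3 by (auto simp: g2)
    have 1: "poly (base_change g1) (1 / x) = 0" using poly_g2[OF x] r x by simp
    have "x * poly (pderiv (base_change g2)) x = 3 * poly (base_change g2) x - x\<^sup>2 * poly (pderiv (base_change g1)) (1 / x)"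
    proof -
      have "x * (1 / x) = 1" using x by simp
      note rc = reverse_cubic(2)[OF this, of "to_ac c2" "to_ac c1" "to_ac c0" "to_ac c3"]
      have "poly (pderiv (base_change g2)) x = to_ac c2 + 2 * to_ac c1 * x + 3 * to_ac c0 * x * x"
        by (simp add: g2 pderiv_pCons algebra_simps)
      moreover have "poly (pderiv (base_change g1)) (1 / x) = to_ac c1 + 2 * to_ac c2 * (1 / x) + 3 * to_ac c3 * (1 / x) * (1 / x)"
        by (simp add: g1 pderiv_pCons algebra_simps add_divide_distrib)
      moreover have "poly (base_change g2) x = to_ac c3 + x * (to_ac c2 + x * (to_ac c1 + x * to_ac c0))"
        by (simp add: g2)
      ultimately show ?thesis using rc by (simp only: power2_eq_square)
    qed
    then show ?thesis using simple1[OF 1] x r by auto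
  qed
qed (auto simp: g2 c0)

sublocale C: curve fC 3 by (rule curve_C)
sublocale E1: elliptic g1 by (rule elliptic_1)
sublocale E2: elliptic g2 by (rule elliptic_2)

section \<open>Points, quotient maps and involutions\<close>

lemma point_Aff: "Aff x y \<in> points fC \<longleftrightarrow> y\<^sup>2 = poly (base_change fC) x" by (auto simp: points_def)
lemma point_Infty: "Infty s \<in> points fC \<longleftrightarrow> s\<^sup>2 = to_ac c3"
proof -
  have "coeff (base_change fC) 6 = to_ac c3" by (simp add: fC numeral_eq_Suc)
  then show ?thesis by (simp add: points_def C.half_deg)
qed

primrec chi :: "point \<Rightarrow> point" where
  "chi (Aff x y) = Aff (x\<^sup>2) y" | "chi (Infty s) = Infty 0"

primrec phi :: "point \<Rightarrow> point" where
  "phi (Aff x y) = (if x = 0 then Infty 0 else Aff (1 / x\<^sup>2) (y / x ^ 3))" | "phi (Infty s) = Aff 0 s"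

text \<open>\<epsilon> = 1 gives the involution with quotient map \<open>chi\<close>, \<epsilon> =
  -1 the one with quotient map \<open>phi\<close>. The sign at infinity comes from s = y /
  x^3.\<close>

primrec iot :: "qbar \<Rightarrow> point \<Rightarrow> point" where
  "iot \<epsilon> (Aff x y) = Aff (- x) (\<epsilon> * y)" | "iot \<epsilon> (Infty s) = Infty (- (\<epsilon> * s))"

lemma fx_minus: "to_fract [:- x, 1:] = fx - cf x" for x :: qbar
proof -
  have "to_fract [:- x, 1:] + cf x = fx" by (simp add: cf_def flip: to_fract_add)
  then show ?thesis by (simp add: eq_diff_eq)
qed

lemma aff_vpos:
  assumes "Aff x y \<in> points fC"
  shows "vpos (ord_at fC (Aff x y)) (fx - cf x, 0)" "vpos (ord_at fC (Aff x y)) (- cf y, 1)"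
    "vnn (ord_at fC (Aff x y)) (fx, 0)" "vnn (ord_at fC (Aff x y)) (0, 1)"
proof -
  let ?V = "ord_at fC (Aff x y)"
  interpret v: valuation C.F ?V by (rule C.valuation_ord[OF assms])
  note c = C.centredD[OF C.centred_ord_at(1)[OF assms]]
  show 1: "vpos ?V (fx - cf x, 0)" using c(2) by (simp add: vpos_def fx_minus)
  show 2: "vpos ?V (- cf y, 1)" using c(3) by simp
  have "vnn ?V ((fx - cf x, 0) + (cf x, 0))" by (intro v.vnn_add v.vpos_imp_vnn[OF 1] v.vnn_cf)
  then show "vnn ?V (fx, 0)" by simp
  have "vnn ?V ((- cf y, 1) + (cf y, 0))" by (intro v.vnn_add v.vpos_imp_vnn[OF 2] v.vnn_cf)
  then show "vnn ?V (0, 1)" by simp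
qed

lemma inf_vpos:
  assumes "Infty s \<in> points fC"
  shows "ord_at fC (Infty s) (1 / fx, 0) = 1" "vpos (ord_at fC (Infty s)) (- cf s, 1 / fx ^ 3)"
    "ord_at fC (Infty s) (0, 1 / fx ^ 3) = 0" "s \<noteq> 0"
proof -
  show s: "s \<noteq> 0" using assms c3 by (auto simp: point_Infty)
  show "ord_at fC (Infty s) (1 / fx, 0) = 1" using C.ord_loc_par[OF assms] s by (simp add: C.ram_def)
  show "vpos (ord_at fC (Infty s)) (- cf s, 1 / fx ^ 3)"
    using C.centredD(3)[OF C.centred_ord_at(1)[OF assms]] by simp
  show "ord_at fC (Infty s) (0, 1 / fx ^ 3) = 0" using C.ord_z[OF assms] s by simp
qed

text \<open>At affine points x^2 - x0^2 has the factor x - x0. At infinity the chart coordinates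
  pull back to 1/x^2 and y / x^4 = (1/x) (y / x^3), which vanish there.\<close>

lemma chi_special: "special_map fC 3 g1 2 sqx 1 chi"
proof unfold_locales
  show "(1::qbar poly fract)\<^sup>2 * to_fract C.F = rat_eval cf sqx (to_fract E1.F)"
    unfolding sq.ev_to_fract poly_map_cf_to_fract by (simp add: fC g1 pcompose_pCons)
next
  fix P assume P: "P \<in> points fC"
  interpret v: valuation C.F "ord_at fC P" by (rule C.valuation_ord[OF P])
  show "chi P \<in> points g1"
  proof (cases P)
    case (Aff x y)
    then show ?thesis using P by (simp add: point_Aff poly_fC) (simp add: points_def)
  qed simp
  show "vpos (ord_at fC P) (pull sqx 1 (loc_par (chi P), 0))"
  proof (cases P)
    case (Aff x y)
    note a = aff_vpos[OF P[unfolded Aff]]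
    have "pull sqx 1 (loc_par (chi P), 0) = C.rmul_F (fx - cf x, 0) ((fx, 0) + (cf x, 0))"
      unfolding Aff by (simp add: pull_def fx_minus sq.ev_diff C.rmul_x) (simp add: sqx_eq cf_mult power2_eq_square algebra_simps)
    moreover have "vnn (ord_at fC P) ((fx, 0) + (cf x, 0))" using a unfolding Aff[symmetric] by (intro v.vnn_add v.vnn_cf) auto
    ultimately show ?thesis using v.vpos_mult a(1) unfolding Aff[symmetric] by simp
  next
    case (Infty s)
    note a = inf_vpos[OF P[unfolded Infty]]
    have i: "vpos (ord_at fC P) (1 / fx, 0)" using a(1) unfolding Infty by (simp add: vpos_def)
    have "pull sqx 1 (loc_par (chi P), 0) = C.rmul_F (1 / fx, 0) (1 / fx, 0)"
      unfolding Infty by (simp add: pull_def sq.ev_divide C.rmul_x) (simp add: sqx_eq)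
    then show ?thesis using v.vpos_mult[OF i v.vpos_imp_vnn[OF i]] by simp
  qed
  show "vpos (ord_at fC P) (pull sqx 1 ((0, loc_b 2 (chi P)) - (cf (loc_val (chi P)), 0)))"
  proof (cases P)
    case (Aff x y)
    then show ?thesis using aff_vpos(2)[OF P[unfolded Aff]] by (simp add: pull_def sq.ev_minus)
  next
    case (Infty s)
    note a = inf_vpos[OF P[unfolded Infty]]
    have i: "vpos (ord_at fC P) (1 / fx, 0)" "vnn (ord_at fC P) (0, 1 / fx ^ 3)"
      using a(1,3) unfolding Infty by (simp_all add: vpos_def vnn_def)
    have "pull sqx 1 ((0, loc_b 2 (chi P)) - (cf (loc_val (chi P)), 0)) = C.rmul_F (1 / fx, 0) (0, 1 / fx ^ 3)"
      unfolding Infty by (simp add: pull_def sq.ev_divide sq.ev_power C.rmul_x) (simp add: sqx_eq power2_eq_square power3_eq_cube)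
    then show ?thesis using v.vpos_mult[OF i] by simp
  qed
qed simp

text \<open>Over x = 0 the image is the origin and its chart coordinates pull back to x^2 and x y;
  elsewhere the affine coordinates pull back to 1/x^2 and y / x^3.\<close>

lemma phi_special: "special_map fC 3 g2 2 (1 / sqx) (1 / fx ^ 3) phi"
proof -
  interpret i: rat_evaluation cf "1 / sqx" by (rule rat_evaluation_invsq)
  show ?thesis
  proof unfold_locales
    define z where "z = (fx :: qbar poly fract)"
    have z: "z \<noteq> 0" by (simp add: z_def)
    have "to_fract C.F = poly (map_poly cf C.F) z" unfolding z_def by (rule to_fract_poly)
    then show "(1 / fx ^ 3)\<^sup>2 * to_fract C.F = i.ev (to_fract E2.F)"
      using z unfolding i.ev_to_fract unfolding sqx_eq z_def[symmetric]
      by (simp add: fC g2 map_poly_pCons field_simps power2_eq_square power3_eq_cube)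
  next
    fix P assume P: "P \<in> points fC"
    interpret v: valuation C.F "ord_at fC P" by (rule C.valuation_ord[OF P])
    show "phi P \<in> points g2"
    proof (cases P)
      case (Aff x y)
      show ?thesis
      proof (cases "x = 0")
        case False
        have "(y / x ^ 3)\<^sup>2 = poly E2.F (1 / x\<^sup>2)"
          using P False poly_fC_g2[OF False] by (simp add: Aff point_Aff power_divide flip: power_mult)
        then show ?thesis using False Aff by (auto simp: points_def)
      qed (simp add: Aff)
    next
      case (Infty s)
      then show ?thesis using P by (simp add: point_Infty) (simp add: points_def g2)
    qed
    show "vpos (ord_at fC P) (pull (1 / sqx) (1 / fx ^ 3) (loc_par (phi P), 0))"
    proof (cases P)
      case (Aff x y)
      note a = aff_vpos[OF P[unfolded Aff], folded Aff]
      show ?thesis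
      proof (cases "x = 0")
        case True
        have "pull (1 / sqx) (1 / fx ^ 3) (loc_par (phi P), 0) = C.rmul_F (fx, 0) (fx, 0)"
          unfolding Aff by (simp add: True pull_def i.ev_divide C.rmul_x) (simp add: sqx_eq)
        then show ?thesis using a True v.vpos_mult[of "(fx, 0)" "(fx, 0)"] by simp
      next
        case False
        have x: "vpos (ord_at fC P) ((fx, 0) - (cf x, 0))" using a by simp
        have ix: "vpos (ord_at fC P) ((1 / fx, 0) - (cf (1 / x), 0))"
          by (rule v.vpos_inverse_value[OF x False]) (simp add: C.rmul_x)
        have "pull (1 / sqx) (1 / fx ^ 3) (loc_par (phi P), 0) = C.rmul_F (1 / fx, 0) (1 / fx, 0) - (cf (1 / x * (1 / x)), 0)"
          unfolding Aff using False by (simp add: pull_def fx_minus i.ev_diff C.rmul_x) (simp add: sqx_eq power2_eq_square)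
        then show ?thesis using v.vpos_mult_values[OF ix ix] by simp
      qed
    next
      case (Infty s)
      note a = inf_vpos[OF P[unfolded Infty], folded Infty]
      have i: "vpos (ord_at fC P) (1 / fx, 0)" using a(1) by (simp add: vpos_def)
      have "pull (1 / sqx) (1 / fx ^ 3) (loc_par (phi P), 0) = C.rmul_F (1 / fx, 0) (1 / fx, 0)"
        unfolding Infty by (simp add: pull_def C.rmul_x) (simp add: sqx_eq)
      then show ?thesis using v.vpos_mult[OF i v.vpos_imp_vnn[OF i]] by simp
    qed
    show "vpos (ord_at fC P) (pull (1 / sqx) (1 / fx ^ 3) ((0, loc_b 2 (phi P)) - (cf (loc_val (phi P)), 0)))"
    proof (cases P)
      case (Aff x y)
      note a = aff_vpos[OF P[unfolded Aff], folded Aff]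
      show ?thesis
      proof (cases "x = 0")
        case True
        have "pull (1 / sqx) (1 / fx ^ 3) ((0, loc_b 2 (phi P)) - (cf (loc_val (phi P)), 0)) = C.rmul_F (fx, 0) (0, 1)"
          unfolding Aff by (simp add: True pull_def i.ev_divide i.ev_power C.rmul_x) (simp add: sqx_eq power2_eq_square power3_eq_cube)
        then show ?thesis using a True v.vpos_mult[of "(fx, 0)" "(0, 1)"] by simp
      next
        case False
        have x: "vpos (ord_at fC P) ((fx, 0) - (cf x, 0))" and y: "vpos (ord_at fC P) ((0, 1) - (cf y, 0))" using a by simp_all
        have ix: "vpos (ord_at fC P) ((1 / fx, 0) - (cf (1 / x), 0))"
          by (rule v.vpos_inverse_value[OF x False]) (simp add: C.rmul_x)
        have "pull (1 / sqx) (1 / fx ^ 3) ((0, loc_b 2 (phi P)) - (cf (loc_val (phi P)), 0)) =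
           C.rmul_F (0, 1) (C.rmul_F (1 / fx, 0) (C.rmul_F (1 / fx, 0) (1 / fx, 0))) - (cf (y * (1 / x * (1 / x * (1 / x)))), 0)"
          unfolding Aff using False by (simp add: pull_def i.ev_minus C.rmul_x power3_eq_cube)
        then show ?thesis using v.vpos_mult_values[OF y v.vpos_mult_values[OF ix v.vpos_mult_values[OF ix ix]]] by simp
      qed
    next
      case (Infty s)
      show ?thesis using inf_vpos(2)[OF P[unfolded Infty]] by (simp add: Infty pull_def i.ev_minus)
    qed
  qed simp
qed

lemma iot_special:
  assumes e: "\<epsilon> * \<epsilon> = 1"
  shows "special_map fC 3 fC 3 negx (cf \<epsilon>) (iot \<epsilon>)"
proof unfold_locales
  show "cf \<epsilon> \<noteq> 0" using e by auto
  have "pcompose C.F [:0, - 1:] = C.F" by (simp add: fC pcompose_pCons)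
  then show "(cf \<epsilon>)\<^sup>2 * to_fract C.F = rat_eval cf negx (to_fract C.F)"
    unfolding ng.ev_to_fract poly_map_cf_to_fract using e by (simp add: power2_eq_square flip: cf_mult)
next
  fix P assume P: "P \<in> points fC"
  interpret v: valuation C.F "ord_at fC P" by (rule C.valuation_ord[OF P])
  note cen = C.centredD[OF C.centred_ord_at(1)[OF P]]
  have e2: "(\<epsilon> * y)\<^sup>2 = y\<^sup>2" for y using e by (simp add: power2_eq_square algebra_simps)
  show "iot \<epsilon> P \<in> points fC" using P by (cases P) (auto simp: point_Aff point_Infty poly_fC e2)
  have "pull negx (cf \<epsilon>) (loc_par (iot \<epsilon> P), 0) = - (loc_par P, 0)"
  proof (cases P)
    case (Aff x y)
    have "to_fract [:x, 1:] = fx + cf x" by (simp add: cf_def flip: to_fract_add)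
    then have "pull negx (cf \<epsilon>) (loc_par (iot \<epsilon> P), 0) = (negx + cf x, 0)"
      by (simp add: Aff pull_def ng.ev_add)
    then show ?thesis by (simp add: Aff fx_minus negx_eq)
  next
    case (Infty s)
    have "pull negx (cf \<epsilon>) (loc_par (iot \<epsilon> P), 0) = (1 / negx, 0)"
      by (simp add: Infty pull_def ng.ev_divide)
    then show ?thesis by (simp add: Infty negx_eq)
  qed
  then show "vpos (ord_at fC P) (pull negx (cf \<epsilon>) (loc_par (iot \<epsilon> P), 0))"
    using cen(2) by (simp only: v.vpos_uminus) (simp add: vpos_def)
  show "vpos (ord_at fC P) (pull negx (cf \<epsilon>) ((0, loc_b 3 (iot \<epsilon> P)) - (cf (loc_val (iot \<epsilon> P)), 0)))"
  proof (cases P)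
    case (Aff x y)
    have "pull negx (cf \<epsilon>) ((0, loc_b 3 (iot \<epsilon> P)) - (cf (loc_val (iot \<epsilon> P)), 0)) =
        C.rmul_F (cf \<epsilon>, 0) ((0, loc_b 3 P) - (cf (loc_val P), 0))"
      by (simp add: Aff pull_def ng.ev_minus ng.ev_mult C.rmul_x cf_mult)
    then show ?thesis using v.vpos_smult[OF cen(3), of \<epsilon>] by simp
  next
    case (Infty s)
    have "pull negx (cf \<epsilon>) ((0, loc_b 3 (iot \<epsilon> P)) - (cf (loc_val (iot \<epsilon> P)), 0)) =
        C.rmul_F (cf (- \<epsilon>), 0) ((0, loc_b 3 P) - (cf (loc_val P), 0))"
      by (simp add: Infty pull_def ng.ev_minus ng.ev_divide ng.ev_power C.rmul_x cf_mult cf_minus ng.ev_mult) (simp add: negx_eq)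
    then show ?thesis using v.vpos_smult[OF cen(3), of "- \<epsilon>"] by simp
  qed
qed

sublocale chi: special_map fC 3 g1 2 sqx 1 chi by (rule chi_special)
sublocale phi: special_map fC 3 g2 2 "1 / sqx" "1 / fx ^ 3" phi by (rule phi_special)

lemma iot_iot: "\<epsilon> * \<epsilon> = 1 \<Longrightarrow> iot \<epsilon> (iot \<epsilon> P) = P"
  by (cases P) (auto simp flip: mult.assoc)

lemma iot_points: "\<epsilon> * \<epsilon> = 1 \<Longrightarrow> P \<in> points fC \<Longrightarrow> iot \<epsilon> P \<in> points fC"
  by (rule special_map.pt[OF iot_special])

lemma iot_pull_pull: "\<epsilon> * \<epsilon> = 1 \<Longrightarrow> pull negx (cf \<epsilon>) (pull negx (cf \<epsilon>) h) = h"
  by (simp add: pull_def ng.ev_mult ng_ng mult.assoc prod_eq_iff flip: cf_mult)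

lemma iot_ord:
  assumes e: "\<epsilon> * \<epsilon> = 1" and P: "P \<in> points fC" and h: "h \<noteq> 0"
  shows "ord_at fC P (pull negx (cf \<epsilon>) h) = ord_at fC (iot \<epsilon> P) h"
  using special_map.iso_ord(1)[OF iot_special[OF e] iot_special[OF e] iot_pull_pull[OF e] iot_iot[OF e] iot_points[OF e P] h]
  by (simp add: iot_iot[OF e])

text \<open>The product of \<open>h\<close> with its image under the involution is invariant, so
  both of its components are even functions of x, that is, functions of x^2.\<close>

lemma chi_norm: "\<exists>H. pull sqx 1 H = C.rmul_F h (pull negx (cf 1) h)"
proof -
  define k where "k = C.rmul_F h (pull negx (cf 1) h)"
  interpret i: special_map fC 3 fC 3 negx "cf 1" "iot 1" by (rule iot_special) simp
  have "pull negx (cf 1) k = k"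
  proof -
    have "pull negx (cf 1) (pull negx (cf 1) h) = h" by (rule iot_pull_pull) simp
    then show ?thesis unfolding k_def i.pb_mult by (simp only: C.rmul_commute)
  qed
  then have "rat_eval cf negx (fst k) = fst k" "rat_eval cf negx (snd k) = snd k"
    by (simp_all add: pull_def prod_eq_iff)
  then obtain A B where "fst k = rat_eval cf sqx A" "snd k = rat_eval cf sqx B" using even_fract by metis
  then have "pull sqx 1 (A, B) = k" by (simp add: pull_def prod_eq_iff)
  then show ?thesis unfolding k_def by blast
qed

text \<open>Invariance now makes the first component even and the second odd; multiplied by x^3 the
  latter becomes even, and even functions are functions of 1/x^2.\<close>

lemma phi_norm: "\<exists>H. pull (1 / sqx) (1 / fx ^ 3) H = C.rmul_F h (pull negx (cf (- 1)) h)"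
proof -
  define k where "k = C.rmul_F h (pull negx (cf (- 1)) h)"
  interpret i: special_map fC 3 fC 3 negx "cf (- 1)" "iot (- 1)" by (rule iot_special) simp
  interpret s: rat_evaluation cf "1 / sqx" by (rule rat_evaluation_invsq)
  have "pull negx (cf (- 1)) k = k"
  proof -
    have "pull negx (cf (- 1)) (pull negx (cf (- 1)) h) = h" by (rule iot_pull_pull) simp
    then show ?thesis unfolding k_def i.pb_mult by (simp only: C.rmul_commute)
  qed
  then have e: "rat_eval cf negx (fst k) = fst k" "rat_eval cf negx (snd k) = - snd k"
    by (auto simp: pull_def prod_eq_iff cf_minus minus_equation_iff)
  obtain A where A: "fst k = rat_eval cf sqx A" using even_fract[OF e(1)] .
  obtain B where B: "snd k = fx * rat_eval cf sqx B" using odd_fract[OF e(2)] .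
  have "snd k * fx ^ 3 = rat_eval cf sqx (fx * fx * B)"
    unfolding B sq.ev_mult sq.ev_fx by (simp add: sqx_eq power3_eq_cube)
  then have "snd k = rat_eval cf sqx (fx * fx * B) / fx ^ 3" by (simp add: eq_divide_eq)
  then have "pull (1 / sqx) (1 / fx ^ 3) (rat_eval cf (1 / fx) A, rat_eval cf (1 / fx) (fx * fx * B)) = k"
    using A by (simp add: pull_def prod_eq_iff sq_range_invsq)
  then show ?thesis unfolding k_def by blast
qed

section \<open>Fibres and ramification of the quotient maps\<close>

lemma chi_fibre: "P \<in> points fC \<Longrightarrow> Q \<in> points fC \<Longrightarrow> chi Q = chi P \<longleftrightarrow> Q = P \<or> Q = iot 1 P"
proof (cases P; cases Q)
  fix s s' assume "P \<in> points fC" "Q \<in> points fC" and *: "P = Infty s" "Q = Infty s'"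
  then have "s'\<^sup>2 = s\<^sup>2" by (simp add: point_Infty)
  then show ?thesis using * by (auto simp: power2_eq_iff)
qed (auto simp: power2_eq_iff)

lemma phi_fibre: "P \<in> points fC \<Longrightarrow> Q \<in> points fC \<Longrightarrow> phi Q = phi P \<longleftrightarrow> Q = P \<or> Q = iot (- 1) P"
proof (cases P; cases Q)
  fix x y x' y' assume pts: "P \<in> points fC" "Q \<in> points fC" and *: "P = Aff x y" "Q = Aff x' y'"
  show ?thesis
  proof (cases "x = 0 \<or> x' = 0")
    case True
    show ?thesis
    proof (cases "x = 0 \<and> x' = 0")
      case True
      then have "y'\<^sup>2 = y\<^sup>2" using pts * by (simp add: point_Aff)
      then show ?thesis using * True by (auto simp: power2_eq_iff)
    qed (use True * in auto)
  next
    case False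
    have "1 / x'\<^sup>2 = 1 / x\<^sup>2 \<longleftrightarrow> x' = x \<or> x' = - x" using False by (auto simp: power2_eq_iff)
    moreover have "- (y' / x ^ 3) = y / x ^ 3 \<longleftrightarrow> y' = - y"
    proof -
      have "- (y' / x ^ 3) = (- y') / x ^ 3" by simp
      moreover have "(- y') / x ^ 3 = y / x ^ 3 \<longleftrightarrow> - y' = y" using False by (simp only: divide_cancel_right) simp
      ultimately show ?thesis by auto
    qed
    ultimately show ?thesis using * False by auto
  qed
qed auto

lemma chi_surj: "R \<in> points g1 \<Longrightarrow> \<exists>P\<in>points fC. chi P = R"
proof (cases R)
  case (Aff a y)
  assume R: "R \<in> points g1"
  obtain x where x: "x\<^sup>2 = a" using nth_root_exists[of 2 a] by auto
  then have "Aff x y \<in> points fC" using R Aff by (auto simp: point_Aff poly_fC points_def)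
  then show ?thesis using Aff x by (intro bexI[of _ "Aff x y"]) auto
next
  case (Infty s)
  assume R: "R \<in> points g1"
  obtain s' where "s'\<^sup>2 = to_ac c3" using nth_root_exists[of 2 "to_ac c3"] by auto
  then show ?thesis using R Infty E1.infinity_only by (intro bexI[of _ "Infty s'"]) (auto simp: point_Infty)
qed

lemma phi_surj: "R \<in> points g2 \<Longrightarrow> \<exists>P\<in>points fC. phi P = R"
proof (cases R)
  case (Aff a y)
  assume R: "R \<in> points g2"
  then have y: "y\<^sup>2 = poly E2.F a" using Aff by (auto simp: points_def)
  show ?thesis
  proof (cases "a = 0")
    case True
    then show ?thesis using y Aff by (intro bexI[of _ "Infty y"]) (auto simp: point_Infty g2)
  next
    case False
    obtain b where b: "b\<^sup>2 = a" using nth_root_exists[of 2 a] by auto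
    then have bnz: "b \<noteq> 0" using False by auto
    have "(y * (1 / b) ^ 3)\<^sup>2 = poly C.F (1 / b)"
      using poly_fC_g2[of "1 / b"] bnz y b by (simp add: power_divide flip: power_mult)
    then have "Aff (1 / b) (y * (1 / b) ^ 3) \<in> points fC" by (simp add: point_Aff)
    moreover have "phi (Aff (1 / b) (y * (1 / b) ^ 3)) = R" using Aff b bnz by (simp add: power_divide)
    ultimately show ?thesis by blast
  qed
next
  case (Infty s)
  assume R: "R \<in> points g2"
  obtain y where "y\<^sup>2 = to_ac c0" using nth_root_exists[of 2 "to_ac c0"] by auto
  then show ?thesis using R Infty E2.infinity_only by (intro bexI[of _ "Aff 0 y"]) (auto simp: point_Aff poly_fC_0)
qed

lemma vunit: "Aff x y \<in> points fC \<Longrightarrow> a + x \<noteq> 0 \<Longrightarrow> ord_at fC (Aff x y) (fx + cf a, 0) = 0"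
proof -
  assume P: "Aff x y \<in> points fC" and a: "a + x \<noteq> 0"
  interpret v: valuation C.F "ord_at fC (Aff x y)" by (rule C.valuation_ord[OF P])
  have "(fx + cf a, 0) - (cf (a + x), 0) = ((fx - cf x, 0) :: ratfun)" by (simp add: cf_add)
  then have "vpos (ord_at fC (Aff x y)) ((fx + cf a, 0) - (cf (a + x), 0))" using aff_vpos(1)[OF P] by (simp only:)
  from v.V_unit[OF this a] show ?thesis by simp
qed

lemma ord_fx_minus: "Aff x y \<in> points fC \<Longrightarrow> y \<noteq> 0 \<Longrightarrow> ord_at fC (Aff x y) (fx - cf x, 0) = 1"
  using C.ord_loc_par[of "Aff x y"] by (simp add: C.ram_def fx_minus)

lemma pair_nz: "A \<noteq> 0 \<Longrightarrow> (A, B) \<noteq> (0::ratfun)" "B \<noteq> 0 \<Longrightarrow> (A, B) \<noteq> (0::ratfun)"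
  by (simp_all add: zero_prod_def)

lemma fx_cf_nz: "fx + cf a \<noteq> 0" "fx - cf a \<noteq> 0" for a :: qbar
proof -
  have "fx + cf a = to_fract [:a, 1:]" by (simp add: cf_def flip: to_fract_add)
  moreover have "fx - cf a = to_fract [:- a, 1:]" by (simp only: fx_minus)
  ultimately show "fx + cf a \<noteq> 0" "fx - cf a \<noteq> 0" by simp_all
qed

lemma fx_ne_cf: "fx \<noteq> cf a" for a :: qbar
  using fx_cf_nz(2)[of a] by auto

text \<open>The involution fixes the points over x = 0, where y is nonzero because c0 is, and x^2
  has order 2 there. At the other affine points with y nonzero, x + x0 is a unit; where y = 0 the
  uniformizer y pulls back to itself.\<close>

lemma chi_ram: "P \<in> points fC \<Longrightarrow> chi.ram_index P = (if iot 1 P = P then 2 else 1)"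
proof (cases P)
  case (Aff x y)
  assume P: "P \<in> points fC"
  have x: "x \<noteq> 0 \<or> y \<noteq> 0" using P c0 poly_fC_0 by (auto simp: Aff point_Aff)
  have fixed: "iot 1 P = P \<longleftrightarrow> x = 0" using Aff by (auto simp: neg_eq_iff_add_eq_0 simp flip: mult_2)
  show ?thesis
  proof (cases "y = 0")
    case True
    have "chi.ram_index P = ord_at fC P (0, 1)" by (simp add: chi.ram_index_def Aff True loc_unif_def pull_def)
    then show ?thesis using C.ord_z[OF P] True x fixed by (simp add: Aff)
  next
    case False
    have "pull sqx 1 (loc_unif 2 (chi P)) = C.rmul_F (fx - cf x, 0) (fx + cf x, 0)"
      unfolding Aff using False
      by (simp add: pull_def loc_unif_def fx_minus sq.ev_diff C.rmul_x) (simp add: sqx_eq cf_mult power2_eq_square algebra_simps)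
    then have "chi.ram_index P = ord_at fC P (fx - cf x, 0) + ord_at fC P (fx + cf x, 0)"
      unfolding chi.ram_index_def using C.ord_mult[OF P] by (simp add: pair_nz fx_cf_nz fx_ne_cf)
    moreover have "ord_at fC P (fx + cf x, 0) = (if x = 0 then 1 else 0)"
    proof (cases "x = 0")
      case True
      then show ?thesis using ord_fx_minus[OF P[unfolded Aff] False] by (simp add: Aff)
    next
      case xn: False
      have "x + x \<noteq> 0" using xn by (simp flip: mult_2)
      then show ?thesis using vunit[OF P[unfolded Aff]] xn by (simp add: Aff)
    qed
    ultimately show ?thesis using ord_fx_minus[OF P[unfolded Aff] False] fixed by (simp add: Aff)
  qed
next
  case (Infty s)
  assume P: "P \<in> points fC"
  note a = inf_vpos[OF P[unfolded Infty], folded Infty]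
  have "pull sqx 1 (loc_unif 2 (chi P)) = C.rmul_F (1 / fx, 0) (0, 1 / fx ^ 3)"
    unfolding Infty by (simp add: pull_def loc_unif_def sq.ev_divide sq.ev_power C.rmul_x) (simp add: sqx_eq power2_eq_square power3_eq_cube)
  then have "chi.ram_index P = 1" unfolding chi.ram_index_def using C.ord_mult[OF P, of "(1 / fx, 0)" "(0, 1 / fx ^ 3)"] a
    by (simp add: pair_nz)
  moreover have "iot 1 P \<noteq> P" using a(4) Infty by (auto simp: neg_eq_iff_add_eq_0 simp flip: mult_2)
  ultimately show ?thesis by simp
qed

text \<open>Here the fixed points are those at infinity, where the uniformizer of the image pulls
  back to 1/x^2, of order 2. At x = 0 it pulls back to x y with y a unit.\<close>

lemma phi_ram: "P \<in> points fC \<Longrightarrow> phi.ram_index P = (if iot (- 1) P = P then 2 else 1)"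
proof (cases P)
  case (Aff x y)
  assume P: "P \<in> points fC"
  interpret i: rat_evaluation cf "1 / sqx" by (rule rat_evaluation_invsq)
  interpret v: valuation C.F "ord_at fC P" by (rule C.valuation_ord[OF P])
  have xy: "x \<noteq> 0 \<or> y \<noteq> 0" using P c0 poly_fC_0 by (auto simp: Aff point_Aff)
  have nf: "iot (- 1) P \<noteq> P" using xy Aff by (auto simp: neg_eq_iff_add_eq_0 simp flip: mult_2)
  show ?thesis
  proof (cases "x = 0")
    case True
    then have y: "y \<noteq> 0" using xy by simp
    have "pull (1 / sqx) (1 / fx ^ 3) (loc_unif 2 (phi P)) = C.rmul_F (fx, 0) (0, 1)"
      unfolding Aff by (simp add: True pull_def loc_unif_def i.ev_divide i.ev_power C.rmul_x) (simp add: sqx_eq power2_eq_square power3_eq_cube)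
    then have "phi.ram_index P = ord_at fC P (fx, 0) + ord_at fC P (0, 1)"
      unfolding phi.ram_index_def using C.ord_mult[OF P, of "(fx, 0)" "(0, 1)"] by (simp add: pair_nz)
    then show ?thesis using ord_fx_minus[OF P[unfolded Aff] y] C.ord_z[OF P] True y nf by (simp add: Aff)
  next
    case False
    have f0: "ord_at fC P (fx, 0) = 0" using vunit[OF P[unfolded Aff], of 0] False by (simp add: Aff)
    have inv0: "ord_at fC P (1 / fx, 0) = 0"
      using C.ord_mult[OF P, of "(1 / fx, 0)" "(fx, 0)"] f0 v.V_one by (simp add: pair_nz C.rmul_x)
    show ?thesis
    proof (cases "y = 0")
      case True
      have "pull (1 / sqx) (1 / fx ^ 3) (loc_unif 2 (phi P)) = C.rmul_F (1 / fx, 0) (C.rmul_F (1 / fx, 0) (C.rmul_F (1 / fx, 0) (0, 1)))"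
        unfolding Aff using False True by (simp add: pull_def loc_unif_def C.rmul_x power3_eq_cube)
      moreover have "ord_at fC P (0, 1) = 1" using C.ord_z[OF P] True by (simp add: Aff)
      ultimately have "phi.ram_index P = 1" unfolding phi.ram_index_def
        using inv0 by (simp add: C.ord_mult[OF P] pair_nz)
      then show ?thesis using nf by simp
    next
      case yn: False
      have "(1 / fx * (1 / fx) - cf (1 / x\<^sup>2)) = (1 / fx) * ((1 / fx) * (cf (- 1 / x\<^sup>2) * ((fx - cf x) * (fx + cf x))))"
      proof -
        have c: "cf (- 1 / x\<^sup>2) * (cf x * cf x) = - 1"
          using False by (simp add: power2_eq_square cf_minus flip: cf_mult)
        have c2: "cf (- 1 / x\<^sup>2) = - cf (1 / x\<^sup>2)" by (simp flip: cf_minus)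
        have "cf (- 1 / x\<^sup>2) * ((fx - cf x) * (fx + cf x)) = 1 - cf (1 / x\<^sup>2) * (fx * fx)"
          using c unfolding c2 by (simp add: algebra_simps)
        then show ?thesis by (simp add: right_diff_distrib)
      qed
      then have "pull (1 / sqx) (1 / fx ^ 3) (loc_unif 2 (phi P)) =
        C.rmul_F (1 / fx, 0) (C.rmul_F (1 / fx, 0) (C.rmul_F (cf (- 1 / x\<^sup>2), 0) (C.rmul_F (fx - cf x, 0) (fx + cf x, 0))))"
        unfolding Aff using False yn by (simp add: pull_def loc_unif_def fx_minus i.ev_diff C.rmul_x) (simp add: sqx_eq mult.commute mult.left_commute)
      moreover have "ord_at fC P (fx + cf x, 0) = 0"
      proof -
        have "x + x \<noteq> 0" using False by (simp flip: mult_2)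
        then show ?thesis using vunit[OF P[unfolded Aff]] by (simp add: Aff)
      qed
      moreover have "ord_at fC P (cf (- 1 / x\<^sup>2), 0) = 0" using False by (intro v.V_cf) simp
      moreover have "cf (- 1 / x\<^sup>2) \<noteq> 0" using False by simp
      ultimately have "phi.ram_index P = 1" unfolding phi.ram_index_def
        using inv0 ord_fx_minus[OF P[unfolded Aff] yn, folded Aff] by (simp add: C.ord_mult[OF P] pair_nz fx_cf_nz fx_ne_cf del: divide_minus_left)
      then show ?thesis using nf by simp
    qed
  qed
next
  case (Infty s)
  assume P: "P \<in> points fC"
  interpret i: rat_evaluation cf "1 / sqx" by (rule rat_evaluation_invsq)
  note a = inf_vpos[OF P[unfolded Infty], folded Infty]
  have "pull (1 / sqx) (1 / fx ^ 3) (loc_unif 2 (phi P)) = C.rmul_F (1 / fx, 0) (1 / fx, 0)"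
    unfolding Infty using a(4) by (simp add: pull_def loc_unif_def C.rmul_x) (simp add: sqx_eq)
  then have "phi.ram_index P = 2" unfolding phi.ram_index_def using C.ord_mult[OF P, of "(1 / fx, 0)" "(1 / fx, 0)"] a
    by (simp add: pair_nz)
  then show ?thesis using Infty by simp
qed

lemma chi_push: "D \<in> principal fC \<Longrightarrow> frag_extend (frag_of \<circ> chi) D \<in> principal g1"
  by (rule chi.push_principal[where \<iota> = "iot 1" and iota = "pull negx (cf 1)"])
     (use iot_points[of 1] iot_ord[of 1] special_map.pb_eq_0_iff[OF iot_special[of 1]] chi_norm chi_fibre chi_surj chi_ram in auto)

lemma phi_push: "D \<in> principal fC \<Longrightarrow> frag_extend (frag_of \<circ> phi) D \<in> principal g2"
  by (rule phi.push_principal[where \<iota> = "iot (- 1)" and iota = "pull negx (cf (- 1))"])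
     (use iot_points[of "- 1"] iot_ord[of "- 1"] special_map.pb_eq_0_iff[OF iot_special[of "- 1"]] phi_norm phi_fibre phi_surj phi_ram in auto)

end

section \<open>Chords and tangents\<close>

text \<open>Comparison of the coefficients of F - (l x + m)^2 and k3 (x - x1)(x - x2)(x - x3). The
  condition on \<open>l\<close> is the chord condition with the factor x2 - x1 divided out, so it
  covers tangents as well.\<close>

lemma chord_identities:
  fixes k0 k1 k2 k3 x1 x2 x3 y1 l :: "'a::field"
  assumes "y1 * y1 = k0 + x1 * (k1 + x1 * (k2 + x1 * k3))"
    and "l * (2 * y1 + l * (x2 - x1)) = k3 * x2 * x2 + (k2 + k3 * x1) * x2 + (k1 + k2 * x1 + k3 * x1 * x1)"
    and "k3 * x3 = l * l - k2 - k3 * x1 - k3 * x2"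
  shows "k1 - 2 * l * (y1 - l * x1) = k3 * (x1 * x2 + x1 * x3 + x2 * x3)"
    and "k0 - (y1 - l * x1) * (y1 - l * x1) = - (k3 * x1 * x2 * x3)"
proof -
  have k1: "k1 = l * (2 * y1 + l * (x2 - x1)) - k3 * x2 * x2 - (k2 + k3 * x1) * x2 - k2 * x1 - k3 * x1 * x1"
    using assms(2) by (simp add: algebra_simps)
  have a: "k3 * (x1 * x2 + x1 * x3 + x2 * x3) = k3 * x1 * x2 + (x1 + x2) * (k3 * x3)" by (simp add: algebra_simps)
  show 1: "k1 - 2 * l * (y1 - l * x1) = k3 * (x1 * x2 + x1 * x3 + x2 * x3)"
    unfolding a assms(3) by (subst k1) (simp add: algebra_simps)
  have k0: "k0 = y1 * y1 - x1 * (k1 + x1 * (k2 + x1 * k3))" using assms(1) by (simp add: algebra_simps)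
  have b: "k3 * x1 * x2 * x3 = x1 * x2 * (k3 * x3)" by (simp add: algebra_simps)
  have "k0 - (y1 - l * x1) * (y1 - l * x1) = - (x1 * (k1 - 2 * l * (y1 - l * x1)) + x1 * x1 * (k2 + x1 * k3) - l * l * x1 * x1)"
    by (subst k0) (simp add: algebra_simps)
  also have "\<dots> = - (k3 * x1 * x2 * x3)"
    unfolding 1 a b unfolding assms(3) by (simp add: algebra_simps)
  finally show "k0 - (y1 - l * x1) * (y1 - l * x1) = - (k3 * x1 * x2 * x3)" .
qed

context elliptic
begin

definition "k0 = coeff F 0"
definition "k1 = coeff F 1"
definition "k2 = coeff F 2"
definition "k3 = coeff F 3"

lemma F_cubic: "F = [:k0, k1, k2, k3:]"
proof (rule poly_eqI)
  fix n :: nat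
  consider "n = 0" | "n = 1" | "n = 2" | "n = 3" | "n > 3" by linarith
  then show "coeff F n = coeff [:k0, k1, k2, k3:] n"
  proof cases
    case 5
    then have "coeff F n = 0" using degF deg3 by (simp add: coeff_eq_0)
    moreover have "coeff [:k0, k1, k2, k3:] n = 0" using 5 by (intro coeff_eq_0) (auto intro: le_less_trans[OF degree_pCons_le])
    ultimately show ?thesis by simp
  qed (auto simp: k0_def k1_def k2_def k3_def numeral_eq_Suc)
qed

lemma k3_nz [simp]: "k3 \<noteq> 0"
  using degF deg3 F_nz unfolding k3_def by (metis leading_coeff_0_iff)

lemma Aff_point: "Aff x y \<in> points f \<longleftrightarrow> y * y = k0 + x * (k1 + x * (k2 + x * k3))"
proof -
  have "poly F x = k0 + x * (k1 + x * (k2 + x * k3))" by (subst F_cubic) simp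
  then show ?thesis by (auto simp: points_def power2_eq_square)
qed

text \<open>The norm of y - (l x + m) is a multiple of the product of the three linear factors. A
  point on the line with y nonzero has its conjugate off the line, so the norm shows its order; a
  point with y = 0 is its own conjugate and the norm shows twice the order.\<close>

lemma line_principal:
  assumes eq: "F - [:m, l:] * [:m, l:] = Polynomial.smult k3 ([:- a, 1:] * [:- b, 1:] * [:- c, 1:])"
  shows "frag_of (Aff a (l * a + m)) + frag_of (Aff b (l * b + m)) + frag_of (Aff c (l * c + m)) -
     (frag_of Orig + frag_of Orig + frag_of Orig) \<in> principal f"
    and "Aff a (l * a + m) \<in> points f" "Aff b (l * b + m) \<in> points f" "Aff c (l * c + m) \<in> points f"
proof -
  have pe: "poly F x - (l * x + m) * (l * x + m) = k3 * ((x - a) * (x - b) * (x - c))" for x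
    using arg_cong[OF eq, of "\<lambda>p. poly p x"] by (simp add: algebra_simps)
  show pts: "Aff a (l * a + m) \<in> points f" "Aff b (l * b + m) \<in> points f" "Aff c (l * c + m) \<in> points f"
    using pe[of a] pe[of b] pe[of c] by (auto simp: points_def power2_eq_square)
  define L where "L = (- to_fract [:m, l:], 1 :: qbar poly fract)"
  have Lnz: "L \<noteq> 0" by (simp add: L_def zero_prod_def)
  define Pr where "Pr = [:- a, 1:] * [:- b, 1:] * [:- c, 1:]"
  have Prnz: "Pr \<noteq> 0" unfolding Pr_def by simp
  have N: "rnorm F L = to_fract (Polynomial.smult (- k3) Pr)"
  proof -
    have "rnorm F L = to_fract ([:m, l:] * [:m, l:] - F)"
      unfolding rnorm_def L_def by (simp only: fst_conv snd_conv power2_eq_square to_fract_diff to_fract_mult) simp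
    also have "[:m, l:] * [:m, l:] - F = - (F - [:m, l:] * [:m, l:])" by (simp only: minus_diff_eq)
    finally show ?thesis unfolding eq Pr_def by simp
  qed
  have ordPr: "Polynomial.order x (Polynomial.smult (- k3) Pr) = (if x = a then 1 else 0) + (if x = b then 1 else 0) + (if x = c then 1 else 0)" for x
  proof -
    have "Polynomial.order x (Polynomial.smult (- k3) Pr) = Polynomial.order x Pr" by (rule order_smult) simp
    also have "\<dots> = Polynomial.order x [:- a, 1:] + Polynomial.order x [:- b, 1:] + Polynomial.order x [:- c, 1:]"
      unfolding Pr_def by (subst order_mult, simp, subst order_mult, simp, simp)
    finally show ?thesis by (simp add: order_linear_poly)
  qed
  let ?D = "frag_of (Aff a (l * a + m)) + frag_of (Aff b (l * b + m)) + frag_of (Aff c (l * c + m)) -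
     (frag_of Orig + frag_of Orig + frag_of Orig)"
  have aff: "ord_at f (Aff x y) L = Poly_Mapping.lookup ?D (Aff x y)" if P: "Aff x y \<in> points f" for x y
  proof -
    have P': "Aff x (- y) \<in> points f" using P pconj_in_points[of "Aff x y"] by simp
    have val: "vpos (ord_at f (Aff x w)) (L - (cf (w - (l * x + m)), 0))" if W: "Aff x w \<in> points f" for w
    proof -
      interpret v: valuation F "ord_at f (Aff x w)" by (rule valuation_ord[OF W])
      note c = centredD[OF centred_ord_at(1)[OF W]]
      have "L - (cf (w - (l * x + m)), 0) = ((0, 1) - (cf w, 0)) - (cf l, 0) \<diamondop> (to_fract [:- x, 1:], 0)"
      proof -
        have e1: "to_fract [:m, l:] = cf m + cf l * fx" by (simp add: cf_def flip: to_fract_add to_fract_mult)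
        have e2: "to_fract [:- x, 1:] = fx - cf x"
          using to_fract_pCons[of "- x" "[:1:]"] by (simp add: cf_minus flip: cf_def)
        show ?thesis unfolding L_def e1 e2 by (simp add: rmul_x cf_diff cf_add cf_mult algebra_simps)
      qed
      moreover have "vpos (ord_at f (Aff x w)) ((0, 1) - (cf w, 0))" using c(3) by simp
      moreover have "vpos (ord_at f (Aff x w)) ((cf l, 0) \<diamondop> (to_fract [:- x, 1:], 0))"
        using c(2) by (intro v.vpos_smult) (simp add: vpos_def)
      ultimately show ?thesis using v.vpos_diff by metis
    qed
    have lk: "Poly_Mapping.lookup ?D (Aff x y) = (if y = l * x + m then int ((if x = a then 1 else 0) + (if x = b then 1 else 0) + (if x = c then 1 else 0)) else 0)"
      by (auto simp: lookup_add lookup_minus)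
    have nrm: "ord_at f (Aff x y) L + ord_at f (Aff x (- y)) L = ram (Aff x y) * int ((if x = a then 1 else 0) + (if x = b then 1 else 0) + (if x = c then 1 else 0))"
      using ord_norm[OF P Lnz] N nu_affine[of "Polynomial.smult (- k3) Pr" x] Prnz ordPr[of x] by simp
    show ?thesis
    proof (cases "y = l * x + m")
      case False
      then have "ord_at f (Aff x y) L = 0"
        using valuation.V_unit[OF valuation_ord[OF P] val[OF P]] by simp
      then show ?thesis using lk False by simp
    next
      case True
      show ?thesis
      proof (cases "y = 0")
        case y0: True
        then show ?thesis using nrm lk True by (simp add: ram_def)
      next
        case yn: False
        have "- y - (l * x + m) = - (2 * y)" using True by simp
        then have "- y - (l * x + m) \<noteq> 0" using yn by (simp only:) simp
        then have "ord_at f (Aff x (- y)) L = 0"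
          using valuation.V_unit[OF valuation_ord[OF P'] val[OF P']] by simp
        then show ?thesis using nrm lk True yn by (simp add: ram_def)
      qed
    qed
  qed
  \<comment> \<open>The two divisors agree away from the origin; as both have degree 0, the
    coefficient there agrees too and the pole needs no computation.\<close>
  have "fdiv L - ?D = frag_cmul (Poly_Mapping.lookup (fdiv L - ?D) Orig) (frag_of Orig)"
  proof (rule poly_mapping_eqI)
    fix P
    show "Poly_Mapping.lookup (fdiv L - ?D) P = Poly_Mapping.lookup (frag_cmul (Poly_Mapping.lookup (fdiv L - ?D) Orig) (frag_of Orig)) P"
    proof (cases "P \<in> points f")
      case True
      then show ?thesis using aff Lnz infinity_only
        by (cases P) (auto simp: lookup_minus lookup_fdiv)
    next
      case False
      then have "P \<noteq> Orig" "P \<notin> {Aff a (l * a + m), Aff b (l * b + m), Aff c (l * c + m)}" using pts by auto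
      then show ?thesis using False by (auto simp: lookup_minus lookup_add lookup_fdiv)
    qed
  qed
  moreover have "div_degree (fdiv L - ?D) = 0"
    by (simp add: div_degree_diff div_degree_add div_degree_fdiv)
  moreover have "div_degree (frag_cmul n (frag_of Orig)) = n" for n :: int
  proof -
    have "Poly_Mapping.keys (frag_cmul n (frag_of Orig)) \<subseteq> {Orig}"
    proof
      fix P assume "P \<in> Poly_Mapping.keys (frag_cmul n (frag_of Orig))"
      then have "Poly_Mapping.lookup (frag_cmul n (frag_of Orig)) P \<noteq> 0" by (simp only: in_keys_iff) simp
      then show "P \<in> {Orig}" by (simp split: if_splits)
    qed
    then show ?thesis using div_degree_eq_sum[of "{Orig}" "frag_cmul n (frag_of Orig)"] by simp
  qed
  ultimately have "fdiv L - ?D = frag_cmul 0 (frag_of Orig)" by metis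
  then have "?D = fdiv L" by simp
  then show "?D \<in> principal f" using Lnz principal_iff by blast
qed

text \<open>The third intersection point of the line, negated. Giving the slope \<open>l\<close> by
  an equation instead of a quotient treats addition and doubling together.\<close>

theorem add_formula:
  assumes P1: "Aff x1 y1 \<in> points f"
    and y2: "y2 = y1 + l * (x2 - x1)"
    and l: "l * (y1 + y2) = k3 * x2 * x2 + (k2 + k3 * x1) * x2 + (k1 + k2 * x1 + k3 * x1 * x1)"
    and x3: "x3 = (l * l - k2) / k3 - x1 - x2"
  shows "Aff x1 y1 \<otimes>\<^bsub>G\<^esub> Aff x2 y2 = Aff x3 (- (y1 + l * (x3 - x1)))" "Aff x2 y2 \<in> points f"
proof -
  define m where "m = y1 - l * x1"
  have h1: "y1 * y1 = k0 + x1 * (k1 + x1 * (k2 + x1 * k3))" using P1 by (simp add: Aff_point)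
  have h2: "l * (2 * y1 + l * (x2 - x1)) = k3 * x2 * x2 + (k2 + k3 * x1) * x2 + (k1 + k2 * x1 + k3 * x1 * x1)"
    using l y2 by (simp add: algebra_simps)
  have h3: "k3 * x3 = l * l - k2 - k3 * x1 - k3 * x2" using x3 by (simp add: right_diff_distrib)
  note id = chord_identities[OF h1 h2 h3, folded m_def]
  have "F - [:m, l:] * [:m, l:] = Polynomial.smult k3 ([:- x1, 1:] * [:- x2, 1:] * [:- x3, 1:])"
  proof -
    have "F - [:m, l:] * [:m, l:] = [:k0 - m * m, k1 - 2 * l * m, k2 - l * l, k3:]"
      by (subst F_cubic) (simp add: algebra_simps)
    also have "\<dots> = [:- (k3 * x1 * x2 * x3), k3 * (x1 * x2 + x1 * x3 + x2 * x3), - (k3 * x1 + k3 * x2 + k3 * x3), k3:]"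
      using id h3 by simp
    also have "\<dots> = Polynomial.smult k3 ([:- x1, 1:] * [:- x2, 1:] * [:- x3, 1:])"
      by (simp add: algebra_simps)
    finally show ?thesis .
  qed
  note lp = line_principal[OF this]
  have e1: "l * x1 + m = y1" by (simp add: m_def)
  have e2: "l * x2 + m = y2" using y2 by (simp add: m_def algebra_simps)
  have e3: "l * x3 + m = y1 + l * (x3 - x1)" by (simp add: m_def algebra_simps)
  show p2: "Aff x2 y2 \<in> points f" using lp(3) e2 by simp
  let ?R = "Aff x3 (y1 + l * (x3 - x1))"
  have R: "?R \<in> points f" using lp(4) e3 by simp
  have s: "sums_to (- (frag_of ?R - frag_of Orig)) (pconj ?R)" by (rule sums_to_uminus[OF sums_to_point[OF R]])
  have "- (frag_of ?R - frag_of Orig) - ((frag_of (Aff x1 y1) - frag_of Orig) + (frag_of (Aff x2 y2) - frag_of Orig)) \<in> principal f"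
    using principal_uminus[OF lp(1)] unfolding e1 e2 e3 by (simp add: algebra_simps)
  from sums_to_equiv[OF s this] have "sums_to ((frag_of (Aff x1 y1) - frag_of Orig) + (frag_of (Aff x2 y2) - frag_of Orig)) (pconj ?R)" .
  moreover have "sums_to ((frag_of (Aff x1 y1) - frag_of Orig) + (frag_of (Aff x2 y2) - frag_of Orig)) (Aff x1 y1 \<otimes>\<^bsub>G\<^esub> Aff x2 y2)"
    by (intro sums_to_add sums_to_point P1 p2)
  ultimately show "Aff x1 y1 \<otimes>\<^bsub>G\<^esub> Aff x2 y2 = Aff x3 (- (y1 + l * (x3 - x1)))"
    using sums_to_unique by fastforce
qed

lemma double_formula:
  assumes P: "Aff x y \<in> points f" and y: "y \<noteq> 0"
    and l: "l = (3 * k3 * x * x + 2 * k2 * x + k1) / (2 * y)" and x3: "x3 = (l * l - k2) / k3 - 2 * x"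
  shows "Aff x y \<otimes>\<^bsub>G\<^esub> Aff x y = Aff x3 (- (y + l * (x3 - x)))"
proof (rule add_formula(1)[OF P])
  have "l * (2 * y) = 3 * k3 * x * x + 2 * k2 * x + k1" using l y by simp
  then show "l * (y + y) = k3 * x * x + (k2 + k3 * x) * x + (k1 + k2 * x + k3 * x * x)"
    by (simp add: algebra_simps flip: mult_2)
qed (use x3 in \<open>auto simp: algebra_simps\<close>)

text \<open>The abscissa of a half of \<open>R\<close> is a root of a quartic. The ordinate found
  there is nonzero, since otherwise \<open>F\<close> and its derivative would vanish together, and a
  wrong sign is repaired by negation.\<close>

theorem divisible_by_2:
  assumes R: "R \<in> points f"
  shows "\<exists>Q\<in>points f. Q \<otimes>\<^bsub>G\<^esub> Q = R"
proof (cases R)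
  case (Infty s)
  then have "R = Orig" using R infinity_only by simp
  then show ?thesis using G.l_one[of Orig] by (intro bexI[of _ Orig]) auto
next
  case (Aff a b)
  \<comment> \<open>Obtained from \<open>l * l = k2 + k3 * (a + 2 * x)\<close> by inserting the
    tangent slope and clearing 4 y^2. Its leading coefficient is 9 k3^2 - 8 k3^2.\<close>
  define p where "p = [:k1, 2 * k2, 3 * k3:] * [:k1, 2 * k2, 3 * k3:] - Polynomial.smult 4 (F * [:k2 + k3 * a, 2 * k3:])"
  have "coeff p 4 = k3 * k3" unfolding p_def by (subst F_cubic) (simp add: numeral_eq_Suc algebra_simps)
  then have "coeff p 4 \<noteq> 0" by simp
  then have "Polynomial.degree p \<ge> 4" by (rule le_degree)
  then obtain x where x: "poly p x = 0" using alg_closed_imp_poly_has_root[of p] by auto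
  have Fd: "poly (pderiv F) x = 3 * k3 * x * x + 2 * k2 * x + k1"
    by (subst F_cubic) (simp add: pderiv_pCons algebra_simps)
  define D where "D = 3 * k3 * x * x + 2 * k2 * x + k1"
  have px: "D * D = 4 * poly F x * (k2 + k3 * a + 2 * k3 * x)"
    using x by (simp add: p_def D_def algebra_simps)
  obtain y where y: "y\<^sup>2 = poly F x" using nth_root_exists[of 2 "poly F x"] by auto
  have ynz: "y \<noteq> 0"
  proof
    assume "y = 0"
    then have "poly F x = 0" using y by simp
    moreover from this px have "D = 0" by simp
    ultimately show False using simple[of x] Fd by (simp add: D_def)
  qed
  have P: "Aff x y \<in> points f" using y by (auto simp: points_def)
  define l where "l = D / (2 * y)"
  have "l * l = D * D / (4 * (y * y))" by (simp add: l_def)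
  also have "\<dots> = k2 + k3 * a + 2 * k3 * x" unfolding px using ynz y by (auto simp: power2_eq_square simp flip: y)
  finally have "(l * l - k2) / k3 - 2 * x = a" by (simp add: field_simps)
  then have dbl: "Aff x y \<otimes>\<^bsub>G\<^esub> Aff x y = Aff a (- (y + l * (a - x)))"
    using double_formula[OF P ynz] by (simp add: l_def D_def)
  have "Aff a (- (y + l * (a - x))) \<in> points f" using mult_G(1)[OF P P] dbl by simp
  then have "(- (y + l * (a - x)))\<^sup>2 = b\<^sup>2" using R Aff by (auto simp: points_def)
  then consider "- (y + l * (a - x)) = b" | "- (y + l * (a - x)) = - b" by (metis power2_eq_iff)
  then show ?thesis
  proof cases
    case 1
    then show ?thesis using dbl P Aff by auto
  next
    case 2
    have "inv\<^bsub>G\<^esub> (Aff x y \<otimes>\<^bsub>G\<^esub> Aff x y) = inv\<^bsub>G\<^esub> (Aff x y) \<otimes>\<^bsub>G\<^esub> inv\<^bsub>G\<^esub> (Aff x y)"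
      using G.inv_mult[of "Aff x y" "Aff x y"] P by simp
    moreover have "inv\<^bsub>G\<^esub> (Aff x y \<otimes>\<^bsub>G\<^esub> Aff x y) = R"
      using inv_G[OF mult_G(1)[OF P P]] unfolding dbl 2 by (simp add: Aff)
    ultimately show ?thesis using inv_G[OF P] P pconj_in_points[of "Aff x y"] by metis
  qed
qed

section \<open>Translations are morphisms\<close>

text \<open>At the origin x has a double and y a triple pole, so the two terms have orders 2 (n -
  deg p) and 2 (n - deg q) - 3.\<close>

lemma vpos_Orig:
  assumes D: "D = to_fract [:- a, 1:]" and p: "p = 0 \<or> Polynomial.degree p < n" and q: "q = 0 \<or> Polynomial.degree q + 2 \<le> n"
  shows "vpos (ord_at f Orig) (to_fract p / D ^ n, to_fract q / D ^ n)"
proof -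
  interpret v: valuation F "ord_at f Orig" by (rule valuation_ord[OF O_point])
  have Dn: "D ^ n = to_fract ([:- a, 1:] ^ n)" by (simp add: D to_fract_power)
  have dn: "Polynomial.degree ([:- a, 1:] ^ n) = n" by (simp add: degree_power_eq)
  have F: "to_fract r / D ^ n = Fraction_Field.Fract r ([:- a, 1:] ^ n)" for r
    unfolding Dn by (simp add: to_fract_def divide_fract)
  have "vpos (ord_at f Orig) (to_fract p / D ^ n, 0)"
  proof (cases "p = 0")
    case False
    have "nu (1 / fx) (to_fract p / D ^ n) = int n - int (Polynomial.degree p)"
      unfolding F using nu_Fract(2)[OF False, of "[:- a, 1:] ^ n"] dn by simp
    then show ?thesis using p False ord_x[OF O_point, of "to_fract p / D ^ n"] by (simp add: vpos_def ram_def D)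
  qed (simp add: vpos_def zero_prod_def)
  moreover have "vpos (ord_at f Orig) (0, to_fract q / D ^ n)"
  proof (cases "q = 0")
    case False
    have "to_fract q / D ^ n / (1 / fx\<^sup>2) = to_fract (q * [:0, 1:] ^ 2) / D ^ n"
      by (simp add: to_fract_power)
    moreover have "Polynomial.degree (q * [:0, 1:] ^ 2) = Polynomial.degree q + 2"
      using False by (subst degree_mult_eq) (auto simp: degree_power_eq)
    moreover have "q * [:0, 1:] ^ 2 \<noteq> 0" using False by simp
    ultimately have "nu (1 / fx) (to_fract q / D ^ n / (1 / fx\<^sup>2)) = int n - int (Polynomial.degree q + 2)"
      unfolding F using nu_Fract(2)[of "q * [:0, 1:] ^ 2" "[:- a, 1:] ^ n"] dn by simp
    then show ?thesis using q False ord_y_part[OF O_point, of "to_fract q / D ^ n"]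
      by (simp add: vpos_def ram_def D)
  qed (simp add: vpos_def zero_prod_def)
  ultimately have "vpos (ord_at f Orig) ((to_fract p / D ^ n, 0) + (0, to_fract q / D ^ n))" by (rule v.vpos_add)
  then show ?thesis by simp
qed

end

lemma (in valuation) vnn_uminus: "vnn V (- h) = vnn V h"
  by (simp add: vnn_def V_uminus)

lemma (in valuation) V_add_neg: "a \<noteq> 0 \<Longrightarrow> V a < 0 \<Longrightarrow> vnn V b \<Longrightarrow> a + b \<noteq> 0 \<and> V (a + b) = V a"
proof (cases "b = 0")
  case False
  assume a: "a \<noteq> 0" "V a < 0" "vnn V b"
  then have lt: "V a < V b" using False by (simp add: vnn_def)
  have "a + b \<noteq> 0"
  proof
    assume "a + b = 0"
    then have "a = - b" by (simp add: add_eq_0_iff2)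
    then show False using lt by (simp add: V_uminus)
  qed
  then show ?thesis using V_add_less[OF a(1) False lt] by simp
qed simp

context elliptic
begin

text \<open>The coordinates of Q + T given by the chord formula, as functions of Q. The formula
  degenerates at the origin, at -T and at T; in the first two cases the poles are followed, in the
  last the slope is rewritten.\<close>

lemma translation_realized:
  assumes T: "Aff x1 y1 \<in> points f"
  shows "\<exists>U W U' W'. realizes f (\<lambda>Q. Q \<otimes>\<^bsub>G\<^esub> Aff x1 y1) U W U' W'"
proof -
  let ?T = "Aff x1 y1"
  define D where "D = to_fract [:- x1, 1:]"
  have Dx: "D = fx - cf x1" unfolding D_def using to_fract_pCons[of "- x1" "[:1:]"] by (simp add: cf_minus flip: cf_def)
  have Dnz: "D \<noteq> 0" by (simp add: D_def)
  \<comment> \<open>\<open>lam\<close> is the slope (y - y1) / (x - x1) of the line through Q and T;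
    \<open>U\<close> and \<open>W\<close> are the coordinates of the sum.\<close>
  define lam where "lam = (- cf y1 / D, 1 / D)"
  define A where "A = (cf (1 / k3), 0) \<diamondop> (lam \<diamondop> lam)"
  define U where "U = A - (cf (k2 / k3) + fx + cf x1, 0)"
  define W where "W = - ((cf y1, 0) + lam \<diamondop> (U - (cf x1, 0)))"
  define U' where "U' = rinv F U"
  define W' where "W' = W \<diamondop> (U' \<diamondop> U')"
  have lam_nz: "lam \<noteq> 0" using Dnz by (simp add: lam_def zero_prod_def)
  have lam_eq: "lam = (1 / D, 0) \<diamondop> ((0, 1) - (cf y1, 0))" by (simp add: lam_def rmul_x)
  have k3f: "cf (1 / k3) \<noteq> 0" using k3_nz by simp
  have A_nz: "A \<noteq> 0" using lam_nz k3f by (simp add: A_def zero_prod_def[symmetric]) (simp add: zero_prod_def)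
  have T': "Aff x1 (- y1) \<in> points f" using T pconj_in_points[of ?T] by simp
  \<comment> \<open>At -T the slope has a simple pole. This includes y1 = 0, where y - y1 has order
    1 and x - x1 order 2.\<close>
  have neg: "U \<noteq> 0 \<and> ord_at f (Aff x1 (- y1)) U = - 2 \<and> W \<noteq> 0 \<and> ord_at f (Aff x1 (- y1)) W = - 3"
  proof -
    let ?V = "ord_at f (Aff x1 (- y1))"
    interpret v: valuation F ?V by (rule valuation_ord[OF T'])
    note c = centredD[OF centred_ord_at(1)[OF T']]
    have Vd: "?V (D, 0) = (if y1 = 0 then 2 else 1)" using ord_loc_par[OF T'] by (simp add: D_def ram_def)
    have "?V (1 / D, 0) + ?V (D, 0) = 0"
      using v.V_mult[of "(1 / D, 0)" "(D, 0)"] Dnz v.V_one by (simp add: rmul_x zero_prod_def)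
    then have Vi: "?V (1 / D, 0) = - (if y1 = 0 then 2 else 1)" using Vd by simp
    have Vy: "?V ((0, 1) - (cf y1, 0)) = (if y1 = 0 then 1 else 0)"
    proof (cases "y1 = 0")
      case True
      then show ?thesis using ord_z[OF T'] by (simp add: zero_prod_def)
    next
      case False
      have "- y1 - y1 \<noteq> 0" using False by (simp add: minus_equation_iff eq_neg_iff_add_eq_0 flip: mult_2)
      moreover have "((0, 1) - (cf y1, 0)) - (cf (- y1 - y1), 0) = ((0, 1) - (cf (- y1), 0) :: ratfun)"
        unfolding cf_diff cf_minus by (simp add: prod_eq_iff)
      then have "vpos ?V (((0, 1) - (cf y1, 0)) - (cf (- y1 - y1), 0))" using c(3) by simp
      ultimately have "?V ((0, 1) - (cf y1, 0)) = 0" using v.V_unit by blast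
      then show ?thesis using False by simp
    qed
    have Vl: "?V lam = - 1"
      unfolding lam_eq using v.V_mult[of "(1 / D, 0)" "(0, 1) - (cf y1, 0)"] Dnz Vi Vy by (simp add: zero_prod_def)
    have VA: "?V A = - 2"
    proof -
      have "(cf (1 / k3), 0) \<noteq> (0 :: ratfun)" using k3f by (simp add: zero_prod_def)
      then show ?thesis unfolding A_def
        using v.V_mult[of "(cf (1 / k3), 0)" "lam \<diamondop> lam"] v.V_mult[OF lam_nz lam_nz] Vl lam_nz v.V_cf[of "1 / k3"] by simp
    qed
    have fxn: "vnn ?V (fx, 0)"
    proof -
      have "vnn ?V ((D, 0) + (cf x1, 0))" using Vd by (intro v.vnn_add v.vnn_cf) (simp add: vnn_def)
      then show ?thesis by (simp add: Dx)
    qed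
    have b: "vnn ?V (- (cf (k2 / k3) + fx + cf x, 0))" for x
    proof -
      have "vnn ?V (- ((cf (k2 / k3), 0) + (fx, 0) + (cf x, 0)))"
        unfolding v.vnn_uminus by (intro v.vnn_add v.vnn_cf fxn)
      then show ?thesis by simp
    qed
    have VA0: "?V A < 0" using VA by simp
    have Ueq: "U = A + - (cf (k2 / k3) + fx + cf x1, 0)" unfolding U_def by (rule diff_conv_add_uminus)
    have U: "U \<noteq> 0 \<and> ?V U = - 2" unfolding Ueq using v.V_add_neg[OF A_nz VA0 b[of x1]] unfolding VA .
    have U1: "U - (cf x1, 0) \<noteq> 0 \<and> ?V (U - (cf x1, 0)) = - 2"
    proof -
      have "U - (cf x1, 0) = A + (- (cf (k2 / k3) + fx + cf (2 * x1), 0))"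
        unfolding U_def by (simp add: cf_mult cf_numeral prod_eq_iff algebra_simps)
      note e = this
      show ?thesis unfolding e using v.V_add_neg[OF A_nz VA0 b[of "2 * x1"]] unfolding VA .
    qed
    have Wl: "lam \<diamondop> (U - (cf x1, 0)) \<noteq> 0" "?V (lam \<diamondop> (U - (cf x1, 0))) = - 3"
      using U1 lam_nz Vl v.V_mult[OF lam_nz] by auto
    have "W \<noteq> 0 \<and> ?V W = - 3"
      using v.V_add_neg[OF Wl(1) _ v.vnn_cf[of y1]] Wl(2) unfolding W_def v.V_uminus
      by (metis add.commute neg_equal_0_iff_equal neg_less_0_iff_less zero_less_numeral)
    then show ?thesis using U by blast
  qed
  have "realizes f (\<lambda>Q. Q \<otimes>\<^bsub>G\<^esub> ?T) U W U' W'"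
    unfolding realizes_def
  proof (intro conjI ballI)
    show "U' \<diamondop> U = (1, 0)" unfolding U'_def using rinv_right neg rmul_commute by metis
    show "W' = W \<diamondop> (U' \<diamondop> U')" by (rule W'_def)
    fix Q assume Q: "Q \<in> points f"
    show "Q \<otimes>\<^bsub>G\<^esub> ?T \<in> points f" by (rule mult_G(1)[OF Q T])
    interpret v: valuation F "ord_at f Q" by (rule valuation_ord[OF Q])
    note cen = centredD[OF centred_ord_at(1)[OF Q]]
    show "case Q \<otimes>\<^bsub>G\<^esub> ?T of
         Aff x y \<Rightarrow> vpos (ord_at f Q) (U - (cf x, 0)) \<and> vpos (ord_at f Q) (W - (cf y, 0))
       | Infty s \<Rightarrow> vpos (ord_at f Q) U' \<and> vpos (ord_at f Q) (W' - (cf s, 0))"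
    proof (cases Q)
      case (Infty s)
      then have Q0: "Q = Orig" using Q infinity_only by simp
      have QT: "Q \<otimes>\<^bsub>G\<^esub> ?T = ?T" using G.l_one[of ?T] T Q0 by simp
      \<comment> \<open>The even part of \<open>U - x1\<close> with the denominator (x - x1)^2
        cleared. Its cubic and quadratic terms cancel, which makes \<open>U\<close> take the value
        x1 at the origin.\<close>
      define l where "l = Polynomial.smult (1 / k3) ([:y1 * y1:] + F) - [:k2 / k3 + 2 * x1, 1:] * [:- x1, 1:]\<^sup>2"
      have lexp: "l = [:(y1 * y1 + k0) / k3 - (k2 / k3 + 2 * x1) * (x1 * x1), k1 / k3 - (x1 * x1 - 2 * x1 * (k2 / k3 + 2 * x1)):]"
        unfolding l_def by (subst F_cubic) (simp add: power2_eq_square algebra_simps add_divide_distrib)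
      have degl: "Polynomial.degree l \<le> 1" unfolding lexp by (rule order_trans[OF degree_pCons_le]) simp
      have U1: "U - (cf x1, 0) = (to_fract l / D\<^sup>2, to_fract [:- 2 * y1 / k3:] / D\<^sup>2)"
      proof -
        have lf: "to_fract l = cf (1 / k3) * (cf y1 * cf y1 + to_fract F) - (cf (k2 / k3) + 2 * cf x1 + fx) * D\<^sup>2"
        proof -
          have "to_fract (Polynomial.smult (1 / k3) ([:y1 * y1:] + F)) = cf (1 / k3) * (cf y1 * cf y1 + to_fract F)"
            by (simp add: cf_def flip: to_fract_add to_fract_mult)
          moreover have "to_fract [:k2 / k3 + 2 * x1, 1:] = cf (k2 / k3) + 2 * cf x1 + fx"
            using to_fract_pCons[of "k2 / k3 + 2 * x1" "[:1:]"] by (simp add: cf_add cf_mult cf_numeral flip: cf_def)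
          ultimately show ?thesis by (simp only: l_def to_fract_diff to_fract_mult to_fract_power D_def)
        qed
        have "lam \<diamondop> lam = ((cf y1 * cf y1 + to_fract F) / D\<^sup>2, (- 2 * cf y1) / D\<^sup>2)"
          by (simp add: lam_def rmul_def power2_eq_square add_divide_distrib)
        then have "U - (cf x1, 0) = (cf (1 / k3) * ((cf y1 * cf y1 + to_fract F) / D\<^sup>2) - (cf (k2 / k3) + fx + cf x1) - cf x1, cf (1 / k3) * ((- 2 * cf y1) / D\<^sup>2))"
          by (simp add: U_def A_def rmul_x)
        moreover have "cf (1 / k3) * ((cf y1 * cf y1 + to_fract F) / D\<^sup>2) - (cf (k2 / k3) + fx + cf x1) - cf x1 = to_fract l / D\<^sup>2"
          unfolding lf using Dnz by (simp add: diff_divide_distrib)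
        moreover have "cf (1 / k3) * ((- 2 * cf y1) / D\<^sup>2) = to_fract [:- 2 * y1 / k3:] / D\<^sup>2"
        proof -
          have "- 2 * y1 / k3 = (1 / k3) * (- 2 * y1)" by simp
          then have "cf (- 2 * y1 / k3) = cf (1 / k3) * cf (- 2 * y1)" by (simp only: cf_mult)
          also have "cf (- 2 * y1) = - 2 * cf y1" by (simp add: cf_mult cf_minus cf_numeral)
          finally have "to_fract [:- 2 * y1 / k3:] = cf (1 / k3) * (- 2 * cf y1)" by (simp only: cf_def)
          then show ?thesis by (simp only: times_divide_eq_right)
        qed
        ultimately show ?thesis by (simp only:)
      qed
      have u: "vpos (ord_at f Q) (U - (cf x1, 0))"
        unfolding U1 Q0 by (rule vpos_Orig[OF D_def]) (use degl in auto)
      \<comment> \<open>Numerators of \<open>W - y1\<close> over (x - x1)^3. The cubic terms of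
        \<open>pA\<close>, with coefficients -2 y1 and 2 y1, cancel, so the degree drops below
        3.\<close>
      define pA where "pA = Polynomial.smult (- 2 * y1) ([:- x1, 1:] ^ 3) + Polynomial.smult y1 l + Polynomial.smult (2 * y1 / k3) F"
      define pB where "pB = Polynomial.smult y1 [:- 2 * y1 / k3:] - l"
      have "W - (cf y1, 0) = (to_fract pA / D ^ 3, to_fract pB / D ^ 3)"
      proof -
        define c where "c = to_fract [:- 2 * y1 / k3:]"
        have cA: "to_fract (Polynomial.smult a p) = cf a * to_fract p" for a p by (simp add: cf_def flip: to_fract_mult)
        have c': "cf (2 * y1 / k3) = - c" by (simp add: c_def cf_minus flip: cf_def)
        have "lam \<diamondop> (U - (cf x1, 0)) = ((- cf y1 * to_fract l + to_fract F * c) / D ^ 3, (- cf y1 * c + to_fract l) / D ^ 3)"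
          unfolding U1 lam_def c_def[symmetric]
          by (simp add: rmul_def power2_eq_square power3_eq_cube add_divide_distrib diff_divide_distrib mult.assoc)
        then have "W - (cf y1, 0) = (- (2 * cf y1) - (- cf y1 * to_fract l + to_fract F * c) / D ^ 3, - ((- cf y1 * c + to_fract l) / D ^ 3))"
          by (simp add: W_def)
        moreover have "- (2 * cf y1) - (- cf y1 * to_fract l + to_fract F * c) / D ^ 3 = to_fract pA / D ^ 3"
        proof -
          have "to_fract pA = - (2 * cf y1) * D ^ 3 + cf y1 * to_fract l - c * to_fract F"
            unfolding pA_def to_fract_add cA c' by (simp add: D_def to_fract_power cf_mult cf_minus cf_numeral)
          then show ?thesis using Dnz by (simp add: diff_divide_distrib add_divide_distrib mult.commute)
        qed
        moreover have "- ((- cf y1 * c + to_fract l) / D ^ 3) = to_fract pB / D ^ 3"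
        proof -
          have "to_fract pB = cf y1 * c - to_fract l" unfolding pB_def to_fract_diff cA c_def ..
          then show ?thesis by (simp add: diff_divide_distrib add_divide_distrib)
        qed
        ultimately show ?thesis by simp
      qed
      moreover have "vpos (ord_at f Orig) (to_fract pA / D ^ 3, to_fract pB / D ^ 3)"
      proof (rule vpos_Orig[OF D_def])
        have c3: "coeff pA 3 = 0" unfolding pA_def lexp
          by (subst F_cubic) (simp add: numeral_eq_Suc)
        have "Polynomial.degree pA \<le> 3"
        proof -
          have "Polynomial.degree ([:- x1, 1:] ^ 3) = 3" by (simp add: degree_power_eq)
          then show ?thesis unfolding pA_def using degl degF deg3
            by (intro degree_add_le order_trans[OF degree_smult_le]) auto
        qed
        then show "pA = 0 \<or> Polynomial.degree pA < 3" using c3 eq_zero_or_degree_less by blast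
        have "Polynomial.degree pB \<le> 1" unfolding pB_def using degl by (intro degree_diff_le) auto
        then show "pB = 0 \<or> Polynomial.degree pB + 2 \<le> 3" by simp
      qed
      ultimately show ?thesis using QT u Q0 by simp
    next
      case (Aff x y)
      show ?thesis
      proof (cases "Q = Aff x1 (- y1)")
        case True
        have "inv\<^bsub>G\<^esub> ?T = Q" using inv_G[OF T] True by simp
        then have QT: "Q \<otimes>\<^bsub>G\<^esub> ?T = Orig" using G.l_inv[of ?T] T by simp
        have "ord_at f Q U' = 2" unfolding U'_def using v.V_rinv[of U] neg True by simp
        moreover have U'nz: "U' \<noteq> 0" unfolding U'_def using rinv_nz neg by blast
        \<comment> \<open>The orders are 2 for \<open>U'\<close> and -3 + 4 = 1 for
          \<open>W'\<close>, so both coordinates vanish and the image is the origin.\<close>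
        ultimately have "vpos (ord_at f Q) U'" "ord_at f Q W' = 1"
          using v.V_mult[of W "U' \<diamondop> U'"] v.V_mult[OF U'nz U'nz] neg True by (auto simp: vpos_def W'_def)
        then show ?thesis using QT by (simp add: vpos_def zero_prod_def[symmetric])
      next
        case False
        have xv: "vpos (ord_at f Q) ((fx, 0) - (cf x, 0))"
        proof -
          have "loc_par Q = fx - cf x" using to_fract_pCons[of "- x" "[:1:]"] Aff by (simp add: cf_minus flip: cf_def)
          then show ?thesis using cen(2) by (simp add: vpos_def)
        qed
        have yv: "vpos (ord_at f Q) ((0, 1) - (cf y, 0))" using cen(3) Aff by simp
        have yy: "y * y = k0 + x * (k1 + x * (k2 + x * k3))" "y1 * y1 = k0 + x1 * (k1 + x1 * (k2 + x1 * k3))"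
          using Q T Aff by (simp_all add: Aff_point)
        define q where "q = (\<lambda>x. k3 * x * x + (k2 + k3 * x1) * x + (k1 + k2 * x1 + k3 * x1 * x1))"
        have qid: "(y - y1) * (y + y1) = (x - x1) * q x"
          unfolding q_def using yy by (simp add: algebra_simps)
        have "\<exists>l. vpos (ord_at f Q) (lam - (cf l, 0)) \<and> y = y1 + l * (x - x1) \<and> l * (y1 + y) = q x"
        proof (cases "x = x1")
          case True
          then have "y\<^sup>2 = y1\<^sup>2" using yy by (simp add: power2_eq_square)
          then have y: "y = y1" "y + y1 \<noteq> 0" using False Aff True by (auto simp: power2_eq_iff eq_neg_iff_add_eq_0)
          define l where "l = q x / (y + y1)"
          \<comment> \<open>At T itself numerator and denominator of the slope vanish. Multiplying
            by y + y1, a unit there, turns it into the difference quotient of \<open>F\<close>, a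
            polynomial in x.\<close>
          define S :: ratfun where "S = (0, 1) + (cf y1, 0)"
          have Snz: "S \<noteq> 0" by (simp add: S_def zero_prod_def)
          have "S - (cf (y + y1), 0) = (0, 1) - (cf y, 0)" by (simp add: S_def cf_add)
          then have Sv: "vpos (ord_at f Q) (S - (cf (y + y1), 0))" using yv by simp
          have iS: "vpos (ord_at f Q) (rinv F S - (cf (1 / (y + y1)), 0))"
            by (rule v.vpos_inverse_value[OF Sv y(2)]) (metis rinv_right[OF Snz] rmul_commute)
          define qf where "qf = (cf k3, 0) \<diamondop> ((fx, 0) \<diamondop> (fx, 0)) + (cf (k2 + k3 * x1), 0) \<diamondop> (fx, 0) + (cf (k1 + k2 * x1 + k3 * x1 * x1), 0)"
          have "qf - (cf (q x), 0) = (cf k3, 0) \<diamondop> ((fx, 0) \<diamondop> (fx, 0) - (cf (x * x), 0)) + (cf (k2 + k3 * x1), 0) \<diamondop> ((fx, 0) - (cf x, 0))"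
            by (simp add: qf_def q_def rmul_x cf_add cf_mult algebra_simps)
          then have qv: "vpos (ord_at f Q) (qf - (cf (q x), 0))"
            using v.vpos_add[OF v.vpos_smult[OF v.vpos_mult_values[OF xv xv]] v.vpos_smult[OF xv]] by simp
          have "lam \<diamondop> S = qf"
          proof -
            have Fx: "to_fract F = cf k0 + fx * (cf k1 + fx * (cf k2 + fx * cf k3))"
              unfolding to_fract_poly[of F] by (subst F_cubic) (simp add: map_poly_pCons)
            have y1c: "cf y1 * cf y1 = cf k0 + cf x1 * (cf k1 + cf x1 * (cf k2 + cf x1 * cf k3))"
              using arg_cong[OF yy(2), of cf] by (simp only: cf_mult cf_add)
            have "lam \<diamondop> S = ((to_fract F - cf y1 * cf y1) / D, 0)"
              by (simp add: lam_def S_def rmul_def diff_divide_distrib)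
            also have "to_fract F - cf y1 * cf y1 = (cf k3 * (fx * fx) + cf (k2 + k3 * x1) * fx + cf (k1 + k2 * x1 + k3 * x1 * x1)) * D"
              unfolding Fx y1c Dx by (simp add: cf_add cf_mult algebra_simps)
            finally show ?thesis using Dnz by (simp add: qf_def rmul_x)
          qed
          then have "lam = qf \<diamondop> rinv F S" by (metis rinv_right[OF Snz] rmul_assoc rmul_one(1))
          then have "vpos (ord_at f Q) (lam - (cf (q x * (1 / (y + y1))), 0))"
            using v.vpos_mult_values[OF qv iS] by simp
          then show ?thesis using y True by (intro exI[of _ l]) (auto simp: l_def add.commute)
        next
          case ne: False
          define l where "l = (y - y1) * (1 / (x - x1))"
          have "(D, 0) - (cf (x - x1), 0) = (fx, 0) - (cf x, 0)" by (simp add: Dx cf_diff)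
          then have "vpos (ord_at f Q) ((D, 0) - (cf (x - x1), 0))" using xv by simp
          then have iD: "vpos (ord_at f Q) ((1 / D, 0) - (cf (1 / (x - x1)), 0))"
            using ne Dnz by (intro v.vpos_inverse_value[where h = "(D, 0)"]) (auto simp: rmul_x)
          have "((0, 1) - (cf y1, 0)) - (cf (y - y1), 0) = ((0, 1) - (cf y, 0) :: ratfun)" by (simp add: cf_diff)
          then have "vpos (ord_at f Q) (((0, 1) - (cf y1, 0)) - (cf (y - y1), 0))" using yv by simp
          from v.vpos_mult_values[OF iD this] have lv: "vpos (ord_at f Q) (lam - (cf l, 0))"
            unfolding lam_eq[symmetric] l_def by (simp only: mult.commute)
          have "l * (y1 + y) = ((y - y1) * (y + y1)) / (x - x1)" by (simp add: l_def add.commute)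
          also have "\<dots> = q x" unfolding qid using ne by simp
          finally show ?thesis using lv ne by (intro exI[of _ l]) (auto simp: l_def)
        qed
        then obtain l where lv: "vpos (ord_at f Q) (lam - (cf l, 0))" and l: "y = y1 + l * (x - x1)" "l * (y1 + y) = q x" by blast
        define x3 where "x3 = (l * l - k2) / k3 - x1 - x"
        define y3 where "y3 = - (y1 + l * (x3 - x1))"
        have "?T \<otimes>\<^bsub>G\<^esub> Q = Aff x3 y3"
          unfolding Aff y3_def by (rule add_formula(1)[OF T l(1) _ x3_def]) (use l(2) q_def in simp)
        then have QT: "Q \<otimes>\<^bsub>G\<^esub> ?T = Aff x3 y3" using G.m_comm[of Q ?T] Q T by simp
        have "U - (cf x3, 0) = (cf (1 / k3), 0) \<diamondop> (lam \<diamondop> lam - (cf (l * l), 0)) - ((fx, 0) - (cf x, 0))"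
        proof -
          have "x3 = (1 / k3) * (l * l) - k2 / k3 - x1 - x" by (simp add: x3_def diff_divide_distrib)
          then have "cf x3 = cf (1 / k3) * cf (l * l) - cf (k2 / k3) - cf x1 - cf x" by (simp only: cf_diff cf_mult)
          then show ?thesis by (simp add: U_def A_def rmul_x rmul_diff prod_eq_iff algebra_simps)
        qed
        then have u: "vpos (ord_at f Q) (U - (cf x3, 0))"
          using v.vpos_diff[OF v.vpos_smult[OF v.vpos_mult_values[OF lv lv]] xv] by simp
        have "(U - (cf x1, 0)) - (cf (x3 - x1), 0) = U - (cf x3, 0)" by (simp add: cf_diff prod_eq_iff)
        then have "vpos (ord_at f Q) ((U - (cf x1, 0)) - (cf (x3 - x1), 0))" using u by (simp only:)
        note w = v.vpos_mult_values[OF lv this]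
        have "W - (cf y3, 0) = - (lam \<diamondop> (U - (cf x1, 0)) - (cf (l * (x3 - x1)), 0))"
          unfolding W_def y3_def by (simp add: cf_minus cf_add cf_diff prod_eq_iff)
        then have "vpos (ord_at f Q) (W - (cf y3, 0))" using w v.vpos_uminus by metis
        then show ?thesis using QT u by simp
      qed
    qed
  qed
  then show ?thesis by blast
qed

end

section \<open>The Galois action\<close>

lemma alg_closure_rat_algebraic: "\<exists>p. p \<noteq> 0 \<and> poly (base_change p) x = 0" for x :: qbar
  using alg_closure_algebraic[of x] by (auto simp: base_change_def)

lemma to_ac_of_rat: "to_ac q = of_int (fst (quotient_of q)) / (of_int (snd (quotient_of q)) :: qbar)"
proof -
  have "q = of_int (fst (quotient_of q)) / of_int (snd (quotient_of q))"
    by (rule quotient_of_div) simp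
  then show ?thesis by (metis to_ac_divide to_ac_of_int)
qed

locale galois_elt =
  fixes \<sigma> :: "qbar \<Rightarrow> qbar"
  assumes \<sigma>: "\<sigma> \<in> galois"
begin

lemma s_add: "\<sigma> (x + y) = \<sigma> x + \<sigma> y" and s_mult: "\<sigma> (x * y) = \<sigma> x * \<sigma> y" and s_bij: "bij \<sigma>"
  using \<sigma> by (auto simp: galois_def)

lemma s_0 [simp]: "\<sigma> 0 = 0" using s_add[of 0 0] by simp
lemma s_eq_iff [simp]: "\<sigma> x = \<sigma> y \<longleftrightarrow> x = y" using s_bij by (meson bij_def inj_eq)
lemma s_eq_0_iff [simp]: "\<sigma> x = 0 \<longleftrightarrow> x = 0" using s_eq_iff[of x 0] by simp
lemma s_1 [simp]: "\<sigma> 1 = 1"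
proof -
  have "\<sigma> 1 * \<sigma> 1 = \<sigma> 1 * 1" by (simp flip: s_mult)
  then show ?thesis by (metis mult_cancel_left s_eq_0_iff zero_neq_one)
qed
lemma s_minus: "\<sigma> (- x) = - \<sigma> x"
proof -
  have "\<sigma> (- x) + \<sigma> x = 0" by (simp flip: s_add)
  then show ?thesis by (simp add: eq_neg_iff_add_eq_0)
qed
lemma s_diff: "\<sigma> (x - y) = \<sigma> x - \<sigma> y" using s_add[of x "- y"] by (simp add: s_minus)
lemma s_divide: "\<sigma> (x / y) = \<sigma> x / \<sigma> y"
proof (cases "y = 0")
  case False
  then have "\<sigma> (x / y) * \<sigma> y = \<sigma> x" by (simp flip: s_mult)
  then show ?thesis using False by (simp add: eq_divide_eq)
qed simp
lemma s_power: "\<sigma> (x ^ n) = \<sigma> x ^ n" by (induction n) (auto simp: s_mult)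
lemma s_of_nat: "\<sigma> (of_nat n) = of_nat n" by (induction n) (auto simp: s_add)
lemma s_of_int: "\<sigma> (of_int n) = of_int n"
  by (cases n rule: int_cases2) (auto simp: s_of_nat s_minus)
lemma s_to_ac [simp]: "\<sigma> (to_ac q) = to_ac q"
  by (simp add: to_ac_of_rat s_divide s_of_int)

lemma s_poly: "\<sigma> (poly p x) = poly (map_poly \<sigma> p) (\<sigma> x)"
  by (induction p) (auto simp: map_poly_pCons s_add s_mult)

lemma s_base_change [simp]: "map_poly \<sigma> (base_change p) = base_change p"
  by (rule poly_eqI) (simp add: base_change_def coeff_map_poly)

lemma inv_galois: "inv_into UNIV \<sigma> \<in> galois"
proof -
  have s: "\<sigma> (inv_into UNIV \<sigma> x) = x" for x using s_bij by (simp add: bij_is_surj surj_f_inv_f)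
  have "inv_into UNIV \<sigma> (x + y) = inv_into UNIV \<sigma> x + inv_into UNIV \<sigma> y" for x y by (rule s_eq_iff[THEN iffD1]) (simp add: s s_add)
  moreover have "inv_into UNIV \<sigma> (x * y) = inv_into UNIV \<sigma> x * inv_into UNIV \<sigma> y" for x y by (rule s_eq_iff[THEN iffD1]) (simp add: s s_mult)
  ultimately show ?thesis using s_bij bij_imp_bij_inv by (auto simp: galois_def)
qed

abbreviation gp where "gp \<equiv> galois_point \<sigma>"
abbreviation gd where "gd \<equiv> frag_extend (frag_of \<circ> gp)"

lemma gp_inv: "gp (galois_point (inv_into UNIV \<sigma>) P) = P" "galois_point (inv_into UNIV \<sigma>) (gp P) = P"
  using s_bij by (cases P; simp add: bij_is_surj bij_is_inj surj_f_inv_f inv_f_f)+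

lemma gd_inv: "gd (frag_extend (frag_of \<circ> galois_point (inv_into UNIV \<sigma>)) D) = D"
proof -
  have "gd (frag_extend (frag_of \<circ> galois_point (inv_into UNIV \<sigma>)) D) = frag_extend ((frag_of \<circ> gp) \<circ> galois_point (inv_into UNIV \<sigma>)) D"
    by (rule frag_extend_compose)
  also have "(frag_of \<circ> gp) \<circ> galois_point (inv_into UNIV \<sigma>) = frag_of" by (auto simp: gp_inv)
  finally show ?thesis by (simp only: frag_expansion[symmetric])
qed

text \<open>The action of \<sigma> on the coefficients of rational functions: evaluation at x with
  constants twisted by \<sigma>.\<close>

sublocale sg: rat_evaluation "\<lambda>a. cf (\<sigma> a)" "fx :: qbar poly fract"
proof
  have "poly (map_poly (\<lambda>a. cf (\<sigma> a)) p) fx = to_fract (map_poly \<sigma> p)" for p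
    by (subst to_fract_poly) (simp add: map_poly_map_poly o_def)
  moreover have "map_poly \<sigma> p \<noteq> 0" if "p \<noteq> 0" for p
    using that by (metis coeff_map_poly leading_coeff_0_iff s_0 s_eq_0_iff coeff_0)
  ultimately show "p \<noteq> 0 \<Longrightarrow> poly (map_poly (\<lambda>a. cf (\<sigma> a)) p) fx \<noteq> 0" for p by simp
qed (auto simp: s_add s_mult cf_add cf_mult)

lemma sg_to_fract: "sg.ev (to_fract p) = to_fract (map_poly \<sigma> p)"
  unfolding sg.ev_to_fract by (subst to_fract_poly) (simp add: map_poly_map_poly o_def)

definition gs :: "ratfun \<Rightarrow> ratfun" where "gs h = (sg.ev (fst h), sg.ev (snd h))"

lemma gs_eq_0_iff [simp]: "gs h = 0 \<longleftrightarrow> h = 0" by (auto simp: gs_def prod_eq_iff)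

lemma loc_gs: "sg.ev (loc_par P) = loc_par (gp P)" "sg.ev (loc_b d P) = loc_b d (gp P)" "loc_val (gp P) = \<sigma> (loc_val P)"
  by (cases P; simp add: sg_to_fract map_poly_pCons s_minus sg.ev_divide sg.ev_power)+

lemma gp_Orig [simp]: "gp (Infty 0) = Infty 0" by simp

end

locale galois_curve = curve f d + galois_elt \<sigma> for f d \<sigma>
begin

lemma gp_points: "P \<in> points f \<Longrightarrow> gp P \<in> points f"
proof (cases P)
  case (Aff x y)
  assume "P \<in> points f"
  then have "y\<^sup>2 = poly F x" using Aff by (auto simp: points_def)
  then have "(\<sigma> y)\<^sup>2 = poly F (\<sigma> x)" using s_poly[of F x] by (simp flip: s_power)
  then show ?thesis using Aff by (auto simp: points_def)
next
  case (Infty s)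
  assume "P \<in> points f"
  then have "s\<^sup>2 = coeff F (2 * half_deg f)" using Infty by (auto simp: points_def)
  then have "\<sigma> (s\<^sup>2) = coeff F (2 * half_deg f)" by (simp add: base_change_def coeff_map_poly)
  then have "(\<sigma> s)\<^sup>2 = coeff F (2 * half_deg f)" by (simp add: s_power)
  then show ?thesis using Infty by (auto simp: points_def)
qed

lemma gs_mult: "gs (h \<diamondop> k) = gs h \<diamondop> gs k"
  by (simp add: gs_def rmul_def sg.ev_add sg.ev_mult sg_to_fract)

lemma gs_add: "gs (h + k) = gs h + gs k"
  by (simp add: gs_def sg.ev_add)

text \<open>The order at \<sigma>(P) of the twisted function is a valuation centred at P with value
  1 on the uniformizer.\<close>

lemma ord_gs:
  assumes P: "P \<in> points f" and h: "h \<noteq> 0"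
  shows "ord_at f (gp P) (gs h) = ord_at f P h"
proof -
  let ?V = "\<lambda>h. ord_at f (gp P) (gs h)"
  have P': "gp P \<in> points f" by (rule gp_points[OF P])
  interpret v: valuation F "ord_at f (gp P)" by (rule valuation_ord[OF P'])
  note cen = centredD[OF centred_ord_at(1)[OF P']]
  have "is_val F ?V" unfolding is_val_def
  proof (intro conjI allI impI)
    fix h k :: ratfun assume *: "h \<noteq> 0" "k \<noteq> 0"
    then show "?V (h \<diamondop> k) = ?V h + ?V k" by (simp add: gs_mult v.V_mult)
    assume "h + k \<noteq> 0"
    then have "gs h + gs k \<noteq> 0" by (simp flip: gs_add)
    then show "min (?V h) (?V k) \<le> ?V (h + k)" using * v.V_add[of "gs h" "gs k"] by (simp add: gs_add)
  qed (simp add: gs_def v.V_cf)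
  moreover have "gs (loc_par P, 0) = (loc_par (gp P), 0)" by (simp add: gs_def loc_gs)
  moreover have "gs ((0, loc_b d P) - (cf (loc_val P), 0)) = (0, loc_b d (gp P)) - (cf (loc_val (gp P)), 0)"
    by (simp add: gs_def loc_gs sg.ev_minus)
  moreover have "vpos ?V h = vpos (ord_at f (gp P)) (gs h)" for h by (simp add: vpos_def)
  ultimately have c: "centred F d ?V P" using cen by (simp add: centred_def)
  have "gs (loc_unif d P) = loc_unif d (gp P)" by (simp add: gs_def loc_unif_def loc_gs)
  then have "?V (loc_unif d P) = 1" using centred_ord_at(2)[OF P'] by simp
  then show ?thesis using centred_eq_ord_at[OF P c h] by simp
qed

lemma gp_points_inv: "P \<in> points f \<Longrightarrow> galois_point (inv_into UNIV \<sigma>) P \<in> points f"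
proof -
  interpret i: galois_curve f d "inv_into UNIV \<sigma>" by unfold_locales (rule inv_galois)
  show "P \<in> points f \<Longrightarrow> galois_point (inv_into UNIV \<sigma>) P \<in> points f" by (rule i.gp_points)
qed

lemma gd_principal: "D \<in> principal f \<Longrightarrow> gd D \<in> principal f"
proof -
  assume "D \<in> principal f"
  then obtain h where h: "h \<noteq> 0" "D = fdiv h" by (auto simp: principal_iff)
  have "gd D = fdiv (gs h)"
  proof (rule poly_mapping_eqI)
    fix R
    define P where "P = galois_point (inv_into UNIV \<sigma>) R"
    have PR: "gp P = R" by (simp add: P_def gp_inv)
    have "Poly_Mapping.lookup (gd D) R = (\<Sum>Q\<in>{P}. Poly_Mapping.lookup D Q)"
      by (rule lookup_frag_extend_superset) (use PR gp_inv(2) in \<open>auto simp: P_def\<close>)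
    also have "\<dots> = Poly_Mapping.lookup (fdiv (gs h)) R"
    proof (cases "R \<in> points f")
      case True
      then have "P \<in> points f" unfolding P_def by (rule gp_points_inv)
      then show ?thesis using True h PR ord_gs[of P h] by (simp add: lookup_fdiv)
    next
      case False
      then have "P \<notin> points f" using gp_points PR by auto
      then show ?thesis using False h by (simp add: lookup_fdiv)
    qed
    finally show "Poly_Mapping.lookup (gd D) R = Poly_Mapping.lookup (fdiv (gs h)) R" .
  qed
  then show ?thesis using h principal_iff gs_eq_0_iff by metis
qed

lemma gd_divisors0: "D \<in> carrier (divisors0 f) \<Longrightarrow> gd D \<in> carrier (divisors0 f)"
proof -
  assume D: "D \<in> carrier (divisors0 f)"
  have "Poly_Mapping.keys (gd D) \<subseteq> points f"
    using keys_frag_extend[of "frag_of \<circ> gp" D] D gp_points by (fastforce simp: carrier_divisors0)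
  moreover have "div_degree (gd D) = div_degree D"
  proof -
    have "div_degree (frag_cmul n D) = n * div_degree D" for n :: int and D
      using div_degree_eq_sum[of "Poly_Mapping.keys D" "frag_cmul n D"]
      by (auto simp: div_degree_def in_keys_iff sum_distrib_left)
    moreover have "div_degree (sum g A) = (\<Sum>i\<in>A. div_degree (g i))" if "finite A" for g :: "point \<Rightarrow> _" and A
      using that by (induction A rule: finite_induct) (auto simp: div_degree_add)
    ultimately show ?thesis unfolding frag_extend_def by (simp add: div_degree_def[of D])
  qed
  ultimately show ?thesis using D by (simp add: carrier_divisors0)
qed

lemma galois_class_div_class: "galois_class \<sigma> (div_class f D) = div_class f (gd D)"
proof (intro equalityI subsetI)
  fix E assume "E \<in> galois_class \<sigma> (div_class f D)"
  then obtain E0 where E0: "E = gd E0" "E0 - D \<in> principal f" by (auto simp: galois_class_def div_class_eq)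
  then show "E \<in> div_class f (gd D)" using gd_principal[OF E0(2)] by (simp add: div_class_eq frag_extend_diff)
next
  fix E assume "E \<in> div_class f (gd D)"
  then have E: "E - gd D \<in> principal f" by (simp add: div_class_eq)
  interpret i: galois_curve f d "inv_into UNIV \<sigma>" by unfold_locales (rule inv_galois)
  have ii: "inv_into UNIV (inv_into UNIV \<sigma>) = \<sigma>" using s_bij by (rule inv_inv_eq)
  have "i.gd (E - gd D) \<in> principal f" by (rule i.gd_principal[OF E])
  then have "i.gd E - D \<in> principal f" using i.gd_inv[of D] by (simp add: frag_extend_diff ii)
  moreover have "E = gd (i.gd E)" by (simp add: gd_inv)
  ultimately show "E \<in> galois_class \<sigma> (div_class f D)" by (auto simp: galois_class_def div_class_eq)
qed

end

locale galois_elliptic = elliptic f + galois_elt \<sigma> for f \<sigma>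
begin

sublocale galois_curve f 2 \<sigma> ..

lemma sums_to_gd: "sums_to D R \<Longrightarrow> sums_to (gd D) (gp R)"
  using gd_principal[of "frag_of R - frag_of Orig - D"] gp_points[of R]
  by (auto simp: sums_to_def frag_extend_diff)

end

section \<open>An automorphism moving a square root\<close>

text \<open>A set of pairs that is the graph of an isomorphism between two subrings.\<close>

definition partial_aut :: "(qbar \<times> qbar) set \<Rightarrow> bool" where
  "partial_aut R \<longleftrightarrow> (1, 1) \<in> R \<and> (\<forall>p\<in>R. \<forall>q\<in>R. p - q \<in> R \<and> (fst p * fst q, snd p * snd q) \<in> R) \<and>
     (\<forall>p\<in>R. fst p = 0 \<longleftrightarrow> snd p = 0)"

locale paut =
  fixes R assumes R: "partial_aut R"
begin

lemma one: "(1, 1) \<in> R" and diff: "p \<in> R \<Longrightarrow> q \<in> R \<Longrightarrow> p - q \<in> R"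
  and mult: "(a, b) \<in> R \<Longrightarrow> (c, d) \<in> R \<Longrightarrow> (a * c, b * d) \<in> R"
  and zero_iff: "(a, b) \<in> R \<Longrightarrow> a = 0 \<longleftrightarrow> b = 0"
  using R unfolding partial_aut_def by force+

lemma zero: "(0, 0) \<in> R" using diff[OF one one] by (simp add: zero_prod_def)
lemma uminus: "(a, b) \<in> R \<Longrightarrow> (- a, - b) \<in> R" using diff[OF zero] by fastforce
lemma add: "(a, b) \<in> R \<Longrightarrow> (c, d) \<in> R \<Longrightarrow> (a + c, b + d) \<in> R"
  using diff[of "(a, b)" "(- c, - d)"] uminus[of c d] by simp
lemma functional: "(a, b) \<in> R \<Longrightarrow> (a, c) \<in> R \<Longrightarrow> b = c"
  using diff[of "(a, b)" "(a, c)"] zero_iff[of 0 "b - c"] by simp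
lemma injective: "(a, c) \<in> R \<Longrightarrow> (b, c) \<in> R \<Longrightarrow> a = b"
  using diff[of "(a, c)" "(b, c)"] zero_iff[of "a - b" 0] by simp
lemma sum: "finite A \<Longrightarrow> (\<And>i. i \<in> A \<Longrightarrow> (g i, h i) \<in> R) \<Longrightarrow> (\<Sum>i\<in>A. g i, \<Sum>i\<in>A. h i) \<in> R"
  by (induction A rule: finite_induct) (auto simp: zero add)

text \<open>\<open>q\<close> is the image of \<open>p\<close> under the partial automorphism,
  applied to coefficients.\<close>

definition PX where "PX p q \<longleftrightarrow> (\<forall>i. (coeff p i, coeff q i) \<in> R)"

lemma PX_diff: "PX p p' \<Longrightarrow> PX q q' \<Longrightarrow> PX (p - q) (p' - q')" unfolding PX_def using diff by fastforce
lemma PX_add: "PX p p' \<Longrightarrow> PX q q' \<Longrightarrow> PX (p + q) (p' + q')" unfolding PX_def using add by fastforce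
lemma PX_mult: "PX p p' \<Longrightarrow> PX q q' \<Longrightarrow> PX (p * q) (p' * q')"
  unfolding PX_def coeff_mult by (intro allI sum mult) auto
lemma PX_monom: "(a, b) \<in> R \<Longrightarrow> PX (monom a n) (monom b n)" unfolding PX_def by (auto simp: zero)
lemma PX_const: "(a, b) \<in> R \<Longrightarrow> PX [:a:] [:b:]" using PX_monom[of a b 0] by (simp add: monom_0)
lemma PX_zero_iff: "PX p q \<Longrightarrow> p = 0 \<longleftrightarrow> q = 0"
  unfolding PX_def poly_eq_iff by (auto simp: zero_iff) (metis zero_iff)+
lemma PX_degree: "PX p q \<Longrightarrow> Polynomial.degree p = Polynomial.degree q"
proof -
  assume pq: "PX p q"
  have "coeff p i = 0 \<longleftrightarrow> coeff q i = 0" for i using pq zero_iff by (auto simp: PX_def)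
  then show ?thesis unfolding Polynomial.degree_def by simp
qed

text \<open>Long division runs in parallel on both sides, because matching leading coefficients have
  matching quotients; \<open>inv\<close> makes the domain a field.\<close>

lemma PX_division:
  assumes inv: "\<And>a b. (a, b) \<in> R \<Longrightarrow> a \<noteq> 0 \<Longrightarrow> (1 / a, 1 / b) \<in> R"
    and D: "PX D D'" "D \<noteq> 0" and P: "PX p p'"
  shows "\<exists>q q' r r'. PX q q' \<and> PX r r' \<and> p = q * D + r \<and> p' = q' * D' + r' \<and> (r = 0 \<or> Polynomial.degree r < Polynomial.degree D)"
  using P
proof (induction "Polynomial.degree p" arbitrary: p p' rule: less_induct)
  case less
  have PX0: "PX 0 0" by (simp add: PX_def zero)
  show ?case
  proof (cases "p = 0 \<or> Polynomial.degree p < Polynomial.degree D")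
    case True
    then show ?thesis using less.prems PX0 by (intro exI[of _ 0] exI[of _ p] exI[of _ p']) auto
  next
    case False
    define n where "n = Polynomial.degree p - Polynomial.degree D"
    define a a' where "a = lead_coeff p / lead_coeff D" and "a' = lead_coeff p' / lead_coeff D'"
    have dp: "Polynomial.degree p' = Polynomial.degree p" "Polynomial.degree D' = Polynomial.degree D"
      using PX_degree less.prems D by auto
    have "(lead_coeff p, lead_coeff p') \<in> R" "(1 / lead_coeff D, 1 / lead_coeff D') \<in> R"
      using less.prems D inv dp unfolding PX_def by auto
    then have aR: "(a, a') \<in> R" using mult unfolding a_def a'_def by fastforce
    define s s' where "s = p - monom a n * D" and "s' = p' - monom a' n * D'"
    have PXs: "PX s s'" unfolding s_def s'_def by (intro PX_diff less.prems PX_mult PX_monom aR D)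
    have lD: "lead_coeff D \<noteq> 0" using D by simp
    have ds: "s = 0 \<or> Polynomial.degree s < Polynomial.degree p"
    proof (rule eq_zero_or_degree_less)
      have "Polynomial.degree (monom a n * D) \<le> Polynomial.degree p"
        using degree_mult_le[of "monom a n" D] degree_monom_le[of a n] False unfolding n_def by linarith
      then show "Polynomial.degree s \<le> Polynomial.degree p" unfolding s_def by (intro degree_diff_le) auto
      show "coeff s (Polynomial.degree p) = 0"
        using False lD by (simp add: s_def coeff_monom_mult n_def a_def)
    qed
    have "\<exists>q q' r r'. PX q q' \<and> PX r r' \<and> s = q * D + r \<and> s' = q' * D' + r' \<and> (r = 0 \<or> Polynomial.degree r < Polynomial.degree D)"
    proof (cases "s = 0")
      case True
      then have "s' = 0" using PX_zero_iff[OF PXs] by simp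
      then show ?thesis using True PX0 by (intro exI[of _ 0]) auto
    next
      case sn: False
      then show ?thesis using less.hyps[OF _ PXs] ds by blast
    qed
    then obtain q q' r r' where *: "PX q q'" "PX r r'" "s = q * D + r" "s' = q' * D' + r'" "r = 0 \<or> Polynomial.degree r < Polynomial.degree D" by blast
    have "PX (q + monom a n) (q' + monom a' n)" by (intro PX_add PX_monom aR *)
    moreover have "p = (q + monom a n) * D + r" "p' = (q' + monom a' n) * D' + r'"
      using *(3,4) unfolding s_def s'_def by (simp_all add: algebra_simps)
    ultimately show ?thesis using * by blast
  qed
qed

end

text \<open>An isomorphism of subrings extends to fractions, so a maximal partial automorphism has a
  field as its domain.\<close>

lemma partial_aut_localize:
  assumes R: "partial_aut R"
  shows "partial_aut {(a / c, b / d) | a b c d. (a, b) \<in> R \<and> (c, d) \<in> R \<and> c \<noteq> 0}"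
    (is "partial_aut ?L")
proof -
  interpret paut R by standard (rule R)
  have L: "(a / c, b / d) \<in> ?L" if "(a, b) \<in> R" "(c, d) \<in> R" "c \<noteq> 0" for a b c d using that by blast
  show ?thesis unfolding partial_aut_def
  proof (intro conjI ballI)
    show "(1, 1) \<in> ?L" using L[OF one one] by simp
    fix p q assume "p \<in> ?L" "q \<in> ?L"
    then obtain a b c d a' b' c' d' where *: "p = (a / c, b / d)" "(a, b) \<in> R" "(c, d) \<in> R" "c \<noteq> 0"
      "q = (a' / c', b' / d')" "(a', b') \<in> R" "(c', d') \<in> R" "c' \<noteq> 0" by blast
    have dn: "d \<noteq> 0" "d' \<noteq> 0" using zero_iff * by blast+
    have cc: "(c * c', d * d') \<in> R" "c * c' \<noteq> 0" using mult * by auto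
    have "(a * c' - a' * c, b * d' - b' * d) \<in> R" using diff[OF mult[OF *(2,7)] mult[OF *(6,3)]] by simp
    from L[OF this cc] show "p - q \<in> ?L" using * dn by (simp add: diff_frac_eq)
    from L[OF mult[OF *(2,6)] cc] show "(fst p * fst q, snd p * snd q) \<in> ?L" using * by simp
  next
    fix p assume "p \<in> ?L"
    then obtain a b c d where *: "p = (a / c, b / d)" "(a, b) \<in> R" "(c, d) \<in> R" "c \<noteq> 0" by blast
    then have "d \<noteq> 0" using zero_iff by blast
    then show "(fst p = 0) = (snd p = 0)" using * zero_iff by auto
  qed
qed

text \<open>The extension of a field isomorphism to a simple algebraic extension: \<open>a\<close>
  is sent to a root \<open>b\<close> of the image of a polynomial of least degree vanishing at
  \<open>a\<close>. Both directions of well-definedness come from division with remainder.\<close>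

lemma partial_aut_extend:
  assumes R: "partial_aut R" and inv: "\<And>a b. (a, b) \<in> R \<Longrightarrow> a \<noteq> 0 \<Longrightarrow> (1 / a, 1 / b) \<in> R"
  shows "\<exists>S b. partial_aut S \<and> R \<subseteq> S \<and> (a, b) \<in> S"
proof -
  interpret paut R by standard (rule R)
  obtain p0 :: "rat poly" where p0: "p0 \<noteq> 0" "poly (base_change p0) a = 0" using alg_closure_rat_algebraic by blast
  have nat: "(of_nat n, of_nat n) \<in> R" for n by (induction n) (auto simp: zero one intro!: add)
  have int: "(of_int n, of_int n) \<in> R" for n
    by (cases n rule: int_cases2) (auto simp: nat intro!: uminus)
  have rat: "(to_ac q, to_ac q) \<in> R" for q
  proof -
    have "snd (quotient_of q) \<noteq> 0" using quotient_of_denom_pos'[of q] by simp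
    then show ?thesis unfolding to_ac_of_rat
      using mult[OF int[of "fst (quotient_of q)"] inv[OF int[of "snd (quotient_of q)"]]] by simp
  qed
  have "PX (base_change p0) (base_change p0)" by (simp add: PX_def base_change_def coeff_map_poly rat)
  moreover have "base_change p0 \<noteq> 0" using p0(1) by (auto simp: base_change_def poly_eq_iff coeff_map_poly)
  ultimately have ex: "\<exists>n p p'. PX p p' \<and> p \<noteq> 0 \<and> poly p a = 0 \<and> Polynomial.degree p = n" using p0(2) by blast
  define N where "N = (LEAST n. \<exists>p p'. PX p p' \<and> p \<noteq> 0 \<and> poly p a = 0 \<and> Polynomial.degree p = n)"
  obtain p p' where p: "PX p p'" "p \<noteq> 0" "poly p a = 0" "Polynomial.degree p = N"
    using LeastI_ex[OF ex] unfolding N_def by blast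
  have min: "N \<le> Polynomial.degree q" if "PX q q'" "q \<noteq> 0" "poly q a = 0" for q q'
    unfolding N_def using that by (intro Least_le) blast
  have N0: "N > 0"
  proof (rule ccontr)
    assume "\<not> N > 0"
    then obtain c where "p = [:c:]" using p(4) by (metis degree_eq_zeroE gr0I)
    then show False using p by simp
  qed
  have dp': "Polynomial.degree p' = N" using PX_degree[OF p(1)] p(4) by simp
  obtain b where b: "poly p' b = 0" using alg_closed_imp_poly_has_root[of p'] dp' N0 by auto
  have fwd: "poly q' b = 0" if q: "PX q q'" "poly q a = 0" for q q'
  proof -
    obtain u u' r r' where *: "PX u u'" "PX r r'" "q = u * p + r" "q' = u' * p' + r'" "r = 0 \<or> Polynomial.degree r < N"
      using PX_division[OF inv p(1,2) q(1)] p(4) by blast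
    have "poly r a = 0" using * q(2) p(3) by simp
    then have "r = 0" using min[OF *(2)] *(5) by (meson not_le)
    then have "r' = 0" using PX_zero_iff[OF *(2)] by simp
    then show ?thesis using * b by simp
  qed
  \<comment> \<open>For the converse direction take \<open>g\<close> of least degree among
    polynomials whose image vanishes at \<open>b\<close>. It divides \<open>p\<close>; if it did not
    vanish at \<open>a\<close>, the cofactor would, and minimality of \<open>p\<close> would make
    \<open>g\<close> constant.\<close>
  define m where "m = (LEAST n. \<exists>q q'. PX q q' \<and> q \<noteq> 0 \<and> poly q' b = 0 \<and> Polynomial.degree q = n)"
  have "\<exists>n q q'. PX q q' \<and> q \<noteq> 0 \<and> poly q' b = 0 \<and> Polynomial.degree q = n" using p b by blast
  then obtain g g' where g: "PX g g'" "g \<noteq> 0" "poly g' b = 0" "Polynomial.degree g = m"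
    unfolding m_def using LeastI_ex[of "\<lambda>n. \<exists>q q'. PX q q' \<and> q \<noteq> 0 \<and> poly q' b = 0 \<and> Polynomial.degree q = n"] by blast
  have ming: "m \<le> Polynomial.degree q" if "PX q q'" "q \<noteq> 0" "poly q' b = 0" for q q'
    unfolding m_def using that by (intro Least_le) blast
  have divg: "\<exists>u u'. PX u u' \<and> q = u * g" if q: "PX q q'" "poly q' b = 0" for q q'
  proof -
    obtain u u' r r' where *: "PX u u'" "PX r r'" "q = u * g + r" "q' = u' * g' + r'" "r = 0 \<or> Polynomial.degree r < m"
      using PX_division[OF inv g(1,2) q(1)] g(4) by blast
    have "poly r' b = 0" using * q(2) g(3) by simp
    then have "r = 0" using ming[OF *(2)] *(5) by (meson not_le)
    then show ?thesis using * by auto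
  qed
  have ga: "poly g a = 0"
  proof (rule ccontr)
    assume ne: "poly g a \<noteq> 0"
    obtain u u' where u: "PX u u'" "p = u * g" using divg[OF p(1) b] by blast
    then have "poly u a = 0" using p(3) ne by simp
    moreover have "u \<noteq> 0" using u p(2) by auto
    ultimately have "N \<le> Polynomial.degree u" using min[OF u(1)] by simp
    moreover have "N = Polynomial.degree u + m" using u p g \<open>u \<noteq> 0\<close> degree_mult_eq[of u g] by simp
    ultimately have "m = 0" by simp
    then have "Polynomial.degree g' = 0" using PX_degree[OF g(1)] g(4) by simp
    then obtain c where "g' = [:c:]" by (metis degree_eq_zeroE)
    then have "g' = 0" using g(3) by simp
    then show False using PX_zero_iff[OF g(1)] g(2) by simp
  qed
  have bwd: "poly q a = 0" if "PX q q'" "poly q' b = 0" for q q'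
    using divg[OF that] ga by auto
  define S where "S = {(poly q a, poly q' b) | q q'. PX q q'}"
  have "partial_aut S" unfolding partial_aut_def
  proof (intro conjI ballI)
    show "(1, 1) \<in> S" unfolding S_def using PX_const[OF one] by force
    fix x y assume "x \<in> S" "y \<in> S"
    then obtain q q' r r' where *: "x = (poly q a, poly q' b)" "PX q q'" "y = (poly r a, poly r' b)" "PX r r'"
      unfolding S_def by blast
    have "x - y = (poly (q - r) a, poly (q' - r') b)" by (simp add: *)
    then show "x - y \<in> S" unfolding S_def using PX_diff[OF *(2,4)] by blast
    have "(fst x * fst y, snd x * snd y) = (poly (q * r) a, poly (q' * r') b)" by (simp add: *)
    then show "(fst x * fst y, snd x * snd y) \<in> S" unfolding S_def using PX_mult[OF *(2,4)] by blast
  next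
    fix x assume "x \<in> S"
    then obtain q q' where "x = (poly q a, poly q' b)" "PX q q'" unfolding S_def by blast
    then show "(fst x = 0) = (snd x = 0)" using fwd bwd by auto
  qed
  moreover have "R \<subseteq> S"
  proof
    fix x assume "x \<in> R"
    then obtain c d where cd: "x = (c, d)" "(c, d) \<in> R" by (cases x) auto
    then show "x \<in> S" unfolding S_def using PX_const[OF cd(2)] by force
  qed
  moreover have "(a, b) \<in> S"
  proof -
    have "PX (monom 1 1) (monom 1 1)" by (rule PX_monom[OF one])
    then show ?thesis unfolding S_def by (intro CollectI exI[of _ "monom 1 1"]) (auto simp: poly_monom)
  qed
  ultimately show ?thesis by blast
qed

text \<open>Zorn's lemma. A maximal partial automorphism is closed under quotients and, as
  everything is algebraic over the rationals, defined everywhere. It permutes the finitely many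
  roots of each rational polynomial, hence is surjective.\<close>

theorem extend_to_galois:
  assumes R0: "partial_aut R0"
  shows "\<exists>\<sigma>\<in>galois. \<forall>(a, b)\<in>R0. \<sigma> a = b"
proof -
  define \<A> where "\<A> = {R. partial_aut R \<and> R0 \<subseteq> R}"
  have "\<exists>M\<in>\<A>. \<forall>Z\<in>\<A>. M \<subseteq> Z \<longrightarrow> Z = M"
  proof (rule subset_Zorn_nonempty)
    show "\<A> \<noteq> {}" using R0 by (auto simp: \<A>_def)
    fix C assume C: "C \<noteq> {}" "subset.chain \<A> C"
    have pa: "partial_aut Z" "R0 \<subseteq> Z" if "Z \<in> C" for Z using C(2) that by (auto simp: subset_chain_def \<A>_def)
    have common: "\<exists>Z\<in>C. p \<in> Z \<and> q \<in> Z" if pq: "p \<in> \<Union>C" "q \<in> \<Union>C" for p q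
    proof -
      obtain Z1 Z2 where Z: "Z1 \<in> C" "p \<in> Z1" "Z2 \<in> C" "q \<in> Z2" using pq by blast
      then have "Z1 \<subseteq> Z2 \<or> Z2 \<subseteq> Z1" using C(2) by (auto simp: subset_chain_def)
      then show ?thesis using Z by blast
    qed
    have "partial_aut (\<Union>C)" unfolding partial_aut_def
    proof (intro conjI ballI)
      show "(1, 1) \<in> \<Union>C" using C(1) pa(1) by (auto simp: partial_aut_def)
      fix p q assume "p \<in> \<Union>C" "q \<in> \<Union>C"
      then obtain Z where Z: "Z \<in> C" "p \<in> Z" "q \<in> Z" using common by blast
      then show "p - q \<in> \<Union>C" "(fst p * fst q, snd p * snd q) \<in> \<Union>C" using pa(1)[OF Z(1)] by (auto simp: partial_aut_def)
    next
      fix p assume "p \<in> \<Union>C"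
      then show "(fst p = 0) = (snd p = 0)" using pa(1) by (auto simp: partial_aut_def)
    qed
    then show "\<Union>C \<in> \<A>" using C(1) pa(2) by (auto simp: \<A>_def)
  qed
  then obtain M where M: "partial_aut M" "R0 \<subseteq> M" "\<And>Z. partial_aut Z \<Longrightarrow> M \<subseteq> Z \<Longrightarrow> Z = M"
    by (auto simp: \<A>_def)
  interpret paut M by standard (rule M)
  let ?L = "{(a / c, b / d) | a b c d. (a, b) \<in> M \<and> (c, d) \<in> M \<and> c \<noteq> 0}"
  have "M \<subseteq> ?L"
  proof
    fix x assume "x \<in> M"
    then obtain c d where "x = (c / 1, d / 1)" "(c, d) \<in> M" by (cases x) auto
    then show "x \<in> ?L" using one by force
  qed
  then have L: "?L = M" using M(3)[OF partial_aut_localize[OF M(1)]] by blast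
  have inv: "(1 / a, 1 / b) \<in> M" if "(a, b) \<in> M" "a \<noteq> 0" for a b
  proof -
    have "(1 / a, 1 / b) \<in> ?L" using that one by blast
    then show ?thesis using L by simp
  qed
  have total: "\<exists>b. (a, b) \<in> M" for a
  proof -
    obtain S b where S: "partial_aut S" "M \<subseteq> S" "(a, b) \<in> S" using partial_aut_extend[OF M(1) inv] by blast
    then show ?thesis using M(3)[OF S(1,2)] by blast
  qed
  define \<sigma> where "\<sigma> a = (THE b. (a, b) \<in> M)" for a
  have s: "(a, \<sigma> a) \<in> M" for a
  proof -
    obtain b where b: "(a, b) \<in> M" using total by blast
    then show ?thesis unfolding \<sigma>_def by (rule theI[of "\<lambda>b. (a, b) \<in> M"]) (rule functional[OF _ b])
  qed
  have seq: "(a, b) \<in> M \<Longrightarrow> \<sigma> a = b" for a b by (rule functional[OF s])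
  have add_s: "\<sigma> (x + y) = \<sigma> x + \<sigma> y" and mult_s: "\<sigma> (x * y) = \<sigma> x * \<sigma> y" for x y
    by (rule seq[OF add[OF s s]], rule seq[OF mult[OF s s]])
  have inj: "inj \<sigma>" by (rule injI, rule injective[OF s]) (metis s)
  have int: "\<sigma> (of_int n) = of_int n" for n
  proof -
    have nat: "\<sigma> (of_nat n) = of_nat n" for n by (induction n) (auto simp: add_s seq[OF one] seq[OF zero])
    show ?thesis
    proof (cases n rule: int_cases2)
      case (nonpos k)
      then show ?thesis using seq[OF uminus[OF s[of "of_nat k"]]] nat by simp
    qed (simp add: nat)
  qed
  have rat: "\<sigma> (to_ac q) = to_ac q" for q
  proof -
    have nz: "of_int (snd (quotient_of q)) \<noteq> (0 :: qbar)" using quotient_of_denom_pos'[of q] by simp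
    have "\<sigma> (to_ac q) * of_int (snd (quotient_of q)) = of_int (fst (quotient_of q))"
      using mult_s[of "to_ac q" "of_int (snd (quotient_of q))"] nz by (simp add: to_ac_of_rat int)
    then show ?thesis using nz by (simp add: to_ac_of_rat eq_divide_eq)
  qed
  have "surj \<sigma>"
  proof (rule surjI)
    fix y
    obtain p :: "rat poly" where p: "p \<noteq> 0" "poly (base_change p) y = 0" using alg_closure_rat_algebraic by blast
    let ?Z = "{x. poly (base_change p) x = 0}"
    have nz: "base_change p \<noteq> 0" using p(1) by (auto simp: base_change_def poly_eq_iff coeff_map_poly)
    have ev: "\<sigma> (poly (base_change q) x) = poly (base_change q) (\<sigma> x)" for q x
      by (induction q) (auto simp: add_s mult_s rat seq[OF zero])
    have "poly (base_change p) (\<sigma> x) = 0" if "poly (base_change p) x = 0" for x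
      using ev[of p x] that seq[OF zero] by simp
    then have "\<sigma> ` ?Z \<subseteq> ?Z" by blast
    then have "\<sigma> ` ?Z = ?Z" using poly_roots_finite[OF nz] inj by (meson endo_inj_surj inj_on_subset subset_UNIV)
    then have "y \<in> \<sigma> ` ?Z" using p(2) by simp
    then show "\<sigma> (inv_into UNIV \<sigma> y) = y" using f_inv_into_f[of y \<sigma> UNIV] by blast
  qed
  then have "\<sigma> \<in> galois" using inj add_s mult_s by (auto simp: galois_def bij_def)
  then show ?thesis using M(2) seq by blast
qed

text \<open>Conjugation x + y s \<mapsto> x - y s on rational x, y is well defined and injective
  because \<open>r\<close> is not a square; it extends to the whole closure.\<close>

lemma galois_moves_sqrt:
  assumes s: "s * s = to_ac (r::rat)" and r: "\<And>q::rat. q * q \<noteq> r"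
  shows "\<exists>\<sigma>\<in>galois. \<sigma> s = - s"
proof -
  define R0 where "R0 = {(to_ac x + to_ac y * s, to_ac x - to_ac y * s) | x y. True}"
  have I: "(to_ac x + to_ac y * s, to_ac x - to_ac y * s) \<in> R0" for x y by (auto simp: R0_def)
  have indep: "x = 0 \<and> y = 0" if "to_ac x = to_ac y * s" for x y
  proof -
    have "to_ac (x * x) = to_ac (y * y) * (s * s)" using that by (simp add: algebra_simps)
    then have "to_ac (x * x) = to_ac (y * y * r)" by (simp add: s)
    then have xy: "x * x = y * y * r" by (simp only: to_ac_eq_iff)
    have "y = 0"
    proof (rule ccontr)
      assume "y \<noteq> 0"
      then have "(x / y) * (x / y) = r" using xy by (simp add: field_simps)
      then show False using r by blast
    qed
    then show ?thesis using xy by simp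
  qed
  have "partial_aut R0" unfolding partial_aut_def
  proof (intro conjI ballI)
    show "(1, 1) \<in> R0" using I[of 1 0] by simp
    fix p q assume "p \<in> R0" "q \<in> R0"
    then obtain x y x' y' where *: "p = (to_ac x + to_ac y * s, to_ac x - to_ac y * s)" "q = (to_ac x' + to_ac y' * s, to_ac x' - to_ac y' * s)"
      by (auto simp: R0_def)
    show "p - q \<in> R0" using I[of "x - x'" "y - y'"] by (simp add: * algebra_simps)
    have "(to_ac x + to_ac y * s) * (to_ac x' + to_ac y' * s) = to_ac (x * x' + y * y' * r) + to_ac (x * y' + y * x') * s"
      "(to_ac x - to_ac y * s) * (to_ac x' - to_ac y' * s) = to_ac (x * x' + y * y' * r) - to_ac (x * y' + y * x') * s"
      by (simp_all add: algebra_simps s[symmetric])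
    then show "(fst p * fst q, snd p * snd q) \<in> R0" using I[of "x * x' + y * y' * r" "x * y' + y * x'"] by (simp add: *)
  next
    fix p assume "p \<in> R0"
    then obtain x y where *: "p = (to_ac x + to_ac y * s, to_ac x - to_ac y * s)" by (auto simp: R0_def)
    show "(fst p = 0) = (snd p = 0)"
      using indep[of x y] indep[of x "- y"] by (auto simp: * add_eq_0_iff2)
  qed
  from extend_to_galois[OF this] I[of 0 1] show ?thesis by fastforce
qed

section \<open>Homomorphisms from the Jacobian to an elliptic curve\<close>

text \<open>\<open>push\<close> lets the map on divisors descend to divisor classes, and
  \<open>gal\<close> makes the induced homomorphism commute with the Galois action.\<close>

locale jac_map = special_map f d g 2 u w \<phi> + E: elliptic g for f d g u w \<phi> +
  assumes push: "D \<in> principal f \<Longrightarrow> frag_extend (frag_of \<circ> \<phi>) D \<in> principal g"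
    and gal: "\<sigma> \<in> galois \<Longrightarrow> P \<in> points f \<Longrightarrow> \<phi> (galois_point \<sigma> P) = galois_point \<sigma> (\<phi> P)"
begin

lemma keys_pt: "D \<in> carrier (divisors0 f) \<Longrightarrow> P \<in> Poly_Mapping.keys D \<Longrightarrow> \<phi> P \<in> points g"
  using pt by (auto simp: src.carrier_divisors0)

lemma push_sum_sums_to:
  assumes D: "D \<in> carrier (divisors0 f)"
  shows "E.sums_to (frag_extend (frag_of \<circ> \<phi>) D) (push_sum g \<phi> D)"
  by (rule E.sums_to_push_sum0) (use D keys_pt[OF D] in \<open>auto simp: src.carrier_divisors0\<close>)

lemma push_sum_points: "D \<in> carrier (divisors0 f) \<Longrightarrow> push_sum g \<phi> D \<in> points g"
  using push_sum_sums_to by (simp add: E.sums_to_def)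

lemma push_sum_cong:
  assumes D: "D \<in> carrier (divisors0 f)" "D' \<in> carrier (divisors0 f)" and eq: "div_class f D = div_class f D'"
  shows "push_sum g \<phi> D = push_sum g \<phi> D'"
proof (rule E.sums_to_unique[OF _ push_sum_sums_to[OF D(2)]])
  have "frag_extend (frag_of \<circ> \<phi>) (D - D') \<in> principal g"
    using eq by (intro push) (simp add: src.div_class_eq_iff)
  then show "E.sums_to (frag_extend (frag_of \<circ> \<phi>) D') (push_sum g \<phi> D)"
    by (intro E.sums_to_equiv[OF push_sum_sums_to[OF D(1)]]) (simp add: frag_extend_diff)
qed

lemma push_sum_diff:
  assumes P: "P \<in> points f" "Q \<in> points f"
  shows "push_sum g \<phi> (frag_of P - frag_of Q) = \<phi> P \<otimes>\<^bsub>ec_group g\<^esub> inv\<^bsub>ec_group g\<^esub> \<phi> Q"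
proof (rule E.sums_to_unique[OF push_sum_sums_to[OF src.point_diff_divisors0[OF P]]])
  have "E.sums_to ((frag_of (\<phi> P) - frag_of (Infty 0)) + - (frag_of (\<phi> Q) - frag_of (Infty 0))) (\<phi> P \<otimes>\<^bsub>ec_group g\<^esub> pconj (\<phi> Q))"
    using P by (intro E.sums_to_add E.sums_to_uminus E.sums_to_point pt)
  then show "E.sums_to (frag_extend (frag_of \<circ> \<phi>) (frag_of P - frag_of Q)) (\<phi> P \<otimes>\<^bsub>ec_group g\<^esub> inv\<^bsub>ec_group g\<^esub> \<phi> Q)"
    using P by (simp add: frag_extend_diff E.inv_G pt)
qed

lemma push_sum_galois:
  assumes s: "\<sigma> \<in> galois" and D: "D \<in> carrier (divisors0 f)"
  shows "push_sum g \<phi> (frag_extend (frag_of \<circ> galois_point \<sigma>) D) = galois_point \<sigma> (push_sum g \<phi> D)"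
proof -
  interpret gf: galois_curve f d \<sigma> by unfold_locales (rule s)
  interpret gg: galois_elliptic g \<sigma> by unfold_locales (rule s)
  have "frag_extend (frag_of \<circ> \<phi>) (frag_extend (frag_of \<circ> galois_point \<sigma>) D) = frag_extend (frag_of \<circ> (\<phi> \<circ> galois_point \<sigma>)) D"
    using frag_extend_compose[of "frag_of \<circ> \<phi>" "galois_point \<sigma>" D] by (simp add: comp_def)
  also have "\<dots> = frag_extend (frag_of \<circ> (galois_point \<sigma> \<circ> \<phi>)) D"
    by (rule frag_extend_eq) (use D gal[OF s] in \<open>auto simp: src.carrier_divisors0\<close>)
  also have "\<dots> = frag_extend (frag_of \<circ> galois_point \<sigma>) (frag_extend (frag_of \<circ> \<phi>) D)"
    using frag_extend_compose[of "frag_of \<circ> galois_point \<sigma>" \<phi> D] by (simp add: comp_def)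
  finally have "E.sums_to (frag_extend (frag_of \<circ> \<phi>) (frag_extend (frag_of \<circ> galois_point \<sigma>) D)) (galois_point \<sigma> (push_sum g \<phi> D))"
    using gg.sums_to_gd[OF push_sum_sums_to[OF D]] by simp
  then show ?thesis by (rule E.sums_to_unique[OF push_sum_sums_to[OF gf.gd_divisors0[OF D]]])
qed

text \<open>Composed with the Abel-Jacobi map based at P0, the induced homomorphism is \<phi>
  followed by translation by -\<phi>(P0); hence the need for translations as morphisms.\<close>

lemma translate_morphism:
  assumes T: "T \<in> points g"
  shows "morphism_over UNIV f g (\<lambda>P. \<phi> P \<otimes>\<^bsub>ec_group g\<^esub> T)"
proof (cases T)
  case (Aff x y)
  obtain U W U' W' where "tgt.realizes g (\<lambda>Q. Q \<otimes>\<^bsub>ec_group g\<^esub> Aff x y) U W U' W'" using E.translation_realized T Aff by blast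
  from src.realizes_morphism[OF realizes_compose[OF this] tgt.half_deg] show ?thesis by (simp add: comp_def Aff)
next
  case (Infty s)
  then have T: "T = Infty 0" using T E.infinity_only by simp
  have "morphism_over UNIV f g \<phi>" by (rule src.realizes_morphism[OF realizes_self tgt.half_deg]) auto
  moreover have "\<phi> P \<otimes>\<^bsub>ec_group g\<^esub> T = \<phi> P" if "P \<in> points f" for P using E.G.r_one[of "\<phi> P"] pt[OF that] by (simp add: T)
  ultimately show ?thesis by (rule morphism_over_cong)
qed

end

lemma jac_hom_induced:
  assumes "jac_map f d g u w \<phi>" "jac_map f d h u' w' \<chi>" and ind: "induced_by f g h \<phi> \<chi> \<psi>"
  shows "jac_hom f g h \<psi>"
proof -
  interpret a: jac_map f d g u w \<phi> by fact
  interpret b: jac_map f d h u' w' \<chi> by fact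
  have ps: "\<psi> (div_class f D) = (push_sum g \<phi> D, push_sum h \<chi> D)" if "D \<in> carrier (divisors0 f)" for D
    using ind that by (simp add: induced_by_def)
  have "\<psi> \<in> hom (jacobian f) (ec_group g \<times>\<times> ec_group h)"
  proof (rule homI)
    fix c assume "c \<in> carrier (jacobian f)"
    then show "\<psi> c \<in> carrier (ec_group g \<times>\<times> ec_group h)"
      by (rule a.src.div_class_cases) (simp add: ps a.push_sum_points b.push_sum_points)
  next
    fix c c' assume c: "c \<in> carrier (jacobian f)" "c' \<in> carrier (jacobian f)"
    obtain D where D: "D \<in> carrier (divisors0 f)" "c = div_class f D" using a.src.div_class_cases[OF c(1)] .
    obtain D' where D': "D' \<in> carrier (divisors0 f)" "c' = div_class f D'" using a.src.div_class_cases[OF c(2)] .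
    have DD: "D + D' \<in> carrier (divisors0 f)"
      using D(1) D'(1) keys_add_subset[of D "points f" D'] by (simp add: a.src.carrier_divisors0 div_degree_add)
    show "\<psi> (c \<otimes>\<^bsub>jacobian f\<^esub> c') = \<psi> c \<otimes>\<^bsub>ec_group g \<times>\<times> ec_group h\<^esub> \<psi> c'"
      using D D' a.keys_pt b.keys_pt
      by (simp add: a.src.div_class_mult ps DD) (auto intro!: a.E.push_sum_add b.E.push_sum_add)
  qed
  moreover have "morphism_over UNIV f g (\<lambda>P. fst (\<psi> (div_class f (frag_of P - frag_of P\<^sub>0))))"
    "morphism_over UNIV f h (\<lambda>P. snd (\<psi> (div_class f (frag_of P - frag_of P\<^sub>0))))" if "P\<^sub>0 \<in> points f" for P\<^sub>0
  proof -
    have "inv\<^bsub>ec_group g\<^esub> \<phi> P\<^sub>0 \<in> points g" "inv\<^bsub>ec_group h\<^esub> \<chi> P\<^sub>0 \<in> points h"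
      using a.E.G.inv_closed[of "\<phi> P\<^sub>0"] b.E.G.inv_closed[of "\<chi> P\<^sub>0"] a.pt[OF that] b.pt[OF that] by simp_all
    note m = a.translate_morphism[OF this(1)] b.translate_morphism[OF this(2)]
    show "morphism_over UNIV f g (\<lambda>P. fst (\<psi> (div_class f (frag_of P - frag_of P\<^sub>0))))"
      by (rule morphism_over_cong[OF m(1)]) (simp add: ps a.src.point_diff_divisors0 that a.push_sum_diff)
    show "morphism_over UNIV f h (\<lambda>P. snd (\<psi> (div_class f (frag_of P - frag_of P\<^sub>0))))"
      by (rule morphism_over_cong[OF m(2)]) (simp add: ps a.src.point_diff_divisors0 that b.push_sum_diff)
  qed
  moreover have "\<psi> (galois_class \<sigma> c) = map_prod (galois_point \<sigma>) (galois_point \<sigma>) (\<psi> c)"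
    if s: "\<sigma> \<in> galois" and c: "c \<in> carrier (jacobian f)" for \<sigma> c
  proof -
    interpret gf: galois_curve f d \<sigma> by unfold_locales (rule s)
    obtain D where D: "D \<in> carrier (divisors0 f)" "c = div_class f D" using a.src.div_class_cases[OF c] .
    show ?thesis using D s by (simp add: gf.galois_class_div_class ps gf.gd_divisors0 a.push_sum_galois b.push_sum_galois)
  qed
  ultimately show ?thesis by (simp add: jac_hom_def)
qed

lemma special_map_compose:
  assumes "special_map f d g e u w \<phi>" "special_map g e h e' u' w' \<psi>"
  shows "special_map f d h e' (rat_eval cf u u') (rat_eval cf u w' * w) (\<psi> \<circ> \<phi>)"
proof -
  interpret a: special_map f d g e u w \<phi> by fact
  interpret b: special_map g e h e' u' w' \<psi> by fact
  interpret i: rat_evaluation cf u by (rule a.tr)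
  note rc = rat_eval_compose[OF a.tr b.tr]
  have pc: "pull (rat_eval cf u u') (rat_eval cf u w' * w) k = pull u w (pull u' w' k)" for k
    by (simp add: pull_def rc(2) i.ev_mult)
  show ?thesis
  proof (intro special_map.intro special_map_axioms.intro a.src.curve_axioms b.tgt.curve_axioms rc(1))
    show "rat_eval cf u w' * w \<noteq> 0" using a.w_nz b.w_nz by simp
    have "(rat_eval cf u w' * w)\<^sup>2 * to_fract (base_change f) = (rat_eval cf u w')\<^sup>2 * rat_eval cf u (to_fract (base_change g))"
      by (simp only: power_mult_distrib mult.assoc a.eqn)
    also have "\<dots> = rat_eval cf u (w'\<^sup>2 * to_fract (base_change g))" by (simp only: i.ev_mult i.ev_power)
    finally show "(rat_eval cf u w' * w)\<^sup>2 * to_fract (base_change f) = rat_eval cf (rat_eval cf u u') (to_fract (base_change h))"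
      by (simp only: b.eqn rc(2))
  next
    fix P assume P: "P \<in> points f"
    show "(\<psi> \<circ> \<phi>) P \<in> points h" using P by (simp add: a.pt b.pt)
    show "vpos (ord_at f P) (pull (rat_eval cf u u') (rat_eval cf u w' * w) (loc_par ((\<psi> \<circ> \<phi>) P), 0))"
      unfolding pc comp_def by (rule a.vpos_pb[OF P b.c1[OF a.pt[OF P]]])
    show "vpos (ord_at f P) (pull (rat_eval cf u u') (rat_eval cf u w' * w) ((0, loc_b e' ((\<psi> \<circ> \<phi>) P)) - (cf (loc_val ((\<psi> \<circ> \<phi>) P)), 0)))"
      unfolding pc comp_def by (rule a.vpos_pb[OF P b.c2[OF a.pt[OF P]]])
  qed
qed

lemma jac_map_compose_affine:
  assumes "jac_map f d g u w \<phi>" "affine_iso g h k m l"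
  shows "\<exists>u' w'. jac_map f d h u' w' (affine_map (to_ac k) (to_ac m) (to_ac l) \<circ> \<phi>)"
proof -
  interpret a: jac_map f d g u w \<phi> by fact
  interpret b: affine_iso g h k m l by fact
  have "special_map f d g 2 u w \<phi>" "special_map g 2 h 2 (to_fract [:to_ac m, to_ac k:]) (cf (to_ac l)) b.\<alpha>"
    by unfold_locales
  note sm = special_map_compose[OF this]
  interpret c: special_map f d h 2 "rat_eval cf u (to_fract [:to_ac m, to_ac k:])" "rat_eval cf u (cf (to_ac l)) * w" "b.\<alpha> \<circ> \<phi>"
    by (rule sm)
  have "jac_map f d h (rat_eval cf u (to_fract [:to_ac m, to_ac k:])) (rat_eval cf u (cf (to_ac l)) * w) (b.\<alpha> \<circ> \<phi>)"
  proof unfold_locales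
    fix D assume "D \<in> principal f"
    then have "frag_extend (frag_of \<circ> b.\<alpha>) (frag_extend (frag_of \<circ> \<phi>) D) \<in> principal h"
      by (intro b.push_principal_iso a.push)
    then show "frag_extend (frag_of \<circ> (b.\<alpha> \<circ> \<phi>)) D \<in> principal h"
      using frag_extend_compose[of "frag_of \<circ> b.\<alpha>" \<phi> D] by (simp add: comp_def)
  next
    fix \<sigma> P assume s: "\<sigma> \<in> galois" and P: "P \<in> points f"
    interpret galois_elt \<sigma> by unfold_locales (rule s)
    show "(b.\<alpha> \<circ> \<phi>) (galois_point \<sigma> P) = galois_point \<sigma> ((b.\<alpha> \<circ> \<phi>) P)"
      using a.gal[OF s P] by (cases "\<phi> P") (simp_all add: s_add s_mult)
  qed
  then show ?thesis by blast
qed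

lemma push_sum_affine:
  assumes "jac_map f d g u w \<phi>" "affine_iso g h k m l" and D: "D \<in> carrier (divisors0 f)"
  shows "push_sum h (affine_map (to_ac k) (to_ac m) (to_ac l) \<circ> \<phi>) D = affine_map (to_ac k) (to_ac m) (to_ac l) (push_sum g \<phi> D)"
proof -
  interpret a: jac_map f d g u w \<phi> by fact
  interpret b: affine_iso g h k m l by fact
  let ?\<alpha> = "affine_map (to_ac k) (to_ac m) (to_ac l)"
  obtain u' w' where "jac_map f d h u' w' (?\<alpha> \<circ> \<phi>)" using jac_map_compose_affine assms by blast
  then interpret c: jac_map f d h u' w' "?\<alpha> \<circ> \<phi>" .
  have eq: "frag_extend (frag_of \<circ> (?\<alpha> \<circ> \<phi>)) D = frag_extend (frag_of \<circ> ?\<alpha>) (frag_extend (frag_of \<circ> \<phi>) D)"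
    using frag_extend_compose[of "frag_of \<circ> ?\<alpha>" \<phi> D] by (simp add: comp_def)
  define R where "R = push_sum g \<phi> D"
  have R: "R \<in> points g" "frag_of R - frag_of (Infty 0) - frag_extend (frag_of \<circ> \<phi>) D \<in> principal g"
    using a.push_sum_sums_to[OF D] by (simp_all add: R_def a.E.sums_to_def)
  have "b.g.sums_to (frag_extend (frag_of \<circ> (?\<alpha> \<circ> \<phi>)) D) (?\<alpha> R)"
    using b.push_principal_iso[OF R(2)] b.fw.pt[OF R(1)] by (simp add: b.g.sums_to_def eq frag_extend_diff)
  then show ?thesis unfolding R_def by (rule b.g.sums_to_unique[OF c.push_sum_sums_to[OF D]])
qed

text \<open>The affine maps are bijections that send only the origin to the origin, so surjectivity
  and the kernel carry over unchanged.\<close>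

lemma jac_22_isogeny_affine:
  assumes J: "jac_map f d g u w \<phi>" "jac_map f d h u' w' \<chi>" and ind: "induced_by f g h \<phi> \<chi> \<psi>"
    and iso: "jac_22_isogeny f g h \<psi>" and A: "affine_iso g g' k m l" and B: "affine_iso h h' k' m' l'"
  shows "jac_22_isogeny f g' h' (map_prod (affine_map (to_ac k) (to_ac m) (to_ac l)) (affine_map (to_ac k') (to_ac m') (to_ac l')) \<circ> \<psi>)"
proof -
  interpret a: jac_map f d g u w \<phi> by fact
  interpret A: affine_iso g g' k m l by fact
  interpret B: affine_iso h h' k' m' l' by fact
  let ?\<psi> = "map_prod A.\<alpha> B.\<alpha> \<circ> \<psi>"
  obtain v x where JA: "jac_map f d g' v x (A.\<alpha> \<circ> \<phi>)" using jac_map_compose_affine[OF J(1) A] by blast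
  obtain v' x' where JB: "jac_map f d h' v' x' (B.\<alpha> \<circ> \<chi>)" using jac_map_compose_affine[OF J(2) B] by blast
  have "induced_by f g' h' (A.\<alpha> \<circ> \<phi>) (B.\<alpha> \<circ> \<chi>) ?\<psi>"
    using ind push_sum_affine[OF J(1) A] push_sum_affine[OF J(2) B] by (simp add: induced_by_def)
  note hom = jac_hom_induced[OF JA JB this]
  have im: "\<psi> ` carrier (jacobian f) = points g \<times> points h"
    using iso by (simp add: jac_22_isogeny_def jac_isogeny_def)
  have "?\<psi> ` carrier (jacobian f) = points g' \<times> points h'"
    using A.bij B.bij unfolding bij_betw_def image_comp[symmetric] im by (intro map_prod_surj_on) auto
  moreover have "kernel (jacobian f) (ec_group g' \<times>\<times> ec_group h') ?\<psi> = kernel (jacobian f) (ec_group g \<times>\<times> ec_group h) \<psi>"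
  proof -
    have "?\<psi> c = (Infty 0, Infty 0) \<longleftrightarrow> \<psi> c = (Infty 0, Infty 0)" if "c \<in> carrier (jacobian f)" for c
    proof -
      have "\<psi> c \<in> points g \<times> points h" using im that by blast
      then obtain P Q where PQ: "\<psi> c = (P, Q)" "P \<in> points g" "Q \<in> points h" by auto
      have "A.\<alpha> P = Infty 0 \<longleftrightarrow> P = Infty 0" using PQ(2) a.E.infinity_only by (cases P) auto
      moreover have "B.\<alpha> Q = Infty 0 \<longleftrightarrow> Q = Infty 0" using PQ(3) B.f.infinity_only by (cases Q) auto
      ultimately show ?thesis by (simp add: PQ)
    qed
    then show ?thesis by (auto simp: kernel_def)
  qed
  ultimately show ?thesis using iso hom by (simp add: jac_22_isogeny_def jac_isogeny_def)
qed

lemma klein_four_iso: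
  fixes K (structure)
  assumes "group K" and carr: "carrier K = {\<one>, a, b, a \<otimes> b}" and sq: "a \<otimes> a = \<one>" "b \<otimes> b = \<one>"
    and ne: "a \<noteq> \<one>" "b \<noteq> \<one>" "a \<otimes> b \<noteq> \<one>" and comm: "b \<otimes> a = a \<otimes> b"
  shows "K \<cong> integer_mod_group 2 \<times>\<times> integer_mod_group 2"
proof -
  interpret group K by (rule assms(1))
  have ab: "a \<in> carrier K" "b \<in> carrier K" by (subst carr, simp only: insert_iff simp_thms)+
  have "a \<otimes> b = a \<longleftrightarrow> b = \<one>" "a \<otimes> b = b \<longleftrightarrow> a = \<one>" using ab by simp_all
  then have ne': "a \<otimes> b \<noteq> a" "a \<otimes> b \<noteq> b" "a \<noteq> b" using ne sq(1) by metis+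
  define h :: "int \<times> int \<Rightarrow> _" where "h = (\<lambda>(i, j). (if i = 0 then \<one> else a) \<otimes> (if j = 0 then \<one> else b))"
  have h: "h (0, 0) = \<one>" "h (1, 0) = a" "h (0, 1) = b" "h (1, 1) = a \<otimes> b" using ab by (simp_all add: h_def)
  have cm: "carrier (integer_mod_group 2) = {0, 1}" by (auto simp: carrier_integer_mod_group)
  have m: "x \<otimes>\<^bsub>integer_mod_group 2\<^esub> y = (x + y) mod 2" for x y by (simp add: mult_integer_mod_group)
  have s1: "a \<otimes> (a \<otimes> b) = b" using ab sq by (simp flip: m_assoc)
  have s3: "(a \<otimes> b) \<otimes> b = a" using ab sq by (simp add: m_assoc)
  have s2: "b \<otimes> (a \<otimes> b) = a" by (simp only: m_assoc[OF ab(2,1,2), symmetric] comm s3)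
  have s4: "(a \<otimes> b) \<otimes> a = b" by (simp only: m_assoc[OF ab(1,2,1)] comm s1)
  have s5: "(a \<otimes> b) \<otimes> (a \<otimes> b) = \<one>" by (simp only: m_assoc[OF ab m_closed[OF ab]] s2 sq)
  have cd: "carrier (integer_mod_group 2 \<times>\<times> integer_mod_group 2) = {(0, 0), (1, 0), (0, 1), (1, 1)}" by (auto simp: cm)
  have "h \<in> iso (integer_mod_group 2 \<times>\<times> integer_mod_group 2) K"
  proof (rule isoI)
    show "h \<in> hom (integer_mod_group 2 \<times>\<times> integer_mod_group 2) K"
    proof (rule homI)
      fix x assume "x \<in> carrier (integer_mod_group 2 \<times>\<times> integer_mod_group 2)"
      then show "h x \<in> carrier K" unfolding cd by (elim insertE emptyE) (simp_all add: h ab)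
    next
      fix x y assume "x \<in> carrier (integer_mod_group 2 \<times>\<times> integer_mod_group 2)" "y \<in> carrier (integer_mod_group 2 \<times>\<times> integer_mod_group 2)"
      then show "h (x \<otimes>\<^bsub>integer_mod_group 2 \<times>\<times> integer_mod_group 2\<^esub> y) = h x \<otimes> h y"
        unfolding cd by (elim insertE emptyE) (simp_all add: m h ab sq comm s1 s2 s3 s4 s5)
    qed
    have "inj_on h {(0, 0), (1, 0), (0, 1), (1, 1)}"
      using ne ne' by (simp add: inj_on_insert h)
    then show "bij_betw h (carrier (integer_mod_group 2 \<times>\<times> integer_mod_group 2)) (carrier K)"
      unfolding bij_betw_def cd carr by (simp add: h)
  qed
  then show ?thesis
    using group.iso_sym[OF DirProd_group[OF group_integer_mod_group group_integer_mod_group]] is_isoI by blast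
qed

section \<open>The isogeny from the Jacobian of a bielliptic curve\<close>

context bielliptic
begin

lemma jac_map_phi: "jac_map fC 3 g2 (1 / sqx) (1 / fx ^ 3) phi"
proof unfold_locales
  fix \<sigma> P assume "\<sigma> \<in> galois" "P \<in> points fC"
  then interpret galois_elt \<sigma> by unfold_locales
  show "phi (galois_point \<sigma> P) = galois_point \<sigma> (phi P)" by (cases P) (simp_all add: s_divide s_power)
qed (rule phi_push)

lemma jac_map_chi: "jac_map fC 3 g1 sqx 1 chi"
proof unfold_locales
  fix \<sigma> P assume "\<sigma> \<in> galois" "P \<in> points fC"
  then interpret galois_elt \<sigma> by unfold_locales
  show "chi (galois_point \<sigma> P) = galois_point \<sigma> (chi P)" by (cases P) (simp_all add: s_power)
qed (rule chi_push)

sublocale Jp: jac_map fC 3 g2 "1 / sqx" "1 / fx ^ 3" phi by (rule jac_map_phi)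
sublocale Jc: jac_map fC 3 g1 sqx 1 chi by (rule jac_map_chi)

definition psi :: "(point \<Rightarrow>\<^sub>0 int) set \<Rightarrow> point \<times> point" where
  "psi c = (let D = SOME D. D \<in> carrier (divisors0 fC) \<and> c = div_class fC D in (push_sum g2 phi D, push_sum g1 chi D))"

lemma psi_div_class: "D \<in> carrier (divisors0 fC) \<Longrightarrow> psi (div_class fC D) = (push_sum g2 phi D, push_sum g1 chi D)"
proof -
  assume D: "D \<in> carrier (divisors0 fC)"
  define D' where "D' = (SOME D'. D' \<in> carrier (divisors0 fC) \<and> div_class fC D = div_class fC D')"
  have "D' \<in> carrier (divisors0 fC) \<and> div_class fC D = div_class fC D'"
    unfolding D'_def by (rule someI[of _ D]) (simp add: D)
  then have D': "D' \<in> carrier (divisors0 fC)" "div_class fC D = div_class fC D'" by blast+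
  have "psi (div_class fC D) = (push_sum g2 phi D', push_sum g1 chi D')" by (simp only: psi_def Let_def D'_def)
  then show ?thesis by (simp only: Jp.push_sum_cong[OF D D'] Jc.push_sum_cong[OF D D'])
qed

lemma induced_by_psi: "induced_by fC g2 g1 phi chi psi"
  by (simp add: induced_by_def psi_div_class)

lemma jac_hom_psi: "jac_hom fC g2 g1 psi"
  by (rule jac_hom_induced[OF jac_map_phi jac_map_chi induced_by_psi])

lemma psi_hom: "psi \<in> hom (jacobian fC) (ec_group g2 \<times>\<times> ec_group g1)"
  using jac_hom_psi by (simp add: jac_hom_def)

lemma psi_diff:
  assumes "P \<in> points fC" "Q \<in> points fC"
  shows "psi (div_class fC (frag_of P - frag_of Q)) =
    (phi P \<otimes>\<^bsub>ec_group g2\<^esub> inv\<^bsub>ec_group g2\<^esub> phi Q, chi P \<otimes>\<^bsub>ec_group g1\<^esub> inv\<^bsub>ec_group g1\<^esub> chi Q)"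
  using assms by (simp add: psi_div_class C.point_diff_divisors0 Jp.push_sum_diff Jc.push_sum_diff)

text \<open>The two involutions differ by the hyperelliptic one, so each becomes negation on the
  quotient by the other.\<close>

lemma iot_pconj:
  assumes "P \<in> points fC"
  shows "phi (iot 1 P) = pconj (phi P)" "chi (iot (- 1) P) = pconj (chi P)"
proof -
  have "(- x) ^ 3 = - (x ^ 3)" for x :: qbar by (simp add: power3_eq_cube)
  then show "phi (iot 1 P) = pconj (phi P)" by (cases P) simp_all
  show "chi (iot (- 1) P) = pconj (chi P)" by (cases P) simp_all
qed

lemma pt_diff_carrier: "P \<in> points fC \<Longrightarrow> Q \<in> points fC \<Longrightarrow> div_class fC (frag_of P - frag_of Q) \<in> carrier (jacobian fC)"
  by (simp add: C.carrier_jacobian C.point_diff_divisors0)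

lemma psi_surj: "psi ` carrier (jacobian fC) = points g2 \<times> points g1"
proof
  show "psi ` carrier (jacobian fC) \<subseteq> points g2 \<times> points g1"
    using hom_carrier[OF psi_hom] by simp
  show "points g2 \<times> points g1 \<subseteq> psi ` carrier (jacobian fC)"
  proof clarify
    fix R S assume R: "R \<in> points g2" and S: "S \<in> points g1"
    \<comment> \<open>Halving comes first because \<phi> sends P minus its image under
      \<open>iot 1\<close> to 2 \<phi>(P).\<close>
    obtain R' where R': "R' \<in> points g2" "R' \<otimes>\<^bsub>ec_group g2\<^esub> R' = R" using E2.divisible_by_2[OF R] by blast
    obtain P where P: "P \<in> points fC" "phi P = R'" using phi_surj[OF R'(1)] by blast
    obtain S' where S': "S' \<in> points g1" "S' \<otimes>\<^bsub>ec_group g1\<^esub> S' = S" using E1.divisible_by_2[OF S] by blast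
    obtain Q where Q: "Q \<in> points fC" "chi Q = S'" using chi_surj[OF S'(1)] by blast
    have iP: "iot 1 P \<in> points fC" and iQ: "iot (- 1) Q \<in> points fC" using P Q iot_points by auto
    let ?a = "div_class fC (frag_of P - frag_of (iot 1 P))" and ?b = "div_class fC (frag_of Q - frag_of (iot (- 1) Q))"
    have c: "?a \<in> carrier (jacobian fC)" "?b \<in> carrier (jacobian fC)" using pt_diff_carrier P Q iP iQ by blast+
    have "chi (iot 1 P) = chi P" using chi_fibre[OF P(1) iP] by simp
    moreover have "inv\<^bsub>ec_group g2\<^esub> (pconj R') = R'"
      using R'(1) E2.inv_G[OF R'(1)] E2.G.inv_inv[of R'] by simp
    ultimately have a: "psi ?a = (R, Infty 0)"
      using R' psi_diff[OF P(1) iP] iot_pconj(1)[OF P(1)] P E1.G.r_inv[of "chi P"] chi.pt[OF P(1)] by simp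
    have "phi (iot (- 1) Q) = phi Q" using phi_fibre[OF Q(1) iQ] by simp
    moreover have "inv\<^bsub>ec_group g1\<^esub> (pconj S') = S'"
      using S'(1) E1.inv_G[OF S'(1)] E1.G.inv_inv[of S'] by simp
    ultimately have b: "psi ?b = (Infty 0, S)"
      using S' psi_diff[OF Q(1) iQ] iot_pconj(2)[OF Q(1)] Q E2.G.r_inv[of "phi Q"] phi.pt[OF Q(1)] by simp
    have "psi (?a \<otimes>\<^bsub>jacobian fC\<^esub> ?b) = (R, S)"
      using hom_mult[OF psi_hom c] a b R S E1.G.l_one[of S] E2.G.r_one[of R] by simp
    moreover have "?a \<otimes>\<^bsub>jacobian fC\<^esub> ?b \<in> carrier (jacobian fC)"
      using C.comm_group_jacobian c by (meson comm_group.axioms(2) group.is_monoid monoid.m_closed)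
    ultimately show "(R, S) \<in> psi ` carrier (jacobian fC)" by (metis image_eqI)
  qed
qed

lemma psi_diff_trivial:
  assumes P: "P \<in> points fC" and Q: "Q \<in> points fC"
  shows "psi (div_class fC (frag_of P - frag_of Q)) = (Infty 0, Infty 0) \<longleftrightarrow> P = Q \<or> (\<exists>x. P = Aff x 0 \<and> Q = Aff (- x) 0)"
proof -
  have "psi (div_class fC (frag_of P - frag_of Q)) = (Infty 0, Infty 0) \<longleftrightarrow> phi P = phi Q \<and> chi P = chi Q"
  proof -
    have "phi P \<otimes>\<^bsub>ec_group g2\<^esub> inv\<^bsub>ec_group g2\<^esub> phi Q = Infty 0 \<longleftrightarrow> phi P = phi Q"
      using E2.G.inv_solve_right'[of "Infty 0" "phi P" "phi Q"] E2.G.l_one[of "phi Q"] phi.pt P Q by auto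
    moreover have "chi P \<otimes>\<^bsub>ec_group g1\<^esub> inv\<^bsub>ec_group g1\<^esub> chi Q = Infty 0 \<longleftrightarrow> chi P = chi Q"
      using E1.G.inv_solve_right'[of "Infty 0" "chi P" "chi Q"] E1.G.l_one[of "chi Q"] chi.pt P Q by auto
    ultimately show ?thesis by (simp add: psi_diff[OF P Q])
  qed
  also have "\<dots> \<longleftrightarrow> P = Q \<or> (P = iot (- 1) Q \<and> P = iot 1 Q)" using phi_fibre[OF Q P] chi_fibre[OF Q P] by blast
  \<comment> \<open>The two images of Q have opposite second coordinates, so they agree only where
    that coordinate is 0; at infinity it is nonzero because c3 is.\<close>
  also have "P = iot (- 1) Q \<and> P = iot 1 Q \<longleftrightarrow> (\<exists>x. P = Aff x 0 \<and> Q = Aff (- x) 0)"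
  proof (cases Q)
    case (Aff x y)
    have "- y = y \<longleftrightarrow> y = 0" for y :: qbar by (simp add: neg_eq_iff_add_eq_0 flip: mult_2)
    then show ?thesis by (auto simp: Aff equation_minus_iff)
  next
    case (Infty s)
    then have "s \<noteq> 0" using Q c3 by (auto simp: point_Infty)
    then have "- s \<noteq> s" by (simp add: neg_eq_iff_add_eq_0 flip: mult_2)
    then show ?thesis by (auto simp: Infty)
  qed
  finally show ?thesis .
qed

lemma branch_roots:
  obtains s1 s2 s3 :: qbar where "\<And>x. poly (base_change fC) x = 0 \<longleftrightarrow> x \<in> {s1, - s1, s2, - s2, s3, - s3}"
    "distinct [s1, - s1, s2, - s2, s3, - s3]"
proof -
  let ?Z = "{x. poly (base_change g1) x = 0}"
  have fin: "finite ?Z" by (rule poly_roots_finite) (rule E1.F_nz)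
  have "card ?Z = (\<Sum>a\<in>?Z. Polynomial.order a (base_change g1))" using E1.order_F by simp
  also have "\<dots> = 3" using sum_order_eq_degree[OF E1.F_nz fin] E1.degF E1.deg3 by simp
  finally obtain e1 e2 e3 where e: "?Z = {e1, e2, e3}" "e1 \<noteq> e2" "e1 \<noteq> e3" "e2 \<noteq> e3"
    by (auto simp: card_3_iff)
  have e0: "0 \<notin> {e1, e2, e3}" unfolding e(1)[symmetric] using c0 by (simp add: g1)
  obtain s1 s2 s3 :: qbar where s: "s1\<^sup>2 = e1" "s2\<^sup>2 = e2" "s3\<^sup>2 = e3" using nth_root_exists[of 2] by (metis zero_less_numeral)
  have ne: "s1 \<noteq> - s1" "s2 \<noteq> - s2" "s3 \<noteq> - s3" using e0 s by (auto simp: eq_neg_iff_add_eq_0 simp flip: mult_2)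
  have r: "x\<^sup>2 = y\<^sup>2 \<longleftrightarrow> x = y \<or> x = - y" for x y :: qbar by (rule power2_eq_iff)
  have "poly (base_change fC) x = 0 \<longleftrightarrow> x \<in> {s1, - s1, s2, - s2, s3, - s3}" for x
  proof -
    have "poly (base_change fC) x = 0 \<longleftrightarrow> x\<^sup>2 \<in> ?Z" by (simp add: poly_fC)
    also have "\<dots> \<longleftrightarrow> x\<^sup>2 = s1\<^sup>2 \<or> x\<^sup>2 = s2\<^sup>2 \<or> x\<^sup>2 = s3\<^sup>2" by (simp add: e(1) s)
    finally show ?thesis by (auto simp: r)
  qed
  moreover have "distinct [s1, - s1, s2, - s2, s3, - s3]" using ne e(2-4) s by auto
  ultimately show ?thesis using that by blast
qed

text \<open>The divisor of y: the six Weierstrass points minus three fibres at infinity. It supplies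
  the one relation between the three nontrivial classes of the kernel.\<close>

lemma branch_divisor:
  assumes Z: "\<And>x. poly (base_change fC) x = 0 \<longleftrightarrow> x \<in> {s1, - s1, s2, - s2, s3, - s3}"
    and dist: "distinct [s1, - s1, s2, - s2, s3, - s3]"
  shows "frag_of (Aff s1 0) + frag_of (Aff (- s1) 0) + frag_of (Aff s2 0) + frag_of (Aff (- s2) 0) +
     frag_of (Aff s3 0) + frag_of (Aff (- s3) 0) - (C.pstar None + C.pstar None + C.pstar None) = C.fdiv (0, 1)"
    (is "?E = _")
proof (rule poly_mapping_eqI)
  fix Q
  show "Poly_Mapping.lookup ?E Q = Poly_Mapping.lookup (C.fdiv (0, 1)) Q"
  proof (cases Q)
    case (Aff x y)
    have p: "Aff x 0 \<in> points fC \<longleftrightarrow> x \<in> {s1, - s1, s2, - s2, s3, - s3}" 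
    unfolding Z[symmetric] point_Aff by (simp add: eq_commute[of 0])
    have "Poly_Mapping.lookup ?E Q = (if y = 0 \<and> x \<in> {s1, - s1, s2, - s2, s3, - s3} then 1 else 0)"
    proof -
      have cnt: "(\<Sum>a\<leftarrow>xs. if x = a then 1 else 0) = (if x \<in> set xs then 1 else 0 :: int)" if "distinct xs" for xs
        using that by (induction xs) auto
      have l: "Poly_Mapping.lookup (frag_of (Aff a 0)) (Aff x y) = (if y = 0 then if x = a then 1 else 0 else 0 :: int)" for a y
        by (simp add: lookup_frag_of)
      have "Poly_Mapping.lookup ?E Q = (if y = 0 then \<Sum>a\<leftarrow>[s1, - s1, s2, - s2, s3, - s3]. if x = a then 1 else 0 else 0)"
        by (cases "y = 0") (simp_all only: Aff lookup_add lookup_minus C.lookup_pstar l xc.simps option.distinct if_False if_True simp_thms sum_list_simps list.map add_0_right diff_0_right add.assoc)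
      then show ?thesis unfolding cnt[OF dist] by simp
    qed
    moreover have "Poly_Mapping.lookup (C.fdiv (0, 1)) Q = (if Q \<in> points fC \<and> y = 0 then 1 else 0)"
    proof -
      have "nu (to_fract [:- x, 1:]) 1 = 0" using nu_affine[of 1 x] order_root[of 1 x] by simp
      then show ?thesis using C.ord_y_part[of Q 1] by (cases "y = 0") (simp_all add: C.lookup_fdiv Aff zero_prod_def)
    qed
    ultimately show ?thesis using p unfolding Aff by (cases "y = 0") (simp_all only: simp_thms if_False)
  next
    case (Infty s)
    have "Poly_Mapping.lookup ?E Q = (if Q \<in> points fC then - 3 * C.ram Q else 0)"
      by (auto simp: Infty lookup_add lookup_minus C.lookup_pstar)
    moreover have "Poly_Mapping.lookup (C.fdiv (0, 1)) Q = (if Q \<in> points fC then - 3 * C.ram Q else 0)"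
    proof (cases "Q \<in> points fC")
      case True
      then have s: "s \<noteq> 0" using c3 by (auto simp: Infty point_Infty)
      have "nu (1 / fx) (1 / (1 / fx ^ 3) :: qbar poly fract) = - 3" using C.nu_inf_times[of 1] by simp
      then show ?thesis using C.ord_y_part[OF True, of 1] True s by (simp add: C.lookup_fdiv Infty zero_prod_def)
    qed (simp add: C.lookup_fdiv)
    ultimately show ?thesis by simp
  qed
qed

text \<open>The Weierstrass points form three pairs (x, 0), (-x, 0). Reversing a pair does not
  change its class, since twice a Weierstrass point is a fibre, so each pair contributes one class
  of order 2.\<close>

theorem jac_22_isogeny_psi: "jac_22_isogeny fC g2 g1 psi"
proof -
  obtain s1 s2 s3 where Z: "\<And>x. poly (base_change fC) x = 0 \<longleftrightarrow> x \<in> {s1, - s1, s2, - s2, s3, - s3}"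
    and dist: "distinct [s1, - s1, s2, - s2, s3, - s3]" using branch_roots by blast
  have pts: "Aff x 0 \<in> points fC \<longleftrightarrow> x \<in> {s1, - s1, s2, - s2, s3, - s3}" for x 
    unfolding Z[symmetric] point_Aff by (simp add: eq_commute[of 0])
  interpret J: comm_group "jacobian fC" by (rule C.comm_group_jacobian)
  define W where "W x = frag_of (Aff x 0) - frag_of (Aff (- x) 0)" for x :: qbar
  define cl where "cl x = div_class fC (W x)" for x
  let ?R = "{s1, - s1, s2, - s2, s3, - s3}"
  have neg: "- x \<in> ?R" if "x \<in> ?R" for x using that by auto
  have W: "W x \<in> carrier (divisors0 fC)" if "x \<in> ?R" for x
    unfolding W_def using that neg pts by (intro C.point_diff_divisors0) blast+
  have dbl: "frag_of (Aff x 0) + frag_of (Aff x 0) - C.pstar None \<in> principal fC" if "x \<in> ?R" for x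
    using C.pconj_sum_principal[of "Aff x 0" None] that pts by simp
  have cl_neg: "cl (- x) = cl x" if "x \<in> ?R" for x
  proof -
    have "W (- x) - W x = (frag_of (Aff (- x) 0) + frag_of (Aff (- x) 0) - C.pstar None) - (frag_of (Aff x 0) + frag_of (Aff x 0) - C.pstar None)"
      by (simp add: W_def)
    then show ?thesis unfolding cl_def C.div_class_eq_iff using C.principal_diff[OF dbl[OF neg[OF that]] dbl[OF that]] by simp
  qed
  have cl_ne: "cl x \<noteq> \<one>\<^bsub>jacobian fC\<^esub>" if "x \<in> ?R" for x
  proof
    assume "cl x = \<one>\<^bsub>jacobian fC\<^esub>"
    then have "W x \<in> principal fC" by (simp add: cl_def C.one_jacobian C.div_class_eq_iff)
    then have "Aff x 0 = Aff (- x) 0" unfolding W_def using that neg pts by (intro C.principal_point_diff) blast+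
    then show False using that dist by auto
  qed
  have cl_sq: "cl x \<otimes>\<^bsub>jacobian fC\<^esub> cl x = \<one>\<^bsub>jacobian fC\<^esub>" if "x \<in> ?R" for x
  proof -
    have "W x + W x = (frag_of (Aff x 0) + frag_of (Aff x 0) - C.pstar None) - (frag_of (Aff (- x) 0) + frag_of (Aff (- x) 0) - C.pstar None)"
      by (simp add: W_def)
    then have "W x + W x \<in> principal fC" using C.principal_diff[OF dbl[OF that] dbl[OF neg[OF that]]] by simp
    then show ?thesis using W[OF that] by (simp add: cl_def C.div_class_mult C.one_jacobian C.div_class_eq_iff)
  qed
  have W12: "W s1 + W s2 \<in> carrier (divisors0 fC)"
    using W[of s1] W[of s2] keys_add_subset[of "W s1" "points fC" "W s2"] by (simp add: C.carrier_divisors0 div_degree_add)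
  have sum: "cl s1 \<otimes>\<^bsub>jacobian fC\<^esub> cl s2 = cl s3"
  proof -
    \<comment> \<open>Up to doubled Weierstrass points, each equivalent to the fibre at infinity,
      this combination is the divisor of y.\<close>
    have "W s1 + W s2 - W s3 = C.fdiv (0, 1) - (frag_of (Aff (- s1) 0) + frag_of (Aff (- s1) 0) - C.pstar None)
        - (frag_of (Aff (- s2) 0) + frag_of (Aff (- s2) 0) - C.pstar None) - (frag_of (Aff s3 0) + frag_of (Aff s3 0) - C.pstar None)"
      unfolding branch_divisor[OF Z dist, symmetric] by (simp add: W_def)
    moreover have "C.fdiv (0, 1) \<in> principal fC" unfolding C.principal_iff by (intro exI[of _ "(0, 1)"]) (simp add: zero_prod_def)
    ultimately have "W s1 + W s2 - W s3 \<in> principal fC"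
      using C.principal_diff dbl[of "- s1"] dbl[of "- s2"] dbl[of s3] by simp
    then show ?thesis using W[of s1] W[of s2] by (simp add: cl_def C.div_class_mult C.div_class_eq_iff)
  qed
  let ?K = "kernel (jacobian fC) (ec_group g2 \<times>\<times> ec_group g1) psi"
  have sub: "subgroup ?K (jacobian fC)"
    using group_hom.subgroup_kernel[of "jacobian fC" "ec_group g2 \<times>\<times> ec_group g1" psi] psi_hom
    by (simp add: group_hom_def group_hom_axioms_def DirProd_group J.is_group E1.G.is_group E2.G.is_group)
  have K: "?K = {\<one>\<^bsub>jacobian fC\<^esub>, cl s1, cl s2, cl s3}"
  proof
    show "?K \<subseteq> {\<one>\<^bsub>jacobian fC\<^esub>, cl s1, cl s2, cl s3}"
    proof
      fix c assume c: "c \<in> ?K"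
      then have cc: "c \<in> carrier (jacobian fC)" "psi c = (Infty 0, Infty 0)" by (auto simp: kernel_def)
      obtain P Q where P: "P \<in> points fC" "Q \<in> points fC" "c = div_class fC (frag_of P - frag_of Q)"
        using C.genus2_class[OF refl cc(1)] by blast
      then consider "P = Q" | x where "P = Aff x 0" "Q = Aff (- x) 0"
        using cc(2) psi_diff_trivial[OF P(1,2)] by auto
      then show "c \<in> {\<one>\<^bsub>jacobian fC\<^esub>, cl s1, cl s2, cl s3}"
      proof cases
        case 1
        then show ?thesis using P by (simp add: C.one_jacobian)
      next
        case 2
        then have "c = cl x" "x \<in> ?R" using P pts[of x] by (auto simp: cl_def W_def)
        then show ?thesis using cl_neg[of s1] cl_neg[of s2] cl_neg[of s3] by auto
      qed
    qed
    have "cl x \<in> ?K" if "x \<in> ?R" for x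
    proof -
      have "Aff x 0 \<in> points fC" "Aff (- x) 0 \<in> points fC" using that neg pts by blast+
      then have "psi (cl x) = (Infty 0, Infty 0)" unfolding cl_def W_def using psi_diff_trivial by blast
      then show ?thesis using W[OF that] by (auto simp: kernel_def cl_def C.carrier_jacobian)
    qed
    moreover have "\<one>\<^bsub>jacobian fC\<^esub> \<in> ?K" by (rule subgroup.one_closed[OF sub])
    ultimately show "{\<one>\<^bsub>jacobian fC\<^esub>, cl s1, cl s2, cl s3} \<subseteq> ?K" by simp
  qed
  have "(jacobian fC)\<lparr>carrier := ?K\<rparr> \<cong> integer_mod_group 2 \<times>\<times> integer_mod_group 2"
  proof (rule klein_four_iso[where a = "cl s1" and b = "cl s2"])
    show "group ((jacobian fC)\<lparr>carrier := ?K\<rparr>)" by (rule J.subgroup_imp_group[OF sub])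
    show "carrier ((jacobian fC)\<lparr>carrier := ?K\<rparr>) = {\<one>\<^bsub>(jacobian fC)\<lparr>carrier := ?K\<rparr>\<^esub>, cl s1, cl s2, cl s1 \<otimes>\<^bsub>(jacobian fC)\<lparr>carrier := ?K\<rparr>\<^esub> cl s2}"
      using K sum by simp
    have "cl s1 \<in> carrier (jacobian fC)" "cl s2 \<in> carrier (jacobian fC)" using W by (simp_all add: cl_def C.carrier_jacobian)
    then show "cl s2 \<otimes>\<^bsub>(jacobian fC)\<lparr>carrier := ?K\<rparr>\<^esub> cl s1 = cl s1 \<otimes>\<^bsub>(jacobian fC)\<lparr>carrier := ?K\<rparr>\<^esub> cl s2"
      using J.m_comm by simp
  qed (use cl_ne cl_sq sum in simp_all)
  moreover have "finite ?K" by (simp add: K)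
  ultimately show ?thesis using jac_hom_psi psi_surj by (simp add: jac_22_isogeny_def jac_isogeny_def)
qed

section \<open>Smoothness, genus and the bielliptic maps\<close>

lemma C_smooth: "smooth_curve fC" "genus fC = 2"
  using C.genus_eq C.squarefree_f by (simp_all add: smooth_curve_def fC c3)

lemma funs_monomials:
  "(sqx, 0) \<in> funs_over (range to_ac)" "(0, 1) \<in> funs_over (range to_ac)" "(1 / sqx, 0) \<in> funs_over (range to_ac)"
  "(0, 1 / sqx\<^sup>2) \<in> funs_over (range to_ac)" "(0, 1 / fx ^ 3) \<in> funs_over (range to_ac)" "(0, fx) \<in> funs_over (range to_ac)"
proof -
  have b: "base_change 1 = 1" by (simp add: one_pCons)
  have f3: "fx ^ 3 = to_fract [:0, 0, 0, 1::qbar:]" by (simp add: power3_eq_cube flip: to_fract_mult)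
  have f4: "sqx\<^sup>2 = to_fract [:0, 0, 0, 0, 1::qbar:]" by (simp add: power2_eq_square flip: to_fract_mult)
  have "sqx \<in> fracts_over (range to_ac)" by (rule fracts_overI[of 1 _ "[:0, 0, 1:]"]) (simp_all add: b)
  moreover have "1 \<in> fracts_over (range to_ac)" by (rule fracts_overI[of 1 _ 1]) (simp_all add: b)
  moreover have "1 / sqx \<in> fracts_over (range to_ac)" by (rule fracts_overI[of "[:0, 0, 1:]" _ 1]) (simp_all add: b)
  moreover have "1 / sqx\<^sup>2 \<in> fracts_over (range to_ac)" unfolding f4 by (rule fracts_overI[of "[:0, 0, 0, 0, 1:]" _ 1]) (simp_all add: b)
  moreover have "1 / fx ^ 3 \<in> fracts_over (range to_ac)" unfolding f3 by (rule fracts_overI[of "[:0, 0, 0, 1:]" _ 1]) (simp_all add: b)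
  moreover have "fx \<in> fracts_over (range to_ac)" by (rule fracts_overI[of 1 _ "[:0, 1:]"]) (simp_all add: b)
  ultimately show "(sqx, 0) \<in> funs_over (range to_ac)" "(0, 1) \<in> funs_over (range to_ac)" "(1 / sqx, 0) \<in> funs_over (range to_ac)"
    "(0, 1 / sqx\<^sup>2) \<in> funs_over (range to_ac)" "(0, 1 / fx ^ 3) \<in> funs_over (range to_ac)" "(0, fx) \<in> funs_over (range to_ac)"
    using zero_fracts_over by (simp_all add: funs_over_def)
qed

text \<open>A fibre consists of P and its image under the involution, so it has two elements unless
  P is fixed, and all fixed points lie over one abscissa.\<close>

lemma finite_bad_fibres:
  assumes fib: "\<And>P Q. P \<in> points fC \<Longrightarrow> Q \<in> points fC \<Longrightarrow> \<theta> Q = \<theta> P \<longleftrightarrow> Q = P \<or> Q = iot \<epsilon> P"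
    and surj: "\<And>R. R \<in> points g \<Longrightarrow> \<exists>P\<in>points fC. \<theta> P = R" and e: "\<epsilon> * \<epsilon> = 1"
    and fixed: "\<And>P. P \<in> points fC \<Longrightarrow> iot \<epsilon> P = P \<Longrightarrow> xc P = a"
  shows "finite {R \<in> points g. card {P \<in> points fC. \<theta> P = R} \<noteq> 2}"
proof (rule finite_subset)
  show "finite (\<theta> ` {P \<in> points fC. xc P = a})" using C.finite_fibre by simp
  show "{R \<in> points g. card {P \<in> points fC. \<theta> P = R} \<noteq> 2} \<subseteq> \<theta> ` {P \<in> points fC. xc P = a}"
  proof clarify
    fix R assume R: "R \<in> points g" and c: "card {P \<in> points fC. \<theta> P = R} \<noteq> 2"
    obtain P where P: "P \<in> points fC" "\<theta> P = R" using surj[OF R] by blast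
    have i: "iot \<epsilon> P \<in> points fC" by (rule iot_points[OF e P(1)])
    have "Q \<in> points fC \<and> \<theta> Q = R \<longleftrightarrow> Q \<in> {P, iot \<epsilon> P}" for Q
      using fib[OF P(1), of Q] P i by (cases "Q \<in> points fC") auto
    then have "{Q \<in> points fC. \<theta> Q = R} = {P, iot \<epsilon> P}" by (simp only: Collect_mem_eq)
    then have "iot \<epsilon> P = P" using c by (cases "iot \<epsilon> P = P") auto
    then show "R \<in> \<theta> ` {P \<in> points fC. xc P = a}" using fixed[OF P(1)] P by blast
  qed
qed

lemma eq_uminus_iff: "- y = y \<longleftrightarrow> y = 0" for y :: qbar by (simp add: neg_eq_iff_add_eq_0 flip: mult_2)

lemma bielliptic_map_chi: "bielliptic_map fC g1 chi"
proof -
  have "morphism_over (range to_ac) fC g1 chi"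
    by (rule C.realizes_morphism[OF chi.realizes_self[OF refl] E1.half_deg]) (rule funs_monomials)+
  moreover have "finite {R \<in> points g1. card {P \<in> points fC. chi P = R} \<noteq> 2}"
  proof (rule finite_bad_fibres[where \<epsilon> = 1 and a = "Some 0" and \<theta> = chi, OF chi_fibre chi_surj])
    fix P assume "P \<in> points fC" "iot 1 P = P"
    then show "xc P = Some 0" using c3 by (cases P) (auto simp: eq_uminus_iff point_Infty)
  qed auto
  ultimately show ?thesis using E1.elliptic_curve by (simp add: bielliptic_map_def)
qed

lemma bielliptic_map_phi: "bielliptic_map fC g2 phi"
proof -
  have i: "1 / (1 / sqx) = sqx" by simp
  have "(1 / fx ^ 3) / (1 / sqx)\<^sup>2 = (fx :: qbar poly fract)"
  proof -
    have nz: "fx \<noteq> (0 :: qbar poly fract)" by simp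
    show ?thesis unfolding sqx_eq using nz by (simp add: power2_eq_square power3_eq_cube)
  qed
  then have "morphism_over (range to_ac) fC g2 phi"
    by (intro C.realizes_morphism[OF phi.realizes_self[OF refl] E2.half_deg]) (simp_all only: funs_monomials i)
  moreover have "finite {R \<in> points g2. card {P \<in> points fC. phi P = R} \<noteq> 2}"
  proof (rule finite_bad_fibres[where \<epsilon> = "- 1" and a = None and \<theta> = phi, OF phi_fibre phi_surj])
    fix P assume "P \<in> points fC" "iot (- 1) P = P"
    then show "xc P = None" using c0 by (cases P) (auto simp: eq_uminus_iff point_Aff poly_fC_0)
  qed auto
  ultimately show ?thesis using E2.elliptic_curve by (simp add: bielliptic_map_def)
qed

end

section \<open>The 5-rank\<close>

definition fixed5 :: "rat poly \<Rightarrow> point set" where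
  "fixed5 g = {P \<in> points g. P [^]\<^bsub>ec_group g\<^esub> (5::nat) = Infty 0 \<and> (\<forall>\<sigma>\<in>galois. galois_point \<sigma> P = P)}"

lemma (in curve) galois_class_hom:
  assumes s: "\<sigma> \<in> galois"
  shows "galois_class \<sigma> \<in> hom (jacobian f) (jacobian f)"
proof -
  interpret galois_curve f d \<sigma> by unfold_locales (rule s)
  show ?thesis
  proof (rule homI)
    fix c assume "c \<in> carrier (jacobian f)"
    then obtain D where D: "D \<in> carrier (divisors0 f)" "c = div_class f D" by (rule div_class_cases)
    then show "galois_class \<sigma> c \<in> carrier (jacobian f)" by (simp add: galois_class_div_class carrier_jacobian gd_divisors0)
  next
    fix c c' assume c: "c \<in> carrier (jacobian f)" "c' \<in> carrier (jacobian f)"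
    obtain D where D: "D \<in> carrier (divisors0 f)" "c = div_class f D" using div_class_cases[OF c(1)] .
    obtain D' where D': "D' \<in> carrier (divisors0 f)" "c' = div_class f D'" using div_class_cases[OF c(2)] .
    show "galois_class \<sigma> (c \<otimes>\<^bsub>jacobian f\<^esub> c') = galois_class \<sigma> c \<otimes>\<^bsub>jacobian f\<^esub> galois_class \<sigma> c'"
      using D D' by (simp add: div_class_mult galois_class_div_class gd_divisors0 frag_extend_add)
  qed
qed

lemma (in curve) jacobian_rat_torsion_subgroup:
  "subgroup (carrier (torsion (jacobian_rat f))) (jacobian f)"
proof -
  interpret J: comm_group "jacobian f" by (rule comm_group_jacobian)
  have c: "carrier (torsion (jacobian_rat f)) = {c \<in> carrier (jacobian f). (\<forall>\<sigma>\<in>galois. galois_class \<sigma> c = c) \<and> (\<exists>n::nat. n > 0 \<and> c [^]\<^bsub>jacobian f\<^esub> n = \<one>\<^bsub>jacobian f\<^esub>)}"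
    by (auto simp: torsion_def jacobian_rat_def nat_pow_def)
  show ?thesis unfolding c
  proof (intro subgroup.intro subsetI)
    fix x y assume x: "x \<in> {c \<in> carrier (jacobian f). (\<forall>\<sigma>\<in>galois. galois_class \<sigma> c = c) \<and> (\<exists>n::nat. n > 0 \<and> c [^]\<^bsub>jacobian f\<^esub> n = \<one>\<^bsub>jacobian f\<^esub>)}"
      and y: "y \<in> {c \<in> carrier (jacobian f). (\<forall>\<sigma>\<in>galois. galois_class \<sigma> c = c) \<and> (\<exists>n::nat. n > 0 \<and> c [^]\<^bsub>jacobian f\<^esub> n = \<one>\<^bsub>jacobian f\<^esub>)}"
    obtain m :: nat where m: "m > 0" "x [^]\<^bsub>jacobian f\<^esub> m = \<one>\<^bsub>jacobian f\<^esub>" using x by blast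
    obtain n :: nat where n: "n > 0" "y [^]\<^bsub>jacobian f\<^esub> n = \<one>\<^bsub>jacobian f\<^esub>" using y by blast
    have "(x \<otimes>\<^bsub>jacobian f\<^esub> y) [^]\<^bsub>jacobian f\<^esub> (m * n) = (x [^]\<^bsub>jacobian f\<^esub> m) [^]\<^bsub>jacobian f\<^esub> n \<otimes>\<^bsub>jacobian f\<^esub> (y [^]\<^bsub>jacobian f\<^esub> n) [^]\<^bsub>jacobian f\<^esub> m"
      using x y by (simp add: J.nat_pow_distrib J.nat_pow_pow mult.commute)
    then have "(x \<otimes>\<^bsub>jacobian f\<^esub> y) [^]\<^bsub>jacobian f\<^esub> (m * n) = \<one>\<^bsub>jacobian f\<^esub>" using m n by simp
    then show "x \<otimes>\<^bsub>jacobian f\<^esub> y \<in> {c \<in> carrier (jacobian f). (\<forall>\<sigma>\<in>galois. galois_class \<sigma> c = c) \<and> (\<exists>n::nat. n > 0 \<and> c [^]\<^bsub>jacobian f\<^esub> n = \<one>\<^bsub>jacobian f\<^esub>)}"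
      using x y m n hom_mult[OF galois_class_hom] by (auto intro!: exI[of _ "m * n"])
  next
    show "\<one>\<^bsub>jacobian f\<^esub> \<in> {c \<in> carrier (jacobian f). (\<forall>\<sigma>\<in>galois. galois_class \<sigma> c = c) \<and> (\<exists>n::nat. n > 0 \<and> c [^]\<^bsub>jacobian f\<^esub> n = \<one>\<^bsub>jacobian f\<^esub>)}"
      using hom_one[OF galois_class_hom J.is_group J.is_group] by (auto intro!: exI[of _ 1])
  next
    fix x assume x: "x \<in> {c \<in> carrier (jacobian f). (\<forall>\<sigma>\<in>galois. galois_class \<sigma> c = c) \<and> (\<exists>n::nat. n > 0 \<and> c [^]\<^bsub>jacobian f\<^esub> n = \<one>\<^bsub>jacobian f\<^esub>)}"
    have "galois_class \<sigma> (inv\<^bsub>jacobian f\<^esub> x) = inv\<^bsub>jacobian f\<^esub> x" if "\<sigma> \<in> galois" for \<sigma>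
    proof -
      interpret h: group_hom "jacobian f" "jacobian f" "galois_class \<sigma>"
        using galois_class_hom[OF that] by unfold_locales
      show ?thesis using x that by (simp add: h.hom_inv)
    qed
    then show "inv\<^bsub>jacobian f\<^esub> x \<in> {c \<in> carrier (jacobian f). (\<forall>\<sigma>\<in>galois. galois_class \<sigma> c = c) \<and> (\<exists>n::nat. n > 0 \<and> c [^]\<^bsub>jacobian f\<^esub> n = \<one>\<^bsub>jacobian f\<^esub>)}"
      using x by (auto simp: J.nat_pow_inv)
  qed auto
qed

abbreviation Z5 :: "nat \<Rightarrow> (nat \<Rightarrow> int) monoid" where
  "Z5 r \<equiv> product_group {..<r} (\<lambda>_. integer_mod_group 5)"

lemma group_Z5: "group (Z5 r)" by (rule product_group) simp

lemma carrier_Z5: "carrier (Z5 r) = (\<Pi>\<^sub>E i\<in>{..<r}. {0..<5})"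
  by (simp add: carrier_integer_mod_group)

lemma card_Z5: "card (carrier (Z5 r)) = 5 ^ r"
  by (simp add: carrier_Z5 card_PiE del: carrier_product_group)

lemma Z5_exponent: "v \<in> carrier (Z5 r) \<Longrightarrow> v [^]\<^bsub>Z5 r\<^esub> (5::nat) = \<one>\<^bsub>Z5 r\<^esub>"
proof -
  assume v: "v \<in> carrier (Z5 r)"
  have "v [^]\<^bsub>Z5 r\<^esub> n = (\<lambda>i\<in>{..<r}. (int n * v i) mod 5)" for n
  proof (induction n)
    case (Suc n)
    then show ?case by (auto simp: mult_integer_mod_group fun_eq_iff mod_simps algebra_simps)
  qed (auto simp: fun_eq_iff)
  from this[of 5] show ?thesis by (auto simp: fun_eq_iff)
qed

text \<open>The upper bound comes from counting rational 5-torsion on the two factors, the lower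
  bound from lifting one point of order 5 from each.\<close>

lemma rank_5_jacobian:
  assumes "curve f d" "elliptic g" "elliptic h" and iso: "jac_22_isogeny f g h \<psi>"
    and g: "finite (fixed5 g)" "card (fixed5 g) \<le> 5" and h: "finite (fixed5 h)" "card (fixed5 h) \<le> 5"
    and T: "T \<in> fixed5 g" "T \<noteq> Infty 0" and U: "U \<in> fixed5 h" "U \<noteq> Infty 0"
  shows "rk 5 (torsion (jacobian_rat f)) = 2"
proof -
  interpret C: curve f d by fact
  interpret E: elliptic g by fact
  interpret E': elliptic h by fact
  interpret J: comm_group "jacobian f" by (rule C.comm_group_jacobian)
  let ?J = "jacobian f" and ?P = "ec_group g \<times>\<times> ec_group h" and ?G = "torsion (jacobian_rat f)"
  have jh: "jac_hom f g h \<psi>" and surj: "\<psi> ` carrier ?J = points g \<times> points h"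
    and Kiso: "?J\<lparr>carrier := kernel ?J ?P \<psi>\<rparr> \<cong> integer_mod_group 2 \<times>\<times> integer_mod_group 2"
    using iso by (simp_all add: jac_22_isogeny_def jac_isogeny_def)
  have hom: "\<psi> \<in> hom ?J ?P" and gal: "\<And>\<sigma> c. \<sigma> \<in> galois \<Longrightarrow> c \<in> carrier ?J \<Longrightarrow>
      \<psi> (galois_class \<sigma> c) = map_prod (galois_point \<sigma>) (galois_point \<sigma>) (\<psi> c)"
    using jh by (simp_all add: jac_hom_def)
  have Pg: "group ?P" by (rule DirProd_group[OF E.G.is_group E'.G.is_group])
  interpret H: group_hom ?J ?P \<psi> using hom Pg by (simp add: group_hom_def group_hom_axioms_def J.is_group)
  have ppow: "\<psi> (c [^]\<^bsub>?J\<^esub> n) = (fst (\<psi> c) [^]\<^bsub>ec_group g\<^esub> n, snd (\<psi> c) [^]\<^bsub>ec_group h\<^esub> n)" if "c \<in> carrier ?J" for c and n :: nat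
  proof (induction n)
    case (Suc n)
    then show ?case using that by (simp add: H.hom_mult) (metis mult_DirProd prod.collapse)
  qed (simp add: H.hom_one)
  have ker2: "c [^]\<^bsub>?J\<^esub> (2::nat) = \<one>\<^bsub>?J\<^esub>" if "c \<in> carrier ?J" "\<psi> c = (Infty 0, Infty 0)" for c
  proof -
    let ?K = "?J\<lparr>carrier := kernel ?J ?P \<psi>\<rparr>" and ?Z = "integer_mod_group 2 \<times>\<times> integer_mod_group 2"
    have Zg: "group ?Z" by (rule DirProd_group) simp_all
    have Kg: "group ?K" by (rule J.subgroup_imp_group[OF H.subgroup_kernel])
    obtain \<theta> where t: "\<theta> \<in> iso ?K ?Z" using Kiso by (auto simp: is_iso_def)
    then have th: "\<theta> \<in> hom ?K ?Z" and inj: "inj_on \<theta> (kernel ?J ?P \<psi>)" by (auto simp: iso_def bij_betw_def)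
    have cK: "c \<in> kernel ?J ?P \<psi>" using that by (simp add: kernel_def)
    then have ccK: "c \<otimes>\<^bsub>?J\<^esub> c \<in> kernel ?J ?P \<psi>" using H.subgroup_kernel by (simp add: subgroup.m_closed)
    have "\<theta> (c \<otimes>\<^bsub>?J\<^esub> c) = \<theta> c \<otimes>\<^bsub>?Z\<^esub> \<theta> c" using hom_mult[OF th, of c c] cK by simp
    also have "\<dots> = \<one>\<^bsub>?Z\<^esub>" by (cases "\<theta> c") (simp add: mult_integer_mod_group)
    also have "\<dots> = \<theta> \<one>\<^bsub>?J\<^esub>" using hom_one[OF th Kg Zg] by simp
    finally have "c \<otimes>\<^bsub>?J\<^esub> c = \<one>\<^bsub>?J\<^esub>"
      by (rule inj_onD[OF inj _ ccK subgroup.one_closed[OF H.subgroup_kernel]])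
    then show ?thesis using that by (simp add: numeral_2_eq_2)
  qed
  have sub: "subgroup (carrier ?G) ?J" by (rule C.jacobian_rat_torsion_subgroup)
  have Geq: "?G = ?J\<lparr>carrier := carrier ?G\<rparr>" by (simp add: torsion_def jacobian_rat_def)
  have Gg: "group ?G" by (subst Geq) (rule J.subgroup_imp_group[OF sub])
  have Gm: "x \<otimes>\<^bsub>?G\<^esub> y = x \<otimes>\<^bsub>?J\<^esub> y" and G1: "\<one>\<^bsub>?G\<^esub> = \<one>\<^bsub>?J\<^esub>" for x y by (simp_all add: torsion_def jacobian_rat_def)
  have Gc: "c \<in> carrier ?G \<longleftrightarrow> c \<in> carrier ?J \<and> (\<forall>\<sigma>\<in>galois. galois_class \<sigma> c = c) \<and> (\<exists>n::nat. n > 0 \<and> c [^]\<^bsub>?J\<^esub> n = \<one>\<^bsub>?J\<^esub>)" for c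
    by (auto simp: torsion_def jacobian_rat_def nat_pow_def)
  have sp: "a [^]\<^bsub>?J\<^esub> n \<in> K" if "subgroup K ?J" "a \<in> K" for K a and n :: nat
    using that by (induction n) (auto simp: subgroup.one_closed subgroup.m_closed)
  \<comment> \<open>A kernel of exponent 2 meets 5-torsion trivially, so a copy of (Z/5)^r embeds in
    \<open>fixed5 g\<close> times \<open>fixed5 h\<close>, which has at most 25 elements.\<close>
  have upper: "r \<le> 2" if K: "subgroup K ?G" and Ki: "?G\<lparr>carrier := K\<rparr> \<cong> Z5 r" for K r
  proof -
    obtain \<theta> where t: "\<theta> \<in> iso (?G\<lparr>carrier := K\<rparr>) (Z5 r)" using Ki by (auto simp: is_iso_def)
    then have th: "\<theta> \<in> hom (?G\<lparr>carrier := K\<rparr>) (Z5 r)" and bij: "bij_betw \<theta> K (carrier (Z5 r))" by (auto simp: iso_def)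
    have KJ: "subgroup K ?J" using J.incl_subgroup[OF sub] K Geq by metis
    have Kg: "group (?G\<lparr>carrier := K\<rparr>)" by (rule group.subgroup_imp_group[OF Gg K])
    have c5: "c [^]\<^bsub>?J\<^esub> (5::nat) = \<one>\<^bsub>?J\<^esub>" if c: "c \<in> K" for c
    proof -
      interpret t: group_hom "?G\<lparr>carrier := K\<rparr>" "Z5 r" \<theta>
        using th Kg group_Z5 by (simp add: group_hom_def group_hom_axioms_def)
      have e: "c [^]\<^bsub>?G\<lparr>carrier := K\<rparr>\<^esub> n = c [^]\<^bsub>?J\<^esub> n" for n :: nat by (simp add: nat_pow_def torsion_def jacobian_rat_def)
      have "\<theta> (c [^]\<^bsub>?J\<^esub> (5::nat)) = \<theta> c [^]\<^bsub>Z5 r\<^esub> (5::nat)" using t.hom_nat_pow[of c 5] c by (simp add: e)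
      also have "\<dots> = \<one>\<^bsub>Z5 r\<^esub>" using bij c by (intro Z5_exponent) (auto simp: bij_betw_def)
      also have "\<dots> = \<theta> \<one>\<^bsub>?J\<^esub>" using t.hom_one by (simp add: G1)
      finally show ?thesis using bij c subgroup.one_closed[OF KJ] sp[OF KJ c]
        by (auto simp: bij_betw_def dest: inj_onD)
    qed
    have KG: "c \<in> carrier ?G" "c \<in> carrier ?J" if "c \<in> K" for c using that K KJ subgroup.subset by blast+
    have "inj_on \<psi> K"
    proof (rule inj_onI)
      fix b c assume bc: "b \<in> K" "c \<in> K" and eq: "\<psi> b = \<psi> c"
      define e where "e = b \<otimes>\<^bsub>?J\<^esub> inv\<^bsub>?J\<^esub> c"
      have eK: "e \<in> K" unfolding e_def using bc KJ by (simp add: subgroup.m_closed subgroup.m_inv_closed)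
      have "\<psi> e = \<psi> b \<otimes>\<^bsub>?P\<^esub> inv\<^bsub>?P\<^esub> \<psi> c" unfolding e_def using KG bc by (simp add: H.hom_mult H.hom_inv)
      then have "\<psi> e = \<one>\<^bsub>?P\<^esub>" unfolding eq using group.r_inv[OF Pg H.hom_closed[OF KG(2)[OF bc(2)]]] by (simp only:)
      then have "e [^]\<^bsub>?J\<^esub> (2::nat) = \<one>\<^bsub>?J\<^esub>" using ker2 KG eK by simp
      \<comment> \<open>As 5 = 2 * 2 + 1, an element killed by 2 and by 5 is trivial.\<close>
      moreover have "e [^]\<^bsub>?J\<^esub> (5::nat) = (e [^]\<^bsub>?J\<^esub> (2::nat)) [^]\<^bsub>?J\<^esub> (2::nat) \<otimes>\<^bsub>?J\<^esub> e"
        using J.nat_pow_mult[of e 4 1] KG[OF eK] by (simp add: J.nat_pow_pow)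
      ultimately have "e = \<one>\<^bsub>?J\<^esub>" using c5[OF eK] KG[OF eK] by simp
      then show "b = c" unfolding e_def using KG bc by (simp add: J.inv_solve_right')
    qed
    moreover have "\<psi> ` K \<subseteq> fixed5 g \<times> fixed5 h"
    proof
      fix w assume "w \<in> \<psi> ` K"
      then obtain c where c: "c \<in> K" "w = \<psi> c" by blast
      have w: "w \<in> points g \<times> points h" using surj KG(2)[OF c(1)] c by blast
      have "map_prod (galois_point \<sigma>) (galois_point \<sigma>) w = w" if "\<sigma> \<in> galois" for \<sigma>
        using gal[OF that KG(2)[OF c(1)]] KG(1)[OF c(1)] that c by (simp add: Gc)
      moreover have "(fst w [^]\<^bsub>ec_group g\<^esub> (5::nat), snd w [^]\<^bsub>ec_group h\<^esub> (5::nat)) = (Infty 0, Infty 0)"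
      proof -
        have "\<psi> (c [^]\<^bsub>?J\<^esub> (5::nat)) = (Infty 0, Infty 0)" using c5[OF c(1)] H.hom_one by simp
        then show ?thesis unfolding c(2) ppow[OF KG(2)[OF c(1)], of 5] .
      qed
      ultimately show "w \<in> fixed5 g \<times> fixed5 h" using w by (cases w) (auto simp: fixed5_def)
    qed
    ultimately have "card K \<le> card (fixed5 g \<times> fixed5 h)" by (rule card_inj_on_le) (use g h in simp)
    also have "\<dots> \<le> 5 * 5" unfolding card_cartesian_product using g h by (intro mult_mono) auto
    finally have "(5::nat) ^ r \<le> 5 ^ 2" using bij_betw_same_card[OF bij] by (simp add: card_Z5 del: carrier_product_group)
    then show "r \<le> 2" using power_le_imp_le_exp[of "5::nat" r 2] by simp
  qed
  have lift: "\<exists>x\<in>carrier ?G. x [^]\<^bsub>?J\<^esub> (5::nat) = \<one>\<^bsub>?J\<^esub> \<and> \<psi> x = (A, B)" if A: "A \<in> fixed5 g" and B: "B \<in> fixed5 h" for A B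
  proof -
    have AB: "A \<in> points g" "B \<in> points h" "A [^]\<^bsub>ec_group g\<^esub> (5::nat) = Infty 0" "B [^]\<^bsub>ec_group h\<^esub> (5::nat) = Infty 0"
      using A B by (auto simp: fixed5_def)
    then have "(A, B) \<in> \<psi> ` carrier ?J" using surj by simp
    then obtain c where c: "c \<in> carrier ?J" "\<psi> c = (A, B)" by fastforce
    \<comment> \<open>6 is congruent to 1 modulo 5, so the image is still (A, B); 6 is even, so
      every ambiguity in the kernel disappears.\<close>
    let ?x = "c [^]\<^bsub>?J\<^esub> (6::nat)"
    have "\<psi> (c [^]\<^bsub>?J\<^esub> (5::nat)) = (Infty 0, Infty 0)" using ppow[OF c(1), of 5] c AB by simp
    then have "(c [^]\<^bsub>?J\<^esub> (5::nat)) [^]\<^bsub>?J\<^esub> (2::nat) = \<one>\<^bsub>?J\<^esub>" using ker2 c(1) by simp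
    then have "((c [^]\<^bsub>?J\<^esub> (5::nat)) [^]\<^bsub>?J\<^esub> (2::nat)) [^]\<^bsub>?J\<^esub> (3::nat) = \<one>\<^bsub>?J\<^esub>" by simp
    then have x5: "?x [^]\<^bsub>?J\<^esub> (5::nat) = \<one>\<^bsub>?J\<^esub>" using c(1) by (simp add: J.nat_pow_pow)
    have "A [^]\<^bsub>ec_group g\<^esub> (6::nat) = A" "B [^]\<^bsub>ec_group h\<^esub> (6::nat) = B"
    proof -
      have "Infty 0 \<otimes>\<^bsub>ec_group g\<^esub> A = A" "Infty 0 \<otimes>\<^bsub>ec_group h\<^esub> B = B"
        using AB E.G.l_one[of A] E'.G.l_one[of B] by simp_all
      then show "A [^]\<^bsub>ec_group g\<^esub> (6::nat) = A" "B [^]\<^bsub>ec_group h\<^esub> (6::nat) = B"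
        using AB(3,4) E.G.nat_pow_Suc[of A 5] E'.G.nat_pow_Suc[of B 5] by (simp_all del: nat_pow_Suc)
    qed
    then have "\<psi> ?x = (A, B)" using ppow[OF c(1), of 6] c by simp
    moreover have "galois_class \<sigma> ?x = ?x" if s: "\<sigma> \<in> galois" for \<sigma>
    proof -
      interpret S: group_hom ?J ?J "galois_class \<sigma>"
        using C.galois_class_hom[OF s] by (simp add: group_hom_def group_hom_axioms_def J.is_group)
      \<comment> \<open>A preimage \<open>c\<close> differs from its conjugate by an element of the
        kernel, which the sixth power removes.\<close>
      define e where "e = galois_class \<sigma> c \<otimes>\<^bsub>?J\<^esub> inv\<^bsub>?J\<^esub> c"
      have eJ: "e \<in> carrier ?J" unfolding e_def using c by simp
      have eq: "\<psi> (galois_class \<sigma> c) = \<psi> c" using gal[OF s c(1)] A B s c(2) by (simp add: fixed5_def)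
      have "\<psi> e = \<psi> (galois_class \<sigma> c) \<otimes>\<^bsub>?P\<^esub> inv\<^bsub>?P\<^esub> \<psi> c" unfolding e_def using c(1) by (simp add: H.hom_mult H.hom_inv)
      then have "\<psi> e = \<one>\<^bsub>?P\<^esub>" unfolding eq using group.r_inv[OF Pg H.hom_closed[OF c(1)]] by (simp only:)
      then have "e [^]\<^bsub>?J\<^esub> (2::nat) = \<one>\<^bsub>?J\<^esub>" using ker2 eJ by simp
      then have "(e [^]\<^bsub>?J\<^esub> (2::nat)) [^]\<^bsub>?J\<^esub> (3::nat) = \<one>\<^bsub>?J\<^esub>" by simp
      then have e6: "e [^]\<^bsub>?J\<^esub> (6::nat) = \<one>\<^bsub>?J\<^esub>" using eJ by (simp add: J.nat_pow_pow)
      have "galois_class \<sigma> c = e \<otimes>\<^bsub>?J\<^esub> c" unfolding e_def using c by (simp add: J.m_assoc)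
      then have "galois_class \<sigma> ?x = (e \<otimes>\<^bsub>?J\<^esub> c) [^]\<^bsub>?J\<^esub> (6::nat)" using c by (simp add: S.hom_nat_pow)
      also have "\<dots> = ?x" using c eJ e6 by (simp add: J.nat_pow_distrib)
      finally show ?thesis .
    qed
    ultimately show ?thesis using x5 c(1) by (intro bexI[of _ ?x]) (auto simp: Gc intro!: exI[of _ "5::nat"])
  qed
  have O: "Infty 0 \<in> fixed5 g" "Infty 0 \<in> fixed5 h"
  proof -
    have "galois_point \<sigma> (Infty 0) = Infty 0" if "\<sigma> \<in> galois" for \<sigma>
    proof -
      interpret galois_elt \<sigma> by unfold_locales (rule that)
      show ?thesis by simp
    qed
    then show "Infty 0 \<in> fixed5 g" "Infty 0 \<in> fixed5 h"
      using E.G.nat_pow_one[of 5] E'.G.nat_pow_one[of 5] by (auto simp: fixed5_def)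
  qed
  obtain x where x: "x \<in> carrier ?G" "x [^]\<^bsub>?J\<^esub> (5::nat) = \<one>\<^bsub>?J\<^esub>" "\<psi> x = (T, Infty 0)" using lift[OF T(1) O(2)] by blast
  obtain y where y: "y \<in> carrier ?G" "y [^]\<^bsub>?J\<^esub> (5::nat) = \<one>\<^bsub>?J\<^esub>" "\<psi> y = (Infty 0, U)" using lift[OF O(1) U(1)] by blast
  have xJ: "x \<in> carrier ?J" "y \<in> carrier ?J" using x y Gc by blast+
  have pow_mod: "a [^]\<^bsub>?J\<^esub> (n mod 5) = a [^]\<^bsub>?J\<^esub> n" if "a \<in> carrier ?J" "a [^]\<^bsub>?J\<^esub> (5::nat) = \<one>\<^bsub>?J\<^esub>" for a and n :: nat
  proof -
    have "a [^]\<^bsub>?J\<^esub> n = a [^]\<^bsub>?J\<^esub> (5 * (n div 5) + n mod 5)" by simp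
    also have "\<dots> = (a [^]\<^bsub>?J\<^esub> (5::nat)) [^]\<^bsub>?J\<^esub> (n div 5) \<otimes>\<^bsub>?J\<^esub> a [^]\<^bsub>?J\<^esub> (n mod 5)"
      using that(1) by (simp only: J.nat_pow_mult[symmetric] J.nat_pow_pow)
    finally show ?thesis using that by simp
  qed
  \<comment> \<open>The lifts \<open>x\<close> and \<open>y\<close> are independent because \<psi>
    sends them to different factors of the product.\<close>
  define \<theta> :: "(nat \<Rightarrow> int) \<Rightarrow> _" where "\<theta> v = x [^]\<^bsub>?J\<^esub> nat (v 0) \<otimes>\<^bsub>?J\<^esub> y [^]\<^bsub>?J\<^esub> nat (v 1)" for v
  have powG: "a [^]\<^bsub>?J\<^esub> n \<in> carrier ?G" if "a \<in> carrier ?G" for a and n :: nat using sp[OF sub that] .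
  have thom: "\<theta> \<in> hom (Z5 2) ?G"
  proof (rule homI)
    fix v assume "v \<in> carrier (Z5 2)"
    show "\<theta> v \<in> carrier ?G" unfolding \<theta>_def by (rule subgroup.m_closed[OF sub powG[OF x(1)] powG[OF y(1)]])
  next
    fix v w assume "v \<in> carrier (Z5 2)" "w \<in> carrier (Z5 2)"
    then have vw: "v i \<in> {0..<5}" "w i \<in> {0..<5}" if "i < 2" for i using that unfolding carrier_Z5 by (auto simp: PiE_iff)
    have less_2: "(0::nat) < 2" "(1::nat) < 2" by simp_all
    have m: "(v \<otimes>\<^bsub>Z5 2\<^esub> w) i = (v i + w i) mod 5" if "i < 2" for i using that by (simp add: mult_integer_mod_group)
    have n: "nat ((v i + w i) mod 5) = (nat (v i) + nat (w i)) mod 5" if "i < 2" for i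
      using vw[OF that] by (simp add: nat_mod_distrib nat_add_distrib)
    have "\<theta> (v \<otimes>\<^bsub>Z5 2\<^esub> w) = x [^]\<^bsub>?J\<^esub> (nat (v 0) + nat (w 0)) \<otimes>\<^bsub>?J\<^esub> y [^]\<^bsub>?J\<^esub> (nat (v 1) + nat (w 1))"
      unfolding \<theta>_def m[OF less_2(1)] m[OF less_2(2)] n[OF less_2(1)] n[OF less_2(2)]
      by (simp only: pow_mod[OF xJ(1) x(2)] pow_mod[OF xJ(2) y(2)])
    also have "\<dots> = \<theta> v \<otimes>\<^bsub>?J\<^esub> \<theta> w" unfolding \<theta>_def using xJ by (simp add: J.nat_pow_mult[symmetric] J.m_ac)
    finally show "\<theta> (v \<otimes>\<^bsub>Z5 2\<^esub> w) = \<theta> v \<otimes>\<^bsub>?G\<^esub> \<theta> w" by (simp only: Gm)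
  qed
  have small: "n = 0" if "A [^]\<^bsub>G\<^esub> n = \<one>\<^bsub>G\<^esub>" "n < 5" "A [^]\<^bsub>G\<^esub> (5::nat) = \<one>\<^bsub>G\<^esub>" "A \<noteq> \<one>\<^bsub>G\<^esub>" "group G" "A \<in> carrier G" for A G and n :: nat
  proof -
    interpret group G by fact
    have "ord A dvd 5" "ord A dvd n" using that pow_eq_id by blast+
    moreover have "prime (5::nat)" by simp
    ultimately have "ord A = 1 \<or> ord A = 5" by (meson prime_nat_iff)
    moreover have "ord A \<noteq> 1" using that ord_eq_1 by blast
    ultimately show "n = 0" using \<open>ord A dvd n\<close> \<open>n < 5\<close> nat_dvd_not_less by auto
  qed
  interpret t: group_hom "Z5 2" ?G \<theta> using thom Gg group_Z5 by (simp add: group_hom_def group_hom_axioms_def)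
  have inj: "inj_on \<theta> (carrier (Z5 2))"
  proof (unfold t.inj_on_one_iff, intro allI ballI impI)
    fix v assume v: "v \<in> carrier (Z5 2)" and e: "\<theta> v = \<one>\<^bsub>?G\<^esub>"
    have v5: "v i \<in> {0..<5}" if "i < 2" for i using v that unfolding carrier_Z5 by (auto simp: PiE_iff)
    have "\<psi> (\<theta> v) = \<one>\<^bsub>?P\<^esub>" using e H.hom_one by (simp add: G1)
    moreover have "\<psi> (\<theta> v) = (T [^]\<^bsub>ec_group g\<^esub> nat (v 0), U [^]\<^bsub>ec_group h\<^esub> nat (v 1))"
    proof -
      have "T [^]\<^bsub>ec_group g\<^esub> nat (v 0) \<in> carrier (ec_group g)" "U [^]\<^bsub>ec_group h\<^esub> nat (v 1) \<in> carrier (ec_group h)"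
        using T U by (auto simp: fixed5_def intro!: E.G.nat_pow_closed E'.G.nat_pow_closed simp del: E.carrier_G E'.carrier_G simp flip: E.carrier_G E'.carrier_G)
      then show ?thesis unfolding \<theta>_def
        using xJ ppow[OF xJ(1)] ppow[OF xJ(2)] x(3) y(3) E.G.nat_pow_one[of "nat (v 1)"] E'.G.nat_pow_one[of "nat (v 0)"]
          E.G.r_one[of "T [^]\<^bsub>ec_group g\<^esub> nat (v 0)"] E'.G.l_one[of "U [^]\<^bsub>ec_group h\<^esub> nat (v 1)"]
        by (simp add: H.hom_mult)
    qed
    ultimately have "T [^]\<^bsub>ec_group g\<^esub> nat (v 0) = \<one>\<^bsub>ec_group g\<^esub>" "U [^]\<^bsub>ec_group h\<^esub> nat (v 1) = \<one>\<^bsub>ec_group h\<^esub>" by simp_all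
    then have "nat (v 0) = 0" "nat (v 1) = 0"
      using small[where A = T and G = "ec_group g" and n = "nat (v 0)"] small[where A = U and G = "ec_group h" and n = "nat (v 1)"] v5[of 0] v5[of 1] T U E.G.is_group E'.G.is_group
      by (auto simp: fixed5_def)
    then have "v 0 = 0" "v 1 = 0" using v5[of 0] v5[of 1] by auto
    then have "v i = 0" if "i < 2" for i using that by (cases "i = 0") (auto simp: less_2_cases_iff)
    then show "v = \<one>\<^bsub>Z5 2\<^esub>" using v unfolding carrier_Z5 by (auto simp: fun_eq_iff PiE_iff extensional_def)
  qed
  let ?H = "\<theta> ` carrier (Z5 2)"
  have "\<theta> \<in> iso (Z5 2) (?G\<lparr>carrier := ?H\<rparr>)"
    using thom inj by (auto simp: iso_def hom_def bij_betw_def)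
  then have "?G\<lparr>carrier := ?H\<rparr> \<cong> Z5 2" using group.iso_sym[OF group_Z5] is_isoI by blast
  then have ex: "\<exists>K. subgroup K ?G \<and> ?G\<lparr>carrier := K\<rparr> \<cong> Z5 2" using t.img_is_subgroup by blast
  show ?thesis unfolding rk_def by (rule Greatest_equality, rule ex) (use upper in blast)
qed

section \<open>Rational 5-torsion\<close>

text \<open>The 5-division polynomial with abscissae measured in units of \<open>w\<close> and with
  \<open>s\<close> for t - 1. In this scale the known abscissae of order 5 are t^2 and s^2. Over the
  field generated by \<surd>5 the second factor splits into \<surd>5 H + d M^2 and \<surd>5 H - d
  M^2.\<close>

lemma division_poly_identity:
  fixes t s x :: "'a::field_char_0"
  assumes "w = 4 * t^2 * s^2" "q = t * s * (s^2 + t * s - t^2)"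
    and "p = 5 * t^4 * s^2 + 5 * t^2 * s^4 + 2 * t * s^5 - t^6 - 2 * t^5 * s - s^6"
    and "h = w * (x^2 + q) - p * x" "A = x^2 - q" "M = (x - t^2) * (x - s^2)"
    and "H = 4 * t^2 * s^2 * x^5 + (2 * t^6 + 4 * t^5 * s - 8 * t^4 * s^2 - 8 * t^2 * s^4 - 4 * t * s^5 + 2 * s^6) * x^4
     + (8 * t^6 * s^2 - 16 * t^5 * s^3 - 8 * t^4 * s^4 + 16 * t^3 * s^5 + 8 * t^2 * s^6) * x^3
     + (2 * t^10 + 4 * t^9 * s - 16 * t^8 * s^2 - 8 * t^7 * s^3 + 18 * t^6 * s^4 + 18 * t^4 * s^6 + 8 * t^3 * s^7 - 16 * t^2 * s^8 - 4 * t * s^9 + 2 * s^10) * x^2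
     + (4 * t^8 * s^4 - 8 * t^9 * s^3 + 40 * t^7 * s^5 - 20 * t^6 * s^6 - 40 * t^5 * s^7 + 4 * t^4 * s^8 + 8 * t^3 * s^9) * x
     + (2 * t^10 * s^4 - 4 * t^9 * s^5 + 4 * t^5 * s^9 + 2 * t^4 * s^10)"
    and "d = 2 * (t^2 - t * s - s^2)^2 * (t^2 + 4 * t * s - s^2)"
  shows "w * A^2 * (4 * h * x^2 + w * A^2)^2 - 4 * h * x^2 * (5 * w^2 * A^4 - 8 * w * A^2 * q * h + 16 * q^2 * h^2)
    = w * M * (5 * H^2 - d^2 * M^4)"
  unfolding assms by Groebner_Basis.algebra

text \<open>\<open>x\<close> and \<open>y\<close> are the abscissae of Q and 2Q for a point Q of
  order 5, which duplication interchanges. Eliminating \<open>y\<close> leaves the 5-division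
  polynomial in \<open>x\<close>.\<close>

lemma division_polynomial_5:
  fixes x y p q :: "'a::field"
  assumes e1: "4 * x * y * (x^2 - p * x + q) = (x^2 - q)^2" and e2: "4 * x * y * (y^2 - p * y + q) = (y^2 - q)^2"
    and ne: "x \<noteq> y" and g: "g = x^2 - p * x + q" and A: "A = x^2 - q"
  shows "A^2 * (4 * g * x^2 + A^2)^2 = 4 * g * x^2 * (5 * A^4 - 8 * A^2 * q * g + 16 * q^2 * g^2)"
proof -
  \<comment> \<open>The combination y e1 - x e2 eliminates \<open>p\<close> and has the factor x -
    y, which is then cancelled.\<close>
  have "(x - y) * (x * y * (x + y)^2) = (x - y) * (5 * (x * y)^2 - 2 * (x * y) * q + q^2)"
    using e1 e2 by Groebner_Basis.algebra
  then have m: "x * y * (x + y)^2 = 5 * (x * y)^2 - 2 * (x * y) * q + q^2" using ne by simp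
  have e: "4 * x * y * g = A^2" using e1 g A by simp
  have "4 * g * x^2 + A^2 = 4 * g * x * (x + y)" unfolding e[symmetric] by Groebner_Basis.algebra
  then have "A^2 * (4 * g * x^2 + A^2)^2 = 64 * g^3 * x^2 * (x * y * (x + y)^2)"
    unfolding e[symmetric] by (simp only: e) Groebner_Basis.algebra
  also have "\<dots> = 4 * g * x^2 * (5 * (4 * x * y * g)^2 - 8 * (4 * x * y * g) * q * g + 16 * q^2 * g^2)"
    unfolding m by Groebner_Basis.algebra
  also have "(4 * x * y * g)^2 = A^4" unfolding e by (simp flip: power_mult)
  finally show ?thesis unfolding e .
qed

context elliptic
begin

lemma double_x:
  assumes k: "k0 = 0" "k3 = 1" and P: "Aff x y \<in> points f" and y: "y \<noteq> 0"
  obtains x' y' where "Aff x y \<otimes>\<^bsub>G\<^esub> Aff x y = Aff x' y'" "4 * x' * (x * (x^2 + k2 * x + k1)) = (x^2 - k1)^2" "Aff x' y' \<in> points f"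
proof -
  define l where "l = (3 * k3 * x * x + 2 * k2 * x + k1) / (2 * y)"
  define x' where "x' = (l * l - k2) / k3 - 2 * x"
  have yy: "y * y = x * (x^2 + k2 * x + k1)" using P unfolding Aff_point k by (simp add: algebra_simps power2_eq_square)
  have l: "2 * y * l = 3 * x * x + 2 * k2 * x + k1" using y k by (simp add: l_def)
  have x': "x' = l * l - k2 - 2 * x" by (simp add: x'_def k)
  have "4 * x' * (x * (x^2 + k2 * x + k1)) = 4 * x' * (y * y)" by (simp only: yy)
  also have "\<dots> = (2 * y * l)^2 - 4 * (k2 + 2 * x) * (y * y)" unfolding x' by Groebner_Basis.algebra
  also have "\<dots> = (x^2 - k1)^2" unfolding l yy by Groebner_Basis.algebra
  finally have "4 * x' * (x * (x^2 + k2 * x + k1)) = (x^2 - k1)^2" .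
  moreover note d = double_formula[OF P y l_def x'_def]
  moreover have "Aff x' (- (y + l * (x' - x))) \<in> points f" using mult_G(1)[OF P P] unfolding d .
  ultimately show ?thesis using that by blast
qed

text \<open>5 Q = 0 means 2 (2 Q) = -Q, and abscissae do not see the sign, so duplication
  interchanges x(Q) and x(2Q). They differ, since 2 Q = Q or 2 Q = -Q would make Q trivial.\<close>

lemma five_torsion_cases:
  assumes k: "k0 = 0" "k3 = 1" and Q: "Q \<in> points f" "Q [^]\<^bsub>G\<^esub> (5::nat) = Orig" "Q \<noteq> Orig"
  obtains x y x' where "Q = Aff x y" "x \<noteq> x'" "4 * x' * (x * (x^2 + k2 * x + k1)) = (x^2 - k1)^2" "4 * x * (x' * (x'^2 + k2 * x' + k1)) = (x'^2 - k1)^2"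
proof -
  have Qc: "Q \<in> carrier G" using Q by simp
  define D where "D = Q \<otimes>\<^bsub>G\<^esub> Q"
  have Dc: "D \<in> carrier G" using Qc G.m_closed unfolding D_def by blast
  have "Q [^]\<^bsub>G\<^esub> (5::nat) = (Q [^]\<^bsub>G\<^esub> (2::nat)) [^]\<^bsub>G\<^esub> (2::nat) \<otimes>\<^bsub>G\<^esub> Q"
    using G.nat_pow_mult[OF Qc, of 4 1] G.nat_pow_pow[OF Qc, of 2 2] G.nat_pow_eone[OF Qc] by simp
  moreover have sq: "R [^]\<^bsub>G\<^esub> (2::nat) = R \<otimes>\<^bsub>G\<^esub> R" if "R \<in> carrier G" for R
    using G.l_one[OF that] by (simp add: numeral_2_eq_2)
  ultimately have D1: "D \<otimes>\<^bsub>G\<^esub> D \<otimes>\<^bsub>G\<^esub> Q = \<one>\<^bsub>G\<^esub>" using Q(2) sq[OF Qc] sq[OF Dc] by (simp add: D_def)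
  then have DQ: "D \<otimes>\<^bsub>G\<^esub> D = inv\<^bsub>G\<^esub> Q" using G.inv_equality[OF D1 Qc] G.m_closed[OF Dc Dc] by simp
  have Dne: "D \<noteq> \<one>\<^bsub>G\<^esub>" using D1 Q(3) by (metis G.l_one G.one_closed Qc one_G)
  obtain x y where xy: "Q = Aff x y" using Q infinity_only by (cases Q) auto
  have y: "y \<noteq> 0"
  proof
    assume "y = 0"
    then have "inv\<^bsub>G\<^esub> Q = Q" using inv_G[OF Q(1)] xy by simp
    then show False using Dne G.r_inv[OF Qc] by (simp add: D_def)
  qed
  obtain x' y' where D: "D = Aff x' y'" "4 * x' * (x * (x^2 + k2 * x + k1)) = (x^2 - k1)^2" "Aff x' y' \<in> points f"
    using double_x[OF k, of x y] Q(1) y unfolding D_def xy by metis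
  have y': "y' \<noteq> 0"
  proof
    assume "y' = 0"
    then have "inv\<^bsub>G\<^esub> D = D" using inv_G[OF D(3)] D(1) by simp
    then have "D \<otimes>\<^bsub>G\<^esub> D = \<one>\<^bsub>G\<^esub>" using G.r_inv[OF Dc] by simp
    then show False using D1 G.l_one[OF Qc] Q(3) by simp
  qed
  obtain x'' y'' where D'': "D \<otimes>\<^bsub>G\<^esub> D = Aff x'' y''" "4 * x'' * (x' * (x'^2 + k2 * x' + k1)) = (x'^2 - k1)^2"
    using double_x[OF k D(3) y'] unfolding D(1) by metis
  have "x'' = x" using D''(1) DQ inv_G[OF Q(1)] xy by (metis pconj.simps(1) point.inject(1))
  moreover have "x \<noteq> x'"
  proof
    assume "x = x'"
    then have "D = Q \<or> D = pconj Q" using same_fibre[OF Q(1) D(3)] D(1) xy by simp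
    then show False
    proof
      assume "D = Q"
      then have "Q \<otimes>\<^bsub>G\<^esub> Q = Q" by (simp add: D_def)
      then show False using G.l_cancel_one[OF Qc Qc] Q(3) by simp
    next
      assume "D = pconj Q"
      then have "D = inv\<^bsub>G\<^esub> Q" using inv_G[OF Q(1)] by simp
      then have "D \<otimes>\<^bsub>G\<^esub> D = D" using DQ by simp
      then show False using G.l_cancel_one[OF Dc Dc] Dne by simp
    qed
  qed
  ultimately show ?thesis using that[OF xy _ D(2)] D''(2) by simp
qed

text \<open>The equations give 4 Q = Q or 4 Q = -Q. The first would mean 2 Q = -Q, so that Q and 2 Q
  would share an abscissa.\<close>

lemma five_torsion_point:
  assumes k: "k0 = 0" "k3 = 1" and P: "Aff x y \<in> points f" and y: "y \<noteq> 0" and ne: "x \<noteq> x'"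
    and e1: "4 * x' * (x * (x^2 + k2 * x + k1)) = (x^2 - k1)^2" and e2: "4 * x * (x' * (x'^2 + k2 * x' + k1)) = (x'^2 - k1)^2"
    and y': "x' * (x'^2 + k2 * x' + k1) \<noteq> 0"
  shows "Aff x y [^]\<^bsub>G\<^esub> (5::nat) = Orig"
proof -
  let ?Q = "Aff x y"
  have Qc: "?Q \<in> carrier G" using P by simp
  have g: "b * b = a * (a^2 + k2 * a + k1)" if "Aff a b \<in> points f" for a b
    using that unfolding Aff_point k by (simp add: algebra_simps power2_eq_square)
  obtain a b where D: "?Q \<otimes>\<^bsub>G\<^esub> ?Q = Aff a b" "4 * a * (x * (x^2 + k2 * x + k1)) = (x^2 - k1)^2" "Aff a b \<in> points f"
    using double_x[OF k P y] by metis
  have "a = x'" using D(2) e1 g[OF P] y by (metis mult_cancel_left mult_cancel_right mult_eq_0_iff zero_neq_numeral)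
  then have b: "b \<noteq> 0" using g[OF D(3)] y' by auto
  obtain a' b' where D': "Aff a b \<otimes>\<^bsub>G\<^esub> Aff a b = Aff a' b'" "4 * a' * (a * (a^2 + k2 * a + k1)) = (a^2 - k1)^2" "Aff a' b' \<in> points f"
    using double_x[OF k D(3) b] by metis
  have "a' = x" using D'(2) e2 y' unfolding \<open>a = x'\<close> by (metis mult_cancel_left mult_cancel_right mult_eq_0_iff zero_neq_numeral)
  then consider "Aff a' b' = ?Q" | "Aff a' b' = pconj ?Q" using same_fibre[OF P D'(3)] by auto
  then have "Aff a' b' = pconj ?Q"
  proof cases
    case 1
    have "Aff a b \<otimes>\<^bsub>G\<^esub> Aff a b = ?Q" using D'(1) 1 by simp
    then have "Aff a b \<otimes>\<^bsub>G\<^esub> Aff a b \<otimes>\<^bsub>G\<^esub> ?Q = Aff a b" using D(1) by simp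
    then have "Aff a b \<otimes>\<^bsub>G\<^esub> (Aff a b \<otimes>\<^bsub>G\<^esub> ?Q) = Aff a b" using D(3) P by (simp add: G.m_assoc)
    then have "Aff a b \<otimes>\<^bsub>G\<^esub> ?Q = \<one>\<^bsub>G\<^esub>" using G.r_cancel_one[of "Aff a b" "Aff a b \<otimes>\<^bsub>G\<^esub> ?Q"] D(3) P mult_G(1)[OF D(3) P] by simp
    then have "inv\<^bsub>G\<^esub> ?Q = Aff a b" using D(3) P by (intro G.inv_equality) simp_all
    then show ?thesis using ne \<open>a = x'\<close> inv_G[OF P] by simp
  qed
  then have i: "Aff a b \<otimes>\<^bsub>G\<^esub> Aff a b = inv\<^bsub>G\<^esub> ?Q" using D'(1) inv_G[OF P] by simp
  have "?Q [^]\<^bsub>G\<^esub> (5::nat) = (?Q [^]\<^bsub>G\<^esub> (2::nat)) [^]\<^bsub>G\<^esub> (2::nat) \<otimes>\<^bsub>G\<^esub> ?Q"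
    using G.nat_pow_mult[OF Qc, of 4 1] G.nat_pow_pow[OF Qc, of 2 2] G.nat_pow_eone[OF Qc] by simp
  moreover have sq: "R [^]\<^bsub>G\<^esub> (2::nat) = R \<otimes>\<^bsub>G\<^esub> R" if "R \<in> carrier G" for R
    using G.l_one[OF that] by (simp add: numeral_2_eq_2)
  ultimately have "?Q [^]\<^bsub>G\<^esub> (5::nat) = inv\<^bsub>G\<^esub> ?Q \<otimes>\<^bsub>G\<^esub> ?Q" using sq[OF Qc] sq[of "Aff a b"] D(1,3) i by simp
  then show ?thesis using G.l_inv[OF Qc] by simp
qed

end

section \<open>The universal elliptic curve with a point of order 10\<close>

lemma rat_sq_ne_5: "q * q \<noteq> 5" for q :: rat
proof
  assume q: "q * q = 5"
  obtain a b :: int where ab: "q = of_int a / of_int b" "b > 0" "coprime a b" by (rule Rat_cases) (auto simp: Fract_of_int_quotient)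
  have "of_int (a * a) = (of_int (5 * (b * b)) :: rat)" using q ab(2) by (simp add: ab(1) field_simps)
  then have e: "a * a = 5 * (b * b)" by (simp only: of_int_eq_iff)
  have p: "prime (5::int)" by simp
  have "5 dvd a * a" by (simp add: e)
  then have a: "5 dvd a" using p prime_dvd_mult_iff by blast
  then obtain c where c: "a = 5 * c" by blast
  have "5 * (b * b) = 5 * (5 * (c * c))" using e unfolding c by (simp add: algebra_simps)
  then have "5 dvd b * b" by simp
  then have "5 dvd b" using p prime_dvd_mult_iff by blast
  then have "(5::int) dvd 1" using a ab(3) by (metis coprime_common_divisor)
  then show False by simp
qed

lemma rat_eq_5_sq: "x\<^sup>2 = 5 * y\<^sup>2 \<Longrightarrow> y = 0" for x y :: rat
proof (rule ccontr)
  assume "x\<^sup>2 = 5 * y\<^sup>2" "y \<noteq> 0"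
  then have "(x / y) * (x / y) = 5" by (simp add: power2_eq_square times_divide_times_eq)
  then show False using rat_sq_ne_5 by blast
qed

definition EP :: "rat \<Rightarrow> rat" where "EP t = (2 * t^2 - 2 * t + 1) * (4 * t^4 - 12 * t^3 + 6 * t^2 + 2 * t - 1)"
definition EQ :: "rat \<Rightarrow> rat" where "EQ t = 16 * (t^2 - 3 * t + 1) * (t - 1)^5 * t^5"

lemma E_poly_eq: "E_poly t = [:0, EQ t, - EP t, 1:]"
  by (simp add: E_poly_def EP_def EQ_def)

lemma EP_EQ_disc: "(EP t)\<^sup>2 - 4 * EQ t = (2 * t - 1)^5 * (4 * t^2 - 2 * t - 1)"
  unfolding EP_def EQ_def by Groebner_Basis.algebra

locale X1_10 =
  fixes t :: rat
  assumes t: "t \<notin> {0, 1/2, 1}"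
begin

text \<open>Completing the square shows that a rational root of either quadratic would make 5 a
  rational square.\<close>

lemma nonzero: "t \<noteq> 0" "t - 1 \<noteq> 0" "2 * t - 1 \<noteq> 0" "t^2 - 3 * t + 1 \<noteq> 0" "4 * t^2 - 2 * t - 1 \<noteq> 0"
proof -
  show "t \<noteq> 0" "t - 1 \<noteq> 0" "2 * t - 1 \<noteq> 0" using t by auto
  show "t^2 - 3 * t + 1 \<noteq> 0"
  proof
    assume "t^2 - 3 * t + 1 = 0"
    then have "(2 * t - 3)\<^sup>2 = 5" by Groebner_Basis.algebra
    then show False using rat_eq_5_sq[of "2 * t - 3" 1] by simp
  qed
  show "4 * t^2 - 2 * t - 1 \<noteq> 0"
  proof
    assume "4 * t^2 - 2 * t - 1 = 0"
    then have "(4 * t - 1)\<^sup>2 = 5" by Groebner_Basis.algebra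
    then show False using rat_eq_5_sq[of "4 * t - 1" 1] by simp
  qed
qed

lemma EQ_nz: "EQ t \<noteq> 0" and disc_nz: "(EP t)\<^sup>2 - 4 * EQ t \<noteq> 0"
  using nonzero unfolding EP_EQ_disc by (simp_all add: EQ_def)

text \<open>Needed to divide by \<open>EP t\<close> in the explicit condition on \<open>z\<close>.
  The first factor of \<open>EP t\<close> is t^2 + (t - 1)^2; the second is a difference of squares
  over the field generated by \<surd>5, so a zero of it would make 5 a rational square.\<close>

lemma EP_nz: "EP t \<noteq> 0"
proof
  assume "EP t = 0"
  moreover have "t^2 + (t - 1)^2 \<noteq> 0" using nonzero(1) by (simp add: sum_power2_eq_zero_iff)
  then have "2 * t^2 - 2 * t + 1 \<noteq> 0" by (simp add: power2_eq_square algebra_simps)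
  ultimately have "4 * t^4 - 12 * t^3 + 6 * t^2 + 2 * t - 1 = 0" by (simp add: EP_def)
  then have "(t^2 + t * (t - 1) - (t - 1)^2)\<^sup>2 = 5 * (t * (t - 1))\<^sup>2" by Groebner_Basis.algebra
  then show False using rat_eq_5_sq[of _ "t * (t - 1)"] nonzero by simp
qed

lemma elliptic_E: "elliptic (E_poly t)"
proof (intro elliptic.intro curve.intro elliptic_axioms.intro)
  fix x assume r: "poly (base_change (E_poly t)) x = 0"
  let ?p = "to_ac (EP t)" and ?q = "to_ac (EQ t)"
  have D: "?p\<^sup>2 - 4 * ?q \<noteq> 0" "?q \<noteq> 0"
  proof -
    have "to_ac ((EP t)\<^sup>2 - 4 * EQ t) \<noteq> 0" using disc_nz by (simp only: to_ac_eq_0_iff simp_thms)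
    then show "?p\<^sup>2 - 4 * ?q \<noteq> 0" by simp
    show "?q \<noteq> 0" using EQ_nz by simp
  qed
  have f: "x * (x^2 - ?p * x + ?q) = 0" using r by (simp add: E_poly_eq algebra_simps power2_eq_square)
  have d: "poly (pderiv (base_change (E_poly t))) x = 3 * x^2 - 2 * ?p * x + ?q"
    by (simp add: E_poly_eq pderiv_pCons algebra_simps power2_eq_square)
  show "poly (pderiv (base_change (E_poly t))) x \<noteq> 0"
  proof (cases "x = 0")
    case False
    then have g: "x^2 - ?p * x + ?q = 0" using f by simp
    show ?thesis
    proof
      assume "poly (pderiv (base_change (E_poly t))) x = 0"
      then have "x * (2 * x - ?p) = 0" unfolding d using g by Groebner_Basis.algebra
      then have "2 * x - ?p = 0" using False by simp
      then show False using g D(1) by Groebner_Basis.algebra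
    qed
  qed (use D(2) d in simp)
qed (simp_all add: E_poly_eq)

sublocale E: elliptic "E_poly t" by (rule elliptic_E)

abbreviation \<tau> where "\<tau> \<equiv> to_ac t"
abbreviation \<eta> where "\<eta> \<equiv> to_ac (t - 1)"
text \<open>\<open>w\<close>, \<open>q\<close> and \<open>p\<close> are the data of
  \<open>division_poly_identity\<close> at s = t - 1. They write the coefficients of E_t
  homogeneously in t and t - 1: \<open>EQ t\<close> becomes \<open>w^2 * q\<close> and
  \<open>EP t\<close> becomes \<open>p\<close>.\<close>

definition w where "w = 4 * \<tau>^2 * \<eta>^2"
definition q where "q = \<tau> * \<eta> * (\<eta>^2 + \<tau> * \<eta> - \<tau>^2)"
definition p where "p = 5 * \<tau>^4 * \<eta>^2 + 5 * \<tau>^2 * \<eta>^4 + 2 * \<tau> * \<eta>^5 - \<tau>^6 - 2 * \<tau>^5 * \<eta> - \<eta>^6"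

lemma coeffs_E: "E.k0 = 0" "E.k3 = 1" "E.k1 = w^2 * q" "E.k2 = - p"
proof -
  show "E.k0 = 0" "E.k3 = 1" unfolding E.k0_def E.k3_def by (simp_all add: E_poly_eq eval_nat_numeral)
  have "EQ t = (4 * t^2 * (t - 1)^2)^2 * (t * (t - 1) * ((t - 1)^2 + t * (t - 1) - t^2))" unfolding EQ_def by Groebner_Basis.algebra
  then have "to_ac (EQ t) = w^2 * q" unfolding w_def q_def by (simp only: to_ac_add to_ac_mult to_ac_power to_ac_diff to_ac_numeral)
  then show "E.k1 = w^2 * q" unfolding E.k1_def by (simp add: E_poly_eq)
  have "EP t = 5 * t^4 * (t - 1)^2 + 5 * t^2 * (t - 1)^4 + 2 * t * (t - 1)^5 - t^6 - 2 * t^5 * (t - 1) - (t - 1)^6"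
    unfolding EP_def by Groebner_Basis.algebra
  then have "to_ac (EP t) = p" unfolding p_def by (simp only: to_ac_add to_ac_mult to_ac_power to_ac_diff to_ac_numeral)
  then show "E.k2 = - p" unfolding E.k2_def by (simp add: E_poly_eq eval_nat_numeral)
qed

lemma nz_qbar: "\<tau> \<noteq> 0" "\<eta> \<noteq> 0" "w \<noteq> 0" "\<tau> + \<eta> \<noteq> 0" "\<tau> - \<eta> = 1"
  "\<tau>^2 - \<tau> * \<eta> - \<eta>^2 \<noteq> 0" "\<tau>^2 + 4 * \<tau> * \<eta> - \<eta>^2 \<noteq> 0"
proof -
  show n: "\<tau> \<noteq> 0" "\<eta> \<noteq> 0" using nonzero by simp_all
  then show "w \<noteq> 0" by (simp add: w_def)
  have "\<tau> + \<eta> = to_ac (2 * t - 1)" by simp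
  then show "\<tau> + \<eta> \<noteq> 0" using nonzero(3) by (simp only: to_ac_eq_0_iff simp_thms)
  show "\<tau> - \<eta> = 1" by simp
  have "t^2 - t * (t - 1) - (t - 1)^2 = - (t^2 - 3 * t + 1)" by Groebner_Basis.algebra
  then have "to_ac (t^2 - t * (t - 1) - (t - 1)^2) \<noteq> 0" using nonzero(4) by (simp only: to_ac_eq_0_iff neg_equal_0_iff_equal simp_thms)
  then show "\<tau>^2 - \<tau> * \<eta> - \<eta>^2 \<noteq> 0" by simp
  have "t^2 + 4 * t * (t - 1) - (t - 1)^2 = 4 * t^2 - 2 * t - 1" by Groebner_Basis.algebra
  then have "to_ac (t^2 + 4 * t * (t - 1) - (t - 1)^2) \<noteq> 0" using nonzero(5) by (simp only: to_ac_eq_0_iff simp_thms)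
  then show "\<tau>^2 + 4 * \<tau> * \<eta> - \<eta>^2 \<noteq> 0" by simp
qed

text \<open>The abscissae of the known points of order 5; duplication interchanges the two.\<close>

definition a1 where "a1 = w * \<tau>^2"
definition a2 where "a2 = w * \<eta>^2"

lemma (in galois_elt) s_numeral [simp]: "\<sigma> (numeral n) = numeral n"
  using s_of_nat[of "numeral n"] by simp

lemma five_torsion_x:
  assumes Q: "Q \<in> points (E_poly t)" "Q [^]\<^bsub>ec_group (E_poly t)\<^esub> (5::nat) = Infty 0" "Q \<noteq> Infty 0"
    and fixed: "\<And>\<sigma>. \<sigma> \<in> galois \<Longrightarrow> galois_point \<sigma> Q = Q"
  shows "xc Q = Some a1 \<or> xc Q = Some a2"
proof -
  obtain x y x' where x: "Q = Aff x y" "x \<noteq> x'" "4 * x' * (x * (x^2 + E.k2 * x + E.k1)) = (x^2 - E.k1)^2"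
    "4 * x * (x' * (x'^2 + E.k2 * x' + E.k1)) = (x'^2 - E.k1)^2"
    using E.five_torsion_cases[OF coeffs_E(1,2) Q] by metis
  define z where "z = x / w"
  have xz: "x = w * z" using nz_qbar(3) by (simp add: z_def)
  define h where "h = w * (z^2 + q) - p * z"
  define A where "A = z^2 - q"
  define M where "M = (z - \<tau>^2) * (z - \<eta>^2)"
  define H where "H = 4 * \<tau>^2 * \<eta>^2 * z^5 + (2 * \<tau>^6 + 4 * \<tau>^5 * \<eta> - 8 * \<tau>^4 * \<eta>^2 - 8 * \<tau>^2 * \<eta>^4 - 4 * \<tau> * \<eta>^5 + 2 * \<eta>^6) * z^4
     + (8 * \<tau>^6 * \<eta>^2 - 16 * \<tau>^5 * \<eta>^3 - 8 * \<tau>^4 * \<eta>^4 + 16 * \<tau>^3 * \<eta>^5 + 8 * \<tau>^2 * \<eta>^6) * z^3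
     + (2 * \<tau>^10 + 4 * \<tau>^9 * \<eta> - 16 * \<tau>^8 * \<eta>^2 - 8 * \<tau>^7 * \<eta>^3 + 18 * \<tau>^6 * \<eta>^4 + 18 * \<tau>^4 * \<eta>^6 + 8 * \<tau>^3 * \<eta>^7 - 16 * \<tau>^2 * \<eta>^8 - 4 * \<tau> * \<eta>^9 + 2 * \<eta>^10) * z^2
     + (4 * \<tau>^8 * \<eta>^4 - 8 * \<tau>^9 * \<eta>^3 + 40 * \<tau>^7 * \<eta>^5 - 20 * \<tau>^6 * \<eta>^6 - 40 * \<tau>^5 * \<eta>^7 + 4 * \<tau>^4 * \<eta>^8 + 8 * \<tau>^3 * \<eta>^9) * z
     + (2 * \<tau>^10 * \<eta>^4 - 4 * \<tau>^9 * \<eta>^5 + 4 * \<tau>^5 * \<eta>^9 + 2 * \<tau>^4 * \<eta>^10)"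
  define d where "d = 2 * (\<tau>^2 - \<tau> * \<eta> - \<eta>^2)^2 * (\<tau>^2 + 4 * \<tau> * \<eta> - \<eta>^2)"
  have dnz: "d \<noteq> 0" using nz_qbar by (simp add: d_def)
  have e1: "4 * x * x' * (x^2 - p * x + w^2 * q) = (x^2 - w^2 * q)^2"
    using x(3) unfolding coeffs_E by (simp add: mult.assoc mult.left_commute)
  have e2: "4 * x * x' * (x'^2 - p * x' + w^2 * q) = (x'^2 - w^2 * q)^2"
    using x(4) unfolding coeffs_E by (simp add: mult.assoc)
  have wh: "w * h = x^2 - p * x + w^2 * q" unfolding h_def xz by Groebner_Basis.algebra
  have wA: "w^2 * A = x^2 - w^2 * q" unfolding A_def xz by Groebner_Basis.algebra
  \<comment> \<open>Passing between \<open>x\<close> and \<open>z = x / w\<close> changes the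
    division polynomial only by a power of \<open>w\<close>; the right side is the expression of
    \<open>division_polynomial_5\<close> in \<open>x\<close>.\<close>
  have "w^9 * (w * A^2 * (4 * h * z^2 + w * A^2)^2 - 4 * h * z^2 * (5 * w^2 * A^4 - 8 * w * A^2 * q * h + 16 * q^2 * h^2)) =
    (w^2 * A)^2 * (4 * (w * h) * (w * z)^2 + (w^2 * A)^2)^2 - 4 * (w * h) * (w * z)^2 * (5 * (w^2 * A)^4 - 8 * (w^2 * A)^2 * (w^2 * q) * (w * h) + 16 * (w^2 * q)^2 * (w * h)^2)"
    by Groebner_Basis.algebra
  then have "w^9 * (w * A^2 * (4 * h * z^2 + w * A^2)^2 - 4 * h * z^2 * (5 * w^2 * A^4 - 8 * w * A^2 * q * h + 16 * q^2 * h^2)) = 0"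
    unfolding xz[symmetric] division_polynomial_5[OF e1 e2 x(2) wh wA] by (simp only: diff_self)
  then have "w^9 * (w * M * (5 * H^2 - d^2 * M^4)) = 0"
    unfolding division_poly_identity[OF w_def q_def p_def h_def A_def M_def H_def d_def] .
  then have "M = 0 \<or> 5 * H^2 = d^2 * M^4" using nz_qbar(3) by simp
  moreover have "5 * H^2 \<noteq> d^2 * M^4" if "M \<noteq> 0"
  proof
    assume e: "5 * H^2 = d^2 * M^4"
    then have Hnz: "H \<noteq> 0" using dnz that by auto
    \<comment> \<open>A square root of 5 built from \<open>z\<close>, t and t - 1, hence fixed by
      every automorphism that fixes \<open>Q\<close>.\<close>
    define r where "r = d * M^2 / H"
    have "r * r = (d^2 * M^4) / H^2" by (simp add: r_def power2_eq_square power4_eq_xxxx)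
    then have "r * r = to_ac 5" unfolding e[symmetric] using Hnz by simp
    then obtain \<sigma> where s: "\<sigma> \<in> galois" "\<sigma> r = - r" using galois_moves_sqrt[OF _ rat_sq_ne_5] by blast
    interpret galois_elt \<sigma> by unfold_locales (rule s)
    have "\<sigma> x = x" using fixed[OF s(1)] x(1) by simp
    moreover have "\<sigma> w = w" unfolding w_def by (simp only: s_mult s_power s_to_ac s_numeral)
    ultimately have z: "\<sigma> z = z" unfolding z_def by (simp only: s_divide)
    have "\<sigma> M = M" "\<sigma> H = H" "\<sigma> d = d" unfolding M_def H_def d_def
      by (simp_all only: s_mult s_power s_to_ac s_numeral s_add s_diff z)
    then have "\<sigma> r = r" unfolding r_def by (simp only: s_divide s_mult s_power)
    then have "r + r = 0" using s(2) by (metis add.right_inverse)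
    then have "r = 0" by (simp flip: mult_2)
    then show False using Hnz dnz that by (simp add: r_def)
  qed
  ultimately have "M = 0" by blast
  then have "z = \<tau>^2 \<or> z = \<eta>^2" by (simp add: M_def)
  then show ?thesis by (auto simp: x(1) xz a1_def a2_def)
qed

lemma card_fixed5: "finite (fixed5 (E_poly t))" "card (fixed5 (E_poly t)) \<le> 5"
proof -
  obtain P where P: "{Q \<in> points (E_poly t). xc Q = Some a1} = {P, pconj P}" using E.fibre by metis
  obtain R where R: "{Q \<in> points (E_poly t). xc Q = Some a2} = {R, pconj R}" using E.fibre by metis
  have "fixed5 (E_poly t) \<subseteq> insert (Infty 0) ({Q \<in> points (E_poly t). xc Q = Some a1} \<union> {Q \<in> points (E_poly t). xc Q = Some a2})"
    using five_torsion_x by (auto simp: fixed5_def)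
  then have s: "fixed5 (E_poly t) \<subseteq> set [Infty 0, P, pconj P, R, pconj R]" unfolding P R by auto
  then show "finite (fixed5 (E_poly t))" by (rule finite_subset) simp
  have "card (fixed5 (E_poly t)) \<le> card (set [Infty 0, P, pconj P, R, pconj R])" using s by (intro card_mono) simp_all
  also have "\<dots> \<le> length [Infty 0, P, pconj P, R, pconj R]" by (rule card_length)
  finally show "card (fixed5 (E_poly t)) \<le> 5" by simp
qed

lemma fixed5_nontrivial: "\<exists>T\<in>fixed5 (E_poly t). T \<noteq> Infty 0"
proof
  \<comment> \<open>The factor \<tau> - \<eta> is 1; keeping it makes the curve equation at this
    point an identity homogeneous in \<tau> and \<eta>.\<close>
  define y where "y = w * \<tau>^2 * (\<tau> + \<eta>)^2 * (\<tau> - \<eta>)"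
  have P: "Aff a1 y \<in> points (E_poly t)"
    unfolding E.Aff_point coeffs_E a1_def y_def p_def q_def w_def by Groebner_Basis.algebra
  have ynz: "y \<noteq> 0" using nz_qbar by (simp add: y_def)
  have "a1 - a2 = w * (\<tau> + \<eta>) * (\<tau> - \<eta>)" unfolding a1_def a2_def by Groebner_Basis.algebra
  then have "a1 - a2 \<noteq> 0" using nz_qbar by simp
  then have ne: "a1 \<noteq> a2" by simp
  have e1: "4 * a2 * (a1 * (a1^2 + E.k2 * a1 + E.k1)) = (a1^2 - E.k1)^2"
    unfolding coeffs_E a1_def a2_def p_def q_def w_def by Groebner_Basis.algebra
  have e2: "4 * a1 * (a2 * (a2^2 + E.k2 * a2 + E.k1)) = (a2^2 - E.k1)^2"
    unfolding coeffs_E a1_def a2_def p_def q_def w_def by Groebner_Basis.algebra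
  have "a2 * (a2^2 + E.k2 * a2 + E.k1) = (w * \<eta>^2 * (\<tau> - \<eta>)^2 * (\<tau> + \<eta>))^2"
    unfolding coeffs_E a2_def p_def q_def w_def by Groebner_Basis.algebra
  then have y': "a2 * (a2^2 + E.k2 * a2 + E.k1) \<noteq> 0" using nz_qbar by simp
  have "galois_point \<sigma> (Aff a1 y) = Aff a1 y" if "\<sigma> \<in> galois" for \<sigma>
  proof -
    interpret galois_elt \<sigma> by unfold_locales (rule that)
    show ?thesis unfolding a1_def y_def w_def by (simp only: galois_point.simps s_mult s_power s_to_ac s_numeral s_add s_diff)
  qed
  then show "Aff a1 y \<in> fixed5 (E_poly t)"
    using P E.five_torsion_point[OF coeffs_E(1,2) P ynz ne e1 e2 y'] by (simp add: fixed5_def)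
  show "Aff a1 y \<noteq> Infty 0" by simp
qed

end

section \<open>The bielliptic curve\<close>

lemma simple_roots_affine:
  fixes f g :: "rat poly"
  assumes k: "k \<noteq> 0" and l: "l \<noteq> 0" and eq: "Polynomial.smult (l\<^sup>2) f = pcompose g [:m, k:]"
    and g: "\<And>x. poly (base_change g) x = 0 \<Longrightarrow> poly (pderiv (base_change g)) x \<noteq> 0"
    and x: "poly (base_change f) x = 0"
  shows "poly (pderiv (base_change f)) x \<noteq> 0"
proof -
  note bc = base_change_affine[OF eq]
  let ?w = "to_ac m + x * to_ac k"
  have "(to_ac l)\<^sup>2 * poly (base_change f) x = poly (base_change g) ?w"
    using arg_cong[OF bc, of "\<lambda>p. poly p x"] by (simp add: poly_pcompose)
  then have "poly (pderiv (base_change g)) ?w \<noteq> 0" using g x by simp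
  moreover have "(to_ac l)\<^sup>2 * poly (pderiv (base_change f)) x = poly (pderiv (base_change g)) ?w * to_ac k"
    using arg_cong[OF bc, of "\<lambda>p. poly (pderiv p) x"] by (simp add: poly_pcompose pderiv_pcompose pderiv_smult pderiv_pCons)
  ultimately show ?thesis using k l by auto
qed

lemma ec_isomorphic_sym:
  assumes "ec_isomorphism f g \<alpha>" "Infty 0 \<in> points f"
  shows "ec_isomorphic g f"
proof -
  have bij: "bij_betw \<alpha> (points f) (points g)" and O: "\<alpha> (Infty 0) = Infty 0"
    and m: "morphism_over (range to_ac) f g \<alpha>" "morphism_over (range to_ac) g f (inv_into (points f) \<alpha>)"
    using assms(1) by (simp_all add: ec_isomorphism_def)
  have inj: "inj_on \<alpha> (points f)" using bij by (simp add: bij_betw_def)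
  have "morphism_over (range to_ac) f g (inv_into (points g) (inv_into (points f) \<alpha>))"
    by (rule morphism_over_cong[OF m(1)]) (rule inv_into_inv_into_eq[OF bij])
  moreover have "inv_into (points f) \<alpha> (Infty 0) = Infty 0" using inv_into_f_f[OF inj assms(2)] O by simp
  ultimately have "ec_isomorphism g f (inv_into (points f) \<alpha>)"
    using bij_betw_inv_into[OF bij] m(2) by (simp add: ec_isomorphism_def)
  then show ?thesis by (auto simp: ec_isomorphic_def)
qed

text \<open>The long coefficients in terms of the quadratic factors of the two curves: they are the
  elementary symmetric functions of z, f1/e1 and f2/e2 up to sign, cleared by -4 e1 e2, where e_i
  and f_i are the nonzero 2-torsion abscissae of E_t and E_u.\<close>

lemma coef_eqs:
  "coef_a t u z = 2 * (EP t * z - EP u)"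
  "coef_a0 t = - 4 * EQ t"
  "coef_a2 t u z = z * (12 * EQ t - 2 * (EP t)\<^sup>2) + 2 * EP t * EP u"
  "coef_a4 t u z = 3 * ((EP t)\<^sup>2 - 4 * EQ t) * z\<^sup>2 - 2 * z * EP t * EP u - (EP u)\<^sup>2"
  "coef_a6 t u z = z * ((EP u)\<^sup>2 - ((EP t)\<^sup>2 - 4 * EQ t) * z\<^sup>2)"
  unfolding coef_a_def coef_a0_def coef_a2_def coef_a4_def coef_a6_def EP_def EQ_def
  by Groebner_Basis.algebra+

locale theorem_data = T: X1_10 t + U: X1_10 u for t u +
  fixes z :: rat
  assumes curve_eq: "(2*t - 1)^5 * (4*t^2 - 2*t - 1) * z^2 = (2*u - 1)^5 * (4*u^2 - 2*u - 1)"
    and a_nz: "coef_a t u z \<noteq> 0"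
begin

abbreviation a where "a \<equiv> coef_a t u z"
abbreviation a0 where "a0 \<equiv> coef_a0 t"
abbreviation a2 where "a2 \<equiv> coef_a2 t u z"
abbreviation a4 where "a4 \<equiv> coef_a4 t u z"
abbreviation a6 where "a6 \<equiv> coef_a6 t u z"

lemma disc_eq: "(EP u)\<^sup>2 - ((EP t)\<^sup>2 - 4 * EQ t) * z\<^sup>2 = 4 * EQ u"
  using curve_eq EP_EQ_disc[of t] EP_EQ_disc[of u] by simp

lemma z_nz: "z \<noteq> 0"
proof
  assume "z = 0"
  then show False using curve_eq U.nonzero by simp
qed

lemma a6_eq: "a6 = 4 * z * EQ u" using coef_eqs(5)[of t u z] by (simp add: disc_eq)

lemma a0_nz: "a0 \<noteq> 0" and a6_nz: "a6 \<noteq> 0"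
  using T.EQ_nz U.EQ_nz z_nz by (simp_all add: coef_eqs(2) a6_eq)

lemma Et'_poly_eq: "Et'_poly t u z = [:a * a6, a * a4, a * a2, a * a0:]" by (simp add: Et'_poly_def)
lemma Eu'_poly_eq: "Eu'_poly t u z = [:a * a0, a * a2, a * a4, a * a6:]" by (simp add: Eu'_poly_def)
lemma C_poly_eq: "C_poly t u z = [:a * a0, 0, a * a2, 0, a * a4, 0, a * a6:]" by (simp add: C_poly_def)

text \<open>The root z of the cubic goes to the abscissa 0, which determines the constant term.
  Comparing leading coefficients, (a0/a)^3 = l^2 a a0 has the rational solution l = a0 / a^2 thanks
  to the outer factor a.\<close>

lemma affine_t: "Polynomial.smult ((a0 / a\<^sup>2)\<^sup>2) (Et'_poly t u z) = pcompose (E_poly t) [:- (a0 * z / a), a0 / a:]"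
proof -
  \<comment> \<open>Writing \<open>b\<close> for 1/a turns the comparison of coefficients into
    polynomial consequences of one relation.\<close>
  define b where "b = 1 / a"
  have b: "b * (2 * (EP t * z - EP u)) = 1" using a_nz by (simp add: b_def coef_eqs(1))
  have d: "a0 / a\<^sup>2 = a0 * b\<^sup>2" "a0 * z / a = a0 * z * b" "a0 / a = a0 * b" by (simp_all add: b_def power_divide)
  show ?thesis unfolding d Et'_poly_eq E_poly_eq
    apply (simp add: pcompose_pCons)
    unfolding coef_eqs using b
    apply (intro conjI)
    by Groebner_Basis.algebra+
qed

text \<open>The reversed cubic has the root 1/z, which goes to the abscissa 0 because a6 = 4 z Q(u).
  The hypothesis on t, u, z enters through \<open>disc_eq\<close>.\<close>

lemma affine_u: "Polynomial.smult ((a6 / a\<^sup>2)\<^sup>2) (Eu'_poly t u z) = pcompose (E_poly u) [:- (4 * EQ u / a), a6 / a:]"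
proof -
  define b where "b = 1 / a"
  have b: "b * (2 * (EP t * z - EP u)) = 1" using a_nz by (simp add: b_def coef_eqs(1))
  have d: "a6 / a\<^sup>2 = a6 * b\<^sup>2" "4 * EQ u / a = 4 * EQ u * b" "a6 / a = a6 * b" by (simp_all add: b_def power_divide)
  show ?thesis unfolding d Eu'_poly_eq E_poly_eq
    apply (simp add: pcompose_pCons)
    unfolding a6_eq unfolding coef_eqs using b disc_eq
    apply (intro conjI)
    by Groebner_Basis.algebra+
qed

text \<open>The quotient with coordinate x^2 is \<open>Eu'_poly\<close>, so it takes the place of
  \<open>g1\<close>, and \<open>Et'_poly\<close> that of the reversed cubic. Simplicity of the roots
  is carried over from E_u along the affine substitution.\<close>

sublocale B: bielliptic "a * a0" "a * a2" "a * a4" "a * a6" "C_poly t u z" "Eu'_poly t u z" "Et'_poly t u z"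
proof
  show "a * a0 \<noteq> 0" "a * a6 \<noteq> 0" using a_nz a0_nz a6_nz by simp_all
  fix x assume "poly (base_change (Eu'_poly t u z)) x = 0"
  then show "poly (pderiv (base_change (Eu'_poly t u z))) x \<noteq> 0"
    using a_nz a6_nz by (intro simple_roots_affine[OF _ _ affine_u U.E.simple]) simp_all
qed (rule C_poly_eq Eu'_poly_eq Et'_poly_eq)+

sublocale At: affine_iso "Et'_poly t u z" "E_poly t" "a0 / a" "- (a0 * z / a)" "a0 / a\<^sup>2"
  by unfold_locales (use a_nz a0_nz affine_t in simp_all)
sublocale Au: affine_iso "Eu'_poly t u z" "E_poly u" "a6 / a" "- (4 * EQ u / a)" "a6 / a\<^sup>2"
  by unfold_locales (use a_nz a6_nz affine_u in simp_all)

lemma isogeny_E: "jac_22_isogeny (C_poly t u z) (E_poly t) (E_poly u) (map_prod At.\<alpha> Au.\<alpha> \<circ> B.psi)"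
  by (rule jac_22_isogeny_affine[OF B.jac_map_phi B.jac_map_chi B.induced_by_psi B.jac_22_isogeny_psi At.affine_iso_axioms Au.affine_iso_axioms])

lemma rank_5: "rk 5 (torsion (jacobian_rat (C_poly t u z))) = 2"
proof -
  obtain R S where "R \<in> fixed5 (E_poly t)" "R \<noteq> Infty 0" "S \<in> fixed5 (E_poly u)" "S \<noteq> Infty 0"
    using T.fixed5_nontrivial U.fixed5_nontrivial by blast
  then show ?thesis
    by (rule rank_5_jacobian[OF B.C.curve_axioms T.elliptic_E U.elliptic_E isogeny_E T.card_fixed5 U.card_fixed5])
qed

end

theorem theorem2p1:
  fixes t u z :: rat
  assumes "(2*t - 1)^5 * (4*t^2 - 2*t - 1) * z^2 = (2*u - 1)^5 * (4*u^2 - 2*u - 1)"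
    and "t \<notin> {0, 1/2, 1}" and "u \<notin> {0, 1/2, 1}"
  shows "(coef_a t u z \<noteq> 0 \<longleftrightarrow>
           z \<noteq> (8*u^6 - 32*u^5 + 40*u^4 - 20*u^3 + 4*u - 1) /
               (8*t^6 - 32*t^5 + 40*t^4 - 20*t^3 + 4*t - 1)) \<and>
    (coef_a t u z \<noteq> 0 \<longrightarrow>
      smooth_curve (C_poly t u z) \<and> genus (C_poly t u z) = 2 \<and>
      jac_22_isogenous (C_poly t u z) (E_poly t) (E_poly u) \<and>
      rk 5 (torsion (jacobian_rat (C_poly t u z))) = 2 \<and>
      elliptic_curve (E_poly t) \<and> elliptic_curve (Et'_poly t u z) \<and>
      ec_isomorphic (E_poly t) (Et'_poly t u z) \<and>
      elliptic_curve (E_poly u) \<and> elliptic_curve (Eu'_poly t u z) \<and>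
      ec_isomorphic (E_poly u) (Eu'_poly t u z) \<and>
      (\<exists>\<phi> \<chi> \<psi> \<alpha> \<beta>.
         bielliptic_map (C_poly t u z) (Et'_poly t u z) \<phi> \<and>
         (\<forall>x y. Aff x y \<in> points (C_poly t u z) \<longrightarrow> x \<noteq> 0 \<longrightarrow>
            \<phi> (Aff x y) = Aff (1 / x^2) (y / x^3)) \<and>
         bielliptic_map (C_poly t u z) (Eu'_poly t u z) \<chi> \<and>
         (\<forall>x y. Aff x y \<in> points (C_poly t u z) \<longrightarrow> \<chi> (Aff x y) = Aff (x^2) y) \<and>
         induced_by (C_poly t u z) (Et'_poly t u z) (Eu'_poly t u z) \<phi> \<chi> \<psi> \<and>
         jac_22_isogeny (C_poly t u z) (Et'_poly t u z) (Eu'_poly t u z) \<psi> \<and>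
         ec_isomorphism (Et'_poly t u z) (E_poly t) \<alpha> \<and>
         ec_isomorphism (Eu'_poly t u z) (E_poly u) \<beta> \<and>
         jac_22_isogeny (C_poly t u z) (E_poly t) (E_poly u) (map_prod \<alpha> \<beta> \<circ> \<psi>)))"
    (is "?equiv \<and> (_ \<longrightarrow> ?claims)")
proof (intro conjI[of ?equiv] impI)
  have T: "X1_10 t" and U: "X1_10 u" using assms(2,3) by (simp_all add: X1_10_def)
  \<comment> \<open>Numerator and denominator of the excluded quotient are \<open>EP u\<close> and
    \<open>EP t\<close>, so the condition reads EP t * z \<noteq> EP u.\<close>
  have P: "8*v^6 - 32*v^5 + 40*v^4 - 20*v^3 + 4*v - 1 = EP v" for v unfolding EP_def by Groebner_Basis.algebra
  show ?equiv unfolding P coef_eqs(1) using X1_10.EP_nz[OF T] by (simp add: eq_divide_eq mult.commute)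
  assume a: "coef_a t u z \<noteq> 0"
  interpret theorem_data t u z
    using T U assms(1) a by (intro theorem_data.intro theorem_data_axioms.intro)
  show ?claims
  proof (intro conjI exI)
    show "smooth_curve (C_poly t u z)" "genus (C_poly t u z) = 2" by (rule B.C_smooth)+
    show "jac_22_isogenous (C_poly t u z) (E_poly t) (E_poly u)"
      unfolding jac_22_isogenous_def using isogeny_E by blast
    show "rk 5 (torsion (jacobian_rat (C_poly t u z))) = 2" by (rule rank_5)
    show "elliptic_curve (E_poly t)" "elliptic_curve (E_poly u)" by (rule T.E.elliptic_curve U.E.elliptic_curve)+
    show "elliptic_curve (Et'_poly t u z)" "elliptic_curve (Eu'_poly t u z)" by (rule B.E2.elliptic_curve B.E1.elliptic_curve)+
    show "ec_isomorphic (E_poly t) (Et'_poly t u z)" by (rule ec_isomorphic_sym[OF At.ec_isomorphism B.E2.O_point])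
    show "ec_isomorphic (E_poly u) (Eu'_poly t u z)" by (rule ec_isomorphic_sym[OF Au.ec_isomorphism B.E1.O_point])
    show "bielliptic_map (C_poly t u z) (Et'_poly t u z) B.phi" by (rule B.bielliptic_map_phi)
    show "bielliptic_map (C_poly t u z) (Eu'_poly t u z) B.chi" by (rule B.bielliptic_map_chi)
    show "\<forall>x y. Aff x y \<in> points (C_poly t u z) \<longrightarrow> x \<noteq> 0 \<longrightarrow> B.phi (Aff x y) = Aff (1 / x^2) (y / x^3)" by simp
    show "\<forall>x y. Aff x y \<in> points (C_poly t u z) \<longrightarrow> B.chi (Aff x y) = Aff (x^2) y" by simp
    show "induced_by (C_poly t u z) (Et'_poly t u z) (Eu'_poly t u z) B.phi B.chi B.psi" by (rule B.induced_by_psi)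
    show "jac_22_isogeny (C_poly t u z) (Et'_poly t u z) (Eu'_poly t u z) B.psi" by (rule B.jac_22_isogeny_psi)
    show "ec_isomorphism (Et'_poly t u z) (E_poly t) At.\<alpha>" by (rule At.ec_isomorphism)
    show "ec_isomorphism (Eu'_poly t u z) (E_poly u) Au.\<alpha>" by (rule Au.ec_isomorphism)
    show "jac_22_isogeny (C_poly t u z) (E_poly t) (E_poly u) (map_prod At.\<alpha> Au.\<alpha> \<circ> B.psi)" by (rule isogeny_E)
  qed
qed

end
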